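(* Let $d\geqslant2$, $\Omega=\{x\in\mathbb{R}^d : |x|<1\}$, $K>1$, and $$I(n)=\int_\Omega|\nabla n|^2\,dx+K\mathcal{H}^{d-1}(S_n).$$ Let $$\mathcal{A}=\left\{n\in SBV^2(\Omega,\mathbb{S}^{d-1}\cup\{0\}) : n(x)=x\text{ on }\partial\Omega\right\},\qquad \mathcal{B}=\left\{n\in W^{1,2}(\Omega,\mathbb{S}^{d-1}) : n(x)=x\text{ on }\partial\Omega\right\}.$$ Then $$\inf_{n\in\mathcal{A}}I(n)<\inf_{n\in\mathcal{B}}I(n).$$
   Context: The infimum over the empty set is $+\infty$ (for $d=2$ the set $\mathcal{B}$ is empty). $S_n$ is the approximate discontinuity set and $SBV^2$ denotes functions in $SBV$ with approximate gradient $\nabla n\in L^2$ and $\mathcal{H}^{d-1}(S_n)<\infty$. In $\mathcal{B}$ the boundary condition holds in the trace sense. In $\mathcal{A}$ it is imposed in the weak (extended domain) sense: $n$ is extended to a slightly larger ball by a fixed Sobolev extension of the boundary datum (e.g. $x/|x|$), and $S_n$ is the discontinuity set of the extended map, so it includes the part of $\partial\Omega$ where the inner trace of $n$ differs from $x$. *)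

theory Defs
  imports "HOL-Analysis.Analysis"
begin

text \<open>
  Conventions follow Ambrosio, Fusco and Pallara, ``Functions of Bounded Variation and Free
  Discontinuity Problems'' (AFP below). A map on an open set \<open>\<Omega>\<close> is a total function of which only
  the values on \<open>\<Omega>\<close> matter. Gradients are Jacobian matrices, \<open>G $ i $ j = \<partial>\<^sub>j u\<^sub>i\<close>, and the norm of
  \<open>real^'n^'m\<close> is the Frobenius norm.
\<close>

section \<open>Hausdorff measure\<close>

text \<open>
  Normalised so that \<open>\<H>\<^sup>d\<close> is Lebesgue measure on \<open>\<real>\<^sup>d\<close>. The empty set is treated separately only
  because \<open>0 ^ 0 = 1\<close>; covering sets must be bounded because \<open>diameter\<close> carries no information
  for unbounded sets.
\<close>

definition hausdorff_weight :: "nat \<Rightarrow> 'a::metric_space set \<Rightarrow> ennreal" where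
  "hausdorff_weight s C =
     (if C = {} then 0 else ennreal (unit_ball_vol (real s) * (diameter C / 2) ^ s))"

definition hausdorff_content :: "nat \<Rightarrow> real \<Rightarrow> 'a::metric_space set \<Rightarrow> ennreal" where
  "hausdorff_content s \<delta> E =
     (INF C \<in> {C :: nat \<Rightarrow> 'a set. E \<subseteq> (\<Union>i. C i) \<and> (\<forall>i. bounded (C i) \<and> diameter (C i) \<le> \<delta>)}.
        \<Sum>i. hausdorff_weight s (C i))"

definition hausdorff_measure :: "nat \<Rightarrow> 'a::metric_space set \<Rightarrow> ennreal" where
  "hausdorff_measure s E = (SUP \<delta> \<in> {0<..}. hausdorff_content s \<delta> E)"


section \<open>Approximate limits and approximate gradients\<close>

text \<open>AFP, Definitions 3.63 and 3.70.\<close>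

definition approx_limit :: "(real^'n \<Rightarrow> real^'m) \<Rightarrow> real^'n \<Rightarrow> real^'m \<Rightarrow> bool" where
  "approx_limit u x z \<longleftrightarrow>
     ((\<lambda>\<rho>. (\<integral>\<^sup>+y\<in>ball x \<rho>. ennreal (norm (u y - z)) \<partial>lebesgue) / emeasure lebesgue (ball x \<rho>))
        \<longlongrightarrow> 0) (at_right 0)"

definition approx_discontinuity_set :: "(real^'n) set \<Rightarrow> (real^'n \<Rightarrow> real^'m) \<Rightarrow> (real^'n) set" where
  "approx_discontinuity_set \<Omega> u = {x \<in> \<Omega>. \<not> (\<exists>z. approx_limit u x z)}"

definition has_approx_gradient :: "(real^'n \<Rightarrow> real^'m) \<Rightarrow> real^'n^'m \<Rightarrow> real^'n \<Rightarrow> bool" where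
  "has_approx_gradient u A x \<longleftrightarrow>
     (\<exists>z. approx_limit u x z \<and>
       ((\<lambda>\<rho>. (\<integral>\<^sup>+y\<in>ball x \<rho>. ennreal (norm (u y - z - A *v (y - x)) / \<rho>) \<partial>lebesgue)
               / emeasure lebesgue (ball x \<rho>))
          \<longlongrightarrow> 0) (at_right 0))"

text \<open>
  The approximate gradient is unique where it exists, which for BV maps is almost everywhere; the
  value elsewhere is irrelevant.
\<close>

definition approx_gradient :: "(real^'n \<Rightarrow> real^'m) \<Rightarrow> real^'n \<Rightarrow> real^'n^'m" where
  "approx_gradient u x =
     (if \<exists>A. has_approx_gradient u A x then THE A. has_approx_gradient u A x else 0)"


section \<open>Sobolev and SBV maps\<close>

text \<open>
  Test functions of class \<open>C\<^sub>c\<^sup>1(\<Omega>)\<close>, as in Evans and Gariepy, ``Measure Theory and Fine Properties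
  of Functions'', where they are used for both weak and BV derivatives.
\<close>

definition test_function ::
    "(real^'n) set \<Rightarrow> (real^'n \<Rightarrow> real) \<Rightarrow> (real^'n \<Rightarrow> real^'n) \<Rightarrow> bool" where
  "test_function \<Omega> \<phi> D\<phi> \<longleftrightarrow>
     (\<forall>x. GDERIV \<phi> x :> D\<phi> x) \<and> continuous_on UNIV D\<phi> \<and>
     compact (closure {x. \<phi> x \<noteq> 0}) \<and> closure {x. \<phi> x \<noteq> 0} \<subseteq> \<Omega>"

definition L2_on :: "(real^'n) set \<Rightarrow> (real^'n \<Rightarrow> 'b::euclidean_space) \<Rightarrow> bool" where
  "L2_on \<Omega> f \<longleftrightarrow>
     f \<in> borel_measurable (lebesgue_on \<Omega>) \<and> integrable (lebesgue_on \<Omega>) (\<lambda>x. (norm (f x))\<^sup>2)"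

definition weak_gradient ::
    "(real^'n) set \<Rightarrow> (real^'n \<Rightarrow> real^'m) \<Rightarrow> (real^'n \<Rightarrow> real^'n^'m) \<Rightarrow> bool" where
  "weak_gradient \<Omega> u G \<longleftrightarrow>
     (\<forall>\<phi> D\<phi> i j. test_function \<Omega> \<phi> D\<phi> \<longrightarrow>
        (LINT x:\<Omega>|lebesgue. u x $ i * D\<phi> x $ j) = - (LINT x:\<Omega>|lebesgue. \<phi> x * G x $ i $ j))"

definition W12 :: "(real^'n) set \<Rightarrow> (real^'n \<Rightarrow> real^'m) set" where
  "W12 \<Omega> = {u. L2_on \<Omega> u \<and> (\<exists>G. L2_on \<Omega> G \<and> weak_gradient \<Omega> u G)}"

text \<open>
  The distributional derivative of \<open>u\<close> on \<open>\<Omega>\<close> is the finite matrix-valued measure \<open>G \<L>\<^sup>d + \<sigma> \<mu>\<close>, in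
  its Lebesgue decomposition: \<open>\<sigma> \<mu>\<close> is the polar decomposition of the singular part
  \<open>D\<^sup>s u\<close>, so \<open>\<mu>\<close> is the total variation \<open>|D\<^sup>s u|\<close>.
\<close>

definition BV_derivative ::
    "(real^'n) set \<Rightarrow> (real^'n \<Rightarrow> real^'m) \<Rightarrow> (real^'n \<Rightarrow> real^'n^'m) \<Rightarrow>
     (real^'n) measure \<Rightarrow> (real^'n \<Rightarrow> real^'n^'m) \<Rightarrow> bool" where
  "BV_derivative \<Omega> u G \<mu> \<sigma> \<longleftrightarrow>
     G absolutely_integrable_on \<Omega> \<and>
     finite_measure \<mu> \<and> sets \<mu> = sets borel \<and> (AE x in \<mu>. x \<in> \<Omega>) \<and>
     (\<exists>N \<in> null_sets lborel. AE x in \<mu>. x \<in> N) \<and>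
     \<sigma> \<in> borel_measurable borel \<and> (AE x in \<mu>. norm (\<sigma> x) = 1) \<and>
     (\<forall>\<phi> D\<phi> i j. test_function \<Omega> \<phi> D\<phi> \<longrightarrow>
        (LINT x:\<Omega>|lebesgue. u x $ i * D\<phi> x $ j) =
          - ((LINT x:\<Omega>|lebesgue. \<phi> x * G x $ i $ j) + (LINT x|\<mu>. \<phi> x * \<sigma> x $ i $ j)))"

text \<open>
  \<open>SBV\<close> is the set of BV maps without Cantor part. The Cantor part is the restriction of \<open>D\<^sup>s u\<close>
  to the complement of the approximate discontinuity set (AFP, Definition 3.91).
\<close>

definition SBV :: "(real^'n) set \<Rightarrow> (real^'n \<Rightarrow> real^'m) set" where
  "SBV \<Omega> = {u. u absolutely_integrable_on \<Omega> \<and>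
     (\<exists>G \<mu> \<sigma>. BV_derivative \<Omega> u G \<mu> \<sigma> \<and> (AE x in \<mu>. x \<in> approx_discontinuity_set \<Omega> u))}"

definition SBV2 :: "(real^'n) set \<Rightarrow> (real^'n \<Rightarrow> real^'m) set" where
  "SBV2 \<Omega> = {u \<in> SBV \<Omega>. L2_on \<Omega> (approx_gradient u) \<and>
     hausdorff_measure (CARD('n) - 1) (approx_discontinuity_set \<Omega> u) < \<infinity>}"

text \<open>The inner boundary trace \<open>u\<^sup>\<Omega>(x)\<close> of a BV (in particular Sobolev) map: AFP, Theorem 3.87.\<close>

definition has_trace_at ::
    "(real^'n) set \<Rightarrow> (real^'n \<Rightarrow> real^'m) \<Rightarrow> real^'n \<Rightarrow> real^'m \<Rightarrow> bool" where
  "has_trace_at \<Omega> u x z \<longleftrightarrow>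
     ((\<lambda>\<rho>. (\<integral>\<^sup>+y\<in>\<Omega> \<inter> ball x \<rho>. ennreal (norm (u y - z)) \<partial>lebesgue) / ennreal (\<rho> ^ CARD('n)))
        \<longlongrightarrow> 0) (at_right 0)"

definition has_trace ::
    "(real^'n) set \<Rightarrow> (real^'n \<Rightarrow> real^'m) \<Rightarrow> (real^'n \<Rightarrow> real^'m) \<Rightarrow> bool" where
  "has_trace \<Omega> u g \<longleftrightarrow>
     hausdorff_measure (CARD('n) - 1) {x \<in> frontier \<Omega>. \<not> has_trace_at \<Omega> u x (g x)} = 0"


section \<open>The variational problem on the unit ball\<close>

text \<open>
  Extension of \<open>n\<close> from the unit ball by the radial map \<open>x/|x|\<close>, which has boundary values
  \<open>n(x) = x\<close>. The discontinuity set is that of the extended map in a larger ball of radius \<open>R\<close>, so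
  it includes the points of the unit sphere where the boundary condition is not attained.
\<close>

definition radial_extension :: "(real^'n \<Rightarrow> real^'n) \<Rightarrow> real^'n \<Rightarrow> real^'n" where
  "radial_extension n x = (if x \<in> ball 0 1 then n x else x /\<^sub>R norm x)"

definition energy :: "real \<Rightarrow> real \<Rightarrow> (real^'n \<Rightarrow> real^'n) \<Rightarrow> ennreal" where
  "energy R K n =
     (\<integral>\<^sup>+x\<in>ball 0 1. ennreal ((norm (approx_gradient n x))\<^sup>2) \<partial>lebesgue) +
     ennreal K * hausdorff_measure (CARD('n) - 1)
       (approx_discontinuity_set (ball 0 R) (radial_extension n))"

definition admissible_SBV :: "real \<Rightarrow> (real^'n \<Rightarrow> real^'n) set" where
  "admissible_SBV R = {n \<in> SBV2 (ball 0 1).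
     (AE x in lebesgue_on (ball 0 1). n x \<in> sphere 0 1 \<union> {0}) \<and>
     radial_extension n \<in> SBV2 (ball 0 R)}"

definition admissible_Sobolev :: "(real^'n \<Rightarrow> real^'n) set" where
  "admissible_Sobolev = {n \<in> W12 (ball 0 1).
     (AE x in lebesgue_on (ball 0 1). n x \<in> sphere 0 1) \<and>
     has_trace (ball 0 1) n (\<lambda>x. x)}"

end

theory Submission
  imports Defs
begin

text \<open>
  The competitor in \<open>\<A>\<close> is the hedgehog \<open>x/|x|\<close> set to \<open>0\<close> on a small cube of half-width \<open>r\<close>: the
  jump costs \<open>O(r\<^sup>d\<^sup>-\<^sup>1)\<close>, while for \<open>d \<ge> 3\<close> the Dirichlet energy drops by a multiple of
  \<open>r\<^sup>d\<^sup>-\<^sup>2\<close>. For the lower bound in \<open>\<B>\<close>, differentiate \<open>|n| = 1\<close>: the gradient \<open>A\<close> satisfies \<open>A\<^sup>Tn = 0\<close>, so it has rank at most \<open>d - 1\<close>,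
  which gives \<open>(tr A)\<^sup>2 - tr A\<^sup>2 \<le> (d - 2)|A|\<^sup>2\<close>. The left-hand side is a null Lagrangian, so its
  integral is determined by the boundary values and equals \<open>d(d - 1)|\<Omega>|\<close>, the value for \<open>n(x) = x\<close>.
  For \<open>d \<ge> 3\<close> this bounds the energy from below by that of the hedgehog; for \<open>d = 2\<close> it is a contradiction,
  so \<open>\<B>\<close> is empty.
\<close>

text \<open>The obstacle is low regularity: \<open>n\<close> is only of class W^{1,2}, so neither
  |n| = 1 nor the null Lagrangian can be differentiated classically, and both are settled without
  approximation by smooth maps. Weak derivatives are integrated along segments, which gives L^1
  differentiability at Lebesgue points; tangency then follows because |n| = 1 makes the normal
  component of an increment quadratic in the increment. For the minors, smoothed difference
  quotients are formed with the odd kernel \<open>ker\<close>. These averaging operators commute and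
  are antisymmetric, so exchanging two partial derivatives is an exact identity at every scale, and
  only a limit remains. The boundary condition enters by extending n - x by zero; a trace known off
  an H^{d-1}-null subset of the sphere suffices, since the cone over such a set is Lebesgue null.
  For d >= 3 the constants match: the hedgehog has equality in the pointwise inequality and its
  energy d(d-1)|\<Omega>|/(d-2) is the lower bound, so any gain over it, however small, separates
  the two infima.\<close>

lemma ball_measurable[measurable]: "ball (x::'a::euclidean_space) r \<in> sets borel" "cball x r \<in> sets borel"
  "cbox x y \<in> sets borel"
  by auto

section \<open>Coordinate reflections and Lebesgue points\<close>

definition reflect_by :: "('a::euclidean_space \<Rightarrow> real) \<Rightarrow> 'a \<Rightarrow> 'a" where
  "reflect_by s x = (\<Sum>j\<in>Basis. (s j * (x \<bullet> j)) *\<^sub>R j)"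

lemma reflect_by_inner: "j \<in> Basis \<Longrightarrow> reflect_by s x \<bullet> j = s j * (x \<bullet> j)"
  by (simp add: reflect_by_def)

lemma linear_reflect_by: "linear (reflect_by s)"
  by (auto simp: reflect_by_def linear_iff inner_simps algebra_simps sum.distrib scaleR_sum_right)

lemma measurable_reflect_by[measurable]: "reflect_by s \<in> borel_measurable borel"
  by (simp add: reflect_by_def[abs_def])

text \<open>The extensional product pins the values off \<open>Basis\<close>, which makes the set
  finite with exactly one element per orthant.\<close>

definition signs :: "('a::euclidean_space \<Rightarrow> real) set" where
  "signs = (\<Pi>\<^sub>E j\<in>Basis. {1, -1})"

lemma finite_signs: "finite signs"
  unfolding signs_def by (intro finite_PiE) auto

lemma card_signs: "card (signs :: ('a::euclidean_space \<Rightarrow> real) set) = 2 ^ DIM('a)"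
  unfolding signs_def by (simp add: card_PiE numeral_2_eq_2)

lemma signs_square: "s \<in> signs \<Longrightarrow> j \<in> Basis \<Longrightarrow> s j * s j = 1"
  by (auto simp: signs_def PiE_iff)

lemma reflect_by_idem: "s \<in> signs \<Longrightarrow> reflect_by s (reflect_by s x) = x"
  by (rule euclidean_eqI) (simp add: reflect_by_inner signs_square mult.assoc[symmetric])

lemma norm_reflect_by: 
  assumes "s \<in> signs" shows "norm (reflect_by s x) = norm x"
proof -
  have "(reflect_by s x \<bullet> j)\<^sup>2 = (x \<bullet> j)\<^sup>2" if "j \<in> Basis" for j
    using signs_square[OF assms that] that
    by (simp add: reflect_by_inner power2_eq_square algebra_simps)
  then show ?thesis
    by (simp add: norm_eq_sqrt_inner euclidean_inner[of _ x] euclidean_inner[of _ "reflect_by s x"] power2_eq_square)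
qed

lemma distr_reflect_by:
  assumes "s \<in> signs" shows "distr lborel borel (reflect_by s) = lborel"
proof -
  have "lborel = density (distr lborel borel (reflect_by s)) (\<lambda>_. (\<Prod>j\<in>Basis. \<bar>s j\<bar>))"
    using lborel_affine_euclidean[of s 0] signs_square[OF assms] 
    by (force simp: reflect_by_def[abs_def])
  also have "(\<Prod>j\<in>Basis. \<bar>s j\<bar>) = 1"
    using assms by (intro prod.neutral) (auto simp: signs_def PiE_iff)
  finally show ?thesis by (simp add: density_1)
qed

lemma nn_integral_reflect_by:
  assumes "s \<in> signs" and [measurable]: "g \<in> borel_measurable borel"
  shows "(\<integral>\<^sup>+y. g (reflect_by s y) \<partial>lborel) = (\<integral>\<^sup>+y. g y \<partial>lborel)"
  by (subst (2) distr_reflect_by[OF assms(1), symmetric]) (simp add: nn_integral_distr)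

text \<open>
  The library differentiates integrals only over cubes having \<open>x\<close> as their lowest corner. Reflecting
  the coordinates handles the other orthants, and together these cover centred balls.
\<close>

lemma cube_averages_bounded:
  fixes g :: "'a::euclidean_space \<Rightarrow> real"
  assumes g[measurable]: "g \<in> borel_measurable borel" and nn: "\<And>x. 0 \<le> g x"
    and fin: "\<And>r. (\<integral>\<^sup>+y\<in>ball 0 r. ennreal (g y) \<partial>lborel) < \<infinity>"
  shows "AE x in lborel. \<forall>e>0. \<exists>d>0. \<forall>h. 0 < h \<and> h < d \<longrightarrow>
    (\<integral>\<^sup>+y\<in>cbox (x - h *\<^sub>R One) (x + h *\<^sub>R One). ennreal (g y) \<partial>lborel)
      \<le> ennreal (h ^ DIM('a) * (2 ^ DIM('a) * (g x + e)))"
proof -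
  have int: "set_integrable lborel (cbox a b) (\<lambda>y. g (reflect_by s y))" if s: "s \<in> signs" for s and a b :: 'a
  proof -
    obtain r where r: "cbox a b \<subseteq> ball 0 r"
      using bounded_subset_ballD[OF bounded_cbox] by blast
    have "(\<integral>\<^sup>+y. ennreal (norm (indicat_real (cbox a b) y *\<^sub>R g (reflect_by s y))) \<partial>lborel)
        \<le> (\<integral>\<^sup>+y. ennreal (g (reflect_by s y)) * indicator (ball 0 r) (reflect_by s y) \<partial>lborel)"
      using r nn by (intro nn_integral_mono) (auto simp: indicator_def norm_reflect_by[OF s])
    also have "\<dots> = (\<integral>\<^sup>+y\<in>ball 0 r. ennreal (g y) \<partial>lborel)"
      by (rule nn_integral_reflect_by[OF s, of "\<lambda>y. ennreal (g y) * indicator (ball 0 r) y"]) measurable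
    also have "\<dots> < \<infinity>" by (rule fin)
    finally show ?thesis
      unfolding set_integrable_def integrable_iff_bounded by simp
  qed
  have "\<exists>N. negligible N \<and> (\<forall>x e. x \<notin> N \<and> 0 < e \<longrightarrow>
               (\<exists>d>0. \<forall>h. 0 < h \<and> h < d \<longrightarrow>
                  norm(integral (cbox x (x + h *\<^sub>R One)) (\<lambda>y. g (reflect_by s y)) /\<^sub>R h ^ DIM('a) - g (reflect_by s x)) < e))"
    if "s \<in> signs" for s :: "'a \<Rightarrow> real"
  proof -
    have "(\<lambda>y. g (reflect_by s y)) integrable_on cbox a b" for a b
      using int[OF that, of a b] by (rule set_borel_integral_eq_integral)
    from integrable_ccontinuous_explicit[OF this] show ?thesis by metis
  qed
  then obtain N where N: "\<And>s. s \<in> signs \<Longrightarrow> negligible (N s)"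
    and Nd: "\<And>s x e. \<lbrakk>s \<in> signs; x \<notin> N s; 0 < e\<rbrakk> \<Longrightarrow>
               (\<exists>d>0. \<forall>h. 0 < h \<and> h < d \<longrightarrow>
                  norm(integral (cbox x (x + h *\<^sub>R One)) (\<lambda>y. g (reflect_by s y)) /\<^sub>R h ^ DIM('a) - g (reflect_by s x)) < e)"
    by metis
  \<comment> \<open>The point to avoid for the function reflected by \<open>s\<close> is the
    reflection of \<open>x\<close>, so each exceptional set is reflected back; a finite union of
    linear images of null sets is null.\<close>
  define M where "M = (\<Union>s\<in>signs. reflect_by s ` N s)"
  have "negligible M" unfolding M_def
    by (intro negligible_Union finite_imageI finite_signs)
       (auto intro!: negligible_differentiable_image_negligible linear_imp_differentiable_on linear_reflect_by N)
  then have "AE x in lborel. x \<notin> M"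
    using AE_not_in[of M lebesgue] by (simp add: negligible_iff_null_sets AE_completion_iff)
  then show ?thesis
  proof (rule AE_mp, intro AE_I2 impI allI)
    fix x :: 'a and e :: real assume x: "x \<notin> M" and e: "e > 0"
    have "\<exists>d>0. \<forall>h. 0 < h \<and> h < d \<longrightarrow>
        (\<integral>\<^sup>+y. ennreal (g y) * indicator (cbox (reflect_by s x) (reflect_by s x + h *\<^sub>R One)) (reflect_by s y) \<partial>lborel)
          \<le> ennreal (h ^ DIM('a) * (g x + e))" if s: "s \<in> signs" for s
    proof -
      have "reflect_by s x \<notin> N s"
        using x s reflect_by_idem[OF s, of x] by (force simp: M_def)
      from Nd[OF s this e] obtain d where d: "d > 0" "\<And>h. 0 < h \<Longrightarrow> h < d \<Longrightarrow>
         norm(integral (cbox (reflect_by s x) (reflect_by s x + h *\<^sub>R One)) (\<lambda>y. g (reflect_by s y)) /\<^sub>R h ^ DIM('a) - g (reflect_by s (reflect_by s x))) < e"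
        by blast
      have "(\<integral>\<^sup>+y. ennreal (g y) * indicator (cbox (reflect_by s x) (reflect_by s x + h *\<^sub>R One)) (reflect_by s y) \<partial>lborel)
          \<le> ennreal (h ^ DIM('a) * (g x + e))" if h: "0 < h" "h < d" for h
      proof -
        let ?C = "cbox (reflect_by s x) (reflect_by s x + h *\<^sub>R One)"
        have "(\<integral>\<^sup>+y. ennreal (g y) * indicator ?C (reflect_by s y) \<partial>lborel)
            = (\<integral>\<^sup>+y. ennreal (g (reflect_by s y)) * indicator ?C (reflect_by s (reflect_by s y)) \<partial>lborel)"
          by (rule nn_integral_reflect_by[OF s, of "\<lambda>y. ennreal (g y) * indicator ?C (reflect_by s y)", symmetric]) simp
        also have "\<dots> = (\<integral>\<^sup>+y. ennreal (indicator ?C y *\<^sub>R g (reflect_by s y)) \<partial>lborel)"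
          by (intro nn_integral_cong) (auto simp: reflect_by_idem[OF s] indicator_def)
        also have "\<dots> = ennreal (LINT y:?C|lborel. g (reflect_by s y))"
          using int[OF s, of "reflect_by s x" "reflect_by s x + h *\<^sub>R One"] nn
          unfolding set_integrable_def set_lebesgue_integral_def by (intro nn_integral_eq_integral) auto
        also have "(LINT y:?C|lborel. g (reflect_by s y)) = integral ?C (\<lambda>y. g (reflect_by s y))"
          by (rule set_borel_integral_eq_integral[OF int[OF s]])
        also have "ennreal \<dots> \<le> ennreal (h ^ DIM('a) * (g x + e))"
        proof (rule ennreal_leI)
          have "integral ?C (\<lambda>y. g (reflect_by s y)) /\<^sub>R h ^ DIM('a) \<le> g x + e"
            using d(2)[OF h] unfolding reflect_by_idem[OF s] real_norm_def by linarith
          then show "integral ?C (\<lambda>y. g (reflect_by s y)) \<le> h ^ DIM('a) * (g x + e)"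
            using h by (simp add: field_simps)
        qed
        finally show ?thesis .
      qed
      with d(1) show ?thesis by blast
    qed
    then have "\<forall>s\<in>signs. \<exists>d. d > 0 \<and> (\<forall>h. 0 < h \<and> h < d \<longrightarrow>
        (\<integral>\<^sup>+y. ennreal (g y) * indicator (cbox (reflect_by s x) (reflect_by s x + h *\<^sub>R One)) (reflect_by s y) \<partial>lborel)
          \<le> ennreal (h ^ DIM('a) * (g x + e)))" by blast
    from bchoice[OF this] obtain D where D': "\<forall>s\<in>signs. D s > 0 \<and> (\<forall>h. 0 < h \<and> h < D s \<longrightarrow>
        (\<integral>\<^sup>+y. ennreal (g y) * indicator (cbox (reflect_by s x) (reflect_by s x + h *\<^sub>R One)) (reflect_by s y) \<partial>lborel)
          \<le> ennreal (h ^ DIM('a) * (g x + e)))" by (rule exE)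
    have D: "D s > 0" 
      "0 < h \<Longrightarrow> h < D s \<Longrightarrow>
        (\<integral>\<^sup>+y. ennreal (g y) * indicator (cbox (reflect_by s x) (reflect_by s x + h *\<^sub>R One)) (reflect_by s y) \<partial>lborel)
          \<le> ennreal (h ^ DIM('a) * (g x + e))" if "s \<in> signs" for s h
      using D'[rule_format, OF that] by blast+
    have ne: "signs \<noteq> ({} :: ('a \<Rightarrow> real) set)"
      by (auto simp: signs_def PiE_eq_empty_iff)
    have "(\<integral>\<^sup>+y\<in>cbox (x - h *\<^sub>R One) (x + h *\<^sub>R One). ennreal (g y) \<partial>lborel)
      \<le> ennreal (h ^ DIM('a) * (2 ^ DIM('a) * (g x + e)))" if h: "0 < h" "h < Min (D ` signs)" for h
    proof -
      have "(\<integral>\<^sup>+y\<in>cbox (x - h *\<^sub>R One) (x + h *\<^sub>R One). ennreal (g y) \<partial>lborel) \<le> 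
        (\<integral>\<^sup>+y. (\<Sum>s\<in>signs. ennreal (g y) * indicator (cbox (reflect_by s x) (reflect_by s x + h *\<^sub>R One)) (reflect_by s y)) \<partial>lborel)"
      proof (rule nn_integral_mono)
        fix y :: 'a
        show "ennreal (g y) * indicator (cbox (x - h *\<^sub>R One) (x + h *\<^sub>R One)) y \<le> 
          (\<Sum>s\<in>signs. ennreal (g y) * indicator (cbox (reflect_by s x) (reflect_by s x + h *\<^sub>R One)) (reflect_by s y))"
        proof (cases "y \<in> cbox (x - h *\<^sub>R One) (x + h *\<^sub>R One)")
          case True
          \<comment> \<open>The signs of the coordinates of y - x name the orthant of
            \<open>y\<close> as seen from \<open>x\<close>; after this reflection \<open>y\<close>
            lies in the cube with lowest corner at the reflected \<open>x\<close>.\<close>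
          define s where "s = restrict (\<lambda>j. if (y - x) \<bullet> j \<ge> 0 then 1 else - 1 :: real) Basis"
          have s: "s \<in> signs" by (auto simp: s_def signs_def)
          have "reflect_by s y \<in> cbox (reflect_by s x) (reflect_by s x + h *\<^sub>R One)"
            using True by (auto simp: mem_box reflect_by_inner s_def inner_simps)
          then have "ennreal (g y) * indicator (cbox (x - h *\<^sub>R One) (x + h *\<^sub>R One)) y = 
             ennreal (g y) * indicator (cbox (reflect_by s x) (reflect_by s x + h *\<^sub>R One)) (reflect_by s y)"
            using True by simp
          also have "\<dots> \<le> (\<Sum>s\<in>signs. ennreal (g y) * indicator (cbox (reflect_by s x) (reflect_by s x + h *\<^sub>R One)) (reflect_by s y))"
            by (rule member_le_sum[OF s]) (auto simp: finite_signs)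
          finally show ?thesis .
        qed auto
      qed
      also have "\<dots> = (\<Sum>s\<in>signs. \<integral>\<^sup>+y. ennreal (g y) * indicator (cbox (reflect_by s x) (reflect_by s x + h *\<^sub>R One)) (reflect_by s y) \<partial>lborel)"
        by (rule nn_integral_sum) simp
      also have "\<dots> \<le> (\<Sum>s\<in>(signs :: ('a \<Rightarrow> real) set). ennreal (h ^ DIM('a) * (g x + e)))"
        using h Min_le[OF finite_imageI[OF finite_signs], of _ D] by (intro sum_mono D) (auto intro: less_le_trans)
      also have "\<dots> = ennreal (h ^ DIM('a) * (2 ^ DIM('a) * (g x + e)))"
      proof -
        have "(\<Sum>s\<in>(signs :: ('a \<Rightarrow> real) set). ennreal (h ^ DIM('a) * (g x + e)))
            = ennreal (\<Sum>s\<in>(signs :: ('a \<Rightarrow> real) set). h ^ DIM('a) * (g x + e))"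
          using nn[of x] e h by (intro sum_ennreal) auto
        then show ?thesis by (simp add: card_signs mult.left_commute)
      qed
      finally show ?thesis .
    qed
    moreover have "Min (D ` signs) > 0"
      by (subst Min_gr_iff) (use D(1) finite_signs ne in auto)
    ultimately show "\<exists>d>0. \<forall>h. 0 < h \<and> h < d \<longrightarrow>
       (\<integral>\<^sup>+y\<in>cbox (x - h *\<^sub>R One) (x + h *\<^sub>R One). ennreal (g y) \<partial>lborel)
         \<le> ennreal (h ^ DIM('a) * (2 ^ DIM('a) * (g x + e)))" by blast
  qed
qed

lemma ball_subset_cube: "ball x h \<subseteq> cbox (x - h *\<^sub>R One) (x + h *\<^sub>R One)" for x :: "'a::euclidean_space"
proof
  fix y assume "y \<in> ball x h"
  then have "\<bar>(y - x) \<bullet> j\<bar> \<le> h" if "j \<in> Basis" for j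
    using Basis_le_norm[OF that, of "y - x"] by (simp add: dist_norm norm_minus_commute)
  then show "y \<in> cbox (x - h *\<^sub>R One) (x + h *\<^sub>R One)"
    by (force simp: mem_box inner_simps abs_le_iff)
qed

text \<open>The cube bound is applied to |f - q| for \<open>q\<close> in a countable dense set, so
  that a single null set serves all \<open>q\<close>. At a good \<open>x\<close>, a \<open>q\<close>
  close to \<open>f x\<close> is chosen; the limit of the averages of |f - q| is then small
  too.\<close>

lemma lebesgue_points:
  fixes f :: "'a::euclidean_space \<Rightarrow> 'b::euclidean_space"
  assumes f[measurable]: "f \<in> borel_measurable borel" 
    and fin: "\<And>r. (\<integral>\<^sup>+y\<in>ball 0 r. ennreal (norm (f y)) \<partial>lborel) < \<infinity>"
  shows "AE x in lborel. \<forall>e>0. \<exists>d>0. \<forall>h. 0 < h \<and> h < d \<longrightarrow>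
    (\<integral>\<^sup>+y\<in>ball x h. ennreal (norm (f y - f x)) \<partial>lborel) \<le> ennreal (e * h ^ DIM('a))"
proof -
  obtain Q :: "'b set" where Q: "countable Q" "\<And>X. open X \<Longrightarrow> X \<noteq> {} \<Longrightarrow> \<exists>q\<in>Q. q \<in> X"
    using countable_dense_exists by blast
  have "AE x in lborel. \<forall>e>0. \<exists>d>0. \<forall>h. 0 < h \<and> h < d \<longrightarrow>
    (\<integral>\<^sup>+y\<in>cbox (x - h *\<^sub>R One) (x + h *\<^sub>R One). ennreal (norm (f y - q)) \<partial>lborel)
      \<le> ennreal (h ^ DIM('a) * (2 ^ DIM('a) * (norm (f x - q) + e)))" for q
  proof (rule cube_averages_bounded)
    fix r :: real
    have "(\<integral>\<^sup>+y\<in>ball 0 r. ennreal (norm (f y - q)) \<partial>lborel) \<le> 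
        (\<integral>\<^sup>+y. ennreal (norm (f y)) * indicator (ball 0 r) y + ennreal (norm q) * indicator (ball 0 r) y \<partial>lborel)"
      by (intro nn_integral_mono) (auto simp: indicator_def norm_triangle_ineq4 simp flip: ennreal_plus)
    also have "\<dots> = (\<integral>\<^sup>+y\<in>ball 0 r. ennreal (norm (f y)) \<partial>lborel) + ennreal (norm q) * emeasure lborel (ball (0::'a) r)"
      by (subst nn_integral_add) (measurable, auto simp: nn_integral_cmult_indicator)
    also have "\<dots> < \<infinity>" using fin emeasure_lborel_ball_finite[of "0::'a" r]
      by (auto simp: ennreal_mult_less_top)
    finally show "(\<integral>\<^sup>+y\<in>ball 0 r. ennreal (norm (f y - q)) \<partial>lborel) < \<infinity>" .
  qed auto
  then have "AE x in lborel. \<forall>q\<in>Q. \<forall>e>0. \<exists>d>0. \<forall>h. 0 < h \<and> h < d \<longrightarrow>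
    (\<integral>\<^sup>+y\<in>cbox (x - h *\<^sub>R One) (x + h *\<^sub>R One). ennreal (norm (f y - q)) \<partial>lborel)
      \<le> ennreal (h ^ DIM('a) * (2 ^ DIM('a) * (norm (f x - q) + e)))"
    using Q(1) by (simp add: AE_ball_countable)
  then show ?thesis
  proof (rule AE_mp, intro AE_I2 impI allI)
    fix x :: 'a and e :: real 
    assume x: "\<forall>q\<in>Q. \<forall>e>0. \<exists>d>0. \<forall>h. 0 < h \<and> h < d \<longrightarrow>
    (\<integral>\<^sup>+y\<in>cbox (x - h *\<^sub>R One) (x + h *\<^sub>R One). ennreal (norm (f y - q)) \<partial>lborel)
      \<le> ennreal (h ^ DIM('a) * (2 ^ DIM('a) * (norm (f x - q) + e)))" and e: "e > 0"
    \<comment> \<open>The ball sits in a cube of volume (2h)^d, whence the power of 2. The 3 counts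
      the errors: |f x - q| in the limit of the averages, the tolerance of that limit, and |f x - q|
      again from the triangle inequality.\<close>
    define e' where "e' = e / 2 ^ DIM('a) / 3"
    have e': "e' > 0" "2 ^ DIM('a) * (3 * e') = e" using e by (auto simp: e'_def)
    obtain q where q: "q \<in> Q" "norm (f x - q) < e'"
      using Q(2)[of "ball (f x) e'"] e' by (auto simp: dist_norm)
    from x[rule_format, OF q(1) e'(1)] obtain d where d: "d > 0" "\<And>h. 0 < h \<Longrightarrow> h < d \<Longrightarrow>
      (\<integral>\<^sup>+y\<in>cbox (x - h *\<^sub>R One) (x + h *\<^sub>R One). ennreal (norm (f y - q)) \<partial>lborel)
      \<le> ennreal (h ^ DIM('a) * (2 ^ DIM('a) * (norm (f x - q) + e')))" by blast
    have "(\<integral>\<^sup>+y\<in>ball x h. ennreal (norm (f y - f x)) \<partial>lborel) \<le> ennreal (e * h ^ DIM('a))" if h: "0 < h" "h < d" for h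
    proof -
      let ?C = "cbox (x - h *\<^sub>R One) (x + h *\<^sub>R One)"
      have vol: "emeasure lborel ?C = ennreal ((2 * h) ^ DIM('a))"
        using h by (simp add: emeasure_lborel_cbox_eq inner_simps prod_constant)
      have "(\<integral>\<^sup>+y\<in>ball x h. ennreal (norm (f y - f x)) \<partial>lborel) \<le>
         (\<integral>\<^sup>+y. ennreal (norm (f y - q)) * indicator ?C y + ennreal e' * indicator ?C y \<partial>lborel)"
      proof (rule nn_integral_mono)
        fix y
        have "norm (f y - f x) \<le> norm (f y - q) + e'"
          using q(2) norm_triangle_ineq[of "f y - q" "q - f x"] by (simp add: norm_minus_commute)
        then show "ennreal (norm (f y - f x)) * indicator (ball x h) y \<le>
           ennreal (norm (f y - q)) * indicator ?C y + ennreal e' * indicator ?C y"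
          using ball_subset_cube[of x h] e' by (auto simp: indicator_def ennreal_leI simp flip: ennreal_plus)
      qed
      also have "\<dots> = (\<integral>\<^sup>+y\<in>?C. ennreal (norm (f y - q)) \<partial>lborel) + ennreal e' * emeasure lborel ?C"
        by (subst nn_integral_add) (auto simp: nn_integral_cmult_indicator)
      also have "\<dots> \<le> ennreal (h ^ DIM('a) * (2 ^ DIM('a) * (norm (f x - q) + e'))) + ennreal e' * ennreal ((2 * h) ^ DIM('a))"
        using d(2)[OF h] vol by (intro add_mono) auto
      also have "\<dots> = ennreal (h ^ DIM('a) * (2 ^ DIM('a) * (norm (f x - q) + 2 * e')))"
        using e' h by (simp add: power_mult_distrib algebra_simps flip: ennreal_plus ennreal_mult'')
      also have "\<dots> \<le> ennreal (h ^ DIM('a) * (2 ^ DIM('a) * (3 * e')))"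
        using q(2) h by (intro ennreal_leI mult_left_mono) auto
      also have "\<dots> = ennreal (e * h ^ DIM('a))" using e' by (simp add: mult.commute)
      finally show ?thesis .
    qed
    with d(1) show "\<exists>d>0. \<forall>h. 0 < h \<and> h < d \<longrightarrow>
       (\<integral>\<^sup>+y\<in>ball x h. ennreal (norm (f y - f x)) \<partial>lborel) \<le> ennreal (e * h ^ DIM('a))" by blast
  qed
qed

section \<open>Test functions and cutoffs\<close>

lemma DERIV_pos_part_square: "DERIV (\<lambda>t::real. (max 0 t)\<^sup>2) t :> 2 * max 0 t"
proof -
  consider "t < 0" | "t = 0" | "t > 0" by linarith
  then show ?thesis
  proof cases
    case 1
    have "DERIV (\<lambda>t::real. 0) t :> 2 * max 0 t" using 1 by simp
    then show ?thesis
      by (rule has_field_derivative_transform_within_open[where S="{..<0}"]) (use 1 in auto)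
  next
    case 3
    have "DERIV (\<lambda>t::real. t\<^sup>2) t :> 2 * max 0 t" using 3 by (auto intro!: derivative_eq_intros)
    then show ?thesis
      by (rule has_field_derivative_transform_within_open[where S="{0<..}"]) (use 3 in auto)
  next
    case 2
    have "((\<lambda>h::real. (max 0 h)\<^sup>2 / h) \<longlongrightarrow> 0) (at 0)"
    proof (rule Lim_null_comparison)
      show "\<forall>\<^sub>F h::real in at 0. norm ((max 0 h)\<^sup>2 / h) \<le> \<bar>h\<bar>"
        by (intro always_eventually allI) (auto simp: max_def power2_eq_square)
      show "((\<lambda>h::real. \<bar>h\<bar>) \<longlongrightarrow> 0) (at 0)" by (simp add: tendsto_rabs_zero)
    qed
    then show ?thesis using 2 by (simp add: DERIV_def)
  qed
qed

text \<open>The cubic 3t^2 - 2t^3 on [0,1], continued by 0 and 1. The second summand cancels the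
  cubic beyond t = 1; with squared positive parts a single formula is of class C^1, which is the
  regularity asked of test functions.\<close>

definition smoothstep :: "real \<Rightarrow> real" where
  "smoothstep t = (max 0 t)\<^sup>2 * (3 - 2 * t) + (max 0 (t - 1))\<^sup>2 * (2 * t + 1)"

definition smoothstep' :: "real \<Rightarrow> real" where
  "smoothstep' t = 2 * max 0 t * (3 - 2 * t) - 2 * (max 0 t)\<^sup>2
     + (2 * max 0 (t - 1) * (2 * t + 1) + 2 * (max 0 (t - 1))\<^sup>2)"

lemma DERIV_smoothstep: "DERIV smoothstep t :> smoothstep' t"
proof -
  have *: "DERIV (\<lambda>t. (max 0 (t - 1))\<^sup>2) t :> 2 * max 0 (t - 1)"
    using DERIV_chain2[OF DERIV_pos_part_square, of "\<lambda>t. t - 1" 1 t UNIV]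
    by (simp add: DERIV_ident[THEN DERIV_diff, OF DERIV_const, simplified])
  show ?thesis
    unfolding smoothstep_def[abs_def] smoothstep'_def
    by (rule derivative_eq_intros DERIV_pos_part_square * refl)+ (simp add: algebra_simps)
qed

lemma continuous_smoothstep': "continuous_on UNIV smoothstep'"
  unfolding smoothstep'_def[abs_def] by (intro continuous_intros)

lemma smoothstep_0: "t \<le> 0 \<Longrightarrow> smoothstep t = 0"
  by (simp add: smoothstep_def max_def)

lemma smoothstep_1: "t \<ge> 1 \<Longrightarrow> smoothstep t = 1"
  by (simp add: smoothstep_def max_def power2_eq_square algebra_simps)

lemma smoothstep'_eq_0: "t \<le> 0 \<or> t \<ge> 1 \<Longrightarrow> smoothstep' t = 0"
  by (auto simp: smoothstep'_def max_def power2_eq_square algebra_simps)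

lemma smoothstep_bounds: "0 \<le> smoothstep t" "smoothstep t \<le> 1"
proof -
  have "0 \<le> smoothstep t \<and> smoothstep t \<le> 1"
  proof (cases "0 < t \<and> t < 1")
    case True
    \<comment> \<open>This is the factorisation of 1 - t^2(3 - 2t).\<close>
    have "0 \<le> (1 - t)\<^sup>2 * (2 * t + 1)" using True by auto
    then have "t\<^sup>2 * (3 - 2 * t) \<le> 1" by (simp add: power2_eq_square algebra_simps)
    then show ?thesis using True by (simp add: smoothstep_def max_def)
  next
    case False
    then show ?thesis using smoothstep_0[of t] smoothstep_1[of t] by force
  qed
  then show "0 \<le> smoothstep t" "smoothstep t \<le> 1" by auto
qed

lemma smoothstep'_bound: "\<bar>smoothstep' t\<bar> \<le> 2"
proof (cases "0 < t \<and> t < 1")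
  case True
  have "0 \<le> (2 * t - 1)\<^sup>2" by simp
  then have "6 * (t * (1 - t)) \<le> 2" by (simp add: power2_eq_square algebra_simps)
  moreover have "0 \<le> t * (1 - t)" using True by auto
  moreover have "smoothstep' t = 6 * (t * (1 - t))"
    using True by (simp add: smoothstep'_def max_def power2_eq_square algebra_simps)
  ultimately show ?thesis by simp
next
  case False
  then show ?thesis using smoothstep'_eq_0[of t] by force
qed

lemma GDERIV_smoothstep_comp:
  fixes g :: "real^'n \<Rightarrow> real"
  assumes "GDERIV g x :> Dg"
  shows "GDERIV (\<lambda>x. smoothstep (g x)) x :> smoothstep' (g x) *\<^sub>R Dg"
  by (rule GDERIV_DERIV_compose[OF assms DERIV_smoothstep])

lemma GDERIV_norm_square:
  fixes a :: "real^'n"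
  shows "GDERIV (\<lambda>x. (norm (x - a))\<^sup>2) x :> 2 *\<^sub>R (x - a)"
  unfolding gderiv_def power2_norm_eq_inner
  by (auto intro!: derivative_eq_intros simp: inner_commute algebra_simps)

lemma GDERIV_imp_isCont:
  assumes "\<And>x. GDERIV g x :> Dg x"
  shows "continuous_on S g"
  using assms unfolding gderiv_def
  by (meson continuous_at_imp_continuous_on has_derivative_continuous)

lemma test_function_continuous:
  assumes "test_function \<Omega> \<phi> D\<phi>"
  shows "continuous_on UNIV \<phi>" "continuous_on UNIV D\<phi>"
    "\<phi> \<in> borel_measurable borel" "D\<phi> \<in> borel_measurable borel"
  using assms GDERIV_imp_isCont[of \<phi> D\<phi> UNIV] unfolding test_function_def
  by (auto intro: borel_measurable_continuous_onI)

lemma test_function_gradient_0: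
  assumes "test_function \<Omega> \<phi> D\<phi>" "x \<notin> closure {x. \<phi> x \<noteq> 0}"
  shows "\<phi> x = 0" "D\<phi> x = 0"
proof -
  let ?U = "- closure {x. \<phi> x \<noteq> 0}"
  have 0: "\<phi> y = 0" if "y \<in> ?U" for y using that closure_subset[of "{x. \<phi> x \<noteq> 0}"] by auto
  have x: "x \<in> ?U" using assms(2) by simp
  then show "\<phi> x = 0" by (rule 0)
  have "((\<lambda>x. 0) has_derivative (\<lambda>h. 0)) (at x)" by (rule has_derivative_const)
  then have "(\<phi> has_derivative (\<lambda>h. 0)) (at x)"
    by (rule has_derivative_transform_within_open[of _ _ _ _ ?U]) (use x 0[symmetric] in \<open>blast+\<close>)
  moreover have "(\<phi> has_derivative (\<lambda>h. h \<bullet> D\<phi> x)) (at x)"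
    using assms(1) by (simp add: test_function_def gderiv_def)
  ultimately have "(\<lambda>h. h \<bullet> D\<phi> x) = (\<lambda>h. 0)" by (rule has_derivative_unique[symmetric])
  then show "D\<phi> x = 0" by (metis inner_eq_zero_iff)
qed

lemma test_function_support:
  assumes "test_function \<Omega> \<phi> D\<phi>"
  obtains R where "R > 0" "\<And>x. R \<le> norm x \<Longrightarrow> \<phi> x = 0" "\<And>x. R \<le> norm x \<Longrightarrow> D\<phi> x = 0"
proof -
  have "bounded (closure {x. \<phi> x \<noteq> 0})"
    using assms by (simp add: test_function_def compact_imp_bounded)
  then obtain R where R: "R > 0" "closure {x. \<phi> x \<noteq> 0} \<subseteq> ball 0 R"
    using bounded_subset_ballD by blast
  then have "x \<notin> closure {x. \<phi> x \<noteq> 0}" if "R \<le> norm x" for x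
    using that by auto
  with R(1) test_function_gradient_0[OF assms] show ?thesis by (metis that)
qed

lemma test_function_mono: "test_function \<Omega> \<phi> D\<phi> \<Longrightarrow> \<Omega> \<subseteq> \<Omega>' \<Longrightarrow> test_function \<Omega>' \<phi> D\<phi>"
  by (auto simp: test_function_def)

lemma test_function_0_outside:
  assumes "test_function \<Omega> \<phi> D\<phi>" "x \<notin> \<Omega>" shows "\<phi> x = 0" "D\<phi> x = 0"
proof -
  have "x \<notin> closure {x. \<phi> x \<noteq> 0}" using assms unfolding test_function_def by auto
  then show "\<phi> x = 0" "D\<phi> x = 0" by (rule test_function_gradient_0[OF assms(1)])+
qed

lemma compact_support_bounded:
  fixes f :: "real^'n \<Rightarrow> 'b::euclidean_space"
  assumes c: "continuous_on UNIV f" and z: "\<And>x. R \<le> norm x \<Longrightarrow> f x = 0"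
  shows "\<exists>B>0. \<forall>x. norm (f x) \<le> B" "integrable lborel f"
proof -
  have "compact (f ` cball 0 R)"
    using c by (intro compact_continuous_image) (auto intro: continuous_on_subset)
  then obtain B where B: "B > 0" "\<And>x. x \<in> cball 0 R \<Longrightarrow> norm (f x) \<le> B"
    using compact_imp_bounded bounded_pos by (metis image_eqI)
  have "norm (f x) \<le> B" for x
    using B z[of x] by (cases "norm x \<le> R") auto
  with B show "\<exists>B>0. \<forall>x. norm (f x) \<le> B" by blast
  have "integrable lborel (\<lambda>x. indicator (cball 0 R) x *\<^sub>R f x)"
    by (intro borel_integrable_compact continuous_on_subset[OF c]) auto
  moreover have "(\<lambda>x. indicator (cball 0 R) x *\<^sub>R f x) = f"
    by (rule ext) (simp add: indicator_def z)
  ultimately show "integrable lborel f" by simp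
qed

lemma test_function_bounded:
  assumes "test_function \<Omega> \<phi> D\<phi>"
  obtains B where "B > 0" "\<And>x. \<bar>\<phi> x\<bar> \<le> B" "\<And>x. norm (D\<phi> x) \<le> B"
proof -
  obtain R where "R > 0" and R: "\<And>x. R \<le> norm x \<Longrightarrow> \<phi> x = 0" "\<And>x. R \<le> norm x \<Longrightarrow> D\<phi> x = 0"
    using test_function_support[OF assms] by blast
  obtain B1 where "B1 > 0" "\<And>x. \<bar>\<phi> x\<bar> \<le> B1" 
    using compact_support_bounded(1)[OF test_function_continuous(1)[OF assms] R(1)] by auto
  moreover obtain B2 where "B2 > 0" "\<And>x. norm (D\<phi> x) \<le> B2"
    using compact_support_bounded(1)[OF test_function_continuous(2)[OF assms] R(2)] by auto
  ultimately show ?thesis using that[of "max B1 B2"] by (metis max.coboundedI1 max.coboundedI2 less_max_iff_disj)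
qed

lemma test_function_integrable:
  assumes "test_function \<Omega> \<phi> D\<phi>"
  shows "integrable lborel \<phi>" "integrable lborel D\<phi>"
proof -
  obtain R where "R > 0" and R: "\<And>x. R \<le> norm x \<Longrightarrow> \<phi> x = 0" "\<And>x. R \<le> norm x \<Longrightarrow> D\<phi> x = 0"
    using test_function_support[OF assms] by blast
  then show "integrable lborel \<phi>" "integrable lborel D\<phi>"
    using compact_support_bounded(2)[OF test_function_continuous(1)[OF assms] R(1)]
     compact_support_bounded(2)[OF test_function_continuous(2)[OF assms] R(2)] by auto
qed

text \<open>The support of the product lies in the closed set \<open>C\<close> and in the support of
  \<open>\<phi>\<close>. Compactness comes from \<open>\<phi>\<close>, the location from
  \<open>C\<close>, so a factor \<open>\<eta>\<close> without compact support can move a test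
  function from one open set to another.\<close>

lemma test_function_mult:
  assumes "test_function \<Omega> \<phi> D\<phi>" 
    and \<eta>: "\<And>x. GDERIV \<eta> x :> D\<eta> x" "continuous_on UNIV D\<eta>"
    and C: "closed C" "\<And>x. x \<notin> C \<Longrightarrow> \<eta> x = 0" and sub: "C \<inter> \<Omega> \<subseteq> \<Omega>'"
  shows "test_function \<Omega>' (\<lambda>x. \<phi> x * \<eta> x) (\<lambda>x. \<phi> x *\<^sub>R D\<eta> x + \<eta> x *\<^sub>R D\<phi> x)"
  unfolding test_function_def
proof (intro conjI allI)
  have \<phi>: "\<And>x. GDERIV \<phi> x :> D\<phi> x" "compact (closure {x. \<phi> x \<noteq> 0})" "closure {x. \<phi> x \<noteq> 0} \<subseteq> \<Omega>"
    using assms(1) by (auto simp: test_function_def)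
  show "GDERIV (\<lambda>x. \<phi> x * \<eta> x) x :> \<phi> x *\<^sub>R D\<eta> x + \<eta> x *\<^sub>R D\<phi> x" for x
    by (rule GDERIV_mult[OF \<phi>(1) \<eta>(1)])
  show "continuous_on UNIV (\<lambda>x. \<phi> x *\<^sub>R D\<eta> x + \<eta> x *\<^sub>R D\<phi> x)"
    using test_function_continuous[OF assms(1)] \<eta>(2) GDERIV_imp_isCont[of \<eta> D\<eta> UNIV, OF \<eta>(1)]
    by (intro continuous_intros) auto
  have "closure {x. \<phi> x * \<eta> x \<noteq> 0} \<subseteq> closure {x. \<phi> x \<noteq> 0}"
    by (rule closure_mono) auto
  moreover have "closure {x. \<phi> x * \<eta> x \<noteq> 0} \<subseteq> C"
    using C by (intro closure_minimal) auto
  ultimately show "closure {x. \<phi> x * \<eta> x \<noteq> 0} \<subseteq> \<Omega>'"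
    using \<phi>(3) sub by blast
  have eq: "closure {x. \<phi> x * \<eta> x \<noteq> 0} = closure {x. \<phi> x \<noteq> 0} \<inter> closure {x. \<phi> x * \<eta> x \<noteq> 0}"
    using \<open>_ \<subseteq> closure {x. \<phi> x \<noteq> 0}\<close> by blast
  show "compact (closure {x. \<phi> x * \<eta> x \<noteq> 0})"
    by (subst eq) (rule compact_Int_closed[OF \<phi>(2) closed_closure])
qed

text \<open>As \<open>k\<close> grows the bump tends to the indicator of the open ball of radius
  \<open>r\<close> about \<open>a\<close>, while its support stays in the closed ball; with fixed
  \<open>k\<close> it is a plateau function.\<close>

lemma test_function_bump:
  fixes a :: "real^'n"
  assumes "r > 0" and that: "k > 0"
  shows "test_function UNIV (\<lambda>x. smoothstep (k * (r\<^sup>2 - (norm (x - a))\<^sup>2)))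
           (\<lambda>x. smoothstep' (k * (r\<^sup>2 - (norm (x - a))\<^sup>2)) *\<^sub>R (- (2 * k) *\<^sub>R (x - a)))"
  unfolding test_function_def
proof (intro conjI allI)
  let ?g = "\<lambda>x. k * (r\<^sup>2 - (norm (x - a))\<^sup>2)"
  have "GDERIV ?g x :> - (2 * k) *\<^sub>R (x - a)" for x
    unfolding gderiv_def power2_norm_eq_inner
    by (auto intro!: derivative_eq_intros simp: inner_commute algebra_simps)
  then show "GDERIV (\<lambda>x. smoothstep (?g x)) x :> smoothstep' (?g x) *\<^sub>R (- (2 * k) *\<^sub>R (x - a))" for x
    by (rule GDERIV_smoothstep_comp)
  show "continuous_on UNIV (\<lambda>x. smoothstep' (?g x) *\<^sub>R (- (2 * k) *\<^sub>R (x - a)))"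
    by (intro continuous_intros continuous_on_compose2[OF continuous_smoothstep']) auto
  have "closure {x. smoothstep (?g x) \<noteq> 0} \<subseteq> cball a r"
  proof (rule closure_minimal)
    show "{x. smoothstep (?g x) \<noteq> 0} \<subseteq> cball a r"
    proof
      fix x assume "x \<in> {x. smoothstep (?g x) \<noteq> 0}"
      then have "?g x > 0" using smoothstep_0[of "?g x"] by force
      then have "(norm (x - a))\<^sup>2 < r\<^sup>2" using that by (simp add: zero_less_mult_iff)
      then show "x \<in> cball a r" using assms
        by (simp add: power2_less_imp_less dist_norm norm_minus_commute less_imp_le)
    qed
  qed simp
  then show "compact (closure {x. smoothstep (?g x) \<noteq> 0})" 
    by (metis closed_closure compact_Int_closed compact_cball inf.absorb_iff2)
qed simp

section \<open>The fundamental lemma of the calculus of variations\<close>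

text \<open>Bumps approximate indicators of balls, so the integral of \<open>f\<close> over every
  ball vanishes. At a Lebesgue point the value is the limit of these averages, hence 0.\<close>

lemma fundamental_lemma:
  fixes f :: "real^'n \<Rightarrow> real"
  assumes f[measurable]: "f \<in> borel_measurable borel"
    and fin: "\<And>r. (\<integral>\<^sup>+y\<in>ball 0 r. ennreal (norm (f y)) \<partial>lborel) < \<infinity>"
    and orth: "\<And>\<phi> D\<phi>. test_function UNIV \<phi> D\<phi> \<Longrightarrow> (\<integral>x. f x * \<phi> x \<partial>lborel) = 0"
  shows "AE x in lborel. f x = 0"
proof -
  have int: "set_integrable lborel (ball a r) f" for a r
  proof -
    obtain R where R: "ball a r \<subseteq> ball 0 R" using bounded_subset_ballD[OF bounded_ball] by blast
    have "(\<integral>\<^sup>+y. ennreal (norm (indicat_real (ball a r) y *\<^sub>R f y)) \<partial>lborel)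
       \<le> (\<integral>\<^sup>+y\<in>ball 0 R. ennreal (norm (f y)) \<partial>lborel)"
      using R by (intro nn_integral_mono) (auto simp: indicator_def)
    then show ?thesis using fin[of R]
      unfolding set_integrable_def integrable_iff_bounded by (auto intro: le_less_trans)
  qed
  have zero: "(LINT y:ball a r|lborel. f y) = 0" if "r > 0" for a r
  proof -
    define \<phi> where "\<phi> n x = smoothstep (real (Suc n) * (r\<^sup>2 - (norm (x - a))\<^sup>2))" for n x
    have [measurable]: "\<phi> n \<in> borel_measurable borel" for n
      using test_function_continuous(3)[OF test_function_bump[OF that, of "real (Suc n)" a]] by (simp add: \<phi>_def[abs_def])
    have out: "\<phi> n x = 0" if "x \<notin> ball a r" for n x
    proof -
      have "r\<^sup>2 \<le> (norm (x - a))\<^sup>2" using that \<open>r > 0\<close>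
        by (intro power_mono) (auto simp: dist_norm norm_minus_commute)
      then show ?thesis unfolding \<phi>_def
        by (intro smoothstep_0) (simp add: mult_nonneg_nonpos)
    qed
    have "(\<lambda>n. \<integral>x. f x * \<phi> n x \<partial>lborel) \<longlonglongrightarrow> (\<integral>x. f x * indicator (ball a r) x \<partial>lborel)"
    proof (rule integral_dominated_convergence)
      show "integrable lborel (\<lambda>x. norm (f x * indicator (ball a r) x))"
        using int[of a r] by (simp add: set_integrable_def mult.commute)
      show "AE x in lborel. (\<lambda>n. f x * \<phi> n x) \<longlonglongrightarrow> f x * indicator (ball a r) x"
      proof (intro AE_I2)
        fix x
        show "(\<lambda>n. f x * \<phi> n x) \<longlonglongrightarrow> f x * indicator (ball a r) x"
        proof (cases "x \<in> ball a r")
          case True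
          then have "(norm (x - a))\<^sup>2 < r\<^sup>2" 
            by (intro power_strict_mono) (auto simp: dist_norm norm_minus_commute)
          then have c: "r\<^sup>2 - (norm (x - a))\<^sup>2 > 0" by simp
          obtain N where N: "1 / (r\<^sup>2 - (norm (x - a))\<^sup>2) < real N" using reals_Archimedean2 by blast
          have "\<phi> n x = 1" if "n \<ge> N" for n
          proof -
            have "1 \<le> real N * (r\<^sup>2 - (norm (x - a))\<^sup>2)" using N c by (simp add: field_simps)
            also have "\<dots> \<le> real (Suc n) * (r\<^sup>2 - (norm (x - a))\<^sup>2)"
              using that c by (intro mult_right_mono) auto
            finally show ?thesis unfolding \<phi>_def by (rule smoothstep_1)
          qed
          then have "eventually (\<lambda>n. f x * \<phi> n x = f x * indicator (ball a r) x) sequentially"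
            using True by (auto simp: eventually_sequentially)
          then show ?thesis by (rule tendsto_eventually)
        qed (simp add: out)
      qed
      show "AE x in lborel. norm (f x * \<phi> n x) \<le> norm (f x * indicator (ball a r) x)" for n
        using out[of _ n] smoothstep_bounds by (intro AE_I2) (auto simp: indicator_def abs_mult \<phi>_def mult_left_le)
    qed measurable
    moreover have "(\<integral>x. f x * \<phi> n x \<partial>lborel) = 0" for n
      unfolding \<phi>_def by (rule orth, rule test_function_bump[OF that]) simp
    ultimately show ?thesis
      by (simp add: set_lebesgue_integral_def LIMSEQ_const_iff mult.commute)
  qed
  from lebesgue_points[OF f fin]
  show ?thesis
  proof (rule AE_mp, intro AE_I2 impI)
    fix x
    assume x: "\<forall>e>0. \<exists>d>0. \<forall>h. 0 < h \<and> h < d \<longrightarrow>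
       (\<integral>\<^sup>+y\<in>ball x h. ennreal (norm (f y - f x)) \<partial>lborel) \<le> ennreal (e * h ^ DIM(real^'n))"
    \<comment> \<open>Since \<open>f\<close> integrates to 0 over the ball, the integral of f y - f
      x there is -f x times the volume, and the Lebesgue point property bounds it by e h^d.\<close>
    have "\<bar>f x\<bar> * unit_ball_vol (real DIM(real^'n)) \<le> e" if e: "e > 0" for e
    proof -
      obtain d where d: "d > 0" "\<And>h. 0 < h \<Longrightarrow> h < d \<Longrightarrow> 
         (\<integral>\<^sup>+y\<in>ball x h. ennreal (norm (f y - f x)) \<partial>lborel) \<le> ennreal (e * h ^ DIM(real^'n))"
        using x[rule_format, OF e] by auto
      define h where "h = d / 2"
      have h: "0 < h" "h < d" using d by (auto simp: h_def)
      have [simp]: "integrable lborel (indicat_real (ball x h))"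
        using emeasure_lborel_ball_finite[of x h] by (intro integrable_real_indicator) auto
      have i1: "set_integrable lborel (ball x h) (\<lambda>y. f y - f x)"
        using int[of x h] by (intro set_integral_diff) (auto simp: set_integrable_def emeasure_lborel_ball_finite)
      have "ennreal (\<bar>f x\<bar> * measure lborel (ball x h)) = ennreal (norm (LINT y:ball x h|lborel. f y - f x))"
        using int[of x h] zero[OF h(1), of x]
        by (subst set_integral_diff) (auto simp: set_integrable_def set_lebesgue_integral_def emeasure_lborel_ball_finite abs_mult mult.commute)
      also have "\<dots> \<le> (\<integral>\<^sup>+y. ennreal (norm (indicat_real (ball x h) y *\<^sub>R (f y - f x))) \<partial>lborel)"
        unfolding set_lebesgue_integral_def using i1 unfolding set_integrable_def
        by (rule integral_norm_bound_ennreal)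
      also have "\<dots> = (\<integral>\<^sup>+y\<in>ball x h. ennreal (norm (f y - f x)) \<partial>lborel)"
        by (intro nn_integral_cong) (auto simp: indicator_def)
      also have "\<dots> \<le> ennreal (e * h ^ DIM(real^'n))" by (rule d(2)[OF h])
      finally have "\<bar>f x\<bar> * measure lborel (ball x h) \<le> e * h ^ DIM(real^'n)"
        using e h by (simp add: ennreal_le_iff)
      then have "\<bar>f x\<bar> * (unit_ball_vol (real DIM(real^'n)) * h ^ DIM(real^'n)) \<le> e * h ^ DIM(real^'n)"
        using h by (simp add: content_ball)
      then show ?thesis using h by (simp add: mult.assoc[symmetric] del: mult.assoc)
    qed
    then have "\<bar>f x\<bar> * unit_ball_vol (real DIM(real^'n)) \<le> 0" by (rule field_le_epsilon[of _ 0, simplified])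
    then show "f x = 0"
      using unit_ball_vol_pos[of "real DIM(real^'n)"] by (auto simp: mult_le_0_iff dest: leD)
  qed
qed

section \<open>Translations, dilations and slices\<close>

lemma nn_integral_translate:
  fixes f :: "'a::euclidean_space \<Rightarrow> ennreal"
  assumes [measurable]: "f \<in> borel_measurable borel"
  shows "(\<integral>\<^sup>+x. f (a + x) \<partial>lborel) = (\<integral>\<^sup>+x. f x \<partial>lborel)"
  by (subst (2) lborel_distr_plus[of a, symmetric]) (simp add: nn_integral_distr)

lemma integral_translate:
  fixes f :: "'a::euclidean_space \<Rightarrow> 'b::{banach,second_countable_topology}"
  assumes [measurable]: "f \<in> borel_measurable borel"
  shows "(\<integral>x. f (a + x) \<partial>lborel) = (\<integral>x. f x \<partial>lborel)"
  by (subst (2) lborel_distr_plus[of a, symmetric]) (simp add: integral_distr)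

lemma integrable_translate:
  fixes f :: "'a::euclidean_space \<Rightarrow> 'b::{banach,second_countable_topology}"
  assumes "integrable lborel f"
  shows "integrable lborel (\<lambda>x. f (a + x))"
proof -
  have "integrable (distr lborel borel ((+) a)) f" using assms by (simp add: lborel_distr_plus)
  then show ?thesis by (rule integrable_distr[rotated]) simp
qed

lemma nn_integral_affine:
  fixes f :: "'a::euclidean_space \<Rightarrow> ennreal"
  assumes [measurable]: "f \<in> borel_measurable borel" and "c > 0"
  shows "(\<integral>\<^sup>+x. f x \<partial>lborel) = ennreal (c ^ DIM('a)) * (\<integral>\<^sup>+x. f (a + c *\<^sub>R x) \<partial>lborel)"
  using assms(2) by (subst lborel_affine[of c a])
     (auto simp: nn_integral_density nn_integral_distr nn_integral_cmult)

text \<open>By Tonelli, an L^1 bound uniform over the parameter interval [0,1] gives joint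
  integrability; this justifies Fubini for integrals along segments.\<close>

lemma integrable_unit_slab:
  fixes f :: "'a::euclidean_space \<Rightarrow> real \<Rightarrow> 'b::{banach,second_countable_topology}"
  assumes f[measurable]: "case_prod f \<in> borel_measurable (lborel \<Otimes>\<^sub>M lborel)"
    and b: "\<And>t. 0 \<le> t \<Longrightarrow> t \<le> 1 \<Longrightarrow> (\<integral>\<^sup>+x. ennreal (norm (f x t)) \<partial>lborel) \<le> C" and C: "C < \<infinity>"
  shows "integrable (lborel \<Otimes>\<^sub>M lborel) (\<lambda>(x, t). indicat_real {0..1} t *\<^sub>R f x t)"
proof -
  have "(\<integral>\<^sup>+z. ennreal (norm (case z of (x, t) \<Rightarrow> indicat_real {0..1} t *\<^sub>R f x t)) \<partial>(lborel \<Otimes>\<^sub>M lborel))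
      = (\<integral>\<^sup>+t. \<integral>\<^sup>+x. ennreal (norm (indicat_real {0..1} t *\<^sub>R f x t)) \<partial>lborel \<partial>lborel)"
    by (subst lborel_pair.nn_integral_snd[symmetric]) auto
  also have "\<dots> \<le> (\<integral>\<^sup>+t. C * indicator {0..1::real} t \<partial>lborel)"
    by (intro nn_integral_mono) (auto simp: indicator_def b)
  also have "\<dots> = C" by (simp add: nn_integral_cmult_indicator)
  finally show ?thesis using C by (auto simp: integrable_iff_bounded)
qed

section \<open>Slicing along a coordinate axis and the fundamental theorem of calculus\<close>

definition put :: "'n::finite \<Rightarrow> real \<Rightarrow> real^'n \<Rightarrow> real^'n" where
  "put j t x = x + (t - x $ j) *\<^sub>R axis j 1"

lemma put_nth: "put j t x $ k = (if k = j then t else x $ k)"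
  by (simp add: put_def axis_def)

lemma borel_measurable_put[measurable (raw)]:
  assumes [measurable]: "f \<in> borel_measurable M" "g \<in> borel_measurable M"
  shows "(\<lambda>x. put j (f x) (g x)) \<in> borel_measurable M"
proof -
  have "(\<lambda>x. g x $ j) = (\<lambda>x. g x \<bullet> axis j 1)" by (simp add: inner_axis)
  then have [measurable]: "(\<lambda>x. g x $ j) \<in> borel_measurable M" by simp
  show ?thesis unfolding put_def by measurable
qed

lemma borel_measurable_nth[measurable (raw)]:
  assumes [measurable]: "g \<in> borel_measurable M"
  shows "(\<lambda>x. (g x :: 'b::euclidean_space^'n) $ j) \<in> borel_measurable M"
  by (rule borel_measurable_continuous_on[OF _ assms, of "\<lambda>v. v $ j"]) (intro continuous_intros)

text \<open>In \<open>put j t x\<close> the old coordinate \<open>x $ j\<close> is overwritten.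
  Confining it to an interval of length 1 makes it integrate out to the factor 1, so the transversal
  variable can stay in the full space.\<close>

definition strip :: "'n::finite \<Rightarrow> (real^'n) set" where
  "strip j = {x. 0 < x $ j \<and> x $ j < 1}"

lemma strip_measurable[measurable]: "strip (j :: 'n::finite) \<in> sets borel"
proof -
  have "{x \<in> space borel. 0 < x $ j \<and> x $ j < 1} \<in> sets (borel :: (real^'n) measure)" by measurable
  then show ?thesis by (simp add: strip_def)
qed

lemma prod_Basis_vec: "(\<Prod>b\<in>(Basis :: (real^'n) set). f b) = (\<Prod>k\<in>UNIV. f (axis k 1))"
proof -
  have "(Basis :: (real^'n) set) = range (\<lambda>k. axis k 1)" by (auto simp: Basis_vec_def)
  moreover have "inj (\<lambda>k::'n. axis k (1::real))" by (auto intro!: injI simp: axis_eq_axis)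
  ultimately show ?thesis by (subst prod.reindex[symmetric, unfolded o_def]) auto
qed

text \<open>Fubini in direction \<open>j\<close> without a separate space of dimension d - 1: the
  transversal variable is a full vector whose \<open>j\<close>-th entry is a dummy of total mass 1.
  Both measures agree on boxes, which determine Lebesgue measure.\<close>

lemma lborel_slice:
  "distr (density (lborel \<Otimes>\<^sub>M lborel) (\<lambda>(t, x). indicator (strip j) x)) borel (\<lambda>(t, x). put j t x)
     = (lborel :: (real^'n::finite) measure)"
proof (rule lborel_eqI[symmetric])
  fix l u :: "real^'n" assume "\<And>b. b \<in> Basis \<Longrightarrow> l \<bullet> b \<le> u \<bullet> b"
  then have "l \<bullet> axis k 1 \<le> u \<bullet> axis k 1" for k by (auto simp: axis_in_Basis_iff)
  then have le: "l $ k \<le> u $ k" for k by (simp add: inner_axis)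
  let ?D = "density (lborel \<Otimes>\<^sub>M lborel) (\<lambda>(t, x). indicator (strip j) x) :: (real \<times> (real^'n)) measure"
  have "emeasure (distr ?D borel (\<lambda>(t, x). put j t x)) (box l u)
     = emeasure ?D ((\<lambda>(t, x). put j t x) -` box l u \<inter> space ?D)"
    by (subst emeasure_distr) auto
  also have "\<dots> = (\<integral>\<^sup>+z. (case z of (t, x) \<Rightarrow> indicator (strip j) x * indicator (box l u) (put j t x)) \<partial>(lborel \<Otimes>\<^sub>M lborel))"
    by (subst emeasure_density, measurable) (auto intro!: nn_integral_cong simp: indicator_def space_pair_measure)
  also have "\<dots> = (\<integral>\<^sup>+t. \<integral>\<^sup>+x. indicator (strip j) x * indicator (box l u) (put j t x) \<partial>lborel \<partial>lborel)"
    by (subst lborel.nn_integral_fst[symmetric]) auto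
  \<comment> \<open>The condition factors: \<open>t\<close> ranges over the \<open>j\<close>-th edge
    of the box, and \<open>x\<close> over the same box with that edge replaced by the unit
    interval.\<close>
  also have "\<dots> = (\<integral>\<^sup>+t. \<integral>\<^sup>+x. indicator {l $ j<..<u $ j} t * indicator (box (put j 0 l) (put j 1 u)) x \<partial>lborel \<partial>lborel)"
    by (intro nn_integral_cong) (auto simp: indicator_def mem_box_cart put_nth strip_def split: if_splits)
  also have "\<dots> = ennreal (u $ j - l $ j) * emeasure lborel (box (put j 0 l) (put j 1 u))"
    using le by (simp add: nn_integral_cmult nn_integral_multc)
  also have "emeasure lborel (box (put j 0 l) (put j 1 u)) = ennreal (\<Prod>k\<in>UNIV. (put j 1 u - put j 0 l) $ k)"
  proof (subst emeasure_lborel_box)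
    show "put j 0 l \<bullet> b \<le> put j 1 u \<bullet> b" if "b \<in> Basis" for b
      using le that by (auto simp: Basis_vec_def inner_axis put_nth)
  qed (simp add: prod_Basis_vec inner_axis)
  also have "(\<Prod>k\<in>UNIV. (put j 1 u - put j 0 l) $ k) = (\<Prod>k\<in>UNIV - {j}. (u - l) $ k)"
    by (subst prod.remove[of _ j]) (auto simp: put_nth intro!: prod.cong)
  also have "ennreal (u $ j - l $ j) * ennreal (\<Prod>k\<in>UNIV - {j}. (u - l) $ k) = ennreal (\<Prod>k\<in>UNIV. (u - l) $ k)"
    using le by (subst (2) prod.remove[of _ j]) (auto simp: ennreal_mult'' prod_nonneg)
  also have "(\<Prod>k\<in>UNIV. (u - l) $ k) = (\<Prod>b\<in>Basis. (u - l) \<bullet> b)"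
    by (simp add: prod_Basis_vec inner_axis)
  finally show "emeasure (distr ?D borel (\<lambda>(t, x). put j t x)) (box l u) = (\<Prod>b\<in>Basis. (u - l) \<bullet> b)" .
qed simp

lemma integral_slice:
  fixes g :: "real^'n::finite \<Rightarrow> 'b::{banach,second_countable_topology}"
  assumes g: "integrable lborel g"
  shows "(\<integral>y. g y \<partial>lborel) = (\<integral>x. indicat_real (strip j) x *\<^sub>R (\<integral>t. g (put j t x) \<partial>lborel) \<partial>lborel)"
    and "integrable lborel (\<lambda>x. indicat_real (strip j) x *\<^sub>R (\<integral>t. g (put j t x) \<partial>lborel))"
proof -
  have gm[measurable]: "g \<in> borel_measurable borel" using g by auto
  have dens: "density (lborel \<Otimes>\<^sub>M lborel) (\<lambda>(t, x). indicator (strip j) x) 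
     = density (lborel \<Otimes>\<^sub>M lborel) (\<lambda>z::real \<times> (real^'n). ennreal (indicat_real (strip j) (snd z)))"
    by (intro arg_cong2[of _ _ _ _ density] ext) (auto simp: indicator_def)
  note sl = lborel_slice[of j, unfolded dens]
  have "integrable (distr (density (lborel \<Otimes>\<^sub>M lborel) (\<lambda>z. ennreal (indicat_real (strip j) (snd z)))) borel (\<lambda>(t, x). put j t x)) g"
    using g by (simp only: sl)
  then have int0: "integrable (lborel \<Otimes>\<^sub>M lborel) (\<lambda>(t, x). indicat_real (strip j) x *\<^sub>R g (put j t x))"
    by (subst (asm) integrable_distr_eq, measurable)
       (subst (asm) integrable_density, auto simp: case_prod_unfold)
  have "(\<integral>y. g y \<partial>lborel) = (\<integral>y. g y \<partial>distr (density (lborel \<Otimes>\<^sub>M lborel) (\<lambda>z. ennreal (indicat_real (strip j) (snd z)))) borel (\<lambda>(t, x). put j t x))"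
    by (simp only: sl)
  also have "\<dots> = (\<integral>z. (case z of (t, x) \<Rightarrow> indicat_real (strip j) x *\<^sub>R g (put j t x)) \<partial>(lborel \<Otimes>\<^sub>M lborel))"
    by (subst integral_distr, measurable)
       (subst integral_density, auto simp: case_prod_unfold)
  also have "\<dots> = (\<integral>x. (\<integral>t. indicat_real (strip j) x *\<^sub>R g (put j t x) \<partial>lborel) \<partial>lborel)"
    using int0 by (subst lborel_pair.integral_snd) (auto simp: case_prod_unfold)
  finally show "(\<integral>y. g y \<partial>lborel) = (\<integral>x. indicat_real (strip j) x *\<^sub>R (\<integral>t. g (put j t x) \<partial>lborel) \<partial>lborel)"
    by simp
  show "integrable lborel (\<lambda>x. indicat_real (strip j) x *\<^sub>R (\<integral>t. g (put j t x) \<partial>lborel))"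
    using lborel_pair.integrable_snd[OF int0] by simp
qed

lemma DERIV_along:
  fixes F :: "real^'n \<Rightarrow> real"
  assumes "\<And>x. GDERIV F x :> DF x"
  shows "DERIV (\<lambda>t. F (a + t *\<^sub>R h)) t :> DF (a + t *\<^sub>R h) \<bullet> h"
proof -
  have "(F has_derivative (\<lambda>k. k \<bullet> DF (a + t *\<^sub>R h))) (at (a + t *\<^sub>R h))"
    using assms by (simp add: gderiv_def)
  moreover have "((\<lambda>t. a + t *\<^sub>R h) has_derivative (\<lambda>s. s *\<^sub>R h)) (at t)"
    by (auto intro!: derivative_eq_intros)
  ultimately have "((\<lambda>t. F (a + t *\<^sub>R h)) has_derivative (\<lambda>s. (s *\<^sub>R h) \<bullet> DF (a + t *\<^sub>R h))) (at t)"
    by (rule has_derivative_compose[rotated])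
  then show ?thesis by (simp add: has_field_derivative_def inner_commute mult_commute_abs)
qed

lemma DERIV_put:
  fixes F :: "real^'n \<Rightarrow> real"
  assumes "\<And>x. GDERIV F x :> DF x"
  shows "DERIV (\<lambda>t. F (put j t x)) t :> DF (put j t x) $ j"
proof -
  have eq: "put j t x = put j 0 x + t *\<^sub>R axis j 1" for t
    by (simp add: put_def algebra_simps)
  show ?thesis using DERIV_along[OF assms, of "put j 0 x" "axis j 1" t]
    by (simp add: eq[symmetric] inner_axis)
qed

lemma FTC_put:
  fixes F :: "real^'n \<Rightarrow> real"
  assumes F: "\<And>x. GDERIV F x :> DF x" and DF: "continuous_on UNIV DF" and ab: "a \<le> b"
  shows "(\<integral>t. DF (put j t x) $ j * indicator {a..b} t \<partial>lborel) = F (put j b x) - F (put j a x)"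
proof (rule integral_FTC_Icc_real[OF ab])
  show "DERIV (\<lambda>t. F (put j t x)) t :> DF (put j t x) $ j" for t
    by (rule DERIV_put[OF F])
  have "continuous_on UNIV (\<lambda>t. DF (put j t x) $ j)"
    unfolding put_def by (intro continuous_intros continuous_on_compose2[OF DF]) auto
  then show "isCont (\<lambda>t. DF (put j t x) $ j) t" for t
    by (simp add: continuous_on_eq_continuous_at)
qed

lemma FTC_line:
  fixes F :: "real^'n \<Rightarrow> real"
  assumes F: "\<And>x. GDERIV F x :> DF x" and DF: "continuous_on UNIV DF"
  shows "(\<integral>t. DF (a + t *\<^sub>R h) \<bullet> h * indicator {0..1} t \<partial>lborel) = F (a + h) - F a"
proof -
  have "(\<integral>t. DF (a + t *\<^sub>R h) \<bullet> h * indicator {0..1} t \<partial>lborel) = F (a + 1 *\<^sub>R h) - F (a + 0 *\<^sub>R h)"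
  proof (rule integral_FTC_Icc_real)
    show "DERIV (\<lambda>t. F (a + t *\<^sub>R h)) t :> DF (a + t *\<^sub>R h) \<bullet> h" for t
      by (rule DERIV_along[OF F])
    have "continuous_on UNIV (\<lambda>t. DF (a + t *\<^sub>R h) \<bullet> h)"
      by (intro continuous_intros continuous_on_compose2[OF DF]) auto
    then show "isCont (\<lambda>t. DF (a + t *\<^sub>R h) \<bullet> h) t" for t
      by (simp add: continuous_on_eq_continuous_at)
  qed simp
  then show ?thesis by simp
qed

text \<open>On every line parallel to the axis the partial derivative integrates to a difference of
  two values outside the support; slicing collects the lines.\<close>

lemma integral_gradient_0:
  assumes "test_function \<Omega> \<phi> D\<phi>"
  shows "(\<integral>x. D\<phi> x $ j \<partial>lborel) = 0"
proof -
  obtain R where R: "R > 0" "\<And>x. R \<le> norm x \<Longrightarrow> \<phi> x = 0" "\<And>x. R \<le> norm x \<Longrightarrow> D\<phi> x = 0"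
    using test_function_support[OF assms] by blast
  have big: "R \<le> norm (put j t x)" if "R \<le> \<bar>t\<bar>" for t x
    using component_le_norm_cart[of "put j t x" j] that by (simp add: put_nth)
  have z: "(\<integral>t. D\<phi> (put j t x) $ j \<partial>lborel) = 0" for x
  proof -
    have "(\<integral>t. D\<phi> (put j t x) $ j \<partial>lborel) = (\<integral>t. D\<phi> (put j t x) $ j * indicator {-R..R} t \<partial>lborel)"
    proof (intro Bochner_Integration.integral_cong refl)
      fix t
      show "D\<phi> (put j t x) $ j = D\<phi> (put j t x) $ j * indicator {-R..R} t"
      proof (cases "t \<in> {-R..R}")
        case False
        then have "R \<le> \<bar>t\<bar>" by auto
        from R(3)[OF big[OF this]] show ?thesis by simp
      qed simp
    qed
    also have "\<dots> = \<phi> (put j R x) - \<phi> (put j (-R) x)"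
      using assms R(1) test_function_continuous[OF assms] by (intro FTC_put) (auto simp: test_function_def)
    finally show ?thesis using R(2)[OF big, of R x] R(2)[OF big, of "-R" x] by auto
  qed
  have "integrable lborel (\<lambda>x. D\<phi> x $ j)"
    using test_function_integrable(2)[OF assms] by (rule integrable_bounded_linear[OF bounded_linear_vec_nth])
  from integral_slice(1)[OF this, of j] show ?thesis by (simp add: z)
qed

section \<open>Weakly differentiable functions on the whole space\<close>

text \<open>Posed on the whole space with globally integrable data, so that translations and
  averages never leave the domain. Maps on the ball are brought here by extension by zero, which is
  where the boundary condition is spent.\<close>

definition weak_deriv :: "(real^'n \<Rightarrow> real) \<Rightarrow> (real^'n \<Rightarrow> real^'n) \<Rightarrow> bool" where
  "weak_deriv v V \<longleftrightarrow> integrable lborel v \<and> integrable lborel V \<and> 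
     (\<forall>\<phi> D\<phi> j. test_function UNIV \<phi> D\<phi> \<longrightarrow> (\<integral>x. v x * D\<phi> x $ j \<partial>lborel) = - (\<integral>x. \<phi> x * V x $ j \<partial>lborel))"

lemma test_function_translate:
  assumes "test_function UNIV \<phi> D\<phi>"
  shows "test_function UNIV (\<lambda>x. \<phi> (a + x)) (\<lambda>x. D\<phi> (a + x))"
  unfolding test_function_def
proof (intro conjI allI)
  have \<phi>: "\<And>x. GDERIV \<phi> x :> D\<phi> x" "compact (closure {x. \<phi> x \<noteq> 0})" "continuous_on UNIV D\<phi>"
    using assms by (auto simp: test_function_def)
  show "GDERIV (\<lambda>x. \<phi> (a + x)) x :> D\<phi> (a + x)" for x
  proof -
    have "((+) a has_derivative (\<lambda>h. h)) (at x)" by (auto intro!: derivative_eq_intros)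
    from has_derivative_compose[OF this \<phi>(1)[of "a + x", unfolded gderiv_def]]
    show ?thesis by (simp add: gderiv_def)
  qed
  show "continuous_on UNIV (\<lambda>x. D\<phi> (a + x))"
    by (intro continuous_on_compose2[OF \<phi>(3)] continuous_intros) auto
  have "{x. \<phi> (a + x) \<noteq> 0} = (\<lambda>x. - a + x) ` {x. \<phi> x \<noteq> 0}"
  proof (intro set_eqI iffI)
    fix x assume "x \<in> {x. \<phi> (a + x) \<noteq> 0}"
    then show "x \<in> (\<lambda>x. - a + x) ` {x. \<phi> x \<noteq> 0}" by (intro image_eqI[of _ _ "a + x"]) auto
  qed auto
  then have "closure {x. \<phi> (a + x) \<noteq> 0} = (\<lambda>x. - a + x) ` closure {x. \<phi> x \<noteq> 0}"
    by (simp only: closure_translation)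
  then show "compact (closure {x. \<phi> (a + x) \<noteq> 0})"
    using compact_translation[OF \<phi>(2), of "- a"] by (simp only:)
qed simp

text \<open>The fundamental theorem along the segment is tested against \<open>\<phi>\<close>: the
  increment of \<open>v\<close> is moved onto \<open>\<phi>\<close> by translation, written there as
  a classical segment integral, and turned back into \<open>V\<close> by the weak derivative at each
  intermediate point. The fundamental lemma removes the test function.\<close>

lemma weak_deriv_line:
  fixes v :: "real^'n \<Rightarrow> real"
  assumes w: "weak_deriv v V"
  shows "AE x in lborel. v (x + h) - v x = (\<integral>t. V (x + t *\<^sub>R h) \<bullet> h * indicator {0..1} t \<partial>lborel)"
proof -
  have iv: "integrable lborel v" and iV: "integrable lborel V"
    and vm[measurable]: "v \<in> borel_measurable borel" and Vm[measurable]: "V \<in> borel_measurable borel"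
    using w by (auto simp: weak_deriv_def)
  define W where "W x = (\<integral>t. indicat_real {0..1} t *\<^sub>R (V (x + t *\<^sub>R h) \<bullet> h) \<partial>lborel)" for x
  have slabV: "integrable (lborel \<Otimes>\<^sub>M lborel) (\<lambda>(x, t). indicat_real {0..1} t *\<^sub>R (\<psi> x * (V (x + t *\<^sub>R h) \<bullet> h)))"
    if [measurable]: "\<psi> \<in> borel_measurable borel" and B: "\<And>x. \<bar>\<psi> x\<bar> \<le> B" for \<psi> B
  proof (rule integrable_unit_slab)
    show "(\<lambda>(x, t). \<psi> x * (V (x + t *\<^sub>R h) \<bullet> h)) \<in> borel_measurable (lborel \<Otimes>\<^sub>M lborel)" by measurable
    let ?C = "(\<integral>\<^sup>+x. ennreal (B * norm h) * ennreal (norm (V x)) \<partial>lborel)"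
    have "B \<ge> 0" using B[of 0] by linarith
    show "(\<integral>\<^sup>+x. ennreal (norm (\<psi> x * (V (x + t *\<^sub>R h) \<bullet> h))) \<partial>lborel) \<le> ?C" for t
    proof -
      have "(\<integral>\<^sup>+x. ennreal (norm (\<psi> x * (V (x + t *\<^sub>R h) \<bullet> h))) \<partial>lborel) \<le> 
        (\<integral>\<^sup>+x. ennreal (B * norm h) * ennreal (norm (V (t *\<^sub>R h + x))) \<partial>lborel)"
      proof (intro nn_integral_mono)
        fix x
        have "norm (\<psi> x * (V (x + t *\<^sub>R h) \<bullet> h)) \<le> B * (norm (V (x + t *\<^sub>R h)) * norm h)"
          unfolding real_norm_def abs_mult
          using B[of x] Cauchy_Schwarz_ineq2 by (intro mult_mono) (auto simp: \<open>B \<ge> 0\<close>)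
        then show "ennreal (norm (\<psi> x * (V (x + t *\<^sub>R h) \<bullet> h))) \<le> ennreal (B * norm h) * ennreal (norm (V (t *\<^sub>R h + x)))"
          using \<open>B \<ge> 0\<close> by (simp add: ennreal_mult''[symmetric] ac_simps del: ennreal_mult'')
      qed
      also have "\<dots> = ?C"
        by (rule nn_integral_translate[of "\<lambda>x. ennreal (B * norm h) * ennreal (norm (V x))"]) measurable
      finally show ?thesis .
    qed
    show "?C < \<infinity>" using iV by (simp add: nn_integral_cmult integrable_iff_bounded ennreal_mult_less_top)
  qed
  have slab1: "integrable (lborel \<Otimes>\<^sub>M lborel) (\<lambda>(x, t). indicat_real {0..1} t *\<^sub>R (V (x + t *\<^sub>R h) \<bullet> h))"
    using slabV[of "\<lambda>_. 1" 1] by simp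
  have iW: "integrable lborel W"
    using lborel_pair.integrable_fst[OF slab1] by (simp add: W_def[abs_def])
  then have [measurable]: "W \<in> borel_measurable borel" by auto
  \<comment> \<open>The defect of the identity to be proved; the aim is that it is orthogonal to all
    test functions.\<close>
  define f where "f x = v (h + x) - v x - W x" for x
  have "integrable lborel f" unfolding f_def
    using iv iW integrable_translate[OF iv, of h] by auto
  have fm[measurable]: "f \<in> borel_measurable borel" unfolding f_def by measurable
  have "AE x in lborel. f x = 0"
  proof (rule fundamental_lemma[OF fm])
    fix r
    have "(\<integral>\<^sup>+y\<in>ball 0 r. ennreal (norm (f y)) \<partial>lborel) \<le> (\<integral>\<^sup>+y. ennreal (norm (f y)) \<partial>lborel)"
      by (intro nn_integral_mono) (auto simp: indicator_def)
    also have "\<dots> < \<infinity>" using \<open>integrable lborel f\<close> by (simp add: integrable_iff_bounded)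
    finally show "(\<integral>\<^sup>+y\<in>ball 0 r. ennreal (norm (f y)) \<partial>lborel) < \<infinity>" .
  next
    fix \<phi> :: "real^'n \<Rightarrow> real" and D\<phi> assume t: "test_function UNIV \<phi> D\<phi>"
    note tc[measurable] = test_function_continuous(3,4)[OF t]
    obtain B where B: "B > 0" "\<And>x. \<bar>\<phi> x\<bar> \<le> B" "\<And>x. norm (D\<phi> x) \<le> B"
      using test_function_bounded[OF t] by blast
    have mult: "integrable lborel (\<lambda>x. u x * \<psi> x)" 
      if "integrable lborel u" "\<psi> \<in> borel_measurable borel" "\<And>x. \<bar>\<psi> x\<bar> \<le> C" for u \<psi> :: "real^'n \<Rightarrow> real" and C
    proof (rule Bochner_Integration.integrable_bound)
      show "integrable lborel (\<lambda>x. C * norm (u x))" using that by auto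
      show "AE x in lborel. norm (u x * \<psi> x) \<le> norm (C * norm (u x))"
      proof (intro AE_I2)
        fix x
        have "0 \<le> C" using that(3)[of x] by linarith
        then show "norm (u x * \<psi> x) \<le> norm (C * norm (u x))"
          using that(3)[of x] by (simp add: abs_mult mult.commute mult_right_mono)
      qed
    qed (use that in auto)
    have "(\<integral>x. f x * \<phi> x \<partial>lborel) = (\<integral>x. v (h + x) * \<phi> x \<partial>lborel) - (\<integral>x. v x * \<phi> x \<partial>lborel) - (\<integral>x. W x * \<phi> x \<partial>lborel)"
      unfolding f_def left_diff_distrib
      using mult[OF iv _ B(2)] mult[OF iW _ B(2)] mult[OF integrable_translate[OF iv, of h] _ B(2)]
      by simp
    \<comment> \<open>Translation invariance moves the increment from \<open>v\<close> to
      \<open>\<phi>\<close>, with step -h.\<close>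
    also have "(\<integral>x. v (h + x) * \<phi> x \<partial>lborel) = (\<integral>x. v x * \<phi> (- h + x) \<partial>lborel)"
      using integral_translate[of "\<lambda>x. v x * \<phi> (- h + x)" h] by simp
    also have "\<dots> - (\<integral>x. v x * \<phi> x \<partial>lborel) = (\<integral>x. v x * (\<phi> (- h + x) - \<phi> x) \<partial>lborel)"
      unfolding right_diff_distrib using mult[OF iv _ B(2)] mult[OF iv _ B(2), of "\<lambda>x. - h + x"]
      by (simp add: B(2))
    also have "\<dots> = (\<integral>x. \<integral>t. indicat_real {0..1} t *\<^sub>R (v x * (D\<phi> (x + t *\<^sub>R (- h)) \<bullet> (- h))) \<partial>lborel \<partial>lborel)"
    proof (intro Bochner_Integration.integral_cong refl)
      fix x
      have "\<phi> (x + (- h)) - \<phi> x = (\<integral>t. D\<phi> (x + t *\<^sub>R (- h)) \<bullet> (- h) * indicator {0..1} t \<partial>lborel)"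
        using t test_function_continuous[OF t] by (subst FTC_line) (auto simp: test_function_def)
      then show "v x * (\<phi> (- h + x) - \<phi> x) = (\<integral>t. indicat_real {0..1} t *\<^sub>R (v x * (D\<phi> (x + t *\<^sub>R (- h)) \<bullet> (- h))) \<partial>lborel)"
        by (simp add: add.commute ac_simps flip: integral_mult_right_zero)
    qed
    also have "\<dots> = (\<integral>t. \<integral>x. indicat_real {0..1} t *\<^sub>R (v x * (D\<phi> (x + t *\<^sub>R (- h)) \<bullet> (- h))) \<partial>lborel \<partial>lborel)"
    proof (rule lborel_pair.Fubini_integral[symmetric], rule integrable_unit_slab)
      show "(\<lambda>(x, t). v x * (D\<phi> (x + t *\<^sub>R (- h)) \<bullet> (- h))) \<in> borel_measurable (lborel \<Otimes>\<^sub>M lborel)" by measurable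
      let ?C = "(\<integral>\<^sup>+x. ennreal (B * norm h) * ennreal (norm (v x)) \<partial>lborel)"
      show "(\<integral>\<^sup>+x. ennreal (norm (v x * (D\<phi> (x + t *\<^sub>R (- h)) \<bullet> (- h)))) \<partial>lborel) \<le> ?C" for t
      proof (intro nn_integral_mono)
        fix x
        have "\<bar>D\<phi> (x + t *\<^sub>R (- h)) \<bullet> (- h)\<bar> \<le> norm (D\<phi> (x + t *\<^sub>R (- h))) * norm (- h)"
          by (rule Cauchy_Schwarz_ineq2)
        also have "\<dots> \<le> B * norm h" using B(3) by (simp add: mult_right_mono)
        finally have "norm (v x * (D\<phi> (x + t *\<^sub>R (- h)) \<bullet> (- h))) \<le> norm (v x) * (B * norm h)"
          unfolding real_norm_def abs_mult by (rule mult_left_mono) simp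
        then show "ennreal (norm (v x * (D\<phi> (x + t *\<^sub>R (- h)) \<bullet> (- h)))) \<le> ennreal (B * norm h) * ennreal (norm (v x))"
          using B(1) by (simp add: ennreal_mult''[symmetric] ac_simps ennreal_leI del: ennreal_mult'')
      qed
      show "?C < \<infinity>" using iv by (simp add: nn_integral_cmult integrable_iff_bounded ennreal_mult_less_top)
    qed
    \<comment> \<open>For a fixed point of the segment, the translated \<open>\<phi>\<close> is
      again a test function. The weak derivative is applied to it coordinate by coordinate, weighted
      with the entries of \<open>h\<close>, and the translation is then undone on
      \<open>V\<close>.\<close>
    also have "\<dots> = (\<integral>t. \<integral>x. indicat_real {0..1} t *\<^sub>R (\<phi> x * (V (x + t *\<^sub>R h) \<bullet> h)) \<partial>lborel \<partial>lborel)"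
    proof (rule Bochner_Integration.integral_cong[OF refl])
      fix s :: real
      let ?a = "s *\<^sub>R (- h)"
      have int1: "integrable lborel (\<lambda>x. v x * D\<phi> (?a + x) $ j)" for j
        using B(3) component_le_norm_cart by (intro mult[OF iv]) (auto intro: order_trans)
      have int2: "integrable lborel (\<lambda>x. \<phi> (?a + x) * V x $ j)" for j
        using mult[OF integrable_bounded_linear[OF bounded_linear_vec_nth iV, of j], of "\<lambda>x. \<phi> (?a + x)" B] B(2)
        by (simp add: mult.commute)
      have "(\<integral>x. v x * (D\<phi> (x + ?a) \<bullet> (- h)) \<partial>lborel) = (\<integral>x. (\<Sum>j\<in>UNIV. v x * D\<phi> (?a + x) $ j * (- h $ j)) \<partial>lborel)"
        by (simp add: inner_vec_def sum_distrib_left ac_simps)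
      also have "\<dots> = (\<Sum>j\<in>UNIV. (\<integral>x. v x * D\<phi> (?a + x) $ j \<partial>lborel) * (- h $ j))"
        using int1 by (subst Bochner_Integration.integral_sum) auto
      also have "\<dots> = (\<Sum>j\<in>UNIV. (\<integral>x. \<phi> (?a + x) * V x $ j \<partial>lborel) * h $ j)"
        using w test_function_translate[OF t, of ?a] unfolding weak_deriv_def
        by (intro sum.cong refl) fastforce
      also have "\<dots> = (\<integral>x. (\<Sum>j\<in>UNIV. \<phi> (?a + x) * V x $ j * h $ j) \<partial>lborel)"
        using int2 by (subst Bochner_Integration.integral_sum) auto
      also have "\<dots> = (\<integral>x. \<phi> (?a + x) * (V x \<bullet> h) \<partial>lborel)"
        by (simp add: inner_vec_def sum_distrib_left ac_simps)
      also have "\<dots> = (\<integral>x. \<phi> x * (V (x + s *\<^sub>R h) \<bullet> h) \<partial>lborel)"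
        using integral_translate[of "\<lambda>x. \<phi> x * (V (x + s *\<^sub>R h) \<bullet> h)" ?a] by simp
      finally show "(\<integral>x. indicat_real {0..1} s *\<^sub>R (v x * (D\<phi> (x + ?a) \<bullet> (- h))) \<partial>lborel) =
          (\<integral>x. indicat_real {0..1} s *\<^sub>R (\<phi> x * (V (x + s *\<^sub>R h) \<bullet> h)) \<partial>lborel)"
        by (cases "s \<in> {0..1}") auto
    qed
    also have "\<dots> = (\<integral>x. \<integral>t. indicat_real {0..1} t *\<^sub>R (\<phi> x * (V (x + t *\<^sub>R h) \<bullet> h)) \<partial>lborel \<partial>lborel)"
      by (rule lborel_pair.Fubini_integral[OF slabV[OF _ B(2)]]) measurable
    also have "\<dots> = (\<integral>x. W x * \<phi> x \<partial>lborel)"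
      unfolding W_def by (simp add: ac_simps flip: integral_mult_right_zero)
    finally show "(\<integral>x. f x * \<phi> x \<partial>lborel) = 0" by simp
  qed
  then show ?thesis
    by eventually_elim (simp add: f_def W_def algebra_simps)
qed

section \<open>Approximate differentiability\<close>

text \<open>Cauchy-Schwarz under the segment integral. The bound is phrased in
  \<open>ennreal\<close> so that it holds on every segment, including those on which
  \<open>V\<close> is not integrable.\<close>

lemma line_defect_bound:
  fixes V :: "real^'n \<Rightarrow> real^'n"
  assumes [measurable]: "V \<in> borel_measurable borel"
  shows "ennreal \<bar>(\<integral>t. V (x + t *\<^sub>R h) \<bullet> h * indicator {0..1} t \<partial>lborel) - A \<bullet> h\<bar>
    \<le> (\<integral>\<^sup>+t\<in>{0..1}. ennreal (norm (V (x + t *\<^sub>R h) - A)) \<partial>lborel) * ennreal (norm h)"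
proof -
  let ?f = "\<lambda>t. (V (x + t *\<^sub>R h) - A) \<bullet> h * indicator {0..1} t"
  have le: "(\<integral>\<^sup>+t. ennreal (norm (?f t)) \<partial>lborel) \<le> (\<integral>\<^sup>+t\<in>{0..1}. ennreal (norm (V (x + t *\<^sub>R h) - A)) \<partial>lborel) * ennreal (norm h)"
  proof -
    have "(\<integral>\<^sup>+t. ennreal (norm (?f t)) \<partial>lborel) \<le> (\<integral>\<^sup>+t. (ennreal (norm (V (x + t *\<^sub>R h) - A)) * indicator {0..1} t) * ennreal (norm h) \<partial>lborel)"
    proof (intro nn_integral_mono)
      fix t :: real
      have "\<bar>(V (x + t *\<^sub>R h) - A) \<bullet> h\<bar> \<le> norm (V (x + t *\<^sub>R h) - A) * norm h" by (rule Cauchy_Schwarz_ineq2)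
      then show "ennreal (norm (?f t)) \<le> (ennreal (norm (V (x + t *\<^sub>R h) - A)) * indicator {0..1} t) * ennreal (norm h)"
        by (auto simp: indicator_def simp flip: ennreal_mult'')
    qed
    also have "\<dots> = (\<integral>\<^sup>+t\<in>{0..1}. ennreal (norm (V (x + t *\<^sub>R h) - A)) \<partial>lborel) * ennreal (norm h)"
      by (rule nn_integral_multc) measurable
    finally show ?thesis .
  qed
  show ?thesis
  proof (cases "integrable lborel ?f")
    case True
    have iA: "integrable lborel (\<lambda>t::real. A \<bullet> h * indicat_real {0..1} t)"
      by (intro integrable_mult_right integrable_real_indicator) auto
    have "integrable lborel (\<lambda>t. ?f t + A \<bullet> h * indicat_real {0..1} t)" using True iA by (rule Bochner_Integration.integrable_add)
    then have iV: "integrable lborel (\<lambda>t. V (x + t *\<^sub>R h) \<bullet> h * indicat_real {0..1} t)"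
      by (simp add: inner_diff_left algebra_simps)
    have "(\<integral>t. ?f t \<partial>lborel) = (\<integral>t. V (x + t *\<^sub>R h) \<bullet> h * indicator {0..1} t \<partial>lborel) - (\<integral>t. A \<bullet> h * indicat_real {0..1::real} t \<partial>lborel)"
      using iV iA by (simp add: inner_diff_left left_diff_distrib)
    also have "(\<integral>t. A \<bullet> h * indicat_real {0..1::real} t \<partial>lborel) = A \<bullet> h" by simp
    finally have "ennreal \<bar>(\<integral>t. V (x + t *\<^sub>R h) \<bullet> h * indicator {0..1} t \<partial>lborel) - A \<bullet> h\<bar> = ennreal (norm (\<integral>t. ?f t \<partial>lborel))" by simp
    also have "\<dots> \<le> (\<integral>\<^sup>+t. ennreal (norm (?f t)) \<partial>lborel)" by (rule integral_norm_bound_ennreal[OF True])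
    finally show ?thesis using le by (rule order_trans)
  next
    \<comment> \<open>The Bochner integral then has no meaning as an integral, but the right-hand
      side is infinite.\<close>
    case False
    have "?f \<in> borel_measurable lborel" by measurable
    then have "(\<integral>\<^sup>+t. ennreal (norm (?f t)) \<partial>lborel) = \<infinity>"
      using False by (auto simp: integrable_iff_bounded less_top[symmetric])
    with le show ?thesis by (simp add: top_unique)
  qed
qed

lemma AE_scale:
  fixes P :: "'a::euclidean_space \<Rightarrow> bool"
  assumes "AE h in lborel. P h" "c > 0"
  shows "AE y in lborel. P (c *\<^sub>R y)"
proof -
  have "c \<noteq> 0" using assms(2) by simp
  note eq = lborel_affine[OF this, of "0::'a", unfolded add_0]
  have "AE h in density (distr lborel borel (\<lambda>x. c *\<^sub>R x)) (\<lambda>_. ennreal (\<bar>c\<bar>^DIM('a))). P h"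
    using assms(1) by (subst (asm) eq)
  then have "AE h in distr lborel borel (\<lambda>x. c *\<^sub>R x). P h"
    using assms(2) by (simp add: AE_density)
  then show ?thesis by (rule AE_distrD[rotated]) simp
qed

text \<open>In \<open>weak_deriv_line\<close> the null set of points depends on \<open>h\<close>.
  Fubini for null sets exchanges the quantifiers: at almost every fixed \<open>x\<close>, almost
  every increment may be used.\<close>

lemma weak_deriv_pairs:
  fixes v :: "real^'n \<Rightarrow> real"
  assumes w: "weak_deriv v V"
  shows "AE x in lborel. AE h in lborel.
           v (x + h) - v x = (\<integral>t. V (x + t *\<^sub>R h) \<bullet> h * indicator {0..1} t \<partial>lborel)"
proof -
  have [measurable]: "v \<in> borel_measurable borel" "V \<in> borel_measurable borel"
    using w by (auto simp: weak_deriv_def)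
  have "AE h in lborel. AE x in lborel.
           v (x + h) - v x = (\<integral>t. V (x + t *\<^sub>R h) \<bullet> h * indicator {0..1} t \<partial>lborel)"
    by (intro AE_I2 weak_deriv_line w)
  then show ?thesis
    by (subst lborel_pair.AE_commute) measurable
qed

text \<open>For fixed \<open>t\<close> the substitution of x + t\<epsilon>y turns the inner average
  into an integral over the ball of radius t\<epsilon>. The Jacobian cancels the power of the radius
  in the hypothesis, so the bound is the same for all \<open>t\<close> and survives integration over
  [0,1].\<close>

lemma dilated_average_bound:
  fixes g :: "'a::euclidean_space \<Rightarrow> ennreal"
  assumes [measurable]: "g \<in> borel_measurable borel" and "\<epsilon> > 0"
    and b: "\<And>s. 0 < s \<Longrightarrow> s \<le> \<epsilon> \<Longrightarrow> (\<integral>\<^sup>+y\<in>ball x s. g y \<partial>lborel) \<le> c * ennreal (s ^ DIM('a))"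
  shows "(\<integral>\<^sup>+y\<in>ball 0 1. (\<integral>\<^sup>+t\<in>{0..1}. g (x + t *\<^sub>R (\<epsilon> *\<^sub>R y)) \<partial>lborel) \<partial>lborel) \<le> c"
proof -
  have "(\<integral>\<^sup>+y\<in>ball 0 1. (\<integral>\<^sup>+t\<in>{0..1}. g (x + t *\<^sub>R (\<epsilon> *\<^sub>R y)) \<partial>lborel) \<partial>lborel)
    = (\<integral>\<^sup>+y. \<integral>\<^sup>+t. g (x + t *\<^sub>R (\<epsilon> *\<^sub>R y)) * indicator {0..1} t * indicator (ball 0 1) y \<partial>lborel \<partial>lborel)"
    by (intro nn_integral_cong) (simp add: nn_integral_multc)
  also have "\<dots> = (\<integral>\<^sup>+t. \<integral>\<^sup>+y. g (x + t *\<^sub>R (\<epsilon> *\<^sub>R y)) * indicator {0..1} t * indicator (ball 0 1) y \<partial>lborel \<partial>lborel)"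
    by (rule lborel_pair.Fubini') measurable
  also have "\<dots> \<le> (\<integral>\<^sup>+t. c * indicator {0..1::real} t \<partial>lborel)"
  proof (rule nn_integral_mono_AE)
    show "AE t in lborel. (\<integral>\<^sup>+y. g (x + t *\<^sub>R (\<epsilon> *\<^sub>R y)) * indicator {0..1} t * indicator (ball 0 1) y \<partial>lborel) \<le> c * indicator {0..1::real} t"
      using AE_lborel_singleton[of "0::real"]
    proof eventually_elim
      fix t :: real assume "t \<noteq> 0"
      show "(\<integral>\<^sup>+y. g (x + t *\<^sub>R (\<epsilon> *\<^sub>R y)) * indicator {0..1} t * indicator (ball 0 1) y \<partial>lborel) \<le> c * indicator {0..1::real} t"
      proof (cases "t \<in> {0..1}")
        case True
        then have s: "0 < t * \<epsilon>" "t * \<epsilon> \<le> \<epsilon>" using \<open>t \<noteq> 0\<close> assms(2) by (auto simp: mult_le_cancel_right1)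
        have "ennreal ((t * \<epsilon>) ^ DIM('a)) * (\<integral>\<^sup>+y. g (x + t *\<^sub>R (\<epsilon> *\<^sub>R y)) * indicator (ball 0 1) y \<partial>lborel)
            = ennreal ((t * \<epsilon>) ^ DIM('a)) * (\<integral>\<^sup>+y. g (x + (t * \<epsilon>) *\<^sub>R y) * indicator (ball x (t * \<epsilon>)) (x + (t * \<epsilon>) *\<^sub>R y) \<partial>lborel)"
          using s by (intro arg_cong2[of _ _ _ _ "(*)"] nn_integral_cong refl) (auto simp: indicator_def dist_norm mult_less_cancel_left1 mult_less_cancel_left2)
        also have "\<dots> = (\<integral>\<^sup>+y\<in>ball x (t * \<epsilon>). g y \<partial>lborel)"
          using s(1) by (intro nn_integral_affine[symmetric]) measurable
        also have "\<dots> \<le> c * ennreal ((t * \<epsilon>) ^ DIM('a))" by (rule b[OF s])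
        finally have "ennreal ((t * \<epsilon>) ^ DIM('a)) * (\<integral>\<^sup>+y. g (x + t *\<^sub>R (\<epsilon> *\<^sub>R y)) * indicator (ball 0 1) y \<partial>lborel)
          \<le> ennreal ((t * \<epsilon>) ^ DIM('a)) * c" by (simp add: mult.commute)
        then show ?thesis
          using s(1) True by (subst (asm) ennreal_mult_le_mult_iff) (auto simp: ennreal_zero_less_top less_top)
      qed simp
    qed
  qed
  also have "\<dots> = c" by (simp add: nn_integral_cmult_indicator)
  finally show ?thesis .
qed

definition lebesgue_point :: "('a::euclidean_space \<Rightarrow> 'b::real_normed_vector) \<Rightarrow> 'a \<Rightarrow> bool" where
  "lebesgue_point f x \<longleftrightarrow> (\<forall>e>0. \<exists>d>0. \<forall>h. 0 < h \<and> h < d \<longrightarrow>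
    (\<integral>\<^sup>+y\<in>ball x h. ennreal (norm (f y - f x)) \<partial>lborel) \<le> ennreal (e * h ^ DIM('a)))"

lemma AE_lebesgue_point:
  fixes f :: "'a::euclidean_space \<Rightarrow> 'b::euclidean_space"
  assumes f: "integrable lborel f"
  shows "AE x in lborel. lebesgue_point f x"
  unfolding lebesgue_point_def
proof (rule lebesgue_points)
  show "f \<in> borel_measurable borel" using f by auto
  fix r
  have "(\<integral>\<^sup>+y\<in>ball 0 r. ennreal (norm (f y)) \<partial>lborel) \<le> (\<integral>\<^sup>+y. ennreal (norm (f y)) \<partial>lborel)"
    by (intro nn_integral_mono) (auto simp: indicator_def)
  also have "\<dots> < \<infinity>" using f by (simp add: integrable_iff_bounded)
  finally show "(\<integral>\<^sup>+y\<in>ball 0 r. ennreal (norm (f y)) \<partial>lborel) < \<infinity>" .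
qed

lemma lebesgue_point_dilated:
  fixes f :: "'a::euclidean_space \<Rightarrow> 'b::euclidean_space"
  assumes [measurable]: "f \<in> borel_measurable borel" and x: "lebesgue_point f x" and e: "e > 0"
  shows "\<exists>d>0. \<forall>\<epsilon>. 0 < \<epsilon> \<and> \<epsilon> < d \<longrightarrow>
    (\<integral>\<^sup>+y\<in>ball 0 1. (\<integral>\<^sup>+t\<in>{0..1}. ennreal (norm (f (x + t *\<^sub>R (\<epsilon> *\<^sub>R y)) - f x)) \<partial>lborel) \<partial>lborel) \<le> ennreal e"
proof -
  from x[unfolded lebesgue_point_def, rule_format, OF e] obtain d where d: "d > 0"
    "\<And>h. 0 < h \<Longrightarrow> h < d \<Longrightarrow> (\<integral>\<^sup>+y\<in>ball x h. ennreal (norm (f y - f x)) \<partial>lborel) \<le> ennreal (e * h ^ DIM('a))"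
    by blast
  have "(\<integral>\<^sup>+y\<in>ball 0 1. (\<integral>\<^sup>+t\<in>{0..1}. ennreal (norm (f (x + t *\<^sub>R (\<epsilon> *\<^sub>R y)) - f x)) \<partial>lborel) \<partial>lborel) \<le> ennreal e"
    if "0 < \<epsilon>" "\<epsilon> < d" for \<epsilon>
    using that d(2) e by (intro dilated_average_bound) (auto simp: ennreal_mult'')
  with d(1) show ?thesis by blast
qed

text \<open>At a Lebesgue point of \<open>V\<close>, the deviation of \<open>v\<close> from its
  affine approximation is at most \<epsilon> times an average of |V - V x| along segments from
  \<open>x\<close>, and such averages tend to 0. This is differentiability in the L^1 mean, and it
  replaces classical differentiability from here on.\<close>

lemma weak_deriv_approx_diff:
  fixes v :: "real^'n \<Rightarrow> real"
  assumes w: "weak_deriv v V"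
  shows "AE x in lborel. \<forall>e>0. \<exists>d>0. \<forall>\<epsilon>. 0 < \<epsilon> \<and> \<epsilon> < d \<longrightarrow>
    (\<integral>\<^sup>+y\<in>ball 0 1. ennreal \<bar>v (x + \<epsilon> *\<^sub>R y) - v x - \<epsilon> * (V x \<bullet> y)\<bar> \<partial>lborel) \<le> ennreal (e * \<epsilon>)"
proof -
  have iV: "integrable lborel V" and [measurable]: "V \<in> borel_measurable borel" "v \<in> borel_measurable borel" 
    using w by (auto simp: weak_deriv_def)
  show ?thesis
    using AE_lebesgue_point[OF iV] weak_deriv_pairs[OF w]
  proof eventually_elim
    fix x assume x: "lebesgue_point V x" and 
      ae: "AE h in lborel. v (x + h) - v x = (\<integral>t. V (x + t *\<^sub>R h) \<bullet> h * indicator {0..1} t \<partial>lborel)"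
    show "\<forall>e>0. \<exists>d>0. \<forall>\<epsilon>. 0 < \<epsilon> \<and> \<epsilon> < d \<longrightarrow>
       (\<integral>\<^sup>+y\<in>ball 0 1. ennreal \<bar>v (x + \<epsilon> *\<^sub>R y) - v x - \<epsilon> * (V x \<bullet> y)\<bar> \<partial>lborel) \<le> ennreal (e * \<epsilon>)"
    proof (intro allI impI)
      fix e :: real assume e: "e > 0"
      from lebesgue_point_dilated[OF _ x e] obtain d where d: "d > 0" "\<And>\<epsilon>. 0 < \<epsilon> \<Longrightarrow> \<epsilon> < d \<Longrightarrow>
        (\<integral>\<^sup>+y\<in>ball 0 1. (\<integral>\<^sup>+t\<in>{0..1}. ennreal (norm (V (x + t *\<^sub>R (\<epsilon> *\<^sub>R y)) - V x)) \<partial>lborel) \<partial>lborel) \<le> ennreal e"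
        by auto
      have "(\<integral>\<^sup>+y\<in>ball 0 1. ennreal \<bar>v (x + \<epsilon> *\<^sub>R y) - v x - \<epsilon> * (V x \<bullet> y)\<bar> \<partial>lborel) \<le> ennreal (e * \<epsilon>)"
        if \<epsilon>: "0 < \<epsilon>" "\<epsilon> < d" for \<epsilon>
      proof -
        have "(\<integral>\<^sup>+y\<in>ball 0 1. ennreal \<bar>v (x + \<epsilon> *\<^sub>R y) - v x - \<epsilon> * (V x \<bullet> y)\<bar> \<partial>lborel) \<le>
          (\<integral>\<^sup>+y. ((\<integral>\<^sup>+t\<in>{0..1}. ennreal (norm (V (x + t *\<^sub>R (\<epsilon> *\<^sub>R y)) - V x)) \<partial>lborel) * indicator (ball 0 1) y) * ennreal \<epsilon> \<partial>lborel)"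
        proof (rule nn_integral_mono_AE)
          show "AE y in lborel. ennreal \<bar>v (x + \<epsilon> *\<^sub>R y) - v x - \<epsilon> * (V x \<bullet> y)\<bar> * indicator (ball 0 1) y \<le>
            ((\<integral>\<^sup>+t\<in>{0..1}. ennreal (norm (V (x + t *\<^sub>R (\<epsilon> *\<^sub>R y)) - V x)) \<partial>lborel) * indicator (ball 0 1) y) * ennreal \<epsilon>"
            using AE_scale[OF ae \<epsilon>(1)]
          proof eventually_elim
            case (elim y)
            have "ennreal \<bar>v (x + \<epsilon> *\<^sub>R y) - v x - \<epsilon> * (V x \<bullet> y)\<bar> \<le> 
              (\<integral>\<^sup>+t\<in>{0..1}. ennreal (norm (V (x + t *\<^sub>R (\<epsilon> *\<^sub>R y)) - V x)) \<partial>lborel) * ennreal (norm (\<epsilon> *\<^sub>R y))"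
              using line_defect_bound[of V x "\<epsilon> *\<^sub>R y" "V x"] elim by simp
            also have "\<dots> \<le> (\<integral>\<^sup>+t\<in>{0..1}. ennreal (norm (V (x + t *\<^sub>R (\<epsilon> *\<^sub>R y)) - V x)) \<partial>lborel) * ennreal \<epsilon>"
              if "y \<in> ball 0 1"
              using that \<epsilon> by (intro mult_left_mono ennreal_leI) (auto simp: mult_left_le)
            finally show ?case by (auto simp: indicator_def)
          qed
        qed
        also have "\<dots> = (\<integral>\<^sup>+y\<in>ball 0 1. (\<integral>\<^sup>+t\<in>{0..1}. ennreal (norm (V (x + t *\<^sub>R (\<epsilon> *\<^sub>R y)) - V x)) \<partial>lborel) \<partial>lborel) * ennreal \<epsilon>"
          by (rule nn_integral_multc) measurable
        also have "\<dots> \<le> ennreal e * ennreal \<epsilon>" by (rule mult_right_mono[OF d(2)[OF \<epsilon>]]) simp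
        also have "\<dots> = ennreal (e * \<epsilon>)" using e \<epsilon> by (simp add: ennreal_mult'')
        finally show ?thesis .
      qed
      with d(1) show "\<exists>d>0. \<forall>\<epsilon>. 0 < \<epsilon> \<and> \<epsilon> < d \<longrightarrow>
       (\<integral>\<^sup>+y\<in>ball 0 1. ennreal \<bar>v (x + \<epsilon> *\<^sub>R y) - v x - \<epsilon> * (V x \<bullet> y)\<bar> \<partial>lborel) \<le> ennreal (e * \<epsilon>)" by blast
    qed
  qed
qed

section \<open>The Jacobian minors as null Lagrangians\<close>

text \<open>Pratt's form of dominated convergence: the majorants may vary, provided their integrals
  converge to that of their limit. By Scheffe the majorants then converge in L^1. Truncating
  \<open>f k\<close> to the range from -G to G makes it dominated by a fixed function, and what the
  truncation removes is at most |g k - G|.\<close>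

lemma integral_pratt:
  fixes f g :: "nat \<Rightarrow> 'a \<Rightarrow> real" and F G :: "'a \<Rightarrow> real"
  assumes [measurable]: "\<And>k. f k \<in> borel_measurable M" "F \<in> borel_measurable M"
    and g: "\<And>k. integrable M (g k)" and G: "integrable M G"
    and fF: "AE x in M. (\<lambda>k. f k x) \<longlonglongrightarrow> F x" and gG: "AE x in M. (\<lambda>k. g k x) \<longlonglongrightarrow> G x"
    and fg: "\<And>k. AE x in M. \<bar>f k x\<bar> \<le> g k x" and lim: "(\<lambda>k. \<integral>x. g k x \<partial>M) \<longlonglongrightarrow> (\<integral>x. G x \<partial>M)"
  shows "(\<lambda>k. \<integral>x. f k x \<partial>M) \<longlonglongrightarrow> (\<integral>x. F x \<partial>M)"
proof -
  have [measurable]: "g k \<in> borel_measurable M" "G \<in> borel_measurable M" for k using g G by auto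
  have g0: "AE x in M. \<forall>k. \<bar>f k x\<bar> \<le> g k x" using fg by (simp add: AE_all_countable)
  have G0: "AE x in M. \<bar>F x\<bar> \<le> G x" using g0 fF gG
  proof eventually_elim
    case (elim x)
    show ?case by (rule LIMSEQ_le[OF tendsto_rabs[OF elim(2)] elim(3)]) (use elim in auto)
  qed
  have nn: "(\<integral>\<^sup>+x. norm (g k x) \<partial>M) = ennreal (\<integral>x. g k x \<partial>M)" for k
  proof -
    have "(\<integral>\<^sup>+x. norm (g k x) \<partial>M) = (\<integral>\<^sup>+x. ennreal (g k x) \<partial>M)"
      by (rule nn_integral_cong_AE, use fg[of k] in eventually_elim) auto
    also have "\<dots> = ennreal (\<integral>x. g k x \<partial>M)"
      by (rule nn_integral_eq_integral[OF g], use fg[of k] in eventually_elim) auto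
    finally show ?thesis .
  qed
  have nG: "(\<integral>\<^sup>+x. norm (G x) \<partial>M) = ennreal (\<integral>x. G x \<partial>M)"
  proof -
    have "(\<integral>\<^sup>+x. norm (G x) \<partial>M) = (\<integral>\<^sup>+x. ennreal (G x) \<partial>M)"
      by (rule nn_integral_cong_AE, use G0 in eventually_elim) auto
    also have "\<dots> = ennreal (\<integral>x. G x \<partial>M)"
      by (rule nn_integral_eq_integral[OF G], use G0 in eventually_elim) auto
    finally show ?thesis .
  qed
  have "(\<lambda>k. \<integral>\<^sup>+x. norm (g k x - G x) \<partial>M) \<longlonglongrightarrow> 0"
  proof (rule Scheffe_lemma1[OF g G gG])
    have "(\<lambda>k. \<integral>\<^sup>+x. norm (g k x) \<partial>M) \<longlonglongrightarrow> (\<integral>\<^sup>+x. norm (G x) \<partial>M)"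
      unfolding nn nG using lim by (rule tendsto_ennrealI)
    then have "limsup (\<lambda>k. \<integral>\<^sup>+x. norm (g k x) \<partial>M) = (\<integral>\<^sup>+x. norm (G x) \<partial>M)"
      by (intro lim_imp_Limsup) auto
    then show "limsup (\<lambda>k. \<integral>\<^sup>+x. norm (g k x) \<partial>M) \<le> (\<integral>\<^sup>+x. norm (G x) \<partial>M)" by simp
  qed
  moreover have "(\<integral>\<^sup>+x. norm (g k x - G x) \<partial>M) = ennreal (\<integral>x. \<bar>g k x - G x\<bar> \<partial>M)" for k
    using g G by (subst nn_integral_eq_integral[symmetric]) auto
  ultimately have L1: "(\<lambda>k. \<integral>x. \<bar>g k x - G x\<bar> \<partial>M) \<longlonglongrightarrow> 0"
    using tendsto_ennreal_iff[of "\<lambda>k. \<integral>x. \<bar>g k x - G x\<bar> \<partial>M" sequentially 0] by simp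
  \<comment> \<open>The truncation of \<open>f k\<close> by the limit majorant \<open>G\<close>. It
    still converges to \<open>F\<close>, because |F| \<le> G almost everywhere.\<close>
  define f' where "f' k x = max (- G x) (min (G x) (f k x))" for k x
  have [measurable]: "f' k \<in> borel_measurable M" for k unfolding f'_def by measurable
  have f'G: "AE x in M. \<bar>f' k x\<bar> \<le> \<bar>G x\<bar>" for k by (intro AE_I2) (auto simp: f'_def)
  have ik': "integrable M (f' k)" for k
    using f'G by (intro Bochner_Integration.integrable_bound[OF G]) auto
  have ik: "integrable M (f k)" for k
    by (rule Bochner_Integration.integrable_bound[OF g[of k]], measurable, use fg[of k] in eventually_elim) auto
  have "(\<lambda>k. \<integral>x. f' k x \<partial>M) \<longlonglongrightarrow> (\<integral>x. F x \<partial>M)"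
  proof (rule integral_dominated_convergence)
    show "integrable M (\<lambda>x. \<bar>G x\<bar>)" using G by auto
    show "AE x in M. norm (f' k x) \<le> \<bar>G x\<bar>" for k using f'G by simp
    show "AE x in M. (\<lambda>k. f' k x) \<longlonglongrightarrow> F x" using fF G0
    proof eventually_elim
      case (elim x)
      have "(\<lambda>k. max (- G x) (min (G x) (f k x))) \<longlonglongrightarrow> max (- G x) (min (G x) (F x))"
        by (intro tendsto_max tendsto_min tendsto_const elim)
      then show ?case using elim(2) by (simp add: f'_def min_def max_def split: if_splits)
    qed
  qed auto
  moreover have "(\<lambda>k. (\<integral>x. f k x \<partial>M) - (\<integral>x. f' k x \<partial>M)) \<longlonglongrightarrow> 0"
  proof (rule Lim_null_comparison[OF always_eventually L1], intro allI)
    fix k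
    have "norm ((\<integral>x. f k x \<partial>M) - (\<integral>x. f' k x \<partial>M)) = norm (\<integral>x. f k x - f' k x \<partial>M)"
      using ik ik' by simp
    also have "\<dots> \<le> (\<integral>x. norm (f k x - f' k x) \<partial>M)" by (rule integral_norm_bound)
    also have "\<dots> \<le> (\<integral>x. \<bar>g k x - G x\<bar> \<partial>M)"
    proof (rule integral_mono_AE)
      show "AE x in M. norm (f k x - f' k x) \<le> \<bar>g k x - G x\<bar>" using fg[of k] G0
        by eventually_elim (auto simp: f'_def max_def min_def)
    qed (use ik ik' g G in auto)
    finally show "norm ((\<integral>x. f k x \<partial>M) - (\<integral>x. f' k x \<partial>M)) \<le> (\<integral>x. \<bar>g k x - G x\<bar> \<partial>M)" .
  qed
  ultimately have "(\<lambda>k. (\<integral>x. f' k x \<partial>M) + ((\<integral>x. f k x \<partial>M) - (\<integral>x. f' k x \<partial>M))) \<longlonglongrightarrow> (\<integral>x. F x \<partial>M) + 0"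
    by (rule tendsto_add)
  then show ?thesis by simp
qed

lemma integrable_slab:
  fixes f :: "'a::euclidean_space \<Rightarrow> 'b::euclidean_space \<Rightarrow> real" and w :: "'b \<Rightarrow> real"
  assumes f[measurable]: "case_prod f \<in> borel_measurable (lborel \<Otimes>\<^sub>M lborel)" and w: "integrable lborel w"
    and b: "\<And>y. (\<integral>\<^sup>+x. ennreal \<bar>f x y\<bar> \<partial>lborel) \<le> C" and C: "C < \<infinity>"
  shows "integrable (lborel \<Otimes>\<^sub>M lborel) (\<lambda>(x, y). w y * f x y)"
proof -
  have [measurable]: "w \<in> borel_measurable borel" using w by auto
  have "(\<integral>\<^sup>+z. ennreal (norm (case z of (x, y) \<Rightarrow> w y * f x y)) \<partial>(lborel \<Otimes>\<^sub>M lborel))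
      = (\<integral>\<^sup>+y. \<integral>\<^sup>+x. ennreal \<bar>w y * f x y\<bar> \<partial>lborel \<partial>lborel)"
    by (subst lborel_pair.nn_integral_snd[symmetric]) auto
  also have "\<dots> = (\<integral>\<^sup>+y. ennreal \<bar>w y\<bar> * (\<integral>\<^sup>+x. ennreal \<bar>f x y\<bar> \<partial>lborel) \<partial>lborel)"
    by (intro nn_integral_cong) (simp add: abs_mult ennreal_mult'' nn_integral_cmult)
  also have "\<dots> \<le> (\<integral>\<^sup>+y. ennreal \<bar>w y\<bar> * C \<partial>lborel)"
    by (intro nn_integral_mono mult_left_mono b) auto
  also have "\<dots> = (\<integral>\<^sup>+y. ennreal \<bar>w y\<bar> \<partial>lborel) * C" by (rule nn_integral_multc) measurable
  also have "\<dots> < \<infinity>" using C w by (auto simp: integrable_iff_bounded ennreal_mult_less_top)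
  finally show ?thesis by (auto simp: integrable_iff_bounded)
qed

section \<open>Averaging with an odd kernel\<close>

definition ker :: "'n::finite \<Rightarrow> real^'n \<Rightarrow> real" where
  "ker j y = indicat_real (ball 0 1) y * y $ j"

text \<open>Up to normalisation a smoothed difference quotient in direction \<open>j\<close>.
  Averaging over a ball, rather than taking a single increment, matches the differentiability
  available here, which holds only in the mean over balls.\<close>

definition avg :: "'n::finite \<Rightarrow> real \<Rightarrow> (real^'n \<Rightarrow> real) \<Rightarrow> real^'n \<Rightarrow> real" where
  "avg j \<epsilon> u x = (\<integral>y. ker j y * u (x + \<epsilon> *\<^sub>R y) \<partial>lborel)"

lemma ker_measurable[measurable]: "ker j \<in> borel_measurable borel"
  unfolding ker_def[abs_def] by measurable

lemma ker_bound: "\<bar>ker j y\<bar> \<le> indicator (ball 0 1) y"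
  using component_le_norm_cart[of y j] by (auto simp: ker_def indicator_def)

lemma ker_minus: "ker j (- y) = - ker j y"
  by (simp add: ker_def indicator_def)

lemma integrable_unit_ball: "integrable lborel (indicat_real (ball (0::'a::euclidean_space) 1))"
  using emeasure_lborel_ball_finite[of "0::'a" 1] by (intro integrable_real_indicator) auto

lemma integrable_ker_mult:
  assumes [measurable]: "u \<in> borel_measurable borel" and "\<And>y. y \<in> ball 0 1 \<Longrightarrow> \<bar>u y\<bar> \<le> B"
  shows "integrable lborel (\<lambda>y. ker j y * u y)"
proof (rule Bochner_Integration.integrable_bound)
  show "integrable lborel (\<lambda>y. B * indicat_real (ball (0::real^'a) 1) y)"
    using integrable_unit_ball by (rule integrable_mult_right)
  show "AE y in lborel. norm (ker j y * u y) \<le> norm (B * indicat_real (ball 0 1) y)"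
  proof (intro AE_I2)
    fix y
    have "\<bar>ker j y\<bar> * \<bar>u y\<bar> \<le> \<bar>B\<bar>" if "y \<in> ball 0 1"
      using ker_bound[of j y] assms(2)[OF that] that mult_mono[of "\<bar>ker j y\<bar>" 1 "\<bar>u y\<bar>" "\<bar>B\<bar>"] by auto
    then show "norm (ker j y * u y) \<le> norm (B * indicat_real (ball 0 1) y)"
      by (auto simp: indicator_def abs_mult) (simp add: ker_def)
  qed
qed measurable

lemma integrable_ker: "integrable lborel (ker j)"
  using integrable_ker_mult[of "\<lambda>_. 1" 1 j] by simp

definition flip :: "'n::finite \<Rightarrow> real^'n \<Rightarrow> real" where
  "flip k = restrict (\<lambda>b. if b = axis k 1 then - 1 else 1) Basis"

lemma flip_signs: "flip k \<in> signs"
  by (auto simp: flip_def signs_def)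

lemma reflect_flip: "reflect_by (flip k) y $ j = (if j = k then - (y $ j) else y $ j)"
  using reflect_by_inner[of "axis j 1" "flip k" y]
  by (auto simp: flip_def inner_axis axis_in_Basis_iff axis_eq_axis)

lemma integral_reflect_by:
  assumes "s \<in> signs" and [measurable]: "(g :: _ \<Rightarrow> real) \<in> borel_measurable borel"
  shows "(\<integral>y. g (reflect_by s y) \<partial>lborel) = (\<integral>y. g y \<partial>lborel)"
  by (subst (2) distr_reflect_by[OF assms(1), symmetric]) (simp add: integral_distr)

lemma integral_odd_reflection:
  assumes s: "s \<in> signs" and m[measurable]: "(g :: _ \<Rightarrow> real) \<in> borel_measurable borel" 
    and "\<And>y. g (reflect_by s y) = - g y"
  shows "(\<integral>y. g y \<partial>lborel) = 0"
  using integral_reflect_by[OF s m] assms(3) by simp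

lemma integral_ker: "(\<integral>y. ker j y \<partial>lborel) = 0"
  by (rule integral_odd_reflection[OF flip_signs[of j]])
     (auto simp: ker_def indicator_def norm_reflect_by[OF flip_signs] reflect_flip)

text \<open>The second moment of the unit ball in direction \<open>j\<close>. It is the
  normalisation that makes the quotient \<open>dq\<close> below exact on affine functions.\<close>

definition kvar :: "'n::finite \<Rightarrow> real" where
  "kvar j = (\<integral>y. ker j y * y $ j \<partial>lborel)"

lemma integral_ker_nth: "(\<integral>y. ker j y * y $ k \<partial>lborel) = (if k = j then kvar j else 0)"
proof (cases "k = j")
  case False
  then show ?thesis
    by simp (rule integral_odd_reflection[OF flip_signs[of j]],
        auto simp: ker_def indicator_def norm_reflect_by[OF flip_signs] reflect_flip)
qed (simp add: kvar_def)

lemma kvar_pos: "kvar (j :: 'n::finite) > 0"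
proof -
  \<comment> \<open>The ball of radius 1/4 about three quarters of the \<open>j\<close>-th unit
    vector lies in the unit ball, and y_j > 1/2 on it, so the integrand there is at least
    1/4.\<close>
  let ?B = "ball ((3/4) *\<^sub>R axis j 1 :: real^'n) (1/4)"
  have sub: "1/2 < y $ j \<and> norm y < 1" if "y \<in> ?B" for y
  proof -
    have n: "norm (y - (3/4) *\<^sub>R axis j 1) < 1/4" using that by (simp add: dist_norm norm_minus_commute)
    have "norm y \<le> norm (y - (3/4) *\<^sub>R axis j 1) + norm ((3/4) *\<^sub>R axis j 1 :: real^'n)"
      using norm_triangle_ineq[of "y - (3/4) *\<^sub>R axis j 1" "(3/4) *\<^sub>R axis j 1"] by simp
    moreover have "\<bar>(y - (3/4) *\<^sub>R axis j 1) $ j\<bar> \<le> norm (y - (3/4) *\<^sub>R axis j 1)"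
      by (rule component_le_norm_cart)
    moreover have "(y - (3/4) *\<^sub>R axis j 1) $ j = y $ j - 3/4" by (simp add: axis_def)
    moreover have "norm ((3/4) *\<^sub>R axis j 1 :: real^'n) = 3/4" by (simp add: norm_axis_1)
    ultimately show ?thesis using n by linarith
  qed
  have fin: "emeasure lborel ?B < \<infinity>" by (rule emeasure_lborel_ball_finite)
  have "0 < 1/4 * measure lborel ?B" by simp
  also have "1/4 * measure lborel ?B = (\<integral>y. 1/4 * indicat_real ?B y \<partial>lborel)" by simp
  also have "\<dots> \<le> (\<integral>y. ker j y * y $ j \<partial>lborel)"
  proof (rule Bochner_Integration.integral_mono)
    show "integrable lborel (\<lambda>y. 1/4 * indicat_real ?B y)"
      using fin by (intro integrable_mult_right integrable_real_indicator) auto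
    show "integrable lborel (\<lambda>y. ker j y * y $ j)"
      by (rule integrable_ker_mult[of _ 1]) (auto intro: order_trans[OF component_le_norm_cart])
    fix y :: "real^'n"
    have "1/2 * (1/2) \<le> y $ j * y $ j" if "1/2 < y $ j" using that by (intro mult_mono) auto
    then show "1/4 * indicat_real ?B y \<le> ker j y * y $ j"
      using sub[of y] by (auto simp: indicator_def ker_def)
  qed
  finally show ?thesis by (simp add: kvar_def)
qed

lemma avg_measurable[measurable]:
  assumes [measurable]: "u \<in> borel_measurable borel"
  shows "avg j \<epsilon> u \<in> borel_measurable borel"
  unfolding avg_def[abs_def] by measurable

lemma avg_bound:
  fixes u :: "real^'n::finite \<Rightarrow> real"
  assumes [measurable]: "u \<in> borel_measurable borel" and B: "\<And>x. \<bar>u x\<bar> \<le> B"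
  shows "\<bar>avg j \<epsilon> u x\<bar> \<le> B * measure lborel (ball (0::real^'n) 1)"
proof -
  have "\<bar>avg j \<epsilon> u x\<bar> \<le> (\<integral>y. \<bar>ker j y * u (x + \<epsilon> *\<^sub>R y)\<bar> \<partial>lborel)"
    unfolding avg_def by (rule integral_abs_bound)
  also have "\<dots> \<le> (\<integral>y. B * indicat_real (ball (0::real^'n) 1) y \<partial>lborel)"
  proof (rule Bochner_Integration.integral_mono)
    show "integrable lborel (\<lambda>y. \<bar>ker j y * u (x + \<epsilon> *\<^sub>R y)\<bar>)"
      using integrable_ker_mult[of "\<lambda>y. u (x + \<epsilon> *\<^sub>R y)" B j] B by auto
    show "integrable lborel (\<lambda>y. B * indicat_real (ball (0::real^'n) 1) y)"
      using integrable_unit_ball by (rule integrable_mult_right)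
    fix y
    have "\<bar>ker j y\<bar> * \<bar>u (x + \<epsilon> *\<^sub>R y)\<bar> \<le> indicator (ball 0 1) y * B"
      using ker_bound[of j y] B by (intro mult_mono) auto
    then show "\<bar>ker j y * u (x + \<epsilon> *\<^sub>R y)\<bar> \<le> B * indicat_real (ball 0 1) y" by (simp add: abs_mult mult.commute)
  qed
  finally show ?thesis by simp
qed

text \<open>Both iterated averages are one double integral over two independent increments, whose
  order Fubini exchanges.\<close>

lemma avg_commute:
  fixes u :: "real^'n::finite \<Rightarrow> real"
  assumes [measurable]: "u \<in> borel_measurable borel" and B: "\<And>x. \<bar>u x\<bar> \<le> B"
  shows "avg i \<epsilon> (avg j \<epsilon> u) x = avg j \<epsilon> (avg i \<epsilon> u) x"
proof -
  have "B \<ge> 0" using B[of 0] by linarith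
  have int: "integrable (lborel \<Otimes>\<^sub>M lborel) (\<lambda>(y, z). ker i z * (ker j y * u (x + \<epsilon> *\<^sub>R y + \<epsilon> *\<^sub>R z)))"
  proof (rule integrable_slab[OF _ integrable_ker])
    show "(\<integral>\<^sup>+y. ennreal \<bar>ker j y * u (x + \<epsilon> *\<^sub>R y + \<epsilon> *\<^sub>R z)\<bar> \<partial>lborel) \<le> (\<integral>\<^sup>+y. ennreal B * indicator (ball (0::real^'n) 1) y \<partial>lborel)" for z
    proof (intro nn_integral_mono)
      fix y
      have "\<bar>ker j y\<bar> * \<bar>u (x + \<epsilon> *\<^sub>R y + \<epsilon> *\<^sub>R z)\<bar> \<le> indicator (ball 0 1) y * B"
        using ker_bound[of j y] B by (intro mult_mono) auto
      then show "ennreal \<bar>ker j y * u (x + \<epsilon> *\<^sub>R y + \<epsilon> *\<^sub>R z)\<bar> \<le> ennreal B * indicator (ball (0::real^'n) 1) y"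
        using \<open>B \<ge> 0\<close> by (cases "y \<in> ball 0 1") (simp_all add: abs_mult ennreal_leI ker_def)
    qed
    show "(\<integral>\<^sup>+y. ennreal B * indicator (ball (0::real^'n) 1) y \<partial>lborel) < \<infinity>"
      using emeasure_lborel_ball_finite[of "0::real^'n" 1] by (simp add: nn_integral_cmult_indicator ennreal_mult_less_top)
  qed measurable
  have "avg i \<epsilon> (avg j \<epsilon> u) x = (\<integral>z. (\<integral>y. ker i z * (ker j y * u (x + \<epsilon> *\<^sub>R y + \<epsilon> *\<^sub>R z)) \<partial>lborel) \<partial>lborel)"
    unfolding avg_def by (simp add: ac_simps)
  also have "\<dots> = (\<integral>y. (\<integral>z. ker i z * (ker j y * u (x + \<epsilon> *\<^sub>R y + \<epsilon> *\<^sub>R z)) \<partial>lborel) \<partial>lborel)"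
    using lborel_pair.Fubini_integral[OF int] by simp
  also have "\<dots> = avg j \<epsilon> (avg i \<epsilon> u) x"
    unfolding avg_def by (simp add: mult.left_commute[of "ker i _"] flip: integral_mult_right_zero)
  finally show ?thesis .
qed

text \<open>A discrete integration by parts: translation moves the increment from \<open>f\<close>
  to \<open>u\<close> with opposite sign, and the oddness of the kernel turns the sign of the
  increment into a sign of the integral.\<close>

lemma avg_antisym:
  fixes u f :: "real^'n::finite \<Rightarrow> real"
  assumes [measurable]: "u \<in> borel_measurable borel" and B: "\<And>x. \<bar>u x\<bar> \<le> B" and f: "integrable lborel f"
  shows "(\<integral>x. avg j \<epsilon> f x * u x \<partial>lborel) = - (\<integral>x. f x * avg j \<epsilon> u x \<partial>lborel)"
proof -
  have "B \<ge> 0" using B[of 0] by linarith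
  have [measurable]: "f \<in> borel_measurable borel" using f by auto
  have nn: "(\<integral>\<^sup>+x. ennreal \<bar>f (a + x) * w x\<bar> \<partial>lborel) \<le> (\<integral>\<^sup>+x. ennreal B * ennreal \<bar>f x\<bar> \<partial>lborel)"
    if [measurable]: "w \<in> borel_measurable borel" and "\<And>x. \<bar>w x\<bar> \<le> B" for w a
  proof -
    have "(\<integral>\<^sup>+x. ennreal \<bar>f (a + x) * w x\<bar> \<partial>lborel) \<le> (\<integral>\<^sup>+x. ennreal B * ennreal \<bar>f (a + x)\<bar> \<partial>lborel)"
      using that(2) \<open>B \<ge> 0\<close>
      by (intro nn_integral_mono) (auto simp: abs_mult ennreal_leI mult.commute[of B] mult_left_mono simp flip: ennreal_mult'')
    also have "\<dots> = (\<integral>\<^sup>+x. ennreal B * ennreal \<bar>f x\<bar> \<partial>lborel)"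
      by (rule nn_integral_translate[of "\<lambda>x. ennreal B * ennreal \<bar>f x\<bar>"]) measurable
    finally show ?thesis .
  qed
  have C: "(\<integral>\<^sup>+x. ennreal B * ennreal \<bar>f x\<bar> \<partial>lborel) < \<infinity>"
    using f by (simp add: nn_integral_cmult integrable_iff_bounded ennreal_mult_less_top)
  have int1: "integrable (lborel \<Otimes>\<^sub>M lborel) (\<lambda>(x, y). ker j y * (f (\<epsilon> *\<^sub>R y + x) * u x))"
    by (rule integrable_slab[OF _ integrable_ker _ C], measurable, rule nn) (use B in auto)
  have int2: "integrable (lborel \<Otimes>\<^sub>M lborel) (\<lambda>(x, y). ker j y * (f x * u (- (\<epsilon> *\<^sub>R y) + x)))"
  proof (rule integrable_slab[OF _ integrable_ker _ C])
    show "(\<integral>\<^sup>+x. ennreal \<bar>f x * u (- (\<epsilon> *\<^sub>R y) + x)\<bar> \<partial>lborel) \<le> (\<integral>\<^sup>+x. ennreal B * ennreal \<bar>f x\<bar> \<partial>lborel)" for y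
      using nn[of "\<lambda>x. u (- (\<epsilon> *\<^sub>R y) + x)" 0] B by simp
  qed measurable
  have "(\<integral>x. avg j \<epsilon> f x * u x \<partial>lborel) = (\<integral>x. \<integral>y. ker j y * (f (\<epsilon> *\<^sub>R y + x) * u x) \<partial>lborel \<partial>lborel)"
    unfolding avg_def by (simp add: add.commute mult.assoc flip: integral_mult_left_zero)
  also have "\<dots> = (\<integral>y. \<integral>x. ker j y * (f (\<epsilon> *\<^sub>R y + x) * u x) \<partial>lborel \<partial>lborel)"
    by (rule lborel_pair.Fubini_integral[OF int1, symmetric])
  also have "\<dots> = (\<integral>y. \<integral>x. ker j y * (f x * u (- (\<epsilon> *\<^sub>R y) + x)) \<partial>lborel \<partial>lborel)"
  proof (rule Bochner_Integration.integral_cong[OF refl])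
    fix y
    show "(\<integral>x. ker j y * (f (\<epsilon> *\<^sub>R y + x) * u x) \<partial>lborel) = (\<integral>x. ker j y * (f x * u (- (\<epsilon> *\<^sub>R y) + x)) \<partial>lborel)"
      using integral_translate[of "\<lambda>x. ker j y * (f x * u (- (\<epsilon> *\<^sub>R y) + x))" "\<epsilon> *\<^sub>R y"] by simp
  qed
  also have "\<dots> = (\<integral>x. \<integral>y. ker j y * (f x * u (- (\<epsilon> *\<^sub>R y) + x)) \<partial>lborel \<partial>lborel)"
    by (rule lborel_pair.Fubini_integral[OF int2])
  also have "\<dots> = (\<integral>x. - (f x * avg j \<epsilon> u x) \<partial>lborel)"
  proof (rule Bochner_Integration.integral_cong[OF refl])
    fix x
    \<comment> \<open>Reflecting all coordinates at once gives y -> -y.\<close>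
    have s: "restrict (\<lambda>_. - 1) Basis \<in> (signs :: (real^'n \<Rightarrow> real) set)" by (auto simp: signs_def)
    have r: "reflect_by (restrict (\<lambda>_. - 1) Basis) y = - y" for y :: "real^'n"
      by (rule euclidean_eqI) (simp add: reflect_by_inner)
    have "(\<integral>y. ker j y * (f x * u (- (\<epsilon> *\<^sub>R y) + x)) \<partial>lborel) = (\<integral>y. ker j (- y) * (f x * u (- (\<epsilon> *\<^sub>R - y) + x)) \<partial>lborel)"
      using integral_reflect_by[OF s, of "\<lambda>y. ker j y * (f x * u (- (\<epsilon> *\<^sub>R y) + x))"] by (simp add: r)
    also have "\<dots> = - (f x * avg j \<epsilon> u x)"
      unfolding avg_def by (simp add: ker_minus add.commute mult.left_commute)
    finally show "(\<integral>y. ker j y * (f x * u (- (\<epsilon> *\<^sub>R y) + x)) \<partial>lborel) = - (f x * avg j \<epsilon> u x)" .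
  qed
  finally show ?thesis by simp
qed

text \<open>The null Lagrangian identity at a fixed scale: antisymmetry moves one average across,
  the two averages commute, and antisymmetry moves the other one back. The identity is exact, and no
  derivative of \<open>f\<close> or \<open>g\<close> enters.\<close>

lemma integral_avg_avg_symmetric:
  fixes f g :: "real^'n::finite \<Rightarrow> real"
  assumes [measurable]: "g \<in> borel_measurable borel" and B: "\<And>x. \<bar>g x\<bar> \<le> B" and f: "integrable lborel f"
  shows "(\<integral>x. avg i \<epsilon> f x * avg j \<epsilon> g x \<partial>lborel) = (\<integral>x. avg j \<epsilon> f x * avg i \<epsilon> g x \<partial>lborel)"
proof -
  have "(\<integral>x. avg i \<epsilon> f x * avg j \<epsilon> g x \<partial>lborel) = - (\<integral>x. f x * avg i \<epsilon> (avg j \<epsilon> g) x \<partial>lborel)"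
    by (rule avg_antisym[OF _ avg_bound f]) (use B in auto)
  also have "\<dots> = - (\<integral>x. f x * avg j \<epsilon> (avg i \<epsilon> g) x \<partial>lborel)"
    using avg_commute[OF assms(1) B] by simp
  also have "\<dots> = (\<integral>x. avg j \<epsilon> f x * avg i \<epsilon> g x \<partial>lborel)"
    by (rule avg_antisym[OF _ avg_bound f, symmetric]) (use B in auto)
  finally show ?thesis .
qed

section \<open>Difference quotients and their limits\<close>

definition dq :: "'n::finite \<Rightarrow> real \<Rightarrow> (real^'n \<Rightarrow> real) \<Rightarrow> real^'n \<Rightarrow> real" where
  "dq j \<epsilon> v x = avg j \<epsilon> v x / (kvar j * \<epsilon>)"

text \<open>The average of |V|^2 along the segments of length at most \<epsilon> issuing from
  \<open>x\<close>. A multiple of it dominates the square of \<open>dq\<close>, and its integral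
  does not depend on \<epsilon>; this is the form of domination that \<open>integral_pratt\<close>
  accepts.\<close>

definition msq :: "real \<Rightarrow> (real^'n \<Rightarrow> real^'n) \<Rightarrow> real^'n \<Rightarrow> ennreal" where
  "msq \<epsilon> V x = (\<integral>\<^sup>+y\<in>ball 0 1. (\<integral>\<^sup>+t\<in>{0..1}. ennreal ((norm (V (x + t *\<^sub>R (\<epsilon> *\<^sub>R y))))\<^sup>2) \<partial>lborel) \<partial>lborel)"

lemma msq_measurable[measurable]:
  assumes [measurable]: "V \<in> borel_measurable borel"
  shows "msq \<epsilon> V \<in> borel_measurable borel"
  unfolding msq_def[abs_def] by measurable

abbreviation unit_vol :: "'n::finite itself \<Rightarrow> real" where
  "unit_vol _ \<equiv> measure lborel (ball (0 :: real^'n) 1)"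

lemma emeasure_unit_ball: "emeasure lborel (ball (0::real^'n) 1) = ennreal (unit_vol TYPE('n))"
  using emeasure_lborel_ball_finite[of "0::real^'n" 1] by (simp add: emeasure_eq_ennreal_measure less_top)

lemma nn_integral_unit_ball_slab: 
  "(\<integral>\<^sup>+y\<in>ball (0::real^'n) 1. (\<integral>\<^sup>+t\<in>{0..1::real}. c \<partial>lborel) \<partial>lborel) = c * ennreal (unit_vol TYPE('n))"
  by (simp add: nn_integral_cmult_indicator emeasure_unit_ball)

text \<open>For each fixed \<open>y\<close> and \<open>t\<close> the argument of \<open>V\<close> is
  a translate of \<open>x\<close>, so integration over \<open>x\<close> forgets them, and only the
  volume of the unit ball remains.\<close>

lemma nn_integral_msq:
  fixes V :: "real^'n \<Rightarrow> real^'n"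
  assumes [measurable]: "V \<in> borel_measurable borel"
  shows "(\<integral>\<^sup>+x. msq \<epsilon> V x \<partial>lborel) = (\<integral>\<^sup>+x. ennreal ((norm (V x))\<^sup>2) \<partial>lborel) * ennreal (unit_vol TYPE('n))"
proof -
  let ?g = "\<lambda>x. ennreal ((norm (V x))\<^sup>2)"
  have "(\<integral>\<^sup>+x. msq \<epsilon> V x \<partial>lborel) = 
    (\<integral>\<^sup>+y. \<integral>\<^sup>+x. (\<integral>\<^sup>+t\<in>{0..1}. ?g (x + t *\<^sub>R (\<epsilon> *\<^sub>R y)) \<partial>lborel) * indicator (ball 0 1) y \<partial>lborel \<partial>lborel)"
    unfolding msq_def by (rule lborel_pair.Fubini'[symmetric]) measurable
  also have "\<dots> = (\<integral>\<^sup>+y\<in>ball 0 1. (\<integral>\<^sup>+x. \<integral>\<^sup>+t. ?g (x + t *\<^sub>R (\<epsilon> *\<^sub>R y)) * indicator {0..1} t \<partial>lborel \<partial>lborel) \<partial>lborel)"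
    by (intro nn_integral_cong nn_integral_multc) measurable
  also have "\<dots> = (\<integral>\<^sup>+y\<in>ball 0 1. (\<integral>\<^sup>+t. \<integral>\<^sup>+x. ?g (x + t *\<^sub>R (\<epsilon> *\<^sub>R y)) * indicator {0..1} t \<partial>lborel \<partial>lborel) \<partial>lborel)"
    by (intro nn_integral_cong arg_cong2[of _ _ _ _ "(*)"] lborel_pair.Fubini'[symmetric] refl) measurable
  also have "\<dots> = (\<integral>\<^sup>+y\<in>ball (0::real^'n) 1. (\<integral>\<^sup>+t\<in>{0..1::real}. (\<integral>\<^sup>+x. ?g x \<partial>lborel) \<partial>lborel) \<partial>lborel)"
  proof -
    have "(\<integral>\<^sup>+x. ?g (x + t *\<^sub>R (\<epsilon> *\<^sub>R y)) * indicator {0..1} t \<partial>lborel) = (\<integral>\<^sup>+x. ?g x \<partial>lborel) * indicator {0..1} t" for y t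
      using nn_integral_translate[of ?g "t *\<^sub>R (\<epsilon> *\<^sub>R y)"] by (simp add: nn_integral_multc add.commute)
    then show ?thesis by simp
  qed
  also have "\<dots> = (\<integral>\<^sup>+x. ennreal ((norm (V x))\<^sup>2) \<partial>lborel) * ennreal (unit_vol TYPE('n))"
    by (rule nn_integral_unit_ball_slab)
  finally show ?thesis .
qed

lemma msq_tendsto:
  fixes V :: "real^'n \<Rightarrow> real^'n"
  assumes [measurable]: "V \<in> borel_measurable borel" 
    and x: "lebesgue_point (\<lambda>x. (norm (V x))\<^sup>2) x" and \<epsilon>: "\<And>k. \<epsilon> k > 0" "\<epsilon> \<longlonglongrightarrow> 0"
  shows "(\<lambda>k. enn2real (msq (\<epsilon> k) V x)) \<longlonglongrightarrow> (norm (V x))\<^sup>2 * unit_vol TYPE('n)"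
proof (rule LIMSEQ_I)
  fix e :: real assume "e > 0"
  let ?g = "\<lambda>x. (norm (V x))\<^sup>2"
  let ?D = "\<lambda>\<epsilon>. (\<integral>\<^sup>+y\<in>ball 0 1. (\<integral>\<^sup>+t\<in>{0..1}. ennreal (norm (?g (x + t *\<^sub>R (\<epsilon> *\<^sub>R y)) - ?g x)) \<partial>lborel) \<partial>lborel)"
  from lebesgue_point_dilated[OF _ x, of "e/2"] \<open>e > 0\<close>
  obtain d where d: "d > 0" "\<And>\<epsilon>. 0 < \<epsilon> \<Longrightarrow> \<epsilon> < d \<Longrightarrow> ?D \<epsilon> \<le> ennreal (e/2)"
    by auto
  from order_tendstoD(2)[OF \<epsilon>(2) d(1)] obtain N where N: "\<And>k. k \<ge> N \<Longrightarrow> \<epsilon> k < d"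
    by (auto simp: eventually_sequentially)
  have "norm (enn2real (msq (\<epsilon> k) V x) - ?g x * unit_vol TYPE('n)) < e" if "k \<ge> N" for k
  proof -
    have D: "?D (\<epsilon> k) \<le> ennreal (e/2)" using d(2)[OF \<epsilon>(1) N[OF that]] .
    have add: "(\<integral>\<^sup>+y\<in>ball 0 1. (\<integral>\<^sup>+t\<in>{0..1}. p y t + q y t \<partial>lborel) \<partial>lborel) = 
       (\<integral>\<^sup>+y\<in>ball 0 1. (\<integral>\<^sup>+t\<in>{0..1}. p y t \<partial>lborel) \<partial>lborel) + (\<integral>\<^sup>+y\<in>ball 0 1. (\<integral>\<^sup>+t\<in>{0..1}. q y t \<partial>lborel) \<partial>lborel)"
      if [measurable]: "case_prod p \<in> borel_measurable (lborel \<Otimes>\<^sub>M lborel)" "case_prod q \<in> borel_measurable (lborel \<Otimes>\<^sub>M lborel)"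
      for p q :: "real^'n \<Rightarrow> real \<Rightarrow> ennreal"
      by (simp add: distrib_right nn_integral_add)
    have "msq (\<epsilon> k) V x \<le> (\<integral>\<^sup>+y\<in>ball (0::real^'n) 1. (\<integral>\<^sup>+t\<in>{0..1}. ennreal (norm (?g (x + t *\<^sub>R (\<epsilon> k *\<^sub>R y)) - ?g x)) + ennreal (?g x) \<partial>lborel) \<partial>lborel)"
      unfolding msq_def by (intro nn_integral_mono mult_right_mono) (auto simp flip: ennreal_plus intro!: ennreal_leI)
    also have "\<dots> = ?D (\<epsilon> k) + ennreal (?g x) * ennreal (unit_vol TYPE('n))"
      by (subst add, measurable) (simp only: nn_integral_unit_ball_slab)
    also have "\<dots> \<le> ennreal (e/2) + ennreal (?g x) * ennreal (unit_vol TYPE('n))"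
      by (rule add_right_mono[OF D])
    also have "\<dots> = ennreal (e/2 + ?g x * unit_vol TYPE('n))"
      using \<open>e > 0\<close> by (simp add: ennreal_mult'')
    finally have 1: "msq (\<epsilon> k) V x \<le> ennreal (e/2 + ?g x * unit_vol TYPE('n))" .
    then have fin: "msq (\<epsilon> k) V x < \<infinity>" by (rule le_less_trans) simp
    have "ennreal (?g x * unit_vol TYPE('n)) = (\<integral>\<^sup>+y\<in>ball (0::real^'n) 1. (\<integral>\<^sup>+t\<in>{0..1::real}. ennreal (?g x) \<partial>lborel) \<partial>lborel)"
      unfolding nn_integral_unit_ball_slab by (simp add: ennreal_mult'')
    also have "\<dots> \<le> (\<integral>\<^sup>+y\<in>ball (0::real^'n) 1. (\<integral>\<^sup>+t\<in>{0..1}. ennreal (norm (?g (x + t *\<^sub>R (\<epsilon> k *\<^sub>R y)) - ?g x)) + ennreal (?g (x + t *\<^sub>R (\<epsilon> k *\<^sub>R y))) \<partial>lborel) \<partial>lborel)"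
      by (intro nn_integral_mono mult_right_mono) (auto simp flip: ennreal_plus intro!: ennreal_leI)
    also have "\<dots> = ?D (\<epsilon> k) + msq (\<epsilon> k) V x"
      unfolding msq_def by (subst add, measurable)
    also have "\<dots> \<le> ennreal (e/2) + ennreal (enn2real (msq (\<epsilon> k) V x))"
      using D fin by (intro add_mono) (auto simp: less_top)
    finally have 2: "?g x * unit_vol TYPE('n) \<le> e/2 + enn2real (msq (\<epsilon> k) V x)"
      using \<open>e > 0\<close> by (simp flip: ennreal_plus)
    have "enn2real (msq (\<epsilon> k) V x) \<le> e/2 + ?g x * unit_vol TYPE('n)"
      using 1 \<open>e > 0\<close> by (intro enn2real_leI) auto
    with 2 \<open>e > 0\<close> show ?thesis unfolding real_norm_def by linarith
  qed
  then show "\<exists>N. \<forall>k\<ge>N. norm (enn2real (msq (\<epsilon> k) V x) - ?g x * unit_vol TYPE('n)) < e" by blast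
qed

text \<open>The odd kernel annihilates constants and the coordinates other than \<open>j\<close>.
  The constant \<open>c\<close> and the vector \<open>A\<close> are therefore free, and will be the
  value and the gradient of \<open>v\<close> at \<open>x\<close>.\<close>

lemma avg_affine:
  assumes [measurable]: "v \<in> borel_measurable borel" and B: "\<And>x. \<bar>v x\<bar> \<le> B"
  shows "avg j \<epsilon> v x - \<epsilon> * kvar j * A $ j = (\<integral>y. ker j y * (v (x + \<epsilon> *\<^sub>R y) - c - \<epsilon> * (A \<bullet> y)) \<partial>lborel)"
    and "integrable lborel (\<lambda>y. ker j y * (v (x + \<epsilon> *\<^sub>R y) - c - \<epsilon> * (A \<bullet> y)))"
proof -
  have i1: "integrable lborel (\<lambda>y. ker j y * v (x + \<epsilon> *\<^sub>R y))"
    by (rule integrable_ker_mult[of _ B]) (use B in auto)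
  have i2: "integrable lborel (\<lambda>y. ker j y * c)" by (intro integrable_mult_left integrable_ker)
  have i3: "integrable lborel (\<lambda>y. ker j y * y $ k)" for k
    by (rule integrable_ker_mult[of _ 1]) (auto intro: order_trans[OF component_le_norm_cart])
  have eq: "ker j y * (v (x + \<epsilon> *\<^sub>R y) - c - \<epsilon> * (A \<bullet> y)) = 
     ker j y * v (x + \<epsilon> *\<^sub>R y) - ker j y * c - (\<Sum>k\<in>UNIV. (ker j y * y $ k) * (\<epsilon> * A $ k))" for y
    by (simp add: inner_vec_def sum_distrib_left algebra_simps)
  show "integrable lborel (\<lambda>y. ker j y * (v (x + \<epsilon> *\<^sub>R y) - c - \<epsilon> * (A \<bullet> y)))"
    unfolding eq by (intro Bochner_Integration.integrable_diff i1 i2 Bochner_Integration.integrable_sum integrable_mult_left i3)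
  have "(\<integral>y. ker j y * (v (x + \<epsilon> *\<^sub>R y) - c - \<epsilon> * (A \<bullet> y)) \<partial>lborel) = 
     avg j \<epsilon> v x - (\<integral>y. ker j y * c \<partial>lborel) - (\<Sum>k\<in>UNIV. (\<integral>y. ker j y * y $ k \<partial>lborel) * (\<epsilon> * A $ k))"
    unfolding eq avg_def using i1 i2 i3
    by (simp add: Bochner_Integration.integral_diff Bochner_Integration.integral_sum)
  also have "\<dots> = avg j \<epsilon> v x - \<epsilon> * kvar j * A $ j"
    by (simp add: integral_ker integral_ker_nth if_distrib[of "\<lambda>x. x * _"] cong: if_cong)
  finally show "avg j \<epsilon> v x - \<epsilon> * kvar j * A $ j = (\<integral>y. ker j y * (v (x + \<epsilon> *\<^sub>R y) - c - \<epsilon> * (A \<bullet> y)) \<partial>lborel)" ..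
qed

lemma avg_affine_bound:
  assumes [measurable]: "v \<in> borel_measurable borel" and B: "\<And>x. \<bar>v x\<bar> \<le> B"
  shows "ennreal \<bar>avg j \<epsilon> v x - \<epsilon> * kvar j * A $ j\<bar> \<le> (\<integral>\<^sup>+y\<in>ball 0 1. ennreal \<bar>v (x + \<epsilon> *\<^sub>R y) - c - \<epsilon> * (A \<bullet> y)\<bar> \<partial>lborel)"
proof -
  have "ennreal \<bar>avg j \<epsilon> v x - \<epsilon> * kvar j * A $ j\<bar> \<le> (\<integral>\<^sup>+y. ennreal (norm (ker j y * (v (x + \<epsilon> *\<^sub>R y) - c - \<epsilon> * (A \<bullet> y)))) \<partial>lborel)"
    using integral_norm_bound_ennreal[OF avg_affine(2)[OF assms, where j=j and \<epsilon>=\<epsilon> and x=x and A=A and c=c]]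
    by (simp add: avg_affine(1)[OF assms, where j=j and \<epsilon>=\<epsilon> and x=x and A=A and c=c])
  also have "\<dots> \<le> (\<integral>\<^sup>+y\<in>ball 0 1. ennreal \<bar>v (x + \<epsilon> *\<^sub>R y) - c - \<epsilon> * (A \<bullet> y)\<bar> \<partial>lborel)"
  proof (intro nn_integral_mono)
    fix y
    have "\<bar>ker j y\<bar> * \<bar>v (x + \<epsilon> *\<^sub>R y) - c - \<epsilon> * (A \<bullet> y)\<bar> \<le> indicator (ball 0 1) y * \<bar>v (x + \<epsilon> *\<^sub>R y) - c - \<epsilon> * (A \<bullet> y)\<bar>"
      using ker_bound[of j y] by (intro mult_right_mono) auto
    then show "ennreal (norm (ker j y * (v (x + \<epsilon> *\<^sub>R y) - c - \<epsilon> * (A \<bullet> y)))) \<le> ennreal \<bar>v (x + \<epsilon> *\<^sub>R y) - c - \<epsilon> * (A \<bullet> y)\<bar> * indicator (ball 0 1) y"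
      by (cases "y \<in> ball 0 1") (simp_all add: abs_mult ennreal_leI ker_def)
  qed
  finally show ?thesis .
qed

lemma dq_tendsto:
  fixes v :: "real^'n::finite \<Rightarrow> real"
  assumes w: "weak_deriv v V" and B: "\<And>x. \<bar>v x\<bar> \<le> B" and \<epsilon>: "\<And>k. \<epsilon> k > 0" "\<epsilon> \<longlonglongrightarrow> 0"
  shows "AE x in lborel. (\<lambda>k. dq j (\<epsilon> k) v x) \<longlonglongrightarrow> V x $ j"
  using weak_deriv_approx_diff[OF w]
proof eventually_elim
  fix x 
  assume x: "\<forall>e>0. \<exists>d>0. \<forall>\<epsilon>. 0 < \<epsilon> \<and> \<epsilon> < d \<longrightarrow>
    (\<integral>\<^sup>+y\<in>ball 0 1. ennreal \<bar>v (x + \<epsilon> *\<^sub>R y) - v x - \<epsilon> * (V x \<bullet> y)\<bar> \<partial>lborel) \<le> ennreal (e * \<epsilon>)"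
  have vm: "v \<in> borel_measurable borel" using w by (auto simp: weak_deriv_def)
  show "(\<lambda>k. dq j (\<epsilon> k) v x) \<longlonglongrightarrow> V x $ j"
  proof (rule LIMSEQ_I)
    fix e :: real assume e: "e > 0"
    have k: "kvar j > 0" by (rule kvar_pos)
    have "e * kvar j / 2 > 0" using e k by simp
    from x[rule_format, OF this] obtain d where d: "d > 0" "\<And>\<epsilon>. 0 < \<epsilon> \<Longrightarrow> \<epsilon> < d \<Longrightarrow> 
       (\<integral>\<^sup>+y\<in>ball 0 1. ennreal \<bar>v (x + \<epsilon> *\<^sub>R y) - v x - \<epsilon> * (V x \<bullet> y)\<bar> \<partial>lborel) \<le> ennreal (e * kvar j / 2 * \<epsilon>)" by blast
    from order_tendstoD(2)[OF \<epsilon>(2) d(1)] obtain N where N: "\<And>k. k \<ge> N \<Longrightarrow> \<epsilon> k < d"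
      by (auto simp: eventually_sequentially)
    have "norm (dq j (\<epsilon> n) v x - V x $ j) < e" if "n \<ge> N" for n
    proof -
      have "ennreal \<bar>avg j (\<epsilon> n) v x - \<epsilon> n * kvar j * V x $ j\<bar> \<le> ennreal (e * kvar j / 2 * \<epsilon> n)"
        by (rule order_trans[OF avg_affine_bound[OF vm B] d(2)[OF \<epsilon>(1) N[OF that]]])
      then have "\<bar>avg j (\<epsilon> n) v x - \<epsilon> n * kvar j * V x $ j\<bar> \<le> e * kvar j / 2 * \<epsilon> n"
        using e k \<epsilon>(1)[of n] by (simp add: ennreal_le_iff)
      moreover have "dq j (\<epsilon> n) v x - V x $ j = (avg j (\<epsilon> n) v x - \<epsilon> n * kvar j * V x $ j) / (\<epsilon> n * kvar j)"
        using k \<epsilon>(1)[of n] by (simp add: dq_def field_simps)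
      moreover have "\<bar>\<epsilon> n * kvar j\<bar> = \<epsilon> n * kvar j" using k \<epsilon>(1)[of n] by simp
      ultimately have "\<bar>dq j (\<epsilon> n) v x - V x $ j\<bar> \<le> (e * kvar j / 2 * \<epsilon> n) / (\<epsilon> n * kvar j)"
        using k \<epsilon>(1)[of n] by (simp only: abs_divide) (rule divide_right_mono, auto)
      also have "\<dots> = e / 2" using k \<epsilon>(1)[of n] by simp
      finally show ?thesis using e by simp
    qed
    then show "\<exists>N. \<forall>n\<ge>N. norm (dq j (\<epsilon> n) v x - V x $ j) < e" by blast
  qed
qed

text \<open>Increments are segment integrals of \<open>V\<close>. Cauchy-Schwarz is used twice: over
  the ball of increments, which costs its volume, and over the segment parameter in [0,1], which
  costs 1.\<close>

lemma dq_bound: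
  fixes v :: "real^'n::finite \<Rightarrow> real"
  assumes w: "weak_deriv v V" and B: "\<And>x. \<bar>v x\<bar> \<le> B" and \<epsilon>: "\<epsilon> > 0"
  shows "AE x in lborel. ennreal ((dq j \<epsilon> v x)\<^sup>2) \<le> ennreal (unit_vol TYPE('n) / (kvar j)\<^sup>2) * msq \<epsilon> V x"
  using weak_deriv_pairs[OF w]
proof eventually_elim
  fix x 
  assume ae: "AE h in lborel. v (x + h) - v x = (\<integral>t. V (x + t *\<^sub>R h) \<bullet> h * indicator {0..1} t \<partial>lborel)"
  have vm[measurable]: "v \<in> borel_measurable borel" and [measurable]: "V \<in> borel_measurable borel" using w by (auto simp: weak_deriv_def)
  let ?a = "\<lambda>y. (\<integral>\<^sup>+t\<in>{0..1}. ennreal (norm (V (x + t *\<^sub>R (\<epsilon> *\<^sub>R y)))) \<partial>lborel)"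
  have k: "kvar j > 0" by (rule kvar_pos)
  have "ennreal \<bar>avg j \<epsilon> v x\<bar> \<le> (\<integral>\<^sup>+y\<in>ball 0 1. ennreal \<bar>v (x + \<epsilon> *\<^sub>R y) - v x\<bar> \<partial>lborel)"
    using avg_affine_bound[OF vm B, where j=j and \<epsilon>=\<epsilon> and x=x and A=0 and c="v x"] by simp
  also have "\<dots> \<le> (\<integral>\<^sup>+y. (?a y * indicator (ball 0 1) y) * ennreal \<epsilon> \<partial>lborel)"
  proof (rule nn_integral_mono_AE)
    show "AE y in lborel. ennreal \<bar>v (x + \<epsilon> *\<^sub>R y) - v x\<bar> * indicator (ball 0 1) y \<le> (?a y * indicator (ball 0 1) y) * ennreal \<epsilon>"
      using AE_scale[OF ae \<epsilon>]
    proof eventually_elim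
      case (elim y)
      have "ennreal \<bar>v (x + \<epsilon> *\<^sub>R y) - v x\<bar> \<le> ?a y * ennreal (norm (\<epsilon> *\<^sub>R y))"
        using line_defect_bound[of V x "\<epsilon> *\<^sub>R y" 0] elim by simp
      also have "\<dots> \<le> ?a y * ennreal \<epsilon>" if "y \<in> ball 0 1"
        using that \<epsilon> by (intro mult_left_mono ennreal_leI) (auto simp: mult_left_le)
      finally show ?case by (auto simp: indicator_def)
    qed
  qed
  also have "\<dots> = (\<integral>\<^sup>+y\<in>ball 0 1. ?a y \<partial>lborel) * ennreal \<epsilon>"
    by (rule nn_integral_multc) measurable
  finally have 1: "ennreal \<bar>avg j \<epsilon> v x\<bar> \<le> (\<integral>\<^sup>+y\<in>ball 0 1. ?a y \<partial>lborel) * ennreal \<epsilon>" .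
  have "(\<integral>\<^sup>+y\<in>ball 0 1. ?a y \<partial>lborel)\<^sup>2 = (\<integral>\<^sup>+y. indicator (ball 0 1) y * (?a y * indicator (ball 0 1) y) \<partial>lborel)\<^sup>2"
    by (intro arg_cong[of _ _ "\<lambda>x. x\<^sup>2"] nn_integral_cong) (auto simp: indicator_def)
  also have "\<dots> \<le> (\<integral>\<^sup>+y. (indicator (ball (0::real^'n) 1) y)\<^sup>2 \<partial>lborel) * (\<integral>\<^sup>+y. (?a y * indicator (ball 0 1) y)\<^sup>2 \<partial>lborel)"
    by (rule Cauchy_Schwarz_nn_integral) measurable
  also have "(\<integral>\<^sup>+y. (indicator (ball (0::real^'n) 1) y)\<^sup>2 \<partial>lborel) = (\<integral>\<^sup>+y. indicator (ball (0::real^'n) 1) y \<partial>lborel)"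
    by (intro nn_integral_cong) (auto simp: indicator_def)
  also have "\<dots> = ennreal (unit_vol TYPE('n))" by (simp add: emeasure_unit_ball)
  also have "(\<integral>\<^sup>+y. (?a y * indicator (ball 0 1) y)\<^sup>2 \<partial>lborel) \<le> msq \<epsilon> V x"
    unfolding msq_def
  proof (intro nn_integral_mono)
    fix y
    have "(?a y)\<^sup>2 = (\<integral>\<^sup>+t. indicator {0..1} t * (ennreal (norm (V (x + t *\<^sub>R (\<epsilon> *\<^sub>R y)))) * indicator {0..1} t) \<partial>lborel)\<^sup>2"
      by (intro arg_cong[of _ _ "\<lambda>x. x\<^sup>2"] nn_integral_cong) (auto simp: indicator_def)
    also have "\<dots> \<le> (\<integral>\<^sup>+t. (indicator {0..1::real} t)\<^sup>2 \<partial>lborel) * (\<integral>\<^sup>+t. (ennreal (norm (V (x + t *\<^sub>R (\<epsilon> *\<^sub>R y)))) * indicator {0..1} t)\<^sup>2 \<partial>lborel)"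
      by (rule Cauchy_Schwarz_nn_integral) measurable
    also have "(\<integral>\<^sup>+t. (indicator {0..1::real} t)\<^sup>2 \<partial>lborel) = (\<integral>\<^sup>+t. indicator {0..1::real} t \<partial>lborel)"
      by (intro nn_integral_cong) (auto simp: indicator_def)
    also have "\<dots> = 1" by simp
    also have "(\<integral>\<^sup>+t. (ennreal (norm (V (x + t *\<^sub>R (\<epsilon> *\<^sub>R y)))) * indicator {0..1} t)\<^sup>2 \<partial>lborel) = 
        (\<integral>\<^sup>+t\<in>{0..1}. ennreal ((norm (V (x + t *\<^sub>R (\<epsilon> *\<^sub>R y))))\<^sup>2) \<partial>lborel)"
      by (intro nn_integral_cong) (auto simp: indicator_def ennreal_power)
    finally show "(?a y * indicator (ball 0 1) y)\<^sup>2 \<le> (\<integral>\<^sup>+t\<in>{0..1}. ennreal ((norm (V (x + t *\<^sub>R (\<epsilon> *\<^sub>R y))))\<^sup>2) \<partial>lborel) * indicator (ball 0 1) y"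
      by (auto simp: indicator_def)
  qed
  finally have 2: "(\<integral>\<^sup>+y\<in>ball 0 1. ?a y \<partial>lborel)\<^sup>2 \<le> ennreal (unit_vol TYPE('n)) * msq \<epsilon> V x"
    by (simp add: mult_left_mono)
  have "ennreal ((dq j \<epsilon> v x)\<^sup>2) = ennreal (1 / (kvar j * \<epsilon>)\<^sup>2) * (ennreal \<bar>avg j \<epsilon> v x\<bar>)\<^sup>2"
    by (simp add: dq_def power_divide ennreal_power flip: ennreal_mult'')
  also have "\<dots> \<le> ennreal (1 / (kvar j * \<epsilon>)\<^sup>2) * ((\<integral>\<^sup>+y\<in>ball 0 1. ?a y \<partial>lborel) * ennreal \<epsilon>)\<^sup>2"
    by (intro mult_left_mono power_mono 1) auto
  also have "\<dots> = ennreal (1 / (kvar j * \<epsilon>)\<^sup>2) * ennreal (\<epsilon>\<^sup>2) * (\<integral>\<^sup>+y\<in>ball 0 1. ?a y \<partial>lborel)\<^sup>2"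
    using \<epsilon> by (simp add: power_mult_distrib ennreal_power ac_simps)
  also have "ennreal (1 / (kvar j * \<epsilon>)\<^sup>2) * ennreal (\<epsilon>\<^sup>2) = ennreal (1 / (kvar j)\<^sup>2)"
    using \<epsilon> k by (simp add: power_mult_distrib flip: ennreal_mult'')
  also have "ennreal (1 / (kvar j)\<^sup>2) * (\<integral>\<^sup>+y\<in>ball 0 1. ?a y \<partial>lborel)\<^sup>2 \<le> ennreal (1 / (kvar j)\<^sup>2) * (ennreal (unit_vol TYPE('n)) * msq \<epsilon> V x)"
    by (intro mult_left_mono 2) auto
  also have "\<dots> = ennreal (unit_vol TYPE('n) / (kvar j)\<^sup>2) * msq \<epsilon> V x"
    by (simp add: mult.assoc[symmetric] flip: ennreal_mult'')
  finally show "ennreal ((dq j \<epsilon> v x)\<^sup>2) \<le> ennreal (unit_vol TYPE('n) / (kvar j)\<^sup>2) * msq \<epsilon> V x" .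
qed

lemma msq_integrable:
  fixes V :: "real^'n \<Rightarrow> real^'n"
  assumes [measurable]: "V \<in> borel_measurable borel" and i: "integrable lborel (\<lambda>x. (norm (V x))\<^sup>2)"
  shows "AE x in lborel. msq \<epsilon> V x < \<infinity>" "integrable lborel (\<lambda>x. enn2real (msq \<epsilon> V x))"
    "(\<integral>x. enn2real (msq \<epsilon> V x) \<partial>lborel) = (\<integral>x. (norm (V x))\<^sup>2 * unit_vol TYPE('n) \<partial>lborel)"
proof -
  have nn: "(\<integral>\<^sup>+x. msq \<epsilon> V x \<partial>lborel) = ennreal (\<integral>x. (norm (V x))\<^sup>2 * unit_vol TYPE('n) \<partial>lborel)"
    using i by (subst nn_integral_msq) (auto simp: nn_integral_eq_integral ennreal_mult'')
  then have "(\<integral>\<^sup>+x. msq \<epsilon> V x \<partial>lborel) \<noteq> \<infinity>" by simp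
  then have "AE x in lborel. msq \<epsilon> V x \<noteq> \<infinity>" by (intro nn_integral_PInf_AE) auto
  then show ae: "AE x in lborel. msq \<epsilon> V x < \<infinity>" by (simp add: less_top)
  have eq: "(\<integral>\<^sup>+x. ennreal (enn2real (msq \<epsilon> V x)) \<partial>lborel) = (\<integral>\<^sup>+x. msq \<epsilon> V x \<partial>lborel)"
    by (rule nn_integral_cong_AE, use ae in eventually_elim) (auto simp: less_top)
  then show int: "integrable lborel (\<lambda>x. enn2real (msq \<epsilon> V x))"
    using nn by (intro integrableI_nonneg) auto
  have "(\<integral>x. enn2real (msq \<epsilon> V x) \<partial>lborel) = enn2real (\<integral>\<^sup>+x. ennreal (enn2real (msq \<epsilon> V x)) \<partial>lborel)"
    by (rule integral_eq_nn_integral) auto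
  also have "\<dots> = (\<integral>x. (norm (V x))\<^sup>2 * unit_vol TYPE('n) \<partial>lborel)"
    unfolding eq nn by (intro enn2real_ennreal Bochner_Integration.integral_nonneg) auto
  finally show "(\<integral>x. enn2real (msq \<epsilon> V x) \<partial>lborel) = (\<integral>x. (norm (V x))\<^sup>2 * unit_vol TYPE('n) \<partial>lborel)" .
qed

text \<open>Pointwise convergence comes from differentiability in the mean, domination from
  \<open>msq\<close>. As the majorants have integrals independent of \<open>k\<close> and converge
  at Lebesgue points, the limit of the products needs no L^2 convergence of the quotients.\<close>

lemma integral_dq_tendsto:
  fixes f g :: "real^'n::finite \<Rightarrow> real"
  assumes f: "weak_deriv f F" "\<And>x. \<bar>f x\<bar> \<le> B" "integrable lborel (\<lambda>x. (norm (F x))\<^sup>2)"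
    and g: "weak_deriv g G" "\<And>x. \<bar>g x\<bar> \<le> B" "integrable lborel (\<lambda>x. (norm (G x))\<^sup>2)"
    and \<epsilon>: "\<And>k. \<epsilon> k > 0" "\<epsilon> \<longlonglongrightarrow> 0"
  shows "(\<lambda>k. \<integral>x. dq i (\<epsilon> k) f x * dq j (\<epsilon> k) g x \<partial>lborel) \<longlonglongrightarrow> (\<integral>x. F x $ i * G x $ j \<partial>lborel)"
proof -
  have [measurable]: "f \<in> borel_measurable borel" "F \<in> borel_measurable borel" 
     "g \<in> borel_measurable borel" "G \<in> borel_measurable borel" using f g by (auto simp: weak_deriv_def)
  \<comment> \<open>Large enough for both directions, so that both factors share one constant in the
    majorant.\<close>
  define c where "c = unit_vol TYPE('n) / (kvar i)\<^sup>2 + unit_vol TYPE('n) / (kvar j)\<^sup>2"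
  have c: "unit_vol TYPE('n) / (kvar i)\<^sup>2 \<le> c" "unit_vol TYPE('n) / (kvar j)\<^sup>2 \<le> c" "0 \<le> c"
    by (auto simp: c_def)
  have [measurable]: "dq j \<epsilon> h \<in> borel_measurable borel" 
    if [measurable]: "h \<in> borel_measurable borel" for j \<epsilon> and h :: "real^'n \<Rightarrow> real"
    unfolding dq_def[abs_def] by measurable
  have bd: "AE x in lborel. (dq j \<epsilon> h x)\<^sup>2 \<le> c * enn2real (msq \<epsilon> H x)" 
    if "weak_deriv h H" "\<And>x. \<bar>h x\<bar> \<le> B" "integrable lborel (\<lambda>x. (norm (H x))\<^sup>2)" "\<epsilon> > 0" "unit_vol TYPE('n) / (kvar j)\<^sup>2 \<le> c" for j :: 'n and h H \<epsilon>
  proof -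
    have H[measurable]: "H \<in> borel_measurable borel" using that by (auto simp: weak_deriv_def)
    show ?thesis using dq_bound[OF that(1,2,4), of j] msq_integrable(1)[OF H that(3), of \<epsilon>]
    proof eventually_elim
      fix x assume 1: "ennreal ((dq j \<epsilon> h x)\<^sup>2) \<le> ennreal (unit_vol TYPE('n) / (kvar j)\<^sup>2) * msq \<epsilon> H x" and 2: "msq \<epsilon> H x < \<infinity>"
      have "msq \<epsilon> H x = ennreal (enn2real (msq \<epsilon> H x))" using 2 by (simp add: less_top)
      then have "ennreal ((dq j \<epsilon> h x)\<^sup>2) \<le> ennreal (unit_vol TYPE('n) / (kvar j)\<^sup>2 * enn2real (msq \<epsilon> H x))"
        using 1 by (metis ennreal_mult'' enn2real_nonneg)
      then have "(dq j \<epsilon> h x)\<^sup>2 \<le> unit_vol TYPE('n) / (kvar j)\<^sup>2 * enn2real (msq \<epsilon> H x)"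
        by (simp add: ennreal_le_iff)
      also have "\<dots> \<le> c * enn2real (msq \<epsilon> H x)" by (rule mult_right_mono[OF that(5)]) simp
      finally show "(dq j \<epsilon> h x)\<^sup>2 \<le> c * enn2real (msq \<epsilon> H x)" .
    qed
  qed
  let ?M = "\<lambda>k x. c * enn2real (msq (\<epsilon> k) F x) + c * enn2real (msq (\<epsilon> k) G x)"
  let ?L = "\<lambda>x. c * ((norm (F x))\<^sup>2 * unit_vol TYPE('n)) + c * ((norm (G x))\<^sup>2 * unit_vol TYPE('n))"
  note mi = msq_integrable(2)[OF _ f(3)] msq_integrable(2)[OF _ g(3)]
  show ?thesis
  proof (rule integral_pratt[where g = ?M and G = ?L])
    show "integrable lborel (?M k)" for k using mi by auto
    show "integrable lborel ?L" using f(3) g(3) by auto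
    show "AE x in lborel. (\<lambda>k. dq i (\<epsilon> k) f x * dq j (\<epsilon> k) g x) \<longlonglongrightarrow> F x $ i * G x $ j"
      using dq_tendsto[OF f(1,2) \<epsilon>, of i] dq_tendsto[OF g(1,2) \<epsilon>, of j]
      by eventually_elim (rule tendsto_mult)
    show "AE x in lborel. (\<lambda>k. ?M k x) \<longlonglongrightarrow> ?L x"
      using AE_lebesgue_point[OF f(3)] AE_lebesgue_point[OF g(3)]
      by eventually_elim (intro tendsto_intros msq_tendsto \<epsilon>; measurable)
    show "AE x in lborel. \<bar>dq i (\<epsilon> k) f x * dq j (\<epsilon> k) g x\<bar> \<le> ?M k x" for k
      using bd[OF f \<epsilon>(1)[of k] c(1)] bd[OF g \<epsilon>(1)[of k] c(2)]
    proof eventually_elim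
      case (elim x)
      have "2 * (\<bar>dq i (\<epsilon> k) f x\<bar> * \<bar>dq j (\<epsilon> k) g x\<bar>) \<le> (dq i (\<epsilon> k) f x)\<^sup>2 + (dq j (\<epsilon> k) g x)\<^sup>2"
        using sum_squares_bound[of "\<bar>dq i (\<epsilon> k) f x\<bar>" "\<bar>dq j (\<epsilon> k) g x\<bar>"] by (simp add: mult.assoc)
      moreover have "0 \<le> (dq i (\<epsilon> k) f x)\<^sup>2" "0 \<le> (dq j (\<epsilon> k) g x)\<^sup>2" by auto
      ultimately show ?case using elim unfolding abs_mult by linarith
    qed
    have "(\<integral>x. ?M k x \<partial>lborel) = (\<integral>x. ?L x \<partial>lborel)" for k
      using mi f(3) g(3) msq_integrable(3)[OF _ f(3), of "\<epsilon> k"] msq_integrable(3)[OF _ g(3), of "\<epsilon> k"] by simp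
    then show "(\<lambda>k. \<integral>x. ?M k x \<partial>lborel) \<longlonglongrightarrow> (\<integral>x. ?L x \<partial>lborel)" by simp
  qed measurable
qed

text \<open>Both sides are limits of the same sequence, by the exact identity at each scale. Second
  derivatives never appear.\<close>

theorem null_lagrangian:
  fixes f g :: "real^'n::finite \<Rightarrow> real"
  assumes f: "weak_deriv f F" "\<And>x. \<bar>f x\<bar> \<le> B" "integrable lborel (\<lambda>x. (norm (F x))\<^sup>2)"
    and g: "weak_deriv g G" "\<And>x. \<bar>g x\<bar> \<le> B" "integrable lborel (\<lambda>x. (norm (G x))\<^sup>2)"
  shows "(\<integral>x. F x $ i * G x $ j \<partial>lborel) = (\<integral>x. F x $ j * G x $ i \<partial>lborel)"
proof -
  define \<epsilon> where "\<epsilon> k = 1 / real (Suc k)" for k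
  have \<epsilon>: "\<epsilon> k > 0" "\<epsilon> \<longlonglongrightarrow> 0" for k
    unfolding \<epsilon>_def using LIMSEQ_inverse_real_of_nat by (auto simp: inverse_eq_divide)
  have "integrable lborel f" "g \<in> borel_measurable borel" using f(1) g(1) by (auto simp: weak_deriv_def)
  from integral_avg_avg_symmetric[OF this(2) g(2) this(1)]
  have "(\<integral>x. dq i (\<epsilon> k) f x * dq j (\<epsilon> k) g x \<partial>lborel) = (\<integral>x. dq j (\<epsilon> k) f x * dq i (\<epsilon> k) g x \<partial>lborel)" for k
    unfolding dq_def by (simp add: mult.commute mult.left_commute)
  then have "(\<lambda>k. \<integral>x. dq i (\<epsilon> k) f x * dq j (\<epsilon> k) g x \<partial>lborel) \<longlonglongrightarrow> (\<integral>x. F x $ j * G x $ i \<partial>lborel)"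
    using integral_dq_tendsto[OF f g \<epsilon>, of j i] by simp
  with integral_dq_tendsto[OF f g \<epsilon>, of i j] show ?thesis by (rule LIMSEQ_unique)
qed

section \<open>The pointwise inequality\<close>

lemma norm_matrix_square: "(norm (A :: real^'n^'m))\<^sup>2 = (\<Sum>i\<in>UNIV. \<Sum>j\<in>UNIV. (A $ i $ j)\<^sup>2)"
  unfolding power2_norm_eq_inner by (simp add: inner_vec_def power2_eq_square)

lemma trace_transpose_mult: "trace (transpose A ** A) = (norm (A :: real^'n^'n))\<^sup>2"
  unfolding norm_matrix_square trace_def matrix_matrix_mult_def transpose_def
  by (simp add: power2_eq_square) (rule sum.swap)

lemma sum_off_diag_swap:
  fixes f :: "'a \<Rightarrow> 'a \<Rightarrow> real"
  assumes "finite S"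
  shows "(\<Sum>i\<in>S. \<Sum>j\<in>S - {i}. f j i) = (\<Sum>i\<in>S. \<Sum>j\<in>S - {i}. f i j)"
proof -
  have *: "(\<Sum>j\<in>S - {i}. g j) = (\<Sum>j\<in>S. if j = i then 0 else g j)" for i and g :: "'a \<Rightarrow> real"
    using assms by (intro sum.mono_neutral_cong_left) auto
  have "(\<Sum>i\<in>S. \<Sum>j\<in>S - {i}. f j i) = (\<Sum>i\<in>S. \<Sum>j\<in>S. if j = i then 0 else f j i)"
    by (simp only: *)
  also have "\<dots> = (\<Sum>j\<in>S. \<Sum>i\<in>S. if i = j then 0 else f j i)"
    by (subst sum.swap) (simp only: eq_commute)
  finally show ?thesis by (simp only: *)
qed

text \<open>Without row \<open>k\<close>, the minors run over pairs from d - 1 indices. The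
  arithmetic-geometric inequality on the diagonal products uses each diagonal square d - 2 times,
  which fixes the constant; on the off-diagonal products it uses each square once. A projection onto
  the remaining coordinates gives equality, and this is the shape of the hedgehog gradient.\<close>

lemma minor_sum_le:
  fixes A :: "real^'n^'n"
  assumes "CARD('n) \<ge> 2" and row: "A $ k = 0"
  shows "(trace A)\<^sup>2 - trace (A ** A) \<le> (real CARD('n) - 2) * (norm A)\<^sup>2"
proof -
  let ?U = "UNIV - {k}"
  let ?O = "\<lambda>i. UNIV - {k} - {i}"
  have z: "A $ k $ j = 0" for j using row by simp
  have fin: "finite ?U" by simp
  have card: "card (?O i) = CARD('n) - 2" if "i \<in> ?U" for i
    using that by (simp add: card_Diff_singleton numeral_2_eq_2)
  have c2: "real (CARD('n) - 2) = real CARD('n) - 2" using assms(1) by simp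
  have tr: "trace A = (\<Sum>i\<in>?U. A $ i $ i)"
    unfolding trace_def by (subst sum.remove[of _ k]) (auto simp: z)
  have tr2: "trace (A ** A) = (\<Sum>i\<in>?U. \<Sum>j\<in>?U. A $ i $ j * A $ j $ i)"
  proof -
    have "(\<Sum>j\<in>UNIV. A $ i $ j * A $ j $ i) = (\<Sum>j\<in>?U. A $ i $ j * A $ j $ i)" for i
      by (subst sum.remove[of _ k]) (auto simp: z)
    then have "trace (A ** A) = (\<Sum>i\<in>UNIV. \<Sum>j\<in>?U. A $ i $ j * A $ j $ i)"
      by (simp add: trace_def matrix_matrix_mult_def)
    then show ?thesis by (subst (asm) sum.remove[of _ k]) (auto simp: z)
  qed
  have "(trace A)\<^sup>2 - trace (A ** A) = (\<Sum>i\<in>?U. \<Sum>j\<in>?U. A $ i $ i * A $ j $ j - A $ i $ j * A $ j $ i)"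
    unfolding tr tr2 power2_eq_square sum_product by (simp add: sum_subtractf)
  also have "\<dots> = (\<Sum>i\<in>?U. \<Sum>j\<in>?O i. A $ i $ i * A $ j $ j - A $ i $ j * A $ j $ i)"
    by (rule sum.cong[OF refl], rule sum.mono_neutral_right) (auto simp: mult.commute)
  also have "\<dots> \<le> (\<Sum>i\<in>?U. \<Sum>j\<in>?O i. ((A $ i $ i)\<^sup>2 + (A $ j $ j)\<^sup>2) / 2 + ((A $ i $ j)\<^sup>2 + (A $ j $ i)\<^sup>2) / 2)"
  proof (intro sum_mono)
    fix i j
    have amgm: "x * y \<le> (x\<^sup>2 + y\<^sup>2) / 2" for x y :: real
      using sum_squares_bound[of x y] by simp
    show "A $ i $ i * A $ j $ j - A $ i $ j * A $ j $ i \<le> ((A $ i $ i)\<^sup>2 + (A $ j $ j)\<^sup>2) / 2 + ((A $ i $ j)\<^sup>2 + (A $ j $ i)\<^sup>2) / 2"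
      using add_mono[OF amgm[of "A $ i $ i" "A $ j $ j"] amgm[of "A $ i $ j" "- A $ j $ i"]] by simp
  qed
  also have "\<dots> = ((\<Sum>i\<in>?U. \<Sum>j\<in>?O i. (A $ i $ i)\<^sup>2) + (\<Sum>i\<in>?U. \<Sum>j\<in>?O i. (A $ j $ j)\<^sup>2)) / 2 
      + ((\<Sum>i\<in>?U. \<Sum>j\<in>?O i. (A $ i $ j)\<^sup>2) + (\<Sum>i\<in>?U. \<Sum>j\<in>?O i. (A $ j $ i)\<^sup>2)) / 2"
    by (simp add: sum.distrib add_divide_distrib sum_divide_distrib)
  also have "(\<Sum>i\<in>?U. \<Sum>j\<in>?O i. (A $ j $ j)\<^sup>2) = (\<Sum>i\<in>?U. \<Sum>j\<in>?O i. (A $ i $ i)\<^sup>2)"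
    by (rule sum_off_diag_swap) simp
  also have "(\<Sum>i\<in>?U. \<Sum>j\<in>?O i. (A $ j $ i)\<^sup>2) = (\<Sum>i\<in>?U. \<Sum>j\<in>?O i. (A $ i $ j)\<^sup>2)"
    by (rule sum_off_diag_swap) simp
  also have "((\<Sum>i\<in>?U. \<Sum>j\<in>?O i. (A $ i $ i)\<^sup>2) + (\<Sum>i\<in>?U. \<Sum>j\<in>?O i. (A $ i $ i)\<^sup>2)) / 2 
      + ((\<Sum>i\<in>?U. \<Sum>j\<in>?O i. (A $ i $ j)\<^sup>2) + (\<Sum>i\<in>?U. \<Sum>j\<in>?O i. (A $ i $ j)\<^sup>2)) / 2
      = (\<Sum>i\<in>?U. real (CARD('n) - 2) * (A $ i $ i)\<^sup>2) + (\<Sum>i\<in>?U. \<Sum>j\<in>?O i. (A $ i $ j)\<^sup>2)"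
    using card by simp
  also have "\<dots> \<le> (\<Sum>i\<in>?U. real (CARD('n) - 2) * (A $ i $ i)\<^sup>2) + (\<Sum>i\<in>?U. \<Sum>j\<in>?O i. real (CARD('n) - 2) * (A $ i $ j)\<^sup>2)"
  proof (intro add_left_mono sum_mono)
    fix i j assume i: "i \<in> ?U" and j: "j \<in> ?O i"
    \<comment> \<open>An off-diagonal pair avoiding \<open>k\<close> exists only if d >= 3, so the
      factor d - 2 is at least 1 exactly where it is needed; for d = 2 the inner sum is
      empty.\<close>
    have "card (?O i) > 0" using j by (auto simp: card_gt_0_iff)
    then have "1 \<le> real (CARD('n) - 2)" using card[OF i] by simp
    then show "(A $ i $ j)\<^sup>2 \<le> real (CARD('n) - 2) * (A $ i $ j)\<^sup>2" using mult_right_mono[of 1 "real (CARD('n) - 2)" "(A $ i $ j)\<^sup>2"] by simp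
  qed
  also have "\<dots> = (\<Sum>i\<in>?U. \<Sum>j\<in>?U. real (CARD('n) - 2) * (A $ i $ j)\<^sup>2)"
    unfolding sum.distrib[symmetric] by (rule sum.cong[OF refl], rule sum.remove[symmetric]) auto
  also have "\<dots> \<le> (\<Sum>i\<in>?U. \<Sum>j\<in>UNIV. real (CARD('n) - 2) * (A $ i $ j)\<^sup>2)"
    by (intro sum_mono sum_mono2) auto
  also have "\<dots> = (real CARD('n) - 2) * (norm A)\<^sup>2"
    unfolding norm_matrix_square c2 sum_distrib_left[symmetric]
    by (subst (2) sum.remove[of _ k]) (auto simp: z)
  finally show ?thesis .
qed

text \<open>Conjugation by an orthogonal matrix that sends a coordinate axis to \<open>z\<close>
  changes neither the traces nor the Frobenius norm, and turns the tangency condition into a zero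
  row.\<close>

lemma null_lagrangian_le_norm:
  fixes A :: "real^'n^'n"
  assumes "CARD('n) \<ge> 2" and z: "norm z = 1" and tan: "transpose A *v z = 0"
  shows "(trace A)\<^sup>2 - trace (A ** A) \<le> (real CARD('n) - 2) * (norm A)\<^sup>2"
proof -
  obtain k :: 'n where True by blast
  obtain U :: "real^'n^'n" where U: "orthogonal_matrix U" "U *v axis k 1 = z"
    using orthogonal_matrix_exists_basis[OF z] by blast
  have UU: "transpose U ** U = mat 1" "U ** transpose U = mat 1"
    using U(1) by (auto simp: orthogonal_matrix_def)
  define B where "B = transpose U ** A ** U"
  have "transpose B *v axis k 1 = transpose U *v (transpose A *v (U *v axis k 1))"
    unfolding B_def matrix_transpose_mul transpose_transpose by (simp only: matrix_vector_mul_assoc matrix_mul_assoc)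
  also have "\<dots> = 0" unfolding U(2) tan by (rule matrix_vector_mult_0_right)
  finally have "transpose B *v axis k 1 = 0" .
  moreover have "transpose B *v axis k 1 = B $ k"
    by (simp add: vec_eq_iff matrix_vector_mult_basis column_def transpose_def)
  ultimately have row: "B $ k = 0" by simp
  have trB: "trace B = trace A"
    unfolding B_def by (subst trace_mul_sym) (simp add: matrix_mul_assoc UU)
  have "B ** B = transpose U ** (A ** A) ** U"
    unfolding B_def by (metis UU(2) matrix_mul_assoc matrix_mul_rid)
  then have trBB: "trace (B ** B) = trace (A ** A)"
    by (simp, subst trace_mul_sym) (simp add: matrix_mul_assoc UU)
  have "transpose B ** B = transpose U ** (transpose A ** A) ** U"
    unfolding B_def matrix_transpose_mul transpose_transpose by (metis UU(2) matrix_mul_assoc matrix_mul_rid)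
  then have "trace (transpose B ** B) = trace (transpose A ** A)"
    by (simp, subst trace_mul_sym) (simp add: matrix_mul_assoc UU)
  then have nB: "(norm B)\<^sup>2 = (norm A)\<^sup>2" by (simp add: trace_transpose_mult)
  show ?thesis using minor_sum_le[OF assms(1) row] by (simp add: trB trBB nB)
qed

section \<open>Approximate gradients\<close>

text \<open>The second condition in \<open>has_approx_gradient\<close>, rescaled to the unit ball
  and freed of limits and quotients, with the value \<open>z\<close> made explicit. The volume of
  the ball is absorbed in the arbitrary \<open>e\<close>.\<close>

definition approx_affine :: "(real^'n \<Rightarrow> real^'m) \<Rightarrow> real^'n \<Rightarrow> real^'m \<Rightarrow> real^'n^'m \<Rightarrow> bool" where
  "approx_affine u x z A \<longleftrightarrow> (\<forall>e>0. \<exists>d>0. \<forall>\<rho>. 0 < \<rho> \<and> \<rho> < d \<longrightarrow>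
     (\<integral>\<^sup>+y\<in>ball 0 1. ennreal (norm (u (x + \<rho> *\<^sub>R y) - z - \<rho> *\<^sub>R (A *v y))) \<partial>lborel) \<le> ennreal (e * \<rho>))"

lemma ball_average:
  fixes g :: "real^'n \<Rightarrow> ennreal"
  assumes [measurable]: "g \<in> borel_measurable borel" and \<rho>: "\<rho> > 0"
  shows "(\<integral>\<^sup>+y\<in>ball x \<rho>. g y \<partial>lebesgue) / emeasure lebesgue (ball x \<rho>)
    = (\<integral>\<^sup>+y\<in>ball 0 1. g (x + \<rho> *\<^sub>R y) \<partial>lborel) / ennreal (unit_vol TYPE('n))"
proof -
  have 1: "(\<integral>\<^sup>+y\<in>ball x \<rho>. h y \<partial>lborel) = ennreal (\<rho> ^ CARD('n)) * (\<integral>\<^sup>+y\<in>ball 0 1. h (x + \<rho> *\<^sub>R y) \<partial>lborel)"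
    if [measurable]: "h \<in> borel_measurable borel" for h :: "real^'n \<Rightarrow> ennreal"
  proof -
    have "(\<integral>\<^sup>+y\<in>ball x \<rho>. h y \<partial>lborel) = ennreal (\<rho> ^ CARD('n)) * (\<integral>\<^sup>+y. h (x + \<rho> *\<^sub>R y) * indicator (ball x \<rho>) (x + \<rho> *\<^sub>R y) \<partial>lborel)"
      using nn_integral_affine[of "\<lambda>y. h y * indicator (ball x \<rho>) y" \<rho> x] \<rho> by simp
    also have "(\<integral>\<^sup>+y. h (x + \<rho> *\<^sub>R y) * indicator (ball x \<rho>) (x + \<rho> *\<^sub>R y) \<partial>lborel) = (\<integral>\<^sup>+y\<in>ball 0 1. h (x + \<rho> *\<^sub>R y) \<partial>lborel)"
      using \<rho> by (intro nn_integral_cong) (auto simp: indicator_def dist_norm mult_less_cancel_left1 mult_less_cancel_left2)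
    finally show ?thesis .
  qed
  have "emeasure lebesgue (ball x \<rho>) = (\<integral>\<^sup>+y\<in>ball x \<rho>. 1 \<partial>lborel)" by simp
  also have "\<dots> = ennreal (\<rho> ^ CARD('n)) * ennreal (unit_vol TYPE('n))"
    by (subst 1) (simp_all add: emeasure_unit_ball)
  finally have em: "emeasure lebesgue (ball x \<rho>) = ennreal (\<rho> ^ CARD('n)) * ennreal (unit_vol TYPE('n))" .
  show ?thesis
    unfolding em nn_integral_completion 1[OF assms(1)] using \<rho>
    using divide_mult_eq[of "ennreal (\<rho> ^ CARD('n))", unfolded mult.commute[of _ "ennreal (\<rho> ^ CARD('n))"]] by simp
qed

lemma unit_vol_pos: "unit_vol TYPE('n::finite) > 0"
  by simp

lemma tendsto_0_ennreal_iff: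
  fixes F :: "real \<Rightarrow> ennreal"
  shows "(F \<longlongrightarrow> 0) (at_right 0) \<longleftrightarrow> (\<forall>e>0. \<exists>d>0. \<forall>\<rho>. 0 < \<rho> \<and> \<rho> < d \<longrightarrow> F \<rho> \<le> ennreal e)"
proof
  assume F: "(F \<longlongrightarrow> 0) (at_right 0)"
  show "\<forall>e>0. \<exists>d>0. \<forall>\<rho>. 0 < \<rho> \<and> \<rho> < d \<longrightarrow> F \<rho> \<le> ennreal e"
  proof (intro allI impI)
    fix e :: real assume "e > 0"
    then have "eventually (\<lambda>\<rho>. F \<rho> < ennreal e) (at_right 0)"
      by (intro order_tendstoD(2)[OF F]) auto
    then show "\<exists>d>0. \<forall>\<rho>. 0 < \<rho> \<and> \<rho> < d \<longrightarrow> F \<rho> \<le> ennreal e"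
      unfolding eventually_at_right_field by (auto intro: less_imp_le)
  qed
next
  assume F: "\<forall>e>0. \<exists>d>0. \<forall>\<rho>. 0 < \<rho> \<and> \<rho> < d \<longrightarrow> F \<rho> \<le> ennreal e"
  show "(F \<longlongrightarrow> 0) (at_right 0)"
  proof (rule order_tendstoI)
    fix a :: ennreal assume "0 < a"
    have "\<exists>e>0. ennreal e < a"
    proof (cases a)
      case (real r)
      then show ?thesis using \<open>0 < a\<close> by (intro exI[of _ "r / 2"]) (auto simp: ennreal_less_iff)
    next
      case top
      then show ?thesis by (intro exI[of _ 1]) auto
    qed
    then obtain e where e: "e > 0" "ennreal e < a" by blast
    from F[rule_format, OF e(1)] obtain d where "d > 0" "\<And>\<rho>. 0 < \<rho> \<Longrightarrow> \<rho> < d \<Longrightarrow> F \<rho> \<le> ennreal e" by blast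
    then show "eventually (\<lambda>\<rho>. F \<rho> < a) (at_right 0)"
      unfolding eventually_at_right_field using e(2) by (intro exI[of _ d]) (auto intro: le_less_trans)
  qed simp
qed

lemma divide_unit_vol_le: "e \<ge> 0 \<Longrightarrow> F / ennreal (unit_vol TYPE('n::finite)) \<le> ennreal e \<longleftrightarrow> F \<le> ennreal (e * unit_vol TYPE('n))"
proof -
  assume e: "e \<ge> 0"
  let ?V = "ennreal (unit_vol TYPE('n))"
  have V: "?V / ?V = 1" using unit_vol_pos[where 'n='n] by (intro ennreal_divide_self) auto
  have eV: "ennreal (e * unit_vol TYPE('n)) = ennreal e * ?V" using e by (simp add: ennreal_mult'')
  have 1: "F = F / ?V * ?V" by (simp add: ennreal_divide_times V)
  have 2: "ennreal e * ?V / ?V = ennreal e" by (simp add: ennreal_times_divide[symmetric] V)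
  show "F / ?V \<le> ennreal e \<longleftrightarrow> F \<le> ennreal (e * unit_vol TYPE('n))"
  proof
    assume "F / ?V \<le> ennreal e"
    then have "F / ?V * ?V \<le> ennreal e * ?V" by (rule mult_right_mono) simp
    then show "F \<le> ennreal (e * unit_vol TYPE('n))" unfolding eV using 1 by simp
  next
    assume "F \<le> ennreal (e * unit_vol TYPE('n))"
    then have "F / ?V \<le> ennreal e * ?V / ?V" unfolding eV by (rule divide_right_mono_ennreal)
    then show "F / ?V \<le> ennreal e" unfolding 2 .
  qed
qed

lemma approx_limit_iff:
  fixes u :: "real^'n \<Rightarrow> real^'m"
  assumes [measurable]: "u \<in> borel_measurable borel"
  shows "approx_limit u x z \<longleftrightarrow> (\<forall>e>0. \<exists>d>0. \<forall>\<rho>. 0 < \<rho> \<and> \<rho> < d \<longrightarrow>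
     (\<integral>\<^sup>+y\<in>ball 0 1. ennreal (norm (u (x + \<rho> *\<^sub>R y) - z)) \<partial>lborel) \<le> ennreal e)" (is "_ \<longleftrightarrow> ?R")
proof -
  have *: "((\<integral>\<^sup>+y\<in>ball x \<rho>. ennreal (norm (u y - z)) \<partial>lebesgue) / emeasure lebesgue (ball x \<rho>) \<le> ennreal e) \<longleftrightarrow>
     (\<integral>\<^sup>+y\<in>ball 0 1. ennreal (norm (u (x + \<rho> *\<^sub>R y) - z)) \<partial>lborel) \<le> ennreal (e * unit_vol TYPE('n))"
    if "\<rho> > 0" "e > 0" for \<rho> e
    using that by (subst ball_average) (auto simp: divide_unit_vol_le)
  show ?thesis unfolding approx_limit_def tendsto_0_ennreal_iff
  proof safe
    fix e :: real assume "\<forall>e>0. \<exists>d>0. \<forall>\<rho>. 0 < \<rho> \<and> \<rho> < d \<longrightarrow> (\<integral>\<^sup>+y\<in>ball x \<rho>. ennreal (norm (u y - z)) \<partial>lebesgue) / emeasure lebesgue (ball x \<rho>) \<le> ennreal e"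
      and e: "e > 0"
    from this(1)[rule_format, of "e / unit_vol TYPE('n)"] e obtain d where "d > 0"
      "\<And>\<rho>. 0 < \<rho> \<Longrightarrow> \<rho> < d \<Longrightarrow> (\<integral>\<^sup>+y\<in>ball x \<rho>. ennreal (norm (u y - z)) \<partial>lebesgue) / emeasure lebesgue (ball x \<rho>) \<le> ennreal (e / unit_vol TYPE('n))"
      using unit_vol_pos[where 'n='n] by auto
    then show "\<exists>d>0. \<forall>\<rho>. 0 < \<rho> \<and> \<rho> < d \<longrightarrow>
     (\<integral>\<^sup>+y\<in>ball 0 1. ennreal (norm (u (x + \<rho> *\<^sub>R y) - z)) \<partial>lborel) \<le> ennreal e"
      using *[of _ "e / unit_vol TYPE('n)"] e unit_vol_pos[where 'n='n] by (intro exI[of _ d]) auto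
  next
    fix e :: real assume "?R" and e: "e > 0"
    from this(1)[rule_format, of "e * unit_vol TYPE('n)"] e obtain d where "d > 0"
      "\<And>\<rho>. 0 < \<rho> \<Longrightarrow> \<rho> < d \<Longrightarrow> (\<integral>\<^sup>+y\<in>ball 0 1. ennreal (norm (u (x + \<rho> *\<^sub>R y) - z)) \<partial>lborel) \<le> ennreal (e * unit_vol TYPE('n))"
      using unit_vol_pos[where 'n='n] by auto
    then show "\<exists>d>0. \<forall>\<rho>. 0 < \<rho> \<and> \<rho> < d \<longrightarrow> (\<integral>\<^sup>+y\<in>ball x \<rho>. ennreal (norm (u y - z)) \<partial>lebesgue) / emeasure lebesgue (ball x \<rho>) \<le> ennreal e"
      using *[of _ e] e by (intro exI[of _ d]) auto
  qed
qed

lemma matrix_vector_measurable[measurable (raw)]: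
  fixes A :: "real^'n^'m"
  assumes [measurable]: "f \<in> borel_measurable M"
  shows "(\<lambda>y. A *v f y) \<in> borel_measurable M"
  by (rule borel_measurable_continuous_on[OF _ assms]) (intro linear_continuous_on matrix_vector_mul_bounded_linear)

lemma has_approx_gradient_iff:
  fixes u :: "real^'n \<Rightarrow> real^'m"
  assumes [measurable]: "u \<in> borel_measurable borel"
  shows "has_approx_gradient u A x \<longleftrightarrow> (\<exists>z. approx_limit u x z \<and> approx_affine u x z A)"
proof -
  have *: "((\<integral>\<^sup>+y\<in>ball x \<rho>. ennreal (norm (u y - z - A *v (y - x)) / \<rho>) \<partial>lebesgue) / emeasure lebesgue (ball x \<rho>) \<le> ennreal e) \<longleftrightarrow>
     (\<integral>\<^sup>+y\<in>ball 0 1. ennreal (norm (u (x + \<rho> *\<^sub>R y) - z - \<rho> *\<^sub>R (A *v y))) \<partial>lborel) \<le> ennreal (e * unit_vol TYPE('n) * \<rho>)"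
    if \<rho>: "\<rho> > 0" and e: "e > 0" for \<rho> e z
  proof -
    have "((\<integral>\<^sup>+y\<in>ball x \<rho>. ennreal (norm (u y - z - A *v (y - x)) / \<rho>) \<partial>lebesgue) / emeasure lebesgue (ball x \<rho>) \<le> ennreal e) \<longleftrightarrow>
       (\<integral>\<^sup>+y\<in>ball 0 1. ennreal (norm (u (x + \<rho> *\<^sub>R y) - z - A *v (x + \<rho> *\<^sub>R y - x)) / \<rho>) \<partial>lborel) \<le> ennreal (e * unit_vol TYPE('n))"
      using that by (subst ball_average) (auto simp: divide_unit_vol_le)
    also have "(\<integral>\<^sup>+y\<in>ball 0 1. ennreal (norm (u (x + \<rho> *\<^sub>R y) - z - A *v (x + \<rho> *\<^sub>R y - x)) / \<rho>) \<partial>lborel)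
      = (\<integral>\<^sup>+y. ennreal (1 / \<rho>) * (ennreal (norm (u (x + \<rho> *\<^sub>R y) - z - \<rho> *\<^sub>R (A *v y))) * indicator (ball 0 1) y) \<partial>lborel)"
      using \<rho> by (intro nn_integral_cong) (auto simp: indicator_def matrix_vector_mult_scaleR ennreal_mult''[symmetric])
    also have "\<dots> = ennreal (1 / \<rho>) * (\<integral>\<^sup>+y\<in>ball 0 1. ennreal (norm (u (x + \<rho> *\<^sub>R y) - z - \<rho> *\<^sub>R (A *v y))) \<partial>lborel)"
      by (rule nn_integral_cmult) measurable
    also have "\<dots> \<le> ennreal (e * unit_vol TYPE('n)) \<longleftrightarrow> ennreal \<rho> * (ennreal (1 / \<rho>) * (\<integral>\<^sup>+y\<in>ball 0 1. ennreal (norm (u (x + \<rho> *\<^sub>R y) - z - \<rho> *\<^sub>R (A *v y))) \<partial>lborel)) \<le> ennreal \<rho> * ennreal (e * unit_vol TYPE('n))"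
      using \<rho> by (subst ennreal_mult_le_mult_iff) auto
    also have "ennreal \<rho> * (ennreal (1 / \<rho>) * (\<integral>\<^sup>+y\<in>ball 0 1. ennreal (norm (u (x + \<rho> *\<^sub>R y) - z - \<rho> *\<^sub>R (A *v y))) \<partial>lborel)) = (\<integral>\<^sup>+y\<in>ball 0 1. ennreal (norm (u (x + \<rho> *\<^sub>R y) - z - \<rho> *\<^sub>R (A *v y))) \<partial>lborel)"
      using \<rho> by (simp add: mult.assoc[symmetric] flip: ennreal_mult'')
    also have "ennreal \<rho> * ennreal (e * unit_vol TYPE('n)) = ennreal (e * unit_vol TYPE('n) * \<rho>)"
      using \<rho> e by (simp add: mult.commute flip: ennreal_mult'')
    finally show ?thesis .
  qed
  have **: "((\<lambda>\<rho>. (\<integral>\<^sup>+y\<in>ball x \<rho>. ennreal (norm (u y - z - A *v (y - x)) / \<rho>) \<partial>lebesgue) / emeasure lebesgue (ball x \<rho>)) \<longlongrightarrow> 0) (at_right 0)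
      \<longleftrightarrow> approx_affine u x z A" for z
    unfolding tendsto_0_ennreal_iff approx_affine_def
  proof safe
    fix e :: real assume H: "\<forall>e>0. \<exists>d>0. \<forall>\<rho>. 0 < \<rho> \<and> \<rho> < d \<longrightarrow> (\<integral>\<^sup>+y\<in>ball x \<rho>. ennreal (norm (u y - z - A *v (y - x)) / \<rho>) \<partial>lebesgue) / emeasure lebesgue (ball x \<rho>) \<le> ennreal e"
      and e: "e > 0"
    have e': "e / unit_vol TYPE('n) > 0" "e / unit_vol TYPE('n) * unit_vol TYPE('n) = e" using e unit_vol_pos[where 'n='n] by auto
    from H[rule_format, OF e'(1)] obtain d where "d > 0"
      "\<And>\<rho>. 0 < \<rho> \<Longrightarrow> \<rho> < d \<Longrightarrow> (\<integral>\<^sup>+y\<in>ball x \<rho>. ennreal (norm (u y - z - A *v (y - x)) / \<rho>) \<partial>lebesgue) / emeasure lebesgue (ball x \<rho>) \<le> ennreal (e / unit_vol TYPE('n))"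
      by auto
    then show "\<exists>d>0. \<forall>\<rho>. 0 < \<rho> \<and> \<rho> < d \<longrightarrow>
     (\<integral>\<^sup>+y\<in>ball 0 1. ennreal (norm (u (x + \<rho> *\<^sub>R y) - z - \<rho> *\<^sub>R (A *v y))) \<partial>lborel) \<le> ennreal (e * \<rho>)"
      using *[OF _ e'(1)] unfolding e'(2) by (intro exI[of _ d]) auto
  next
    fix e :: real assume H: "\<forall>e>0. \<exists>d>0. \<forall>\<rho>. 0 < \<rho> \<and> \<rho> < d \<longrightarrow>
       (\<integral>\<^sup>+y\<in>ball 0 1. ennreal (norm (u (x + \<rho> *\<^sub>R y) - z - \<rho> *\<^sub>R (A *v y))) \<partial>lborel) \<le> ennreal (e * \<rho>)" and e: "e > 0"
    have "e * unit_vol TYPE('n) > 0" using e unit_vol_pos[where 'n='n] by simp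
    from H[rule_format, OF this] obtain d where "d > 0"
      "\<And>\<rho>. 0 < \<rho> \<Longrightarrow> \<rho> < d \<Longrightarrow> (\<integral>\<^sup>+y\<in>ball 0 1. ennreal (norm (u (x + \<rho> *\<^sub>R y) - z - \<rho> *\<^sub>R (A *v y))) \<partial>lborel) \<le> ennreal (e * unit_vol TYPE('n) * \<rho>)"
      by auto
    then show "\<exists>d>0. \<forall>\<rho>. 0 < \<rho> \<and> \<rho> < d \<longrightarrow> (\<integral>\<^sup>+y\<in>ball x \<rho>. ennreal (norm (u y - z - A *v (y - x)) / \<rho>) \<partial>lebesgue) / emeasure lebesgue (ball x \<rho>) \<le> ennreal e"
      using *[OF _ e] by (intro exI[of _ d]) auto
  qed
  show ?thesis unfolding has_approx_gradient_def ** ..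
qed

lemma matrix_vector_bound:
  fixes A :: "real^'n^'m"
  obtains a where "a \<ge> 0" "\<And>y. norm (A *v y) \<le> a * norm y"
  using bounded_linear.nonneg_bounded[OF matrix_vector_mul_bounded_linear[of A]] by (metis mult.commute)

lemma approx_affine_imp_limit:
  fixes u :: "real^'n \<Rightarrow> real^'m"
  assumes [measurable]: "u \<in> borel_measurable borel" and a: "approx_affine u x z A"
  shows "approx_limit u x z"
  unfolding approx_limit_iff[OF assms(1)]
proof (intro allI impI)
  fix e :: real assume e: "e > 0"
  obtain a where a0: "a \<ge> 0" "\<And>y. norm (A *v y) \<le> a * norm y" using matrix_vector_bound by blast
  from a[unfolded approx_affine_def, rule_format, OF zero_less_one] obtain d where d: "d > 0"
    "\<And>\<rho>. 0 < \<rho> \<Longrightarrow> \<rho> < d \<Longrightarrow> (\<integral>\<^sup>+y\<in>ball 0 1. ennreal (norm (u (x + \<rho> *\<^sub>R y) - z - \<rho> *\<^sub>R (A *v y))) \<partial>lborel) \<le> ennreal (1 * \<rho>)" by blast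
  \<comment> \<open>Chosen so that \<rho> for the affine defect plus \<rho> a times the volume of
    the ball for the linear part stays below \<open>e\<close>.\<close>
  define d' where "d' = min d (e / (1 + a * unit_vol TYPE('n)))"
  have p: "1 + a * unit_vol TYPE('n) > 0" using a0 by (simp add: add_pos_nonneg)
  have "d' > 0" using d e p by (simp add: d'_def)
  have "(\<integral>\<^sup>+y\<in>ball 0 1. ennreal (norm (u (x + \<rho> *\<^sub>R y) - z)) \<partial>lborel) \<le> ennreal e" if \<rho>: "0 < \<rho>" "\<rho> < d'" for \<rho>
  proof -
    have "(\<integral>\<^sup>+y\<in>ball 0 1. ennreal (norm (u (x + \<rho> *\<^sub>R y) - z)) \<partial>lborel) \<le>
      (\<integral>\<^sup>+y. ennreal (norm (u (x + \<rho> *\<^sub>R y) - z - \<rho> *\<^sub>R (A *v y))) * indicator (ball 0 1) y + ennreal (\<rho> * a) * indicator (ball 0 1) y \<partial>lborel)"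
    proof (intro nn_integral_mono)
      fix y :: "real^'n"
      have "norm (u (x + \<rho> *\<^sub>R y) - z) \<le> norm (u (x + \<rho> *\<^sub>R y) - z - \<rho> *\<^sub>R (A *v y)) + \<rho> * a" if "y \<in> ball 0 1"
      proof -
        have "a * norm y \<le> a * 1" using that a0(1) by (intro mult_left_mono) auto
        then have "norm (\<rho> *\<^sub>R (A *v y)) \<le> \<rho> * a" using a0(2)[of y] \<rho> by simp
        then show ?thesis using norm_triangle_ineq[of "u (x + \<rho> *\<^sub>R y) - z - \<rho> *\<^sub>R (A *v y)" "\<rho> *\<^sub>R (A *v y)"] by simp
      qed
      then show "ennreal (norm (u (x + \<rho> *\<^sub>R y) - z)) * indicator (ball 0 1) y \<le> ennreal (norm (u (x + \<rho> *\<^sub>R y) - z - \<rho> *\<^sub>R (A *v y))) * indicator (ball 0 1) y + ennreal (\<rho> * a) * indicator (ball 0 1) y"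
        using a0(1) \<rho> by (cases "y \<in> ball 0 1") (auto simp flip: ennreal_plus intro!: ennreal_leI)
    qed
    also have "\<dots> = (\<integral>\<^sup>+y\<in>ball 0 1. ennreal (norm (u (x + \<rho> *\<^sub>R y) - z - \<rho> *\<^sub>R (A *v y))) \<partial>lborel) + ennreal (\<rho> * a) * ennreal (unit_vol TYPE('n))"
      by (subst nn_integral_add) (auto simp: nn_integral_cmult_indicator emeasure_unit_ball)
    also have "\<dots> \<le> ennreal (1 * \<rho>) + ennreal (\<rho> * a) * ennreal (unit_vol TYPE('n))"
      using d(2)[of \<rho>] \<rho> by (intro add_right_mono) (auto simp: d'_def)
    also have "\<dots> = ennreal (\<rho> * (1 + a * unit_vol TYPE('n)))"
      using \<rho> a0(1) by (simp add: algebra_simps flip: ennreal_mult'' ennreal_plus)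
    also have "\<dots> \<le> ennreal e"
      using \<rho>(2) p by (intro ennreal_leI) (auto simp: d'_def pos_less_divide_eq)
    finally show ?thesis .
  qed
  with \<open>d' > 0\<close> show "\<exists>d>0. \<forall>\<rho>. 0 < \<rho> \<and> \<rho> < d \<longrightarrow> (\<integral>\<^sup>+y\<in>ball 0 1. ennreal (norm (u (x + \<rho> *\<^sub>R y) - z)) \<partial>lborel) \<le> ennreal e" by blast
qed

text \<open>The L^1 norm of an affine function on the unit ball controls its linear coefficients,
  whatever its constant term: pairing with the kernel isolates one coefficient. The proof applies
  \<open>avg_affine_bound\<close> to the zero function, whose affine defect is then the given
  function.\<close>

lemma ker_extract:
  fixes w :: "real^'n"
  shows "ennreal (kvar j * \<bar>w $ j\<bar>) \<le> (\<integral>\<^sup>+y\<in>ball 0 1. ennreal \<bar>c + w \<bullet> y\<bar> \<partial>lborel)"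
proof -
  have "ennreal \<bar>avg j 1 (\<lambda>_. 0) 0 - 1 * kvar j * (- w) $ j\<bar> \<le> (\<integral>\<^sup>+y\<in>ball 0 1. ennreal \<bar>0 - (- c) - 1 * ((- w) \<bullet> y)\<bar> \<partial>lborel)"
    by (rule avg_affine_bound[of "\<lambda>_. 0" 0]) auto
  then show ?thesis using kvar_pos[of j] by (simp add: avg_def abs_mult)
qed

lemma zero_if_small:
  assumes "\<And>e::real. e > 0 \<Longrightarrow> k * \<bar>a\<bar> \<le> C * e" "k > 0" "C \<ge> 0" shows "a = 0"
proof (rule ccontr)
  assume "a \<noteq> 0"
  then have p: "k * \<bar>a\<bar> > 0" using assms by simp
  have "C * (k * \<bar>a\<bar> / (2 * (C + 1))) < k * \<bar>a\<bar>"
    using p assms(3) by (simp add: field_simps) (smt (verit) mult_less_0_iff mult_nonneg_nonneg zero_less_mult_iff)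
  moreover have "k * \<bar>a\<bar> / (2 * (C + 1)) > 0" using p assms(3) by simp
  ultimately show False using assms(1) by (meson not_le)
qed

text \<open>Two affine approximations differ by an affine function that is small in L^1 relative to
  the scale, and \<open>ker_extract\<close> reads off its linear part. The base values may differ,
  as constants are invisible to the kernel.\<close>

lemma approx_affine_unique:
  fixes u :: "real^'n \<Rightarrow> real^'m"
  assumes [measurable]: "u \<in> borel_measurable borel" and A: "approx_affine u x z A" and B: "approx_affine u x z' B"
  shows "A = B"
proof -
  have "(A - B) $ i $ j = 0" for i j
  proof (rule zero_if_small)
    fix e :: real assume e: "e > 0"
    from A[unfolded approx_affine_def, rule_format, OF e] obtain d1 where d1: "d1 > 0"
      "\<And>\<rho>. 0 < \<rho> \<Longrightarrow> \<rho> < d1 \<Longrightarrow> (\<integral>\<^sup>+y\<in>ball 0 1. ennreal (norm (u (x + \<rho> *\<^sub>R y) - z - \<rho> *\<^sub>R (A *v y))) \<partial>lborel) \<le> ennreal (e * \<rho>)" by blast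
    from B[unfolded approx_affine_def, rule_format, OF e] obtain d2 where d2: "d2 > 0"
      "\<And>\<rho>. 0 < \<rho> \<Longrightarrow> \<rho> < d2 \<Longrightarrow> (\<integral>\<^sup>+y\<in>ball 0 1. ennreal (norm (u (x + \<rho> *\<^sub>R y) - z' - \<rho> *\<^sub>R (B *v y))) \<partial>lborel) \<le> ennreal (e * \<rho>)" by blast
    define \<rho> where "\<rho> = min d1 d2 / 2"
    have \<rho>: "0 < \<rho>" "\<rho> < d1" "\<rho> < d2" using d1(1) d2(1) by (auto simp: \<rho>_def)
    let ?w = "\<rho> *\<^sub>R ((A - B) $ i)"
    have "ennreal (kvar j * \<bar>?w $ j\<bar>) \<le> (\<integral>\<^sup>+y\<in>ball 0 1. ennreal \<bar>(z - z') $ i + ?w \<bullet> y\<bar> \<partial>lborel)"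
      by (rule ker_extract)
    also have "\<dots> \<le> (\<integral>\<^sup>+y. ennreal (norm (u (x + \<rho> *\<^sub>R y) - z - \<rho> *\<^sub>R (A *v y))) * indicator (ball 0 1) y
        + ennreal (norm (u (x + \<rho> *\<^sub>R y) - z' - \<rho> *\<^sub>R (B *v y))) * indicator (ball 0 1) y \<partial>lborel)"
    proof (intro nn_integral_mono)
      fix y :: "real^'n"
      have "(z - z') $ i + ?w \<bullet> y = (z - z' + \<rho> *\<^sub>R (A *v y) - \<rho> *\<^sub>R (B *v y)) $ i"
        by (simp add: matrix_vector_mult_def inner_vec_def algebra_simps sum_subtractf sum_distrib_left)
      also have "\<bar>\<dots>\<bar> \<le> norm (z - z' + \<rho> *\<^sub>R (A *v y) - \<rho> *\<^sub>R (B *v y))" by (rule component_le_norm_cart)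
      also have "\<dots> \<le> norm (u (x + \<rho> *\<^sub>R y) - z - \<rho> *\<^sub>R (A *v y)) + norm (u (x + \<rho> *\<^sub>R y) - z' - \<rho> *\<^sub>R (B *v y))"
        using norm_triangle_ineq4[of "u (x + \<rho> *\<^sub>R y) - z' - \<rho> *\<^sub>R (B *v y)" "u (x + \<rho> *\<^sub>R y) - z - \<rho> *\<^sub>R (A *v y)"]
        by (simp add: algebra_simps)
      finally show "ennreal \<bar>(z - z') $ i + ?w \<bullet> y\<bar> * indicator (ball 0 1) y \<le> ennreal (norm (u (x + \<rho> *\<^sub>R y) - z - \<rho> *\<^sub>R (A *v y))) * indicator (ball 0 1) y
        + ennreal (norm (u (x + \<rho> *\<^sub>R y) - z' - \<rho> *\<^sub>R (B *v y))) * indicator (ball 0 1) y"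
        by (cases "y \<in> ball 0 1") (auto simp flip: ennreal_plus intro!: ennreal_leI)
    qed
    also have "\<dots> = (\<integral>\<^sup>+y\<in>ball 0 1. ennreal (norm (u (x + \<rho> *\<^sub>R y) - z - \<rho> *\<^sub>R (A *v y))) \<partial>lborel) +
       (\<integral>\<^sup>+y\<in>ball 0 1. ennreal (norm (u (x + \<rho> *\<^sub>R y) - z' - \<rho> *\<^sub>R (B *v y))) \<partial>lborel)"
      by (rule nn_integral_add) measurable
    also have "\<dots> \<le> ennreal (e * \<rho>) + ennreal (e * \<rho>)" by (intro add_mono d1 d2 \<rho>)
    also have "\<dots> = ennreal (2 * e * \<rho>)" using e \<rho> by (simp flip: ennreal_plus)
    finally have "kvar j * \<bar>?w $ j\<bar> \<le> 2 * e * \<rho>" using e \<rho> by (simp add: ennreal_le_iff)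
    then have "\<rho> * (kvar j * \<bar>(A - B) $ i $ j\<bar>) \<le> \<rho> * (2 * e)" using \<rho>(1) by (simp add: abs_mult ac_simps)
    then show "kvar j * \<bar>(A - B) $ i $ j\<bar> \<le> 2 * e" using \<rho>(1) by simp
  qed (use kvar_pos[of j] in auto)
  then have "A - B = 0" by (simp add: vec_eq_iff)
  then show ?thesis by simp
qed

lemma approx_affine_imp_gradient:
  fixes u :: "real^'n \<Rightarrow> real^'m"
  assumes u: "u \<in> borel_measurable borel" and A: "approx_affine u x z A"
  shows "approx_gradient u x = A"
proof -
  have 1: "has_approx_gradient u A x"
    using has_approx_gradient_iff[OF u] approx_affine_imp_limit[OF u A] A by blast
  have 2: "B = A" if "has_approx_gradient u B x" for B
    using that has_approx_gradient_iff[OF u] approx_affine_unique[OF u _ A] by blast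
  have "(THE A. has_approx_gradient u A x) = A" using 1 2 by (rule the_equality)
  then show ?thesis unfolding approx_gradient_def using 1 by auto
qed

text \<open>All notions are limits of integrals over shrinking balls, hence local and insensitive to
  null sets. This carries results from a Borel representative back to the given map.\<close>

lemma approx_cong:
  fixes u u' :: "real^'n \<Rightarrow> real^'m"
  assumes S: "open S" "x \<in> S" and eq: "AE y in lebesgue. y \<in> S \<longrightarrow> u y = u' y"
  shows "approx_limit u x z \<longleftrightarrow> approx_limit u' x z" "has_approx_gradient u A x \<longleftrightarrow> has_approx_gradient u' A x"
    "approx_gradient u x = approx_gradient u' x"
proof -
  obtain r where r: "r > 0" "ball x r \<subseteq> S" using S open_contains_ball by blast
  have int: "(\<integral>\<^sup>+y\<in>ball x \<rho>. F \<rho> y (u y) \<partial>lebesgue) = (\<integral>\<^sup>+y\<in>ball x \<rho>. F \<rho> y (u' y) \<partial>lebesgue)" if "\<rho> < r" for F \<rho>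
  proof (rule nn_integral_cong_AE, use eq in eventually_elim)
    fix y assume "y \<in> S \<longrightarrow> u y = u' y"
    moreover have "y \<in> S" if "y \<in> ball x \<rho>" using that r(2) \<open>\<rho> < r\<close> by auto
    ultimately show "F \<rho> y (u y) * indicator (ball x \<rho>) y = F \<rho> y (u' y) * indicator (ball x \<rho>) y"
      by (cases "y \<in> ball x \<rho>") auto
  qed
  have lim: "((\<lambda>\<rho>. (\<integral>\<^sup>+y\<in>ball x \<rho>. F \<rho> y (u y) \<partial>lebesgue) / emeasure lebesgue (ball x \<rho>)) \<longlongrightarrow> 0) (at_right 0) \<longleftrightarrow>
    ((\<lambda>\<rho>. (\<integral>\<^sup>+y\<in>ball x \<rho>. F \<rho> y (u' y) \<partial>lebesgue) / emeasure lebesgue (ball x \<rho>)) \<longlongrightarrow> 0) (at_right 0)" for F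
  proof (rule filterlim_cong[OF refl refl])
    show "\<forall>\<^sub>F \<rho> in at_right 0. (\<integral>\<^sup>+y\<in>ball x \<rho>. F \<rho> y (u y) \<partial>lebesgue) / emeasure lebesgue (ball x \<rho>) = (\<integral>\<^sup>+y\<in>ball x \<rho>. F \<rho> y (u' y) \<partial>lebesgue) / emeasure lebesgue (ball x \<rho>)"
      unfolding eventually_at_right_field using r(1) int by (intro exI[of _ r]) auto
  qed
  show l: "approx_limit u x z \<longleftrightarrow> approx_limit u' x z" for z
    unfolding approx_limit_def by (rule lim)
  show g: "has_approx_gradient u A x \<longleftrightarrow> has_approx_gradient u' A x" for A
    unfolding has_approx_gradient_def l using lim[of "\<lambda>\<rho> y w. ennreal (norm (w - _ - A *v (y - x)) / \<rho>)"] by simp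
  show "approx_gradient u x = approx_gradient u' x"
    unfolding approx_gradient_def g ..
qed

section \<open>Boundary layers of the unit ball\<close>

text \<open>A tube of width \<open>D\<close> around a radius of the unit ball is covered by about
  1/D balls of radius 2D, so its volume is of order D^{d-1}. That is the order of the Hausdorff
  weight of a set of diameter \<open>D\<close>, which \<open>cone_null\<close> exploits.\<close>

lemma tube_volume:
  fixes c :: "real^'n"
  assumes c: "norm c = 1" and D: "0 < D" "D \<le> 1" and d: "CARD('n) \<ge> 2"
  obtains T where "T \<in> sets borel" "{z \<in> ball 0 1. norm (z - norm z *\<^sub>R c) \<le> D} \<subseteq> T"
    "emeasure lborel T \<le> ennreal (2 * 2 ^ CARD('n) * unit_ball_vol (real CARD('n)) * D ^ (CARD('n) - 1))"
proof
  define N where "N = nat \<lfloor>1 / D\<rfloor>"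
  let ?T = "\<Union>k\<in>{..N}. cball ((real k * D) *\<^sub>R c) (2 * D)"
  show "?T \<in> sets borel" by (intro sets.finite_UN) auto
  show "{z \<in> ball 0 1. norm (z - norm z *\<^sub>R c) \<le> D} \<subseteq> ?T"
  proof
    fix z assume z: "z \<in> {z \<in> ball 0 1. norm (z - norm z *\<^sub>R c) \<le> D}"
    \<comment> \<open>The index of the centre just below the height |z| on the ray; rounding down
      costs at most \<open>D\<close>, the distance to the ray at most another
      \<open>D\<close>.\<close>
    define k where "k = nat \<lfloor>norm z / D\<rfloor>"
    have fl: "real k = of_int \<lfloor>norm z / D\<rfloor>" using D by (simp add: k_def)
    have k1: "real k \<le> norm z / D" "norm z / D < real k + 1" unfolding fl by linarith+
    have k2: "real k * D \<le> norm z" "norm z \<le> real k * D + D"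
      using k1 D by (simp_all add: field_simps)
    have "norm z / D \<le> 1 / D" using z D by (intro divide_right_mono) auto
    then have "k \<le> N" unfolding k_def N_def by (intro nat_mono floor_mono)
    have "norm (norm z *\<^sub>R c - (real k * D) *\<^sub>R c) \<le> D"
      using k2 c by (simp flip: scaleR_left_diff_distrib)
    then have "norm (z - (real k * D) *\<^sub>R c) \<le> 2 * D"
      using z norm_triangle_ineq[of "z - norm z *\<^sub>R c" "norm z *\<^sub>R c - (real k * D) *\<^sub>R c"] by simp
    then show "z \<in> ?T" using \<open>k \<le> N\<close> by (auto simp: dist_norm norm_minus_commute)
  qed
  have "real N \<le> 1 / D" using D by (simp add: N_def)
  moreover have "1 \<le> 1 / D" using D by simp
  ultimately have N: "real N + 1 \<le> 2 / D" by simp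
  have "emeasure lborel ?T \<le> (\<Sum>k\<le>N. emeasure lborel (cball ((real k * D) *\<^sub>R c) (2 * D)))"
    by (rule emeasure_subadditive_finite) auto
  also have "\<dots> = (\<Sum>k\<le>N. ennreal (unit_ball_vol (real CARD('n)) * (2 * D) ^ CARD('n)))"
    using D by (simp add: emeasure_cball)
  also have "\<dots> = ennreal ((real N + 1) * (unit_ball_vol (real CARD('n)) * (2 * D) ^ CARD('n)))"
    using D by (subst sum_ennreal) (auto simp: algebra_simps)
  also have "\<dots> \<le> ennreal (2 / D * (unit_ball_vol (real CARD('n)) * (2 * D) ^ CARD('n)))"
    using D N by (intro ennreal_leI mult_right_mono) auto
  also have "2 / D * (unit_ball_vol (real CARD('n)) * (2 * D) ^ CARD('n)) = 2 * 2 ^ CARD('n) * unit_ball_vol (real CARD('n)) * D ^ (CARD('n) - 1)"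
    using D d by (cases "CARD('n)") (auto simp: power_mult_distrib field_simps)
  finally show "emeasure lborel ?T \<le> ennreal (2 * 2 ^ CARD('n) * unit_ball_vol (real CARD('n)) * D ^ (CARD('n) - 1))" .
qed

text \<open>A covering set of diameter \<open>D\<close> of a part of \<open>E\<close> yields a tube
  of width \<open>D\<close> around one ray, and the volume of the tube is at most a constant times
  the Hausdorff weight. Sets negligible on the sphere thus become sets of directions negligible in
  the ball, and integrals over the ball can replace surface integrals.\<close>

lemma cone_null:
  fixes E :: "(real^'n) set"
  assumes d: "CARD('n) \<ge> 2" and E: "E \<subseteq> sphere 0 1" "hausdorff_measure (CARD('n) - 1) E = 0"
  shows "AE z in lborel. z \<in> ball 0 1 \<and> z \<noteq> 0 \<longrightarrow> z /\<^sub>R norm z \<notin> E"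
proof -
  define s where "s = CARD('n) - 1"
  have s: "s > 0" using d by (simp add: s_def)
  \<comment> \<open>\<open>K\<close> is the constant of \<open>tube_volume\<close>, and
    \<open>L\<close> turns D^{d-1} into the Hausdorff weight; \<open>\<eta>\<close> below is
    \<open>e\<close> converted by their ratio.\<close>
  define K where "K = 2 * 2 ^ CARD('n) * unit_ball_vol (real CARD('n))"
  define L where "L = unit_ball_vol (real s) / 2 ^ s"
  have K: "K > 0" and L: "L > 0" by (auto simp: K_def L_def)
  have "hausdorff_content s 1 E \<le> hausdorff_measure s E"
    unfolding hausdorff_measure_def by (rule SUP_upper) simp
  then have content: "hausdorff_content s 1 E = 0" using E(2) by (simp add: s_def)
  define Z where "Z = {z \<in> ball 0 1. z \<noteq> 0 \<and> z /\<^sub>R norm z \<in> E}"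
  have "negligible Z"
    unfolding negligible_outer_le
  proof (intro allI impI)
    fix e :: real assume e: "e > 0"
    define \<eta> where "\<eta> = e * L / K"
    have \<eta>: "\<eta> > 0" using e K L by (simp add: \<eta>_def)
    have "hausdorff_content s 1 E < ennreal \<eta>" using content \<eta> by simp
    then obtain C :: "nat \<Rightarrow> (real^'n) set" where C: "E \<subseteq> (\<Union>i. C i)" "\<And>i. bounded (C i)" "\<And>i. diameter (C i) \<le> 1"
      and sum: "(\<Sum>i. hausdorff_weight s (C i)) < ennreal \<eta>"
      unfolding hausdorff_content_def INF_less_iff by auto
    have "\<exists>T. T \<in> sets borel \<and> {z \<in> Z. z /\<^sub>R norm z \<in> C i} \<subseteq> T \<and> emeasure lborel T \<le> ennreal (K / L) * hausdorff_weight s (C i)" for i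
    proof (cases "C i \<inter> E = {}")
      case True
      then show ?thesis by (intro exI[of _ "{}"]) (auto simp: Z_def)
    next
      case False
      then obtain c where c: "c \<in> C i" "c \<in> E" by auto
      then have nc: "norm c = 1" using E(1) by auto
      define D where "D = diameter (C i)"
      have D: "0 \<le> D" "D \<le> 1" using C(2,3)[of i] by (auto simp: D_def diameter_ge_0)
      have near: "norm (z - norm z *\<^sub>R c) \<le> D" if "z \<in> Z" "z /\<^sub>R norm z \<in> C i" for z
      proof -
        have "dist (z /\<^sub>R norm z) c \<le> D" unfolding D_def
          by (rule diameter_bounded_bound[OF C(2) that(2) c(1)])
        moreover have "norm (z - norm z *\<^sub>R c) = norm z * dist (z /\<^sub>R norm z) c"
        proof -
          have "z - norm z *\<^sub>R c = norm z *\<^sub>R (z /\<^sub>R norm z - c)" using that(1) by (simp add: Z_def scaleR_diff_right)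
          then show ?thesis by (simp add: dist_norm)
        qed
        moreover have "norm z \<le> 1" using that(1) by (simp add: Z_def)
        ultimately show ?thesis using mult_mono[of "norm z" 1 "dist (z /\<^sub>R norm z) c" D] by simp
      qed
      have w: "ennreal (K / L) * hausdorff_weight s (C i) = ennreal (K * D ^ s)"
        using c(1) L K D unit_ball_vol_pos[of "real s", THEN less_imp_neq, THEN not_sym] by (auto simp: hausdorff_weight_def D_def[symmetric] L_def power_divide simp flip: ennreal_mult'')
      show ?thesis
      \<comment> \<open>Covering sets may be single points. The tube is then a piece of a line,
        which is null since d >= 2, and \<open>tube_volume\<close> does not apply to it.\<close>
      proof (cases "D = 0")
        case True
        have "dim (span {c}) < DIM(real^'n)" using dim_le_card'[of "{c}"] d by (simp add: dim_span)
        then have "negligible (span {c})" by (rule negligible_lowdim)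
        then have "emeasure lborel (span {c}) = 0"
          by (simp add: negligible_iff_emeasure0 emeasure_completion)
        moreover have "{z \<in> Z. z /\<^sub>R norm z \<in> C i} \<subseteq> span {c}"
        proof safe
          fix z assume "z \<in> Z" "z /\<^sub>R norm z \<in> C i"
          from near[OF this] True have "z = norm z *\<^sub>R c" by simp
          then show "z \<in> span {c}" by (metis span_base span_scale singletonI)
        qed
        ultimately show ?thesis by (intro exI[of _ "span {c}"]) (auto intro: borel_closed closed_span)
      next
        case False
        then have "0 < D" using D by simp
        from tube_volume[OF nc this D(2) d] obtain T where T: "T \<in> sets borel" "{z \<in> ball 0 1. norm (z - norm z *\<^sub>R c) \<le> D} \<subseteq> T"
          "emeasure lborel T \<le> ennreal (K * D ^ s)" unfolding K_def s_def by blast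
        moreover have "{z \<in> Z. z /\<^sub>R norm z \<in> C i} \<subseteq> {z \<in> ball 0 1. norm (z - norm z *\<^sub>R c) \<le> D}"
          using near by (auto simp: Z_def)
        ultimately show ?thesis unfolding w by blast
      qed
    qed
    then have "\<forall>i. \<exists>T. T \<in> sets borel \<and> {z \<in> Z. z /\<^sub>R norm z \<in> C i} \<subseteq> T \<and> emeasure lborel T \<le> ennreal (K / L) * hausdorff_weight s (C i)" by (rule allI)
    from choice[OF this] obtain T where T': "\<forall>i. T i \<in> sets borel \<and> {z \<in> Z. z /\<^sub>R norm z \<in> C i} \<subseteq> T i
        \<and> emeasure lborel (T i) \<le> ennreal (K / L) * hausdorff_weight s (C i)" by (rule exE)
    have T: "T i \<in> sets borel" "{z \<in> Z. z /\<^sub>R norm z \<in> C i} \<subseteq> T i"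
      "emeasure lborel (T i) \<le> ennreal (K / L) * hausdorff_weight s (C i)" for i
      using T'[rule_format, of i] by blast+
    have sub: "Z \<subseteq> (\<Union>i. T i)"
    proof
      fix z assume z: "z \<in> Z"
      then have "z /\<^sub>R norm z \<in> E" by (simp add: Z_def)
      then obtain i where "z /\<^sub>R norm z \<in> C i" using C(1) by blast
      then show "z \<in> (\<Union>i. T i)" using z T(2)[of i] by blast
    qed
    have "emeasure lborel (\<Union>i. T i) \<le> (\<Sum>i. emeasure lborel (T i))"
      using T(1) by (intro emeasure_subadditive_countably) auto
    also have "\<dots> \<le> (\<Sum>i. ennreal (K / L) * hausdorff_weight s (C i))"
      using T(3) by (intro suminf_le) auto
    also have "\<dots> = ennreal (K / L) * (\<Sum>i. hausdorff_weight s (C i))" by simp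
    also have "\<dots> \<le> ennreal (K / L) * ennreal \<eta>" using sum by (intro mult_left_mono) auto
    also have "\<dots> = ennreal e" using e K L by (simp add: \<eta>_def flip: ennreal_mult'')
    finally have le: "emeasure lborel (\<Union>i. T i) \<le> ennreal e" .
    have meas: "(\<Union>i. T i) \<in> sets borel" using T(1) by auto
    have "emeasure lebesgue (\<Union>i. T i) \<le> ennreal e" using le meas by simp
    then have "(\<Union>i. T i) \<in> lmeasurable" 
      using meas by (intro fmeasurableI) (auto intro: le_less_trans)
    moreover have "measure lebesgue (\<Union>i. T i) \<le> e"
      using \<open>emeasure lebesgue (\<Union>i. T i) \<le> ennreal e\<close> e unfolding measure_def by (intro enn2real_leI) auto
    ultimately show "\<exists>T. Z \<subseteq> T \<and> T \<in> lmeasurable \<and> measure lebesgue T \<le> e" using sub by blast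
  qed
  then have "AE z in lborel. z \<notin> Z"
    using AE_not_in[of Z lebesgue] by (simp add: negligible_iff_null_sets AE_completion_iff)
  then show ?thesis by eventually_elim (auto simp: Z_def)
qed

section \<open>Integrals over thin spherical layers\<close>

definition layer :: "real \<Rightarrow> (real^'n) set" where
  "layer \<epsilon> = {y. 1 - \<epsilon> < norm y \<and> norm y < 1}"

lemma layer_measurable[measurable]: "layer \<epsilon> \<in> sets borel"
  unfolding layer_def by measurable

text \<open>For a function of the direction alone, the integral over the ball of radius 1 -
  \<epsilon> is (1 - \<epsilon>)^d times that over the unit ball, so the layer holds the fraction 1
  - (1 - \<epsilon>)^d, at most d\<epsilon> by Bernoulli.\<close>

lemma layer_homogeneous:
  fixes h :: "real^'n \<Rightarrow> ennreal"
  assumes [measurable]: "h \<in> borel_measurable borel" and hom: "\<And>t z. t > 0 \<Longrightarrow> h (t *\<^sub>R z) = h z"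
    and fin: "(\<integral>\<^sup>+z\<in>ball 0 1. h z \<partial>lborel) < \<infinity>" and \<epsilon>: "0 < \<epsilon>" "\<epsilon> < 1"
  shows "(\<integral>\<^sup>+z\<in>layer \<epsilon>. h z \<partial>lborel) \<le> ennreal (real CARD('n) * \<epsilon>) * (\<integral>\<^sup>+z\<in>ball 0 1. h z \<partial>lborel)"
proof -
  obtain H where H: "H \<ge> 0" "(\<integral>\<^sup>+z\<in>ball 0 1. h z \<partial>lborel) = ennreal H"
    using fin by (cases "(\<integral>\<^sup>+z\<in>ball 0 1. h z \<partial>lborel)") auto
  have t: "1 - \<epsilon> > 0" using \<epsilon> by simp
  have "(\<integral>\<^sup>+z\<in>ball 0 (1 - \<epsilon>). h z \<partial>lborel) = ennreal ((1 - \<epsilon>) ^ CARD('n)) * (\<integral>\<^sup>+z. h ((1 - \<epsilon>) *\<^sub>R z) * indicator (ball 0 (1 - \<epsilon>)) ((1 - \<epsilon>) *\<^sub>R z) \<partial>lborel)"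
    using nn_integral_affine[of "\<lambda>z. h z * indicator (ball 0 (1 - \<epsilon>)) z" "1 - \<epsilon>" 0] t by simp
  also have "(\<integral>\<^sup>+z. h ((1 - \<epsilon>) *\<^sub>R z) * indicator (ball 0 (1 - \<epsilon>)) ((1 - \<epsilon>) *\<^sub>R z) \<partial>lborel) = (\<integral>\<^sup>+z\<in>ball 0 1. h z \<partial>lborel)"
    using t by (intro nn_integral_cong) (auto simp: indicator_def hom mult_less_cancel_left1 mult_less_cancel_left2)
  finally have inner: "(\<integral>\<^sup>+z\<in>ball 0 (1 - \<epsilon>). h z \<partial>lborel) = ennreal ((1 - \<epsilon>) ^ CARD('n) * H)"
    using H t by (simp add: ennreal_mult'')
  have "(\<integral>\<^sup>+z\<in>layer \<epsilon>. h z \<partial>lborel) + (\<integral>\<^sup>+z\<in>ball 0 (1 - \<epsilon>). h z \<partial>lborel) 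
     = (\<integral>\<^sup>+z. h z * indicator (layer \<epsilon>) z + h z * indicator (ball 0 (1 - \<epsilon>)) z \<partial>lborel)"
    by (subst nn_integral_add) auto
  also have "\<dots> \<le> (\<integral>\<^sup>+z\<in>ball 0 1. h z \<partial>lborel)"
    using \<epsilon> by (intro nn_integral_mono) (auto simp: indicator_def layer_def)
  finally have le: "(\<integral>\<^sup>+z\<in>layer \<epsilon>. h z \<partial>lborel) + ennreal ((1 - \<epsilon>) ^ CARD('n) * H) \<le> ennreal H"
    unfolding inner H(2) .
  then have "(\<integral>\<^sup>+z\<in>layer \<epsilon>. h z \<partial>lborel) < \<infinity>" by (auto simp: less_top[symmetric] top_unique)
  then obtain l where l: "l \<ge> 0" "(\<integral>\<^sup>+z\<in>layer \<epsilon>. h z \<partial>lborel) = ennreal l"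
    by (cases "(\<integral>\<^sup>+z\<in>layer \<epsilon>. h z \<partial>lborel)") auto
  have "l + (1 - \<epsilon>) ^ CARD('n) * H \<le> H" using le l H t by (simp flip: ennreal_plus)
  moreover have "1 + real CARD('n) * (- \<epsilon>) \<le> (1 + (- \<epsilon>)) ^ CARD('n)" using \<epsilon> by (intro Bernoulli_inequality) auto
  then have "(1 - real CARD('n) * \<epsilon>) * H \<le> (1 - \<epsilon>) ^ CARD('n) * H" using H by (intro mult_right_mono) auto
  ultimately have "l \<le> real CARD('n) * \<epsilon> * H" by (simp add: algebra_simps)
  then show ?thesis using l H \<epsilon> by (simp add: ennreal_leI flip: ennreal_mult'')
qed

text \<open>Every point of the layer is within 2\<epsilon> of the radial projection of each
  \<open>z\<close> in a ball of radius \<epsilon>/2 inside the layer. Exchanging the integrals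
  counts each \<open>y\<close> with at least this volume.\<close>

lemma layer_average:
  fixes w :: "real^'n \<Rightarrow> ennreal"
  assumes [measurable]: "w \<in> borel_measurable borel" and \<epsilon>: "0 < \<epsilon>" "\<epsilon> < 1"
  shows "(\<integral>\<^sup>+y\<in>layer \<epsilon>. w y \<partial>lborel) * ennreal (unit_ball_vol (real CARD('n)) * (\<epsilon> / 2) ^ CARD('n)) \<le>
    (\<integral>\<^sup>+z\<in>layer \<epsilon>. (\<integral>\<^sup>+y\<in>ball (z /\<^sub>R norm z) (2 * \<epsilon>). w y \<partial>lborel) \<partial>lborel)"
proof -
  let ?c = "ennreal (unit_ball_vol (real CARD('n)) * (\<epsilon> / 2) ^ CARD('n))"
  \<comment> \<open>Written through the distance, the indicator is measurable jointly in the centre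
    and the point, as Fubini requires.\<close>
  have ind: "indicator (ball a \<rho>) y = (indicator {..<\<rho>} (dist a y) :: ennreal)" for a y :: "real^'n" and \<rho>
    by (simp add: indicator_def)
  have c: "?c \<le> (\<integral>\<^sup>+z\<in>layer \<epsilon>. indicator {..<2 * \<epsilon>} (dist (z /\<^sub>R norm z) y) \<partial>lborel)" if y: "y \<in> layer \<epsilon>" for y :: "real^'n"
  proof -
    have y1: "norm y \<noteq> 0" "1 - \<epsilon> < norm y" "norm y < 1" using y \<epsilon> by (auto simp: layer_def)
    \<comment> \<open>The point on the ray of \<open>y\<close> at the middle of the layer: the ball
      of radius \<epsilon>/2 about it stays in the layer, and \<open>y\<close> is at distance at
      most \<epsilon>/2.\<close>
    define a where "a = (1 - \<epsilon> / 2) *\<^sub>R (y /\<^sub>R norm y)"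
    have na: "norm a = 1 - \<epsilon> / 2" using y1 \<epsilon> by (simp add: a_def)
    have ya: "norm (a - y) \<le> \<epsilon> / 2"
    proof -
      have "a - y = (1 - \<epsilon> / 2 - norm y) *\<^sub>R (y /\<^sub>R norm y)"
        using y1 by (simp add: a_def algebra_simps)
      then have "norm (a - y) = \<bar>1 - \<epsilon> / 2 - norm y\<bar>" using y1 by (simp add: abs_mult)
      then show ?thesis using y1 by linarith
    qed
    have z: "z \<in> layer \<epsilon> \<and> dist (z /\<^sub>R norm z) y < 2 * \<epsilon>" if "z \<in> ball a (\<epsilon> / 2)" for z
    proof -
      have az: "norm (z - a) < \<epsilon> / 2" using that by (simp add: dist_norm norm_minus_commute)
      have "\<bar>norm z - norm a\<bar> \<le> norm (z - a)" by (rule norm_triangle_ineq3)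
      then have nz: "1 - \<epsilon> < norm z" "norm z < 1" using az na by linarith+
      then have "norm z \<noteq> 0" using \<epsilon> by linarith
      have "z /\<^sub>R norm z - z = (1 - norm z) *\<^sub>R (z /\<^sub>R norm z)" using \<open>norm z \<noteq> 0\<close> by (simp add: algebra_simps)
      then have "norm (z /\<^sub>R norm z - z) = 1 - norm z" using nz \<open>norm z \<noteq> 0\<close> by (simp add: abs_mult)
      moreover have "norm (z - y) \<le> norm (z - a) + norm (a - y)" using norm_triangle_ineq[of "z - a" "a - y"] by simp
      moreover have "norm (z /\<^sub>R norm z - y) \<le> norm (z /\<^sub>R norm z - z) + norm (z - y)"
        using norm_triangle_ineq[of "z /\<^sub>R norm z - z" "z - y"] by simp
      ultimately have "norm (z /\<^sub>R norm z - y) < 2 * \<epsilon>" using az ya nz by linarith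
      then show ?thesis using nz by (simp add: layer_def dist_norm)
    qed
    have "?c = (\<integral>\<^sup>+z. indicator (ball a (\<epsilon> / 2)) z \<partial>lborel)"
      using \<epsilon> by (simp add: emeasure_ball)
    also have "\<dots> \<le> (\<integral>\<^sup>+z\<in>layer \<epsilon>. indicator {..<2 * \<epsilon>} (dist (z /\<^sub>R norm z) y) \<partial>lborel)"
      using z by (intro nn_integral_mono) (auto simp: indicator_def)
    finally show ?thesis .
  qed
  have "(\<integral>\<^sup>+y\<in>layer \<epsilon>. w y \<partial>lborel) * ?c = (\<integral>\<^sup>+y. w y * indicator (layer \<epsilon>) y * ?c \<partial>lborel)"
    by (rule nn_integral_multc[symmetric]) measurable
  also have "\<dots> \<le> (\<integral>\<^sup>+y. \<integral>\<^sup>+z. w y * indicator {..<2 * \<epsilon>} (dist (z /\<^sub>R norm z) y) * indicator (layer \<epsilon>) z \<partial>lborel \<partial>lborel)"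
  proof (intro nn_integral_mono)
    fix y :: "real^'n"
    have "(\<integral>\<^sup>+z. w y * indicator {..<2 * \<epsilon>} (dist (z /\<^sub>R norm z) y) * indicator (layer \<epsilon>) z \<partial>lborel) = 
       w y * (\<integral>\<^sup>+z\<in>layer \<epsilon>. indicator {..<2 * \<epsilon>} (dist (z /\<^sub>R norm z) y) \<partial>lborel)"
      unfolding mult.assoc by (rule nn_integral_cmult) measurable
    then show "w y * indicator (layer \<epsilon>) y * ?c \<le> (\<integral>\<^sup>+z. w y * indicator {..<2 * \<epsilon>} (dist (z /\<^sub>R norm z) y) * indicator (layer \<epsilon>) z \<partial>lborel)"
      using mult_left_mono[OF c, of y "w y"] by (cases "y \<in> layer \<epsilon>") auto
  qed
  also have "\<dots> = (\<integral>\<^sup>+z. \<integral>\<^sup>+y. w y * indicator {..<2 * \<epsilon>} (dist (z /\<^sub>R norm z) y) * indicator (layer \<epsilon>) z \<partial>lborel \<partial>lborel)"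
    by (rule lborel_pair.Fubini') measurable
  also have "\<dots> = (\<integral>\<^sup>+z\<in>layer \<epsilon>. (\<integral>\<^sup>+y\<in>ball (z /\<^sub>R norm z) (2 * \<epsilon>). w y \<partial>lborel) \<partial>lborel)"
    unfolding ind by (intro nn_integral_cong nn_integral_multc) measurable
  finally show ?thesis .
qed

text \<open>A pointwise statement about boundary values becomes the integral statement o(\<epsilon>)
  on layers. By \<open>layer_average\<close> the layer integral is controlled by local means about
  boundary points; these depend only on the direction, so \<open>layer_homogeneous\<close> extracts
  a factor \<epsilon>, and dominated convergence makes the remaining integral over the ball
  small.\<close>

lemma layer_vanish:
  fixes w :: "real^'n \<Rightarrow> ennreal"
  assumes [measurable]: "w \<in> borel_measurable borel" and M: "\<And>y. w y \<le> ennreal M" "M \<ge> 0"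
    and tr: "AE z in lborel. z \<in> ball 0 1 \<longrightarrow> (\<forall>e>0. \<exists>\<delta>>0. \<forall>\<rho>. 0 < \<rho> \<and> \<rho> < \<delta> \<longrightarrow>
       (\<integral>\<^sup>+y\<in>ball (z /\<^sub>R norm z) \<rho>. w y \<partial>lborel) \<le> ennreal (e * \<rho> ^ CARD('n)))"
    and \<epsilon>: "\<And>k. 0 < \<epsilon> k" "\<And>k. \<epsilon> k < 1" "\<epsilon> \<longlonglongrightarrow> 0" and e: "e > 0"
  shows "eventually (\<lambda>k. (\<integral>\<^sup>+y\<in>layer (\<epsilon> k). w y \<partial>lborel) \<le> ennreal (e * \<epsilon> k)) sequentially"
proof -
  define v where "v = unit_ball_vol (real CARD('n))"
  have v: "v > 0" by (simp add: v_def)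
  define b where "b k z = (\<integral>\<^sup>+y\<in>ball (z /\<^sub>R norm z) (2 * \<epsilon> k). w y \<partial>lborel) * ennreal (1 / (2 * \<epsilon> k) ^ CARD('n))" for k and z :: "real^'n"
  have ind: "indicator (ball a \<rho>) y = (indicator {..<\<rho>} (dist a y) :: ennreal)" for a y :: "real^'n" and \<rho>
    by (simp add: indicator_def)
  have bm[measurable]: "b k \<in> borel_measurable borel" for k
    unfolding b_def ind by measurable
  have bM: "b k z \<le> ennreal (M * v)" for k z
  proof -
    have "(\<integral>\<^sup>+y\<in>ball (z /\<^sub>R norm z) (2 * \<epsilon> k). w y \<partial>lborel) \<le> (\<integral>\<^sup>+y. ennreal M * indicator (ball (z /\<^sub>R norm z) (2 * \<epsilon> k)) y \<partial>lborel)"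
      by (intro nn_integral_mono mult_right_mono M) simp
    also have "\<dots> = ennreal M * ennreal (v * (2 * \<epsilon> k) ^ CARD('n))"
      using \<epsilon>(1)[of k] by (simp add: nn_integral_cmult_indicator emeasure_ball v_def)
    finally have "b k z \<le> ennreal M * ennreal (v * (2 * \<epsilon> k) ^ CARD('n)) * ennreal (1 / (2 * \<epsilon> k) ^ CARD('n))"
      unfolding b_def by (rule mult_right_mono) simp
    also have "\<dots> = ennreal (M * v)"
      using \<epsilon>(1)[of k] v M by (simp flip: ennreal_mult'')
    finally show ?thesis .
  qed
  have "(\<lambda>k. \<integral>\<^sup>+z\<in>ball 0 1. b k z \<partial>lborel) \<longlonglongrightarrow> (\<integral>\<^sup>+z. 0 \<partial>(lborel :: (real^'n) measure))"
  proof (rule nn_integral_dominated_convergence[where w = "\<lambda>z. ennreal (M * v) * indicator (ball 0 1) z"])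
    show "AE z in lborel. b k z * indicator (ball 0 1) z \<le> ennreal (M * v) * indicator (ball 0 1) z" for k
      by (intro AE_I2 mult_right_mono bM) simp
    show "(\<integral>\<^sup>+z. ennreal (M * v) * indicator (ball (0::real^'n) 1) z \<partial>lborel) < \<infinity>"
      by (simp add: nn_integral_cmult_indicator emeasure_unit_ball ennreal_mult_less_top)
    show "AE z in lborel. (\<lambda>k. b k z * indicator (ball 0 1) z) \<longlonglongrightarrow> 0"
      using tr
    proof eventually_elim
      fix z :: "real^'n" 
      assume z: "z \<in> ball 0 1 \<longrightarrow> (\<forall>e>0. \<exists>\<delta>>0. \<forall>\<rho>. 0 < \<rho> \<and> \<rho> < \<delta> \<longrightarrow>
       (\<integral>\<^sup>+y\<in>ball (z /\<^sub>R norm z) \<rho>. w y \<partial>lborel) \<le> ennreal (e * \<rho> ^ CARD('n)))"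
      show "(\<lambda>k. b k z * indicator (ball 0 1) z) \<longlonglongrightarrow> 0"
      proof (cases "z \<in> ball 0 1")
        case True
        have "(\<lambda>k. b k z) \<longlonglongrightarrow> 0"
        proof (rule order_tendstoI)
          fix a :: ennreal assume a: "0 < a"
          obtain e where e: "e > 0" "ennreal e < a"
          proof (cases a)
            case (real r)
            then show ?thesis using a that[of "r / 2"] by (auto simp: ennreal_less_iff)
          qed (use that[of 1] in auto)
          from z True e(1) obtain \<delta> where \<delta>: "\<delta> > 0" "\<And>\<rho>. 0 < \<rho> \<Longrightarrow> \<rho> < \<delta> \<Longrightarrow> 
             (\<integral>\<^sup>+y\<in>ball (z /\<^sub>R norm z) \<rho>. w y \<partial>lborel) \<le> ennreal (e * \<rho> ^ CARD('n))" by blast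
          have "eventually (\<lambda>k. \<epsilon> k < \<delta> / 2) sequentially" using \<delta>(1) by (intro order_tendstoD(2)[OF \<epsilon>(3)]) simp
          then show "eventually (\<lambda>k. b k z < a) sequentially"
          proof eventually_elim
            case (elim k)
            have "b k z \<le> ennreal (e * (2 * \<epsilon> k) ^ CARD('n)) * ennreal (1 / (2 * \<epsilon> k) ^ CARD('n))"
              unfolding b_def using elim \<epsilon>(1)[of k] by (intro mult_right_mono \<delta>) auto
            also have "\<dots> = ennreal e" using \<epsilon>(1)[of k] e(1) by (simp flip: ennreal_mult'')
            finally show ?case using e(2) by simp
          qed
        qed simp
        then show ?thesis using True by simp
      qed simp
    qed
  qed measurable
  then have lim: "(\<lambda>k. \<integral>\<^sup>+z\<in>ball 0 1. b k z \<partial>lborel) \<longlonglongrightarrow> 0" by simp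
  \<comment> \<open>The power of 4 is the ratio of the radii 2\<epsilon> and \<epsilon>/2 to the
    power d; the factor d comes from \<open>layer_homogeneous\<close>.\<close>
  define C where "C = 4 ^ CARD('n) / v * real CARD('n)"
  have C: "C > 0" using v by (simp add: C_def)
  have main: "(\<integral>\<^sup>+y\<in>layer (\<epsilon> k). w y \<partial>lborel) \<le> ennreal (C * \<epsilon> k) * (\<integral>\<^sup>+z\<in>ball 0 1. b k z \<partial>lborel)" for k
  proof -
    let ?s = "(2 * \<epsilon> k) ^ CARD('n)"
    have s: "?s > 0" using \<epsilon>(1)[of k] by simp
    let ?I = "\<integral>\<^sup>+y\<in>layer (\<epsilon> k). w y \<partial>lborel"
    have "?I * ennreal (v * (\<epsilon> k / 2) ^ CARD('n)) \<le> (\<integral>\<^sup>+z\<in>layer (\<epsilon> k). (\<integral>\<^sup>+y\<in>ball (z /\<^sub>R norm z) (2 * \<epsilon> k). w y \<partial>lborel) \<partial>lborel)"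
      unfolding v_def by (rule layer_average[OF _ \<epsilon>(1,2)]) measurable
    then have "?I * ennreal (v * (\<epsilon> k / 2) ^ CARD('n)) * ennreal (1 / ?s) \<le> (\<integral>\<^sup>+z\<in>layer (\<epsilon> k). (\<integral>\<^sup>+y\<in>ball (z /\<^sub>R norm z) (2 * \<epsilon> k). w y \<partial>lborel) \<partial>lborel) * ennreal (1 / ?s)"
      by (rule mult_right_mono) simp
    also have "\<dots> = (\<integral>\<^sup>+z. (\<integral>\<^sup>+y\<in>ball (z /\<^sub>R norm z) (2 * \<epsilon> k). w y \<partial>lborel) * indicator (layer (\<epsilon> k)) z * ennreal (1 / ?s) \<partial>lborel)"
      unfolding ind by (rule nn_integral_multc[symmetric]) measurable
    also have "\<dots> = (\<integral>\<^sup>+z\<in>layer (\<epsilon> k). b k z \<partial>lborel)"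
      unfolding b_def by (simp add: ac_simps)
    also have "\<dots> \<le> ennreal (real CARD('n) * \<epsilon> k) * (\<integral>\<^sup>+z\<in>ball 0 1. b k z \<partial>lborel)"
    proof (rule layer_homogeneous[OF bm _ _ \<epsilon>(1,2)])
      show "b k (t *\<^sub>R z) = b k z" if "t > 0" for t z
      proof -
        have "inverse (t * norm z) * t = inverse (norm z)" using that by (simp add: field_simps)
        then have "(t *\<^sub>R z) /\<^sub>R norm (t *\<^sub>R z) = z /\<^sub>R norm z"
          using that by (simp only: norm_scaleR scaleR_scaleR abs_of_pos)
        then show ?thesis unfolding b_def by (rule arg_cong)
      qed
      have "(\<integral>\<^sup>+z\<in>ball 0 1. b k z \<partial>lborel) \<le> (\<integral>\<^sup>+z. ennreal (M * v) * indicator (ball (0::real^'n) 1) z \<partial>lborel)"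
        by (intro nn_integral_mono mult_right_mono bM) simp
      also have "\<dots> < \<infinity>" by (simp add: nn_integral_cmult_indicator emeasure_unit_ball ennreal_mult_less_top)
      finally show "(\<integral>\<^sup>+z\<in>ball 0 1. b k z \<partial>lborel) < \<infinity>" .
    qed
    also have "?I * ennreal (v * (\<epsilon> k / 2) ^ CARD('n)) * ennreal (1 / ?s) = ?I * ennreal (v / 4 ^ CARD('n))"
    proof -
      have "v * (\<epsilon> k / 2) ^ CARD('n) * (1 / ?s) = v / 4 ^ CARD('n)"
        using s \<epsilon>(1)[of k] by (simp add: power_divide power_mult_distrib flip: power_mult_distrib[of 2 2])
      then show ?thesis using v \<epsilon>(1)[of k] by (simp add: mult.assoc flip: ennreal_mult'')
    qed
    finally have "?I * ennreal (v / 4 ^ CARD('n)) * ennreal (4 ^ CARD('n) / v) \<le> ennreal (real CARD('n) * \<epsilon> k) * (\<integral>\<^sup>+z\<in>ball 0 1. b k z \<partial>lborel) * ennreal (4 ^ CARD('n) / v)"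
      by (rule mult_right_mono) simp
    also have "?I * ennreal (v / 4 ^ CARD('n)) * ennreal (4 ^ CARD('n) / v) = ?I"
      using v by (simp add: mult.assoc flip: ennreal_mult'')
    also have "ennreal (real CARD('n) * \<epsilon> k) * (\<integral>\<^sup>+z\<in>ball 0 1. b k z \<partial>lborel) * ennreal (4 ^ CARD('n) / v) = ennreal (C * \<epsilon> k) * (\<integral>\<^sup>+z\<in>ball 0 1. b k z \<partial>lborel)"
    proof -
      have "ennreal (C * \<epsilon> k) = ennreal (real CARD('n) * \<epsilon> k) * ennreal (4 ^ CARD('n) / v)"
        using \<epsilon>(1)[of k] v by (simp add: C_def ac_simps flip: ennreal_mult'')
      then show ?thesis by (simp add: ac_simps)
    qed
    finally show ?thesis .
  qed
  have "eventually (\<lambda>k. (\<integral>\<^sup>+z\<in>ball 0 1. b k z \<partial>lborel) < ennreal (e / C)) sequentially"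
    using e C by (intro order_tendstoD(2)[OF lim]) auto
  then show ?thesis
  proof eventually_elim
    case (elim k)
    have "(\<integral>\<^sup>+y\<in>layer (\<epsilon> k). w y \<partial>lborel) \<le> ennreal (C * \<epsilon> k) * ennreal (e / C)"
      using elim by (intro order_trans[OF main] mult_left_mono) auto
    also have "\<dots> = ennreal (e * \<epsilon> k)" using C e \<epsilon>(1)[of k] by (simp flip: ennreal_mult'')
    finally show ?case .
  qed
qed

section \<open>Extension by the boundary values\<close>

lemma ex_borel_version:
  fixes f :: "'a::euclidean_space \<Rightarrow> 'b::euclidean_space"
  assumes "f \<in> borel_measurable lebesgue"
  obtains g where "g \<in> borel_measurable borel" "AE x in lborel. f x = g x"
proof -
  have "\<exists>g'\<in>borel_measurable lborel. (AE x in lborel. f x \<bullet> b = g' x)" for b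
    using assms by (intro completion_ex_borel_measurable_real) auto
  then have "\<forall>b. \<exists>g'. g' \<in> borel_measurable lborel \<and> (AE x in lborel. f x \<bullet> b = g' x)" by blast
  from choice[OF this] obtain h where h: "\<forall>b. h b \<in> borel_measurable lborel \<and> (AE x in lborel. f x \<bullet> b = h b x)" by (rule exE)
  have [measurable]: "h b \<in> borel_measurable borel" for b using h by simp
  show ?thesis
  proof
    show "(\<lambda>x. \<Sum>b\<in>Basis. h b x *\<^sub>R b) \<in> borel_measurable borel" by measurable
    have "AE x in lborel. \<forall>b\<in>Basis. f x \<bullet> b = h b x"
      by (rule AE_finite_allI) (use h in auto)
    then show "AE x in lborel. f x = (\<Sum>b\<in>Basis. h b x *\<^sub>R b)"
    proof eventually_elim
      case (elim x)
      have "f x = (\<Sum>b\<in>Basis. (f x \<bullet> b) *\<^sub>R b)" by (rule euclidean_representation[symmetric])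
      also have "\<dots> = (\<Sum>b\<in>Basis. h b x *\<^sub>R b)" using elim by (intro sum.cong) auto
      finally show ?case .
    qed
  qed
qed

lemma le_square_plus_1: "a \<le> a\<^sup>2 + 1" for a :: real
  using zero_le_power2[of "a - 1/2"] by (simp add: power2_eq_square algebra_simps)

text \<open>Extending n - x by zero creates no boundary term: a cutoff with gradient of order
  \<open>k\<close> on a layer of width of order 1/k contributes at most \<open>k\<close> times the
  integral of |n - x| over the layer, and the hypothesis \<open>trace\<close> makes that product
  vanish.\<close>

lemma glue_weak_deriv:
  fixes n :: "real^'n \<Rightarrow> real^'n" and G :: "real^'n \<Rightarrow> real^'n^'n"
  assumes [measurable]: "n \<in> borel_measurable borel" "G \<in> borel_measurable borel"
    and n1: "\<And>x. norm (n x) \<le> 1"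
    and G2: "integrable lborel (\<lambda>x. indicat_real (ball 0 1) x * (norm (G x))\<^sup>2)"
    and weak: "\<And>\<psi> D\<psi> i j. test_function (ball 0 1) \<psi> D\<psi> \<Longrightarrow>
      (\<integral>x. indicat_real (ball 0 1) x * (n x $ i * D\<psi> x $ j) \<partial>lborel) = - (\<integral>x. indicat_real (ball 0 1) x * (\<psi> x * G x $ i $ j) \<partial>lborel)"
    and trace: "\<And>e. e > 0 \<Longrightarrow> eventually (\<lambda>k. (\<integral>\<^sup>+y\<in>layer (2 / real (k + 3)). ennreal (norm (n y - y)) \<partial>lborel) \<le> ennreal (e * (2 / real (k + 3)))) sequentially"
  shows "weak_deriv (\<lambda>x. indicat_real (ball 0 1) x * (n x - x) $ i) (\<lambda>x. indicat_real (ball 0 1) x *\<^sub>R (G x - mat 1) $ i)"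
    and "integrable lborel (\<lambda>x. (norm (indicat_real (ball 0 1) x *\<^sub>R (G x - mat 1) $ i))\<^sup>2)"
proof -
  let ?B = "ball (0::real^'n) 1"
  let ?I = "indicat_real ?B"
  define v where "v x = ?I x * (n x - x) $ i" for x
  define V where "V x = ?I x *\<^sub>R (G x - mat 1) $ i" for x
  have [measurable]: "v \<in> borel_measurable borel" "V \<in> borel_measurable borel"
    unfolding v_def[abs_def] V_def[abs_def] by measurable
  have v2: "\<bar>v x\<bar> \<le> 2 * ?I x" for x
  proof -
    have "\<bar>(n x - x) $ i\<bar> \<le> norm (n x - x)" by (rule component_le_norm_cart)
    also have "\<dots> \<le> norm (n x) + norm x" by (rule norm_triangle_ineq4)
    finally show ?thesis using n1[of x] by (auto simp: v_def indicator_def)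
  qed
  have iI: "integrable lborel ?I" by (rule integrable_unit_ball)
  have iv: "integrable lborel v"
  proof (rule Bochner_Integration.integrable_bound)
    show "integrable lborel (\<lambda>x. 2 * ?I x)" using iI by simp
    show "AE x in lborel. norm (v x) \<le> norm (2 * ?I x)" using v2 by (intro AE_I2) simp
  qed measurable
  define m where "m = norm (mat 1 :: real^'n^'n)"
  have V1: "norm (V x) \<le> ?I x * (norm (G x) + m)" for x
  proof -
    have "norm ((G x - mat 1) $ i) \<le> norm (G x - mat 1)" by (rule Finite_Cartesian_Product.norm_nth_le)
    also have "\<dots> \<le> norm (G x) + m" unfolding m_def by (rule norm_triangle_ineq4)
    finally show ?thesis by (auto simp: V_def indicator_def)
  qed
  have sq: "(a + m)\<^sup>2 \<le> 2 * a\<^sup>2 + 2 * m\<^sup>2" for a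
    using zero_le_power2[of "a - m"] by (simp add: power2_eq_square algebra_simps)
  have V22: "(norm (V x))\<^sup>2 \<le> 2 * (?I x * (norm (G x))\<^sup>2) + 2 * m\<^sup>2 * ?I x" for x
  proof -
    have "(norm (V x))\<^sup>2 \<le> (?I x * (norm (G x) + m))\<^sup>2" using V1 by (intro power_mono) auto
    also have "\<dots> \<le> 2 * (?I x * (norm (G x))\<^sup>2) + 2 * m\<^sup>2 * ?I x" using sq[of "norm (G x)"] by (auto simp: indicator_def)
    finally show ?thesis .
  qed
  have iV2: "integrable lborel (\<lambda>x. (norm (V x))\<^sup>2)"
  proof (rule Bochner_Integration.integrable_bound)
    show "integrable lborel (\<lambda>x. 2 * (?I x * (norm (G x))\<^sup>2) + 2 * m\<^sup>2 * ?I x)" using G2 iI by auto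
    show "AE x in lborel. norm ((norm (V x))\<^sup>2) \<le> norm (2 * (?I x * (norm (G x))\<^sup>2) + 2 * m\<^sup>2 * ?I x)"
      using V22 by (intro AE_I2) (auto intro: order_trans[OF _ abs_ge_self])
  qed measurable
  then show "integrable lborel (\<lambda>x. (norm (indicat_real (ball 0 1) x *\<^sub>R (G x - mat 1) $ i))\<^sup>2)"
    by (simp add: V_def)
  have iV: "integrable lborel V"
  proof (rule Bochner_Integration.integrable_bound)
    show "integrable lborel (\<lambda>x. (norm (V x))\<^sup>2 + ?I x)" using iV2 iI by auto
    show "AE x in lborel. norm (V x) \<le> norm ((norm (V x))\<^sup>2 + ?I x)"
    proof (intro AE_I2)
      fix x
      have "norm (V x) \<le> (norm (V x))\<^sup>2 + 1"  by (rule le_square_plus_1)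
      moreover have "V x = 0" if "x \<notin> ?B" using that by (simp add: V_def)
      ultimately show "norm (V x) \<le> norm ((norm (V x))\<^sup>2 + ?I x)" by (cases "x \<in> ?B") auto
    qed
  qed measurable
  have iVj: "integrable lborel (\<lambda>x. V x $ j)" for j
    by (rule integrable_bounded_linear[OF bounded_linear_vec_nth iV])
  have inner: "(\<integral>x. v x * D\<psi> x $ j \<partial>lborel) = - (\<integral>x. \<psi> x * V x $ j \<partial>lborel)" if t: "test_function ?B \<psi> D\<psi>" for \<psi> D\<psi> j
  proof -
    obtain C where C: "C > 0" "\<And>x. \<bar>\<psi> x\<bar> \<le> C" "\<And>x. norm (D\<psi> x) \<le> C" using test_function_bounded[OF t] by blast
    have [measurable]: "\<psi> \<in> borel_measurable borel" "D\<psi> \<in> borel_measurable borel" using test_function_continuous[OF t] by auto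
    have Dj: "\<bar>D\<psi> x $ j\<bar> \<le> C" for x using C(3)[of x] component_le_norm_cart[of "D\<psi> x" j] by linarith
    have bi: "integrable lborel (\<lambda>x. ?I x * g x)" if [measurable]: "g \<in> borel_measurable borel" and "\<And>x. x \<in> ?B \<Longrightarrow> \<bar>g x\<bar> \<le> C'" for g C'
    proof (rule Bochner_Integration.integrable_bound)
      show "integrable lborel (\<lambda>x. C' * ?I x)" using iI by simp
      show "AE x in lborel. norm (?I x * g x) \<le> norm (C' * ?I x)" 
        using that(2) by (intro AE_I2) (auto simp: indicator_def intro: order_trans[OF _ abs_ge_self])
    qed measurable
    have xi: "\<bar>x $ i\<bar> \<le> 1" if "x \<in> ?B" for x using that component_le_norm_cart[of x i] by simp
    have ni: "\<bar>n x $ i\<bar> \<le> 1" for x using n1[of x] component_le_norm_cart[of "n x" i] by linarith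
    have i1: "integrable lborel (\<lambda>x. ?I x * (n x $ i * D\<psi> x $ j))"
    proof (rule bi[of _ "1 * C"])
      show "\<bar>n x $ i * D\<psi> x $ j\<bar> \<le> 1 * C" for x
        unfolding abs_mult using ni Dj C(1) by (intro mult_mono) auto
    qed measurable
    have i2: "integrable lborel (\<lambda>x. ?I x * (x $ i * D\<psi> x $ j))"
    proof (rule bi[of _ "1 * C"])
      show "\<bar>x $ i * D\<psi> x $ j\<bar> \<le> 1 * C" if "x \<in> ?B" for x
        unfolding abs_mult using xi[OF that] Dj C(1) by (intro mult_mono) auto
    qed measurable
    have i3: "integrable lborel (\<lambda>x. ?I x * (\<psi> x * axis i 1 $ j))"
      using C by (intro bi[of _ "C"]) (auto simp: axis_def)
    have i4: "integrable lborel (\<lambda>x. ?I x * (\<psi> x * G x $ i $ j))"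
    proof (rule Bochner_Integration.integrable_bound)
      show "integrable lborel (\<lambda>x. C * (?I x * (norm (G x))\<^sup>2 + ?I x))" using G2 iI by auto
      show "AE x in lborel. norm (?I x * (\<psi> x * G x $ i $ j)) \<le> norm (C * (?I x * (norm (G x))\<^sup>2 + ?I x))"
      proof (intro AE_I2)
        fix x
        have "\<bar>G x $ i $ j\<bar> \<le> norm (G x)" by (rule order_trans[OF component_le_norm_cart Finite_Cartesian_Product.norm_nth_le])
        also have "norm (G x) \<le> (norm (G x))\<^sup>2 + 1" by (rule le_square_plus_1)
        finally have "\<bar>\<psi> x\<bar> * \<bar>G x $ i $ j\<bar> \<le> C * ((norm (G x))\<^sup>2 + 1)" using C by (intro mult_mono) auto
        then show "norm (?I x * (\<psi> x * G x $ i $ j)) \<le> norm (C * (?I x * (norm (G x))\<^sup>2 + ?I x))"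
          using C(1) by (auto simp: indicator_def abs_mult)
      qed
    qed measurable
    have gx: "GDERIV (\<lambda>x. x $ i) x :> axis i 1" for x :: "real^'n"
    proof -
      have "((\<lambda>x. x $ i) has_derivative (\<lambda>h. h $ i)) (at x)"
        by (rule bounded_linear.has_derivative[OF bounded_linear_vec_nth]) (rule has_derivative_ident)
      then show ?thesis by (simp add: gderiv_def inner_axis)
    qed
    \<comment> \<open>The gradient of \<psi> x_i integrates to zero, which gives the weak derivative
      of the identity map without boundary terms.\<close>
    have "test_function ?B (\<lambda>x. \<psi> x * x $ i) (\<lambda>x. \<psi> x *\<^sub>R axis i 1 + x $ i *\<^sub>R D\<psi> x)"
      by (rule test_function_mult[OF t gx, of UNIV]) auto
    from integral_gradient_0[OF this, of j]
    have "0 = (\<integral>x. ?I x * (\<psi> x * axis i 1 $ j) + ?I x * (x $ i * D\<psi> x $ j) \<partial>lborel)"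
    proof -
      have "(\<psi> x *\<^sub>R axis i 1 + x $ i *\<^sub>R D\<psi> x) $ j = ?I x * (\<psi> x * axis i 1 $ j) + ?I x * (x $ i * D\<psi> x $ j)" for x
        using test_function_0_outside[OF t, of x] by (cases "x \<in> ?B") auto
      then show ?thesis using \<open>_ = 0\<close> by simp
    qed
    then have xw: "(\<integral>x. ?I x * (x $ i * D\<psi> x $ j) \<partial>lborel) = - (\<integral>x. ?I x * (\<psi> x * axis i 1 $ j) \<partial>lborel)"
      using i2 i3 by simp
    have "(\<integral>x. v x * D\<psi> x $ j \<partial>lborel) = (\<integral>x. ?I x * (n x $ i * D\<psi> x $ j) - ?I x * (x $ i * D\<psi> x $ j) \<partial>lborel)"
      by (simp add: v_def algebra_simps)
    also have "\<dots> = - (\<integral>x. ?I x * (\<psi> x * G x $ i $ j) \<partial>lborel) + (\<integral>x. ?I x * (\<psi> x * axis i 1 $ j) \<partial>lborel)"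
      using i1 i2 weak[OF t] xw by simp
    also have "\<dots> = - (\<integral>x. ?I x * (\<psi> x * G x $ i $ j) - ?I x * (\<psi> x * axis i 1 $ j) \<partial>lborel)"
      using i3 i4 by simp
    also have "(\<lambda>x. ?I x * (\<psi> x * G x $ i $ j) - ?I x * (\<psi> x * axis i 1 $ j)) = (\<lambda>x. \<psi> x * V x $ j)"
      by (rule ext) (auto simp: V_def mat_def axis_def algebra_simps)
    finally show ?thesis .
  qed
  show "weak_deriv (\<lambda>x. indicat_real (ball 0 1) x * (n x - x) $ i) (\<lambda>x. indicat_real (ball 0 1) x *\<^sub>R (G x - mat 1) $ i)"
    unfolding v_def[symmetric] V_def[symmetric] weak_deriv_def
  proof (intro conjI iv iV allI impI)
    fix \<phi> D\<phi> j assume t: "test_function UNIV \<phi> (D\<phi> :: real^'n \<Rightarrow> real^'n)"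
    obtain C where C: "C > 0" "\<And>x. \<bar>\<phi> x\<bar> \<le> C" "\<And>x. norm (D\<phi> x) \<le> C" using test_function_bounded[OF t] by blast
    have [measurable]: "\<phi> \<in> borel_measurable borel" "D\<phi> \<in> borel_measurable borel" using test_function_continuous[OF t] by auto
    \<comment> \<open>The cutoff is 0 where 1 - |x|^2 \<le> 1/(k+3) and 1 where it is at least
      2/(k+3). The shift by 3 keeps the layer width 2/(k+3) below 1.\<close>
    define q where "q k x = real (k + 3) * (1 - (norm x)\<^sup>2) - 1" for k and x :: "real^'n"
    define \<eta> where "\<eta> k x = smoothstep (q k x)" for k x
    define D\<eta> where "D\<eta> k x = smoothstep' (q k x) *\<^sub>R (- (2 * real (k + 3)) *\<^sub>R x)" for k x
    have g\<eta>: "GDERIV (\<eta> k) x :> D\<eta> k x" for k x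
      unfolding \<eta>_def[abs_def] D\<eta>_def
    proof (rule GDERIV_smoothstep_comp)
      show "GDERIV (q k) x :> - (2 * real (k + 3)) *\<^sub>R x"
        unfolding q_def gderiv_def power2_norm_eq_inner
        by (auto intro!: derivative_eq_intros simp: inner_commute algebra_simps)
    qed
    have cq: "continuous_on UNIV (q k)" for k unfolding q_def by (intro continuous_intros)
    have c\<eta>: "continuous_on UNIV (D\<eta> k)" for k unfolding D\<eta>_def
      by (intro continuous_intros continuous_on_compose2[OF continuous_smoothstep'] cq) auto
    have [measurable]: "\<eta> k \<in> borel_measurable borel" "D\<eta> k \<in> borel_measurable borel" for k
      using c\<eta> GDERIV_imp_isCont[OF g\<eta>] by (auto intro: borel_measurable_continuous_onI)
    have tk: "test_function ?B (\<lambda>x. \<phi> x * \<eta> k x) (\<lambda>x. \<phi> x *\<^sub>R D\<eta> k x + \<eta> k x *\<^sub>R D\<phi> x)" for k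
    proof (rule test_function_mult[OF t g\<eta> c\<eta>])
      show "closed {x. 0 \<le> q k x}" using cq by (intro closed_Collect_le continuous_intros) auto
      show "\<eta> k x = 0" if "x \<notin> {x. 0 \<le> q k x}" for x using that by (simp add: \<eta>_def smoothstep_0)
      show "{x. 0 \<le> q k x} \<inter> UNIV \<subseteq> ?B"
      proof
        fix x assume "x \<in> {x. 0 \<le> q k x} \<inter> UNIV"
        then have "0 < real (k + 3) * (1 - (norm x)\<^sup>2)" by (simp add: q_def)
        then have "(norm x)\<^sup>2 < 1" by (simp add: zero_less_mult_iff)
        then show "x \<in> ?B" by (simp add: power_less_one_iff abs_square_less_1)
      qed
    qed
    have \<eta>1: "0 \<le> \<eta> k x" "\<eta> k x \<le> 1" for k x by (simp_all add: \<eta>_def smoothstep_bounds)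
    have \<eta>lim: "(\<lambda>k. \<eta> k x) \<longlonglongrightarrow> 1" if "x \<in> ?B" for x
    proof -
      have c: "1 - (norm x)\<^sup>2 > 0" using that by (simp add: abs_square_less_1)
      obtain N where N: "2 / (1 - (norm x)\<^sup>2) < real N" using reals_Archimedean2 by blast
      have "\<eta> k x = 1" if "k \<ge> N" for k
      proof -
        have "2 \<le> real N * (1 - (norm x)\<^sup>2)" using N c by (simp add: field_simps)
        also have "\<dots> \<le> real (k + 3) * (1 - (norm x)\<^sup>2)" using that c by (intro mult_right_mono) auto
        finally show ?thesis unfolding \<eta>_def by (intro smoothstep_1) (simp add: q_def)
      qed
      then show ?thesis by (intro tendsto_eventually) (auto simp: eventually_sequentially)
    qed
    have Dj: "\<bar>D\<phi> x $ j\<bar> \<le> C" for x using C(3)[of x] component_le_norm_cart[of "D\<phi> x" j] by linarith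
    have A: "(\<lambda>k. \<integral>x. v x * (\<eta> k x * D\<phi> x $ j) \<partial>lborel) \<longlonglongrightarrow> (\<integral>x. v x * D\<phi> x $ j \<partial>lborel)"
    proof (rule integral_dominated_convergence)
      show "integrable lborel (\<lambda>x. C * \<bar>v x\<bar>)" using iv by auto
      show "AE x in lborel. (\<lambda>k. v x * (\<eta> k x * D\<phi> x $ j)) \<longlonglongrightarrow> v x * D\<phi> x $ j"
      proof (intro AE_I2)
        fix x
        show "(\<lambda>k. v x * (\<eta> k x * D\<phi> x $ j)) \<longlonglongrightarrow> v x * D\<phi> x $ j"
        proof (cases "x \<in> ?B")
          case True
          have "(\<lambda>k. v x * (\<eta> k x * D\<phi> x $ j)) \<longlonglongrightarrow> v x * (1 * D\<phi> x $ j)" by (intro tendsto_intros \<eta>lim True)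
          then show ?thesis by simp
        qed (simp add: v_def)
      qed
      show "AE x in lborel. norm (v x * (\<eta> k x * D\<phi> x $ j)) \<le> C * \<bar>v x\<bar>" for k
      proof (intro AE_I2)
        fix x
        have "\<bar>\<eta> k x\<bar> * \<bar>D\<phi> x $ j\<bar> \<le> 1 * C" using \<eta>1[of k x] Dj by (intro mult_mono) auto
        then have "\<bar>v x\<bar> * (\<bar>\<eta> k x\<bar> * \<bar>D\<phi> x $ j\<bar>) \<le> \<bar>v x\<bar> * C" by (intro mult_left_mono) auto
        then show "norm (v x * (\<eta> k x * D\<phi> x $ j)) \<le> C * \<bar>v x\<bar>" by (simp add: abs_mult mult.commute)
      qed
    qed measurable
    have B: "(\<lambda>k. \<integral>x. \<phi> x * \<eta> k x * V x $ j \<partial>lborel) \<longlonglongrightarrow> (\<integral>x. \<phi> x * V x $ j \<partial>lborel)"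
    proof (rule integral_dominated_convergence)
      show "integrable lborel (\<lambda>x. C * \<bar>V x $ j\<bar>)" using iVj by auto
      show "AE x in lborel. (\<lambda>k. \<phi> x * \<eta> k x * V x $ j) \<longlonglongrightarrow> \<phi> x * V x $ j"
      proof (intro AE_I2)
        fix x
        show "(\<lambda>k. \<phi> x * \<eta> k x * V x $ j) \<longlonglongrightarrow> \<phi> x * V x $ j"
        proof (cases "x \<in> ?B")
          case True
          have "(\<lambda>k. \<phi> x * \<eta> k x * V x $ j) \<longlonglongrightarrow> \<phi> x * 1 * V x $ j" by (intro tendsto_intros \<eta>lim True)
          then show ?thesis by simp
        qed (simp add: V_def)
      qed
      show "AE x in lborel. norm (\<phi> x * \<eta> k x * V x $ j) \<le> C * \<bar>V x $ j\<bar>" for k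
      proof (intro AE_I2)
        fix x
        have "\<bar>\<phi> x\<bar> * \<bar>\<eta> k x\<bar> \<le> C * 1" using \<eta>1[of k x] C by (intro mult_mono) auto
        then have "\<bar>\<phi> x\<bar> * \<bar>\<eta> k x\<bar> * \<bar>V x $ j\<bar> \<le> C * \<bar>V x $ j\<bar>" by (intro mult_right_mono) auto
        then show "norm (\<phi> x * \<eta> k x * V x $ j) \<le> C * \<bar>V x $ j\<bar>" by (simp add: abs_mult)
      qed
    qed measurable
    \<comment> \<open>The factor 4(k+3) is the bound 2 for \<open>smoothstep'\<close> times the
      bound 2(k+3) for the gradient of \<open>q\<close> on the ball. Off the layer the cutoff is
      constant, as |x|^2 \<le> |x| there.\<close>
    have bound: "\<bar>v x * (\<phi> x * D\<eta> k x $ j)\<bar> \<le> 4 * real (k + 3) * C * (norm (n x - x) * indicator (layer (2 / real (k + 3))) x)" for k x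
    proof (cases "x \<in> ?B \<and> x \<in> layer (2 / real (k + 3))")
      case True
      have "\<bar>v x\<bar> \<le> norm (n x - x)" using component_le_norm_cart[of "n x - x" i] by (simp add: v_def indicator_def)
      moreover have "\<bar>D\<eta> k x $ j\<bar> \<le> 4 * real (k + 3)"
      proof -
        have "\<bar>D\<eta> k x $ j\<bar> = \<bar>smoothstep' (q k x)\<bar> * (2 * real (k + 3) * \<bar>x $ j\<bar>)"
          by (simp add: D\<eta>_def abs_mult)
        also have "\<dots> \<le> 2 * (2 * real (k + 3) * 1)"
          using True component_le_norm_cart[of x j] by (intro mult_mono smoothstep'_bound) auto
        finally show ?thesis by simp
      qed
      then have "\<bar>\<phi> x\<bar> * \<bar>D\<eta> k x $ j\<bar> \<le> C * (4 * real (k + 3))" using C by (intro mult_mono) auto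
      ultimately have "\<bar>v x\<bar> * (\<bar>\<phi> x\<bar> * \<bar>D\<eta> k x $ j\<bar>) \<le> norm (n x - x) * (C * (4 * real (k + 3)))"
        by - (rule mult_mono, auto)
      then show ?thesis using True by (simp add: abs_mult ac_simps)
    next
      case False
      have "v x * (\<phi> x * D\<eta> k x $ j) = 0"
      proof (cases "x \<in> ?B")
        case True
        then have "norm x \<le> 1 - 2 / real (k + 3)" using False by (auto simp: layer_def)
        moreover have "(norm x)\<^sup>2 \<le> norm x" using True by (simp add: power2_eq_square mult_left_le_one_le)
        ultimately have "2 / real (k + 3) \<le> 1 - (norm x)\<^sup>2" by linarith
        then have "2 \<le> real (k + 3) * (1 - (norm x)\<^sup>2)" by (simp add: field_simps)
        then have "smoothstep' (q k x) = 0" by (intro smoothstep'_eq_0) (auto simp: q_def)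
        then show ?thesis by (simp add: D\<eta>_def)
      qed (simp add: v_def)
      moreover have "0 \<le> 4 * real (k + 3) * C * (norm (n x - x) * indicator (layer (2 / real (k + 3))) x)"
        using C(1) by (intro mult_nonneg_nonneg) auto
      ultimately show ?thesis by (simp only: abs_zero)
    qed
    have D: "(\<lambda>k. \<integral>x. v x * (\<phi> x * D\<eta> k x $ j) \<partial>lborel) \<longlonglongrightarrow> 0"
    proof (rule LIMSEQ_I)
      fix e :: real assume e: "e > 0"
      \<comment> \<open>The product of 4(k+3)C and the layer bound 2e'/(k+3) is 8Ce', that is
        e/2.\<close>
      define e' where "e' = e / (16 * C)"
      have e': "e' > 0" using e C by (simp add: e'_def)
      from trace[OF e'] obtain N where N: "\<And>k. k \<ge> N \<Longrightarrow> (\<integral>\<^sup>+y\<in>layer (2 / real (k + 3)). ennreal (norm (n y - y)) \<partial>lborel) \<le> ennreal (e' * (2 / real (k + 3)))"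
        unfolding eventually_sequentially by blast
      have "norm ((\<integral>x. v x * (\<phi> x * D\<eta> k x $ j) \<partial>lborel) - 0) < e" if "k \<ge> N" for k
      proof -
        let ?F = "\<lambda>x. v x * (\<phi> x * D\<eta> k x $ j)"
        let ?c = "4 * real (k + 3) * C"
        have c0: "?c \<ge> 0" using C by simp
        have "(\<integral>\<^sup>+x. ennreal (norm (?F x)) \<partial>lborel) \<le> (\<integral>\<^sup>+x. ennreal ?c * (ennreal (norm (n x - x)) * indicator (layer (2 / real (k + 3))) x) \<partial>lborel)"
        proof (intro nn_integral_mono)
          fix x
          have "ennreal (norm (?F x)) \<le> ennreal (?c * (norm (n x - x) * indicator (layer (2 / real (k + 3))) x))"
            using bound[of x k] by (intro ennreal_leI) simp
          also have "\<dots> = ennreal ?c * (ennreal (norm (n x - x)) * indicator (layer (2 / real (k + 3))) x)"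
            using c0 by (cases "x \<in> layer (2 / real (k + 3))") (simp_all add: ennreal_mult'' flip: ennreal_mult'')
          finally show "ennreal (norm (?F x)) \<le> ennreal ?c * (ennreal (norm (n x - x)) * indicator (layer (2 / real (k + 3))) x)" .
        qed
        also have "\<dots> = ennreal ?c * (\<integral>\<^sup>+y\<in>layer (2 / real (k + 3)). ennreal (norm (n y - y)) \<partial>lborel)"
          by (rule nn_integral_cmult) measurable
        also have "\<dots> \<le> ennreal ?c * ennreal (e' * (2 / real (k + 3)))" by (intro mult_left_mono N that) simp
        also have "\<dots> = ennreal (e / 2)"
        proof -
          have "4 * r * C * (e / (16 * C) * (2 / r)) = e / 2" if "r > 0" for r using that C(1) by (simp add: field_simps)
          from this[of "real (k + 3)"] have "?c * (e' * (2 / real (k + 3))) = e / 2" unfolding e'_def by simp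
          moreover have "ennreal ?c * ennreal (e' * (2 / real (k + 3))) = ennreal (?c * (e' * (2 / real (k + 3))))"
            using c0 e' by (intro ennreal_mult[symmetric]) auto
          ultimately show ?thesis by (simp only:)
        qed
        finally have le: "(\<integral>\<^sup>+x. ennreal (norm (?F x)) \<partial>lborel) \<le> ennreal (e / 2)" .
        then have "integrable lborel ?F" unfolding integrable_iff_bounded by (auto intro: le_less_trans)
        from order_trans[OF integral_norm_bound_ennreal[OF this] le]
        have "norm (\<integral>x. ?F x \<partial>lborel) \<le> e / 2" using e by simp
        then show ?thesis using e by simp
      qed
      then show "\<exists>N. \<forall>k\<ge>N. norm ((\<integral>x. v x * (\<phi> x * D\<eta> k x $ j) \<partial>lborel) - 0) < e" by blast
    qed
    have vb: "integrable lborel (\<lambda>x. v x * g x)" if [measurable]: "g \<in> borel_measurable borel" and "\<And>x. \<bar>g x\<bar> \<le> C'" for g C'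
    proof (rule Bochner_Integration.integrable_bound)
      show "integrable lborel (\<lambda>x. C' * \<bar>v x\<bar>)" using iv by auto
      show "AE x in lborel. norm (v x * g x) \<le> norm (C' * \<bar>v x\<bar>)"
      proof (intro AE_I2)
        fix x
        have "\<bar>v x\<bar> * \<bar>g x\<bar> \<le> \<bar>v x\<bar> * \<bar>C'\<bar>" using that(2)[of x] by (intro mult_left_mono) auto
        then show "norm (v x * g x) \<le> norm (C' * \<bar>v x\<bar>)" by (simp add: abs_mult mult.commute)
      qed
    qed measurable
    \<comment> \<open>The interior identity for the product \<phi>\<eta>, split by the product rule.
      The term with the gradient of \<eta> is the boundary contribution, which tends to 0.\<close>
    have eq: "(\<integral>x. v x * (\<phi> x * D\<eta> k x $ j) \<partial>lborel) + (\<integral>x. v x * (\<eta> k x * D\<phi> x $ j) \<partial>lborel) = - (\<integral>x. \<phi> x * \<eta> k x * V x $ j \<partial>lborel)" for k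
    proof -
      obtain C' where C': "\<And>x. norm (\<phi> x *\<^sub>R D\<eta> k x + \<eta> k x *\<^sub>R D\<phi> x) \<le> C'" using test_function_bounded[OF tk] by blast
      have b2: "\<bar>\<eta> k x * D\<phi> x $ j\<bar> \<le> C" for x
        using mult_mono[of "\<bar>\<eta> k x\<bar>" 1 "\<bar>D\<phi> x $ j\<bar>" C] \<eta>1[of k x] Dj[of x] C by (simp add: abs_mult)
      have b1: "\<bar>\<phi> x * D\<eta> k x $ j\<bar> \<le> C' + C" for x
        using C'[of x] b2[of x] component_le_norm_cart[of "\<phi> x *\<^sub>R D\<eta> k x + \<eta> k x *\<^sub>R D\<phi> x" j] by simp
      have "(\<integral>x. v x * (\<phi> x * D\<eta> k x $ j) \<partial>lborel) + (\<integral>x. v x * (\<eta> k x * D\<phi> x $ j) \<partial>lborel) = (\<integral>x. v x * (\<phi> x *\<^sub>R D\<eta> k x + \<eta> k x *\<^sub>R D\<phi> x) $ j \<partial>lborel)"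
        using vb[OF _ b1] vb[OF _ b2] by (simp add: distrib_left)
      then show ?thesis using inner[OF tk[of k], of j] by simp
    qed
    have "(\<lambda>k. (\<integral>x. v x * (\<phi> x * D\<eta> k x $ j) \<partial>lborel) + (\<integral>x. v x * (\<eta> k x * D\<phi> x $ j) \<partial>lborel)) \<longlonglongrightarrow> 0 + (\<integral>x. v x * D\<phi> x $ j \<partial>lborel)"
      by (rule tendsto_add[OF D A])
    moreover have "(\<lambda>k. (\<integral>x. v x * (\<phi> x * D\<eta> k x $ j) \<partial>lborel) + (\<integral>x. v x * (\<eta> k x * D\<phi> x $ j) \<partial>lborel)) \<longlonglongrightarrow> - (\<integral>x. \<phi> x * V x $ j \<partial>lborel)"
      unfolding eq by (rule tendsto_minus[OF B])
    ultimately show "(\<integral>x. v x * D\<phi> x $ j \<partial>lborel) = - (\<integral>x. \<phi> x * V x $ j \<partial>lborel)"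
      using LIMSEQ_unique by fastforce
  qed
qed

section \<open>The lower bound for Sobolev maps\<close>

lemma AE_affine:
  fixes P :: "'a::euclidean_space \<Rightarrow> bool"
  assumes "AE h in lborel. P h" "c > 0"
  shows "AE y in lborel. P (a + c *\<^sub>R y)"
proof -
  have "c \<noteq> 0" using assms(2) by simp
  note eq = lborel_affine[OF this, of a]
  have "AE h in density (distr lborel borel (\<lambda>x. a + c *\<^sub>R x)) (\<lambda>_. ennreal (\<bar>c\<bar>^DIM('a))). P h"
    using assms(1) by (subst (asm) eq)
  then have "AE h in distr lborel borel (\<lambda>x. a + c *\<^sub>R x). P h"
    using assms(2) by (simp add: AE_density)
  then show ?thesis by (rule AE_distrD[rotated]) simp
qed

text \<open>Differentiation of |u| = 1 without a chain rule: for unit vectors z . (u - z) = -|u -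
  z|^2/2, so the component of the increment along \<open>z\<close> is of second order. The linear
  function with gradient A^T z is therefore small in L^1 compared with the scale, and
  \<open>ker_extract\<close> makes it vanish.\<close>

lemma tangential:
  fixes u :: "real^'n \<Rightarrow> real^'m"
  assumes u[measurable]: "u \<in> borel_measurable borel" and A: "approx_affine u x z A" and z: "norm z = 1"
    and S: "open S" "x \<in> S" and unit: "AE y in lborel. y \<in> S \<longrightarrow> norm (u y) = 1"
  shows "transpose A *v z = 0"
proof -
  define w where "w = transpose A *v z"
  have wy: "w \<bullet> y = z \<bullet> (A *v y)" for y
    unfolding w_def by (simp add: dot_lmul_matrix)
  obtain a where a: "a \<ge> 0" "\<And>y. norm (A *v y) \<le> a * norm y" using matrix_vector_bound by blast
  obtain r where r: "r > 0" "ball x r \<subseteq> S" using S open_contains_ball by blast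
  have "w $ j = 0" for j
  proof (rule zero_if_small)
    fix e :: real assume e: "e > 0"
    from A[unfolded approx_affine_def, rule_format, OF e] obtain d where d: "d > 0"
      "\<And>\<rho>. 0 < \<rho> \<Longrightarrow> \<rho> < d \<Longrightarrow> (\<integral>\<^sup>+y\<in>ball 0 1. ennreal (norm (u (x + \<rho> *\<^sub>R y) - z - \<rho> *\<^sub>R (A *v y))) \<partial>lborel) \<le> ennreal (e * \<rho>)" by blast
    \<comment> \<open>One bound for each requirement: the affine defect is small, the ball stays in
      \<open>S\<close>, \<rho> a \<le> 1, and \<rho> a^2 \<le> e.\<close>
    define M where "M = min (min d r) (min (1 / (1 + a)) (e / (1 + a\<^sup>2)))"
    define \<rho> where "\<rho> = M / 2"
    have p: "1 + a > 0" "1 + a\<^sup>2 > 0" using a(1) by (auto simp: add_pos_nonneg)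
    have \<rho>: "0 < \<rho>" "\<rho> < d" "\<rho> < r" "\<rho> < 1 / (1 + a)" "\<rho> < e / (1 + a\<^sup>2)"
    proof -
      have "M > 0" using d(1) r(1) e p by (simp add: M_def)
      then have "0 < \<rho>" "\<rho> < M" by (simp_all add: \<rho>_def)
      moreover have "M \<le> d" "M \<le> r" "M \<le> 1 / (1 + a)" "M \<le> e / (1 + a\<^sup>2)" by (simp_all add: M_def)
      ultimately show "0 < \<rho>" "\<rho> < d" "\<rho> < r" "\<rho> < 1 / (1 + a)" "\<rho> < e / (1 + a\<^sup>2)" by linarith+
    qed
    have \<rho>a: "\<rho> * a \<le> 1" using \<rho>(1,4) p by (simp add: field_simps)
    have \<rho>e: "\<rho> * a\<^sup>2 \<le> e" using \<rho>(1,5) p e by (simp add: field_simps)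
    have "ennreal (kvar j * \<bar>(\<rho> *\<^sub>R w) $ j\<bar>) \<le> (\<integral>\<^sup>+y\<in>ball 0 1. ennreal \<bar>0 + (\<rho> *\<^sub>R w) \<bullet> y\<bar> \<partial>lborel)"
      by (rule ker_extract)
    also have "\<dots> \<le> (\<integral>\<^sup>+y. ennreal 3 * (ennreal (norm (u (x + \<rho> *\<^sub>R y) - z - \<rho> *\<^sub>R (A *v y))) * indicator (ball 0 1) y)
        + ennreal (\<rho> * e) * indicator (ball 0 1) y \<partial>lborel)"
    proof (rule nn_integral_mono_AE, use AE_affine[OF unit \<rho>(1), of x] in eventually_elim)
      fix y :: "real^'n" assume un: "x + \<rho> *\<^sub>R y \<in> S \<longrightarrow> norm (u (x + \<rho> *\<^sub>R y)) = 1"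
      let ?n = "u (x + \<rho> *\<^sub>R y)" let ?e = "?n - z - \<rho> *\<^sub>R (A *v y)" let ?p = "\<rho> *\<^sub>R (A *v y)"
      have bd: "\<bar>\<rho> * (w \<bullet> y)\<bar> \<le> 3 * norm ?e + \<rho> * e" if y: "y \<in> ball 0 1"
      proof -
        have "x + \<rho> *\<^sub>R y \<in> ball x r"
        proof -
          have "\<rho> * norm y \<le> \<rho> * 1" using y \<rho>(1) by (intro mult_left_mono) auto
          then have "\<rho> * norm y < r" using \<rho>(3) by simp
          then show ?thesis using \<rho>(1) by (simp add: dist_norm)
        qed
        then have n1: "norm ?n = 1" using un r by blast
        have pa: "norm ?p \<le> \<rho> * a"
        proof -
          have "a * norm y \<le> a * 1" using y a(1) by (intro mult_left_mono) auto
          then show ?thesis using a(2)[of y] \<rho>(1) by simp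
        qed
        define q where "q = norm (?n - z)"
        have qe: "q \<le> norm ?e + norm ?p" 
          using norm_triangle_ineq[of ?e ?p] by (simp add: q_def)
        have q2: "q \<le> 2" using norm_triangle_ineq4[of ?n z] n1 z by (simp add: q_def)
        have q0: "q \<ge> 0" by (simp add: q_def)
        have zn: "z \<bullet> (?n - z) = - (q\<^sup>2 / 2)"
          using n1 z by (simp add: q_def power2_norm_eq_inner inner_diff inner_commute norm_eq_1 diff_divide_distrib)
        \<comment> \<open>One factor \<open>q\<close> is replaced by the defect plus the linear
          part. Against the defect the other factor is at most 2; against the linear part it is
          expanded again, and \<rho> a \<le> 1 and \<rho> a^2 \<le> e absorb the products.\<close>
        have "q\<^sup>2 \<le> 3 * norm ?e + \<rho> * e"
        proof -
          have "q * q \<le> q * (norm ?e + norm ?p)" using qe q0 by (rule mult_left_mono)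
          also have "\<dots> \<le> 2 * norm ?e + (norm ?e + norm ?p) * norm ?p"
            using mult_right_mono[OF q2, of "norm ?e"] mult_right_mono[OF qe, of "norm ?p"] by (simp add: algebra_simps)
          also have "\<dots> \<le> 2 * norm ?e + (norm ?e * 1 + (\<rho> * a) * (\<rho> * a))"
          proof -
            have "norm ?e * norm ?p \<le> norm ?e * 1" using pa \<rho>a by (intro mult_left_mono) auto
            moreover have "norm ?p * norm ?p \<le> (\<rho> * a) * (\<rho> * a)" using pa \<rho>(1) a(1) by (intro mult_mono) auto
            ultimately show ?thesis by (simp only: distrib_right)
          qed
          also have "(\<rho> * a) * (\<rho> * a) \<le> \<rho> * e" using \<rho>e \<rho>(1) mult_left_mono[OF \<rho>e, of \<rho>] by (simp add: power2_eq_square ac_simps)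
          finally show ?thesis by (simp add: power2_eq_square)
        qed
        moreover have "\<rho> * (w \<bullet> y) = z \<bullet> (?n - z) - z \<bullet> ?e" by (simp add: wy inner_diff_right)
        moreover have "\<bar>z \<bullet> ?e\<bar> \<le> norm ?e" using Cauchy_Schwarz_ineq2[of z ?e] z by simp
        moreover have "\<rho> * e \<ge> 0" using \<rho>(1) e by simp
        moreover have "q\<^sup>2 \<ge> 0" by simp
        ultimately show ?thesis using zn by linarith
      qed
      show "ennreal \<bar>0 + (\<rho> *\<^sub>R w) \<bullet> y\<bar> * indicator (ball 0 1) y \<le> ennreal 3 * (ennreal (norm ?e) * indicator (ball 0 1) y) + ennreal (\<rho> * e) * indicator (ball 0 1) y"
      proof (cases "y \<in> ball 0 1")
        case True
        from ennreal_leI[OF bd[OF True]]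
        have "ennreal \<bar>\<rho> * (w \<bullet> y)\<bar> \<le> ennreal (3 * norm ?e + \<rho> * e)" .
        also have "\<dots> = ennreal (3 * norm ?e) + ennreal (\<rho> * e)" using \<rho>(1) e by (intro ennreal_plus) auto
        also have "ennreal (3 * norm ?e) = ennreal 3 * ennreal (norm ?e)" by (intro ennreal_mult) auto
        finally show ?thesis using True by simp
      qed simp
    qed
    also have "\<dots> = ennreal 3 * (\<integral>\<^sup>+y\<in>ball 0 1. ennreal (norm (u (x + \<rho> *\<^sub>R y) - z - \<rho> *\<^sub>R (A *v y))) \<partial>lborel) + ennreal (\<rho> * e) * ennreal (unit_vol TYPE('n))"
      by (subst nn_integral_add, measurable) (simp only: nn_integral_cmult_indicator emeasure_unit_ball ball_measurable sets_lborel, subst nn_integral_cmult, measurable)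
    also have "\<dots> \<le> ennreal 3 * ennreal (e * \<rho>) + ennreal (\<rho> * e) * ennreal (unit_vol TYPE('n))"
      by (intro add_right_mono mult_left_mono d \<rho>) auto
    also have "\<dots> = ennreal (\<rho> * ((3 + unit_vol TYPE('n)) * e))"
    proof -
      have "ennreal 3 * ennreal (e * \<rho>) = ennreal (3 * (e * \<rho>))" by (rule ennreal_mult[symmetric]) (use e \<rho> in auto)
      moreover have "ennreal (\<rho> * e) * ennreal (unit_vol TYPE('n)) = ennreal (\<rho> * e * unit_vol TYPE('n))" by (rule ennreal_mult[symmetric]) (use e \<rho> in auto)
      moreover have "ennreal (3 * (e * \<rho>)) + ennreal (\<rho> * e * unit_vol TYPE('n)) = ennreal (3 * (e * \<rho>) + \<rho> * e * unit_vol TYPE('n))"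
        by (rule ennreal_plus[symmetric]) (use e \<rho> in auto)
      ultimately show ?thesis by (simp add: algebra_simps)
    qed
    finally have "kvar j * \<bar>(\<rho> *\<^sub>R w) $ j\<bar> \<le> \<rho> * ((3 + unit_vol TYPE('n)) * e)"
      using e \<rho>(1) by (subst (asm) ennreal_le_iff) auto
    then have "\<rho> * (kvar j * \<bar>w $ j\<bar>) \<le> \<rho> * ((3 + unit_vol TYPE('n)) * e)" using \<rho>(1) by (simp add: abs_mult ac_simps)
    then show "kvar j * \<bar>w $ j\<bar> \<le> (3 + unit_vol TYPE('n)) * e" using \<rho>(1) by simp
  qed (use kvar_pos[of j] in auto)
  then show ?thesis by (simp add: vec_eq_iff w_def)
qed

text \<open>Tested with a plateau function equal to 1 on the unit ball: its gradient vanishes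
  wherever \<open>v\<close> does not, and it does not change \<open>V\<close>.\<close>

lemma integral_weak_deriv_0:
  fixes v :: "real^'n \<Rightarrow> real"
  assumes w: "weak_deriv v V" and 0: "\<And>x. x \<notin> ball 0 1 \<Longrightarrow> v x = 0" "\<And>x. x \<notin> ball 0 1 \<Longrightarrow> V x = 0"
  shows "(\<integral>x. V x $ j \<partial>lborel) = 0"
proof -
  let ?q = "\<lambda>x::real^'n. 1 * (2\<^sup>2 - (norm (x - 0))\<^sup>2)"
  let ?\<phi> = "\<lambda>x. smoothstep (?q x)" and ?D = "\<lambda>x. smoothstep' (?q x) *\<^sub>R (- (2 * 1) *\<^sub>R (x - 0))"
  have t: "test_function UNIV ?\<phi> ?D" by (rule test_function_bump) auto
  have q1: "?q x \<ge> 1" if "x \<in> ball 0 1" for x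
  proof -
    have "(norm x)\<^sup>2 \<le> 1\<^sup>2" using that by (intro power_mono) auto
    then show ?thesis by simp
  qed
  have "(\<integral>x. v x * ?D x $ j \<partial>lborel) = - (\<integral>x. ?\<phi> x * V x $ j \<partial>lborel)"
    using w t unfolding weak_deriv_def by blast
  moreover have "v x * ?D x $ j = 0" for x
    using 0(1)[of x] q1[of x] smoothstep'_eq_0[of "?q x"] by (cases "x \<in> ball 0 1") auto
  moreover have "?\<phi> x * V x $ j = V x $ j" for x
    using 0(2)[of x] q1[of x] smoothstep_1[of "?q x"] by (cases "x \<in> ball 0 1") auto
  ultimately show ?thesis by (simp only: integral_zero)
qed

lemma ennreal_divide_le_iff: 
  assumes "r > 0" "e \<ge> 0" "a / ennreal r \<le> ennreal e"
  shows "a \<le> ennreal (e * r)"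
proof -
  have "ennreal r / ennreal r = 1" using assms(1) by (intro ennreal_divide_self) auto
  then have "a = a / ennreal r * ennreal r" by (simp add: ennreal_divide_times)
  also have "\<dots> \<le> ennreal e * ennreal r" using assms(3) by (rule mult_right_mono) simp
  also have "\<dots> = ennreal (e * r)" using assms by (simp add: ennreal_mult'')
  finally show ?thesis .
qed

text \<open>The trace gives closeness to the fixed value \<omega> near a boundary point, and |y -
  \<omega>| < \<rho> replaces \<omega> by the moving value \<open>y\<close>. By
  \<open>cone_null\<close> the exceptional boundary points concern almost no direction, so
  \<open>layer_vanish\<close> applies.\<close>

lemma trace_imp_layer:
  fixes n nb :: "real^'n \<Rightarrow> real^'n"
  assumes d: "CARD('n) \<ge> 2" and tr: "has_trace (ball 0 1) n (\<lambda>x. x)"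
    and nb[measurable]: "nb \<in> borel_measurable borel" and n1: "\<And>x. norm (nb x) \<le> 1"
    and eq: "AE x in lborel. x \<in> ball 0 1 \<longrightarrow> n x = nb x" and e: "e > 0"
  shows "eventually (\<lambda>k. (\<integral>\<^sup>+y\<in>layer (2 / real (k + 3)). ennreal (norm (nb y - y)) \<partial>lborel) \<le> ennreal (e * (2 / real (k + 3)))) sequentially"
proof -
  let ?B = "ball (0::real^'n) 1"
  define w where "w y = ennreal (norm (nb y - y)) * indicator ?B y" for y
  have wm[measurable]: "w \<in> borel_measurable borel" unfolding w_def[abs_def] by measurable
  define E where "E = {x \<in> frontier ?B. \<not> has_trace_at ?B n x x}"
  have "E \<subseteq> sphere 0 1" by (auto simp: E_def frontier_ball)
  moreover have "hausdorff_measure (CARD('n) - 1) E = 0" using tr by (simp add: has_trace_def E_def)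
  ultimately have ae: "AE z in lborel. z \<in> ?B \<and> z \<noteq> 0 \<longrightarrow> z /\<^sub>R norm z \<notin> E" by (rule cone_null[OF d])
  have w2: "w y \<le> ennreal 2" for y
  proof (cases "y \<in> ?B")
    case True
    then have "norm (nb y - y) \<le> 2" using norm_triangle_ineq4[of "nb y" y] n1[of y] by simp
    then have "ennreal (norm (nb y - y)) \<le> ennreal 2" by (rule ennreal_leI)
    then show ?thesis using True by (simp add: w_def)
  qed (simp add: w_def)
  define v where "v = unit_ball_vol (real CARD('n))"
  have v: "v > 0" by (simp add: v_def)
  have "eventually (\<lambda>k. (\<integral>\<^sup>+y\<in>layer (2 / real (k + 3)). w y \<partial>lborel) \<le> ennreal (e * (2 / real (k + 3)))) sequentially"
  proof (rule layer_vanish[OF wm w2 _ _ _ _ _ e])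
    show "AE z in lborel. z \<in> ?B \<longrightarrow> (\<forall>e>0. \<exists>\<delta>>0. \<forall>\<rho>. 0 < \<rho> \<and> \<rho> < \<delta> \<longrightarrow>
       (\<integral>\<^sup>+y\<in>ball (z /\<^sub>R norm z) \<rho>. w y \<partial>lborel) \<le> ennreal (e * \<rho> ^ CARD('n)))"
      using ae AE_lborel_singleton[of "0::real^'n"]
    proof (eventually_elim, intro impI allI)
      fix z :: "real^'n" and e :: real 
      assume z: "z \<in> ?B \<and> z \<noteq> 0 \<longrightarrow> z /\<^sub>R norm z \<notin> E" "z \<noteq> 0" "z \<in> ?B" and e: "e > 0"
      define \<omega> where "\<omega> = z /\<^sub>R norm z"
      have "\<omega> \<in> frontier ?B" using z by (simp add: \<omega>_def frontier_ball)
      then have "has_trace_at ?B n \<omega> \<omega>" using z by (auto simp: E_def \<omega>_def)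
      then have "\<forall>e>0. \<exists>d>0. \<forall>\<rho>. 0 < \<rho> \<and> \<rho> < d \<longrightarrow> 
        (\<integral>\<^sup>+y\<in>?B \<inter> ball \<omega> \<rho>. ennreal (norm (n y - \<omega>)) \<partial>lebesgue) / ennreal (\<rho> ^ CARD('n)) \<le> ennreal e"
        unfolding has_trace_at_def tendsto_0_ennreal_iff .
      from this[rule_format, of "e / 2"] e obtain d where d: "d > 0" "\<And>\<rho>. 0 < \<rho> \<Longrightarrow> \<rho> < d \<Longrightarrow> 
        (\<integral>\<^sup>+y\<in>?B \<inter> ball \<omega> \<rho>. ennreal (norm (n y - \<omega>)) \<partial>lebesgue) / ennreal (\<rho> ^ CARD('n)) \<le> ennreal (e / 2)"
        by auto
      \<comment> \<open>The second bound on \<rho> makes \<rho> times the volume of the ball at most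
        half of the target; the trace supplies the other half.\<close>
      have "(\<integral>\<^sup>+y\<in>ball \<omega> \<rho>. w y \<partial>lborel) \<le> ennreal (e * \<rho> ^ CARD('n))" if \<rho>: "0 < \<rho>" "\<rho> < min d (e / (2 * v))" for \<rho>
      proof -
        have "(\<integral>\<^sup>+y\<in>ball \<omega> \<rho>. w y \<partial>lborel) \<le> (\<integral>\<^sup>+y. ennreal (norm (nb y - \<omega>)) * indicator (?B \<inter> ball \<omega> \<rho>) y + ennreal \<rho> * indicator (ball \<omega> \<rho>) y \<partial>lborel)"
        proof (intro nn_integral_mono)
          fix y
          have "norm (nb y - y) \<le> norm (nb y - \<omega>) + \<rho>" if "y \<in> ball \<omega> \<rho>"
            using norm_triangle_ineq[of "nb y - \<omega>" "\<omega> - y"] that by (simp add: dist_norm)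
          then show "w y * indicator (ball \<omega> \<rho>) y \<le> ennreal (norm (nb y - \<omega>)) * indicator (?B \<inter> ball \<omega> \<rho>) y + ennreal \<rho> * indicator (ball \<omega> \<rho>) y"
            using \<rho>(1) by (auto simp: w_def indicator_def intro!: ennreal_leI simp flip: ennreal_plus)
        qed
        also have "\<dots> = (\<integral>\<^sup>+y\<in>?B \<inter> ball \<omega> \<rho>. ennreal (norm (nb y - \<omega>)) \<partial>lborel) + ennreal \<rho> * ennreal (v * \<rho> ^ CARD('n))"
          using \<rho>(1) by (subst nn_integral_add) (auto simp: nn_integral_cmult_indicator emeasure_ball v_def)
        also have "(\<integral>\<^sup>+y\<in>?B \<inter> ball \<omega> \<rho>. ennreal (norm (nb y - \<omega>)) \<partial>lborel) = (\<integral>\<^sup>+y\<in>?B \<inter> ball \<omega> \<rho>. ennreal (norm (n y - \<omega>)) \<partial>lebesgue)"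
          unfolding nn_integral_completion by (rule nn_integral_cong_AE, use eq in eventually_elim) (auto simp: indicator_def)
        also have "\<dots> \<le> ennreal (e / 2 * \<rho> ^ CARD('n))"
          using d(2)[of \<rho>] \<rho> e by (intro ennreal_divide_le_iff) auto
        also have "ennreal \<rho> * ennreal (v * \<rho> ^ CARD('n)) \<le> ennreal (e / 2 * \<rho> ^ CARD('n))"
        proof -
          have "\<rho> * v \<le> e / 2" using \<rho> v by (simp add: field_simps)
          then have "\<rho> * v * \<rho> ^ CARD('n) \<le> e / 2 * \<rho> ^ CARD('n)" using \<rho>(1) by (intro mult_right_mono) auto
          then show ?thesis using \<rho>(1) v by (simp add: ennreal_leI mult.assoc flip: ennreal_mult'')
        qed
        finally have "(\<integral>\<^sup>+y\<in>ball \<omega> \<rho>. w y \<partial>lborel) \<le> ennreal (e / 2 * \<rho> ^ CARD('n)) + ennreal (e / 2 * \<rho> ^ CARD('n))"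
          by (simp add: add_mono)
        also have "\<dots> = ennreal (e * \<rho> ^ CARD('n))" using e \<rho>(1) by (simp flip: ennreal_plus)
        finally show ?thesis .
      qed
      moreover have "min d (e / (2 * v)) > 0" using d(1) e v by simp
      ultimately show "\<exists>\<delta>>0. \<forall>\<rho>. 0 < \<rho> \<and> \<rho> < \<delta> \<longrightarrow> (\<integral>\<^sup>+y\<in>ball (z /\<^sub>R norm z) \<rho>. w y \<partial>lborel) \<le> ennreal (e * \<rho> ^ CARD('n))"
        unfolding \<omega>_def by blast
    qed
    show "(\<lambda>k. 2 / real (k + 3)) \<longlonglongrightarrow> 0"
      by (rule LIMSEQ_ignore_initial_segment[OF lim_const_over_n])
  qed auto
  then show ?thesis
  proof eventually_elim
    case (elim k)
    have "(\<integral>\<^sup>+y\<in>layer (2 / real (k + 3)). ennreal (norm (nb y - y)) \<partial>lborel) = (\<integral>\<^sup>+y\<in>layer (2 / real (k + 3)). w y \<partial>lborel)"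
      by (intro nn_integral_cong) (auto simp: w_def layer_def indicator_def)
    then show ?case using elim by simp
  qed
qed

lemma lebesgue_on_borel_version:
  fixes f :: "real^'n \<Rightarrow> 'b::euclidean_space"
  assumes "f \<in> borel_measurable (lebesgue_on (ball 0 1))"
  obtains g where "g \<in> borel_measurable borel" "AE x in lborel. x \<in> ball 0 1 \<longrightarrow> f x = g x"
proof -
  have "(\<lambda>x. if x \<in> ball 0 1 then f x else 0) \<in> borel_measurable lebesgue"
    using assms by (subst borel_measurable_if) auto
  then obtain g where g: "g \<in> borel_measurable borel" "AE x in lborel. (if x \<in> ball 0 1 then f x else 0) = g x"
    by (rule ex_borel_version)
  from g(2) have "AE x in lborel. x \<in> ball 0 1 \<longrightarrow> f x = g x" by eventually_elim auto
  with g(1) show ?thesis by (rule that)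
qed

lemma AE_lebesgue_on_ball:
  "(AE x in lebesgue_on (ball (0::real^'n) 1). P x) \<longleftrightarrow> (AE x in lborel. x \<in> ball 0 1 \<longrightarrow> P x)"
  by (subst AE_restrict_space_iff) (auto simp: AE_completion_iff)

lemma integral_lebesgue_eq_lborel:
  fixes f g :: "real^'n \<Rightarrow> real"
  assumes [measurable]: "g \<in> borel_measurable borel" and eq: "AE x in lborel. x \<in> ball 0 1 \<longrightarrow> f x = g x"
  shows "(LINT x:ball 0 1|lebesgue. f x) = (\<integral>x. indicat_real (ball 0 1) x * g x \<partial>lborel)"
proof -
  let ?g = "\<lambda>x. indicat_real (ball 0 1) x * g x"
  have gm: "?g \<in> borel_measurable lborel" by measurable
  have eq': "AE x in lebesgue. indicat_real (ball 0 1) x *\<^sub>R f x = ?g x"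
    unfolding AE_completion_iff using eq by eventually_elim (auto simp: indicator_def)
  have gl: "?g \<in> borel_measurable lebesgue" using gm by (rule measurable_completion)
  have "(LINT x:ball 0 1|lebesgue. f x) = (\<integral>x. ?g x \<partial>lebesgue)"
    unfolding set_lebesgue_integral_def
  proof (rule integral_cong_AE[OF _ gl eq'])
    show "(\<lambda>x. indicat_real (ball 0 1) x *\<^sub>R f x) \<in> borel_measurable lebesgue"
      by (rule borel_measurable_AE[OF gl], use eq' in eventually_elim) (rule sym)
  qed
  also have "\<dots> = (\<integral>x. ?g x \<partial>lborel)" by (rule integral_completion[OF gm])
  finally show ?thesis .
qed

text \<open>Componentwise differentiability in the mean of n - x on the ball. Adding the identity
  back changes value and gradient but not the affine defect, since the identity is affine.\<close>

lemma approx_affine_from_weak_derivs: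
  fixes nb :: "real^'n \<Rightarrow> real^'n" and Gb :: "real^'n \<Rightarrow> real^'n^'n"
  assumes nb[measurable]: "nb \<in> borel_measurable borel"
    and w: "\<And>i. weak_deriv (\<lambda>x. indicat_real (ball 0 1) x * (nb x - x) $ i) (\<lambda>x. indicat_real (ball 0 1) x *\<^sub>R (Gb x - mat 1) $ i)"
  shows "AE x in lborel. x \<in> ball 0 1 \<longrightarrow> approx_affine nb x (nb x) (Gb x)"
proof -
  let ?B = "ball (0::real^'n) 1"
  define v where "v i x = indicat_real ?B x * (nb x - x) $ i" for i x
  define V where "V i x = indicat_real ?B x *\<^sub>R (Gb x - mat 1) $ i" for i x
  have w': "weak_deriv (v i) (V i)" for i using w[of i] by (simp add: v_def[abs_def] V_def[abs_def])
  have vm[measurable]: "v i \<in> borel_measurable borel" for i using w'[of i] unfolding weak_deriv_def by auto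
  have "AE x in lborel. \<forall>i\<in>UNIV. \<forall>e>0. \<exists>d>0. \<forall>\<epsilon>. 0 < \<epsilon> \<and> \<epsilon> < d \<longrightarrow>
    (\<integral>\<^sup>+y\<in>ball 0 1. ennreal \<bar>v i (x + \<epsilon> *\<^sub>R y) - v i x - \<epsilon> * (V i x \<bullet> y)\<bar> \<partial>lborel) \<le> ennreal (e * \<epsilon>)"
    by (rule AE_finite_allI) (use weak_deriv_approx_diff[OF w'] in auto)
  then show ?thesis
  proof (eventually_elim, intro impI)
    fix x assume H: "\<forall>i\<in>UNIV. \<forall>e>0. \<exists>d>0. \<forall>\<epsilon>. 0 < \<epsilon> \<and> \<epsilon> < d \<longrightarrow>
      (\<integral>\<^sup>+y\<in>ball 0 1. ennreal \<bar>v i (x + \<epsilon> *\<^sub>R y) - v i x - \<epsilon> * (V i x \<bullet> y)\<bar> \<partial>lborel) \<le> ennreal (e * \<epsilon>)"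
      and x: "x \<in> ?B"
    obtain r where r: "r > 0" "ball x r \<subseteq> ?B" using open_contains_ball[of ?B] x open_ball by blast
    show "approx_affine nb x (nb x) (Gb x)"
      unfolding approx_affine_def
    proof (intro allI impI)
      fix e :: real assume e: "e > 0"
      \<comment> \<open>The Euclidean norm is bounded by the sum over the d components.\<close>
      define e' where "e' = e / real CARD('n)"
      have e': "e' > 0" "real CARD('n) * e' = e" using e by (auto simp: e'_def)
      have "\<forall>i. \<exists>d>0. \<forall>\<epsilon>. 0 < \<epsilon> \<and> \<epsilon> < d \<longrightarrow>
        (\<integral>\<^sup>+y\<in>ball 0 1. ennreal \<bar>v i (x + \<epsilon> *\<^sub>R y) - v i x - \<epsilon> * (V i x \<bullet> y)\<bar> \<partial>lborel) \<le> ennreal (e' * \<epsilon>)"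
        using H e'(1) by blast
      from choice[OF this] obtain D where D': "\<forall>i. D i > 0 \<and> (\<forall>\<epsilon>. 0 < \<epsilon> \<and> \<epsilon> < D i \<longrightarrow>
        (\<integral>\<^sup>+y\<in>ball 0 1. ennreal \<bar>v i (x + \<epsilon> *\<^sub>R y) - v i x - \<epsilon> * (V i x \<bullet> y)\<bar> \<partial>lborel) \<le> ennreal (e' * \<epsilon>))" by (rule exE)
      define d where "d = min r (Min (range D))"
      have d0: "d > 0" using r(1) D' by (simp add: d_def)
      have dD: "d \<le> D i" for i unfolding d_def by (rule min.coboundedI2) simp
      have "(\<integral>\<^sup>+y\<in>ball 0 1. ennreal (norm (nb (x + \<rho> *\<^sub>R y) - nb x - \<rho> *\<^sub>R (Gb x *v y))) \<partial>lborel) \<le> ennreal (e * \<rho>)" if \<rho>: "0 < \<rho>" "\<rho> < d" for \<rho>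
      proof -
        have "(\<integral>\<^sup>+y\<in>ball 0 1. ennreal (norm (nb (x + \<rho> *\<^sub>R y) - nb x - \<rho> *\<^sub>R (Gb x *v y))) \<partial>lborel) \<le>
          (\<integral>\<^sup>+y. (\<Sum>i\<in>UNIV. ennreal \<bar>v i (x + \<rho> *\<^sub>R y) - v i x - \<rho> * (V i x \<bullet> y)\<bar> * indicator (ball 0 1) y) \<partial>lborel)"
        proof (intro nn_integral_mono)
          fix y :: "real^'n"
          show "ennreal (norm (nb (x + \<rho> *\<^sub>R y) - nb x - \<rho> *\<^sub>R (Gb x *v y))) * indicator (ball 0 1) y \<le>
            (\<Sum>i\<in>UNIV. ennreal \<bar>v i (x + \<rho> *\<^sub>R y) - v i x - \<rho> * (V i x \<bullet> y)\<bar> * indicator (ball 0 1) y)"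
          proof (cases "y \<in> ball 0 1")
            case True
            have "\<rho> * norm y \<le> \<rho> * 1" using True \<rho>(1) by (intro mult_left_mono) auto
            moreover have "\<rho> < r" using \<rho>(2) by (simp add: d_def)
            ultimately have "\<rho> * norm y < r" by linarith
            then have "x + \<rho> *\<^sub>R y \<in> ball x r" using \<rho>(1) by (simp add: dist_norm)
            then have inB: "x + \<rho> *\<^sub>R y \<in> ?B" using r(2) by blast
            have comp: "(nb (x + \<rho> *\<^sub>R y) - nb x - \<rho> *\<^sub>R (Gb x *v y)) $ i = v i (x + \<rho> *\<^sub>R y) - v i x - \<rho> * (V i x \<bullet> y)" for i
            proof -
              have "(Gb x *v y) $ i = Gb x $ i \<bullet> y" by (simp add: matrix_vector_mult_def inner_vec_def)
              moreover have "(mat 1 :: real^'n^'n) $ i \<bullet> y = y $ i"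
                using matrix_vector_mul_lid[of y] by (simp add: matrix_vector_mult_def inner_vec_def vec_eq_iff)
              ultimately show ?thesis using inB x by (simp add: v_def V_def inner_diff_left algebra_simps)
            qed
            have "norm (nb (x + \<rho> *\<^sub>R y) - nb x - \<rho> *\<^sub>R (Gb x *v y)) \<le> (\<Sum>i\<in>UNIV. \<bar>v i (x + \<rho> *\<^sub>R y) - v i x - \<rho> * (V i x \<bullet> y)\<bar>)"
              unfolding comp[symmetric] by (rule norm_le_l1_cart)
            then have "ennreal (norm (nb (x + \<rho> *\<^sub>R y) - nb x - \<rho> *\<^sub>R (Gb x *v y))) \<le> ennreal (\<Sum>i\<in>UNIV. \<bar>v i (x + \<rho> *\<^sub>R y) - v i x - \<rho> * (V i x \<bullet> y)\<bar>)"
              by (rule ennreal_leI)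
            also have "\<dots> = (\<Sum>i\<in>UNIV. ennreal \<bar>v i (x + \<rho> *\<^sub>R y) - v i x - \<rho> * (V i x \<bullet> y)\<bar>)"
              by (rule sum_ennreal[symmetric]) simp
            finally show ?thesis using True by simp
          qed simp
        qed
        also have "\<dots> = (\<Sum>i\<in>UNIV. \<integral>\<^sup>+y\<in>ball 0 1. ennreal \<bar>v i (x + \<rho> *\<^sub>R y) - v i x - \<rho> * (V i x \<bullet> y)\<bar> \<partial>lborel)"
          by (rule nn_integral_sum) measurable
        also have "\<dots> \<le> (\<Sum>i\<in>(UNIV :: 'n set). ennreal (e' * \<rho>))"
          using D' \<rho> dD by (intro sum_mono) (auto intro: less_le_trans)
        also have "\<dots> = ennreal (e * \<rho>)"
          using e' \<rho>(1) by (subst sum_ennreal) (auto simp flip: e'(2))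
        finally show ?thesis .
      qed
      with d0 show "\<exists>d>0. \<forall>\<rho>. 0 < \<rho> \<and> \<rho> < d \<longrightarrow>
        (\<integral>\<^sup>+y\<in>ball 0 1. ennreal (norm (nb (x + \<rho> *\<^sub>R y) - nb x - \<rho> *\<^sub>R (Gb x *v y))) \<partial>lborel) \<le> ennreal (e * \<rho>)" by blast
    qed
  qed
qed

text \<open>The gradient is split as identity plus the gradient \<open>W\<close> of a map vanishing
  off the ball. The part quadratic in \<open>W\<close> integrates to 0 by
  \<open>null_lagrangian\<close>, the linear part by \<open>integral_weak_deriv_0\<close>, and the
  constant d(d-1) of the identity remains.\<close>

lemma integral_null_lagrangian:
  fixes nb :: "real^'n \<Rightarrow> real^'n" and Gb :: "real^'n \<Rightarrow> real^'n^'n"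
  assumes n1: "\<And>x. norm (nb x) \<le> 1" and [measurable]: "Gb \<in> borel_measurable borel"
    and w: "\<And>i. weak_deriv (\<lambda>x. indicat_real (ball 0 1) x * (nb x - x) $ i) (\<lambda>x. indicat_real (ball 0 1) x *\<^sub>R (Gb x - mat 1) $ i)"
    and L2: "\<And>i. integrable lborel (\<lambda>x. (norm (indicat_real (ball 0 1) x *\<^sub>R (Gb x - mat 1) $ i))\<^sup>2)"
  shows "has_bochner_integral lborel (\<lambda>x. indicat_real (ball 0 1) x * ((trace (Gb x))\<^sup>2 - trace (Gb x ** Gb x)))
           (real CARD('n) * (real CARD('n) - 1) * unit_vol TYPE('n))"
proof -
  let ?B = "ball (0::real^'n) 1"
  let ?I = "indicat_real ?B"
  let ?d = "real CARD('n)"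
  define v where "v i x = ?I x * (nb x - x) $ i" for i x
  define V where "V i x = ?I x *\<^sub>R (Gb x - mat 1) $ i" for i x
  have w': "weak_deriv (v i) (V i)" for i using w[of i] by (simp add: v_def[abs_def] V_def[abs_def])
  have L2': "integrable lborel (\<lambda>x. (norm (V i x))\<^sup>2)" for i using L2[of i] by (simp add: V_def)
  have iV: "integrable lborel (V i)" for i using w'[of i] unfolding weak_deriv_def by auto
  then have [measurable]: "V i \<in> borel_measurable borel" for i by auto
  have v2: "\<bar>v i x\<bar> \<le> 2" for i x
  proof -
    have "\<bar>(nb x - x) $ i\<bar> \<le> norm (nb x - x)" by (rule component_le_norm_cart)
    also have "\<dots> \<le> norm (nb x) + norm x" by (rule norm_triangle_ineq4)
    finally show ?thesis using n1[of x] by (auto simp: v_def indicator_def)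
  qed
  have prod: "integrable lborel (\<lambda>x. V i x $ k * V j x $ l)" for i j k l
  proof (rule Bochner_Integration.integrable_bound)
    show "integrable lborel (\<lambda>x. (norm (V i x))\<^sup>2 + (norm (V j x))\<^sup>2)" using L2' by auto
    show "AE x in lborel. norm (V i x $ k * V j x $ l) \<le> norm ((norm (V i x))\<^sup>2 + (norm (V j x))\<^sup>2)"
    proof (intro AE_I2)
      fix x
      have "\<bar>V i x $ k\<bar> * \<bar>V j x $ l\<bar> \<le> norm (V i x) * norm (V j x)"
        by (intro mult_mono component_le_norm_cart) auto
      also have "\<dots> \<le> (norm (V i x))\<^sup>2 + (norm (V j x))\<^sup>2"
      proof -
        have "2 * (norm (V i x) * norm (V j x)) \<le> (norm (V i x))\<^sup>2 + (norm (V j x))\<^sup>2"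
          using sum_squares_bound[of "norm (V i x)" "norm (V j x)"] by (simp add: mult.assoc)
        moreover have "0 \<le> norm (V i x) * norm (V j x)" by simp
        ultimately show ?thesis by linarith
      qed
      finally show "norm (V i x $ k * V j x $ l) \<le> norm ((norm (V i x))\<^sup>2 + (norm (V j x))\<^sup>2)"
        by (simp add: abs_mult)
    qed
  qed measurable
  have nl: "(\<integral>x. V i x $ i * V j x $ j \<partial>lborel) = (\<integral>x. V i x $ j * V j x $ i \<partial>lborel)" for i j
    by (rule null_lagrangian[OF w' v2 L2' w' v2 L2'])
  have tr0: "(\<integral>x. V i x $ i \<partial>lborel) = 0" for i
    by (rule integral_weak_deriv_0[OF w']) (auto simp: v_def V_def)
  have iVi: "integrable lborel (\<lambda>x. V i x $ i)" for i
    by (rule integrable_bounded_linear[OF bounded_linear_vec_nth iV])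
  \<comment> \<open>(tr G)^2 - tr G^2 expanded about the identity. The coefficient 2d - 2 of the
    trace is 2d from the square minus 2 from the trace of the square.\<close>
  have eq: "?I x * ((trace (Gb x))\<^sup>2 - trace (Gb x ** Gb x)) =
     (\<Sum>i\<in>UNIV. \<Sum>j\<in>UNIV. V i x $ i * V j x $ j - V i x $ j * V j x $ i) + (2 * ?d - 2) * (\<Sum>i\<in>UNIV. V i x $ i) + ?d * (?d - 1) * ?I x" for x
  proof (cases "x \<in> ?B")
    case True
    define W where "W = Gb x - mat 1"
    have VW: "V i x $ j = W $ i $ j" for i j using True by (simp add: V_def W_def)
    have G: "Gb x = W + mat 1" by (simp add: W_def)
    have t1: "trace (Gb x) = trace W + ?d" by (simp add: G trace_add trace_I)
    have "Gb x ** Gb x = W ** W + W + W + mat 1"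
    proof -
      have "(P + Q) ** S = P ** S + Q ** S" for P Q S :: "real^'n^'n"
        by (simp add: vec_eq_iff matrix_matrix_mult_def distrib_right sum.distrib)
      then show ?thesis by (simp add: G matrix_add_ldistrib)
    qed
    then have t2: "trace (Gb x ** Gb x) = trace (W ** W) + 2 * trace W + ?d"
      by (simp only: trace_add trace_I)
    have t3: "(trace W)\<^sup>2 - trace (W ** W) = (\<Sum>i\<in>UNIV. \<Sum>j\<in>UNIV. W $ i $ i * W $ j $ j - W $ i $ j * W $ j $ i)"
      unfolding trace_def matrix_matrix_mult_def power2_eq_square sum_product by (simp add: sum_subtractf)
    have t4: "(trace W + ?d)\<^sup>2 - (trace (W ** W) + 2 * trace W + ?d) = ((trace W)\<^sup>2 - trace (W ** W)) + (2 * ?d - 2) * trace W + ?d * (?d - 1)"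
      by (simp add: power2_eq_square algebra_simps)
    have t5: "(\<Sum>i\<in>UNIV. W $ i $ i) = trace W" by (simp add: trace_def)
    show ?thesis unfolding VW t1 t2 t4 t5 using t3 True by simp
  next
    case False
    then have "V i x = 0" for i by (simp add: V_def)
    then show ?thesis using False by simp
  qed
  have int2: "has_bochner_integral lborel (\<lambda>x. V i x $ i * V j x $ j - V i x $ j * V j x $ i) 0" for i j
    using has_bochner_integral_diff[OF has_bochner_integral_integrable[OF prod[of i i j j]] has_bochner_integral_integrable[OF prod[of i j j i]]]
    by (simp only: nl[of i j] diff_self)
  have int1: "has_bochner_integral lborel (\<lambda>x. V i x $ i) 0" for i
    using has_bochner_integral_integrable[OF iVi[of i]] by (simp add: tr0)
  have intI: "has_bochner_integral lborel ?I (unit_vol TYPE('n))"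
    using has_bochner_integral_integrable[OF integrable_unit_ball] by simp
  have "has_bochner_integral lborel (\<lambda>x. (\<Sum>i\<in>UNIV. \<Sum>j\<in>UNIV. V i x $ i * V j x $ j - V i x $ j * V j x $ i) + (2 * ?d - 2) * (\<Sum>i\<in>UNIV. V i x $ i) + ?d * (?d - 1) * ?I x)
     ((\<Sum>i\<in>(UNIV::'n set). \<Sum>j\<in>(UNIV::'n set). 0) + (2 * ?d - 2) * (\<Sum>i\<in>(UNIV::'n set). 0) + ?d * (?d - 1) * unit_vol TYPE('n))"
    by (intro has_bochner_integral_add has_bochner_integral_sum has_bochner_integral_mult_right int1 int2 intI)
  then show ?thesis unfolding eq by simp
qed

text \<open>The factor d - 2 is kept on the right instead of being divided out: for d = 2 it is 0 in
  \<open>ennreal\<close>, whatever the Dirichlet integral, and the inequality then refutes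
  membership.\<close>

theorem sobolev_lower_bound:
  fixes n :: "real^'n \<Rightarrow> real^'n"
  assumes d: "CARD('n) \<ge> 2" and n: "n \<in> admissible_Sobolev"
  shows "ennreal (real CARD('n) * (real CARD('n) - 1) * unit_vol TYPE('n)) \<le>
     ennreal (real CARD('n) - 2) * (\<integral>\<^sup>+x\<in>ball 0 1. ennreal ((norm (approx_gradient n x))\<^sup>2) \<partial>lebesgue)"
proof -
  let ?B = "ball (0::real^'n) 1"
  let ?I = "indicat_real ?B"
  obtain G where nL: "L2_on ?B n" and GL: "L2_on ?B G" and weak: "weak_gradient ?B n G"
    using n by (auto simp: admissible_Sobolev_def W12_def)
  have unit: "AE x in lborel. x \<in> ?B \<longrightarrow> norm (n x) = 1"
    using n by (simp add: admissible_Sobolev_def AE_lebesgue_on_ball)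
  have tr: "has_trace ?B n (\<lambda>x. x)" using n by (simp add: admissible_Sobolev_def)
  obtain n0 where n0[measurable]: "n0 \<in> borel_measurable borel" and n0eq: "AE x in lborel. x \<in> ?B \<longrightarrow> n x = n0 x"
    using nL lebesgue_on_borel_version[of n] by (auto simp: L2_on_def)
  obtain Gb where Gb[measurable]: "Gb \<in> borel_measurable borel" and Geq: "AE x in lborel. x \<in> ?B \<longrightarrow> G x = Gb x"
    using GL lebesgue_on_borel_version[of G] by (auto simp: L2_on_def)
  \<comment> \<open>A Borel representative with norm at most 1 everywhere, not just almost
    everywhere, as the averaging and gluing lemmas ask for uniform bounds.\<close>
  define nb where "nb x = (if norm (n0 x) = 1 then n0 x else 0)" for x
  have nb[measurable]: "nb \<in> borel_measurable borel" unfolding nb_def[abs_def] by measurable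
  have nb1: "norm (nb x) \<le> 1" for x by (simp add: nb_def)
  have nbeq: "AE x in lborel. x \<in> ?B \<longrightarrow> n x = nb x" 
    using n0eq unit by eventually_elim (auto simp: nb_def)
  have nbunit: "AE x in lborel. x \<in> ?B \<longrightarrow> norm (nb x) = 1"
    using nbeq unit by eventually_elim auto
  have GL2: "integrable lborel (\<lambda>x. ?I x * (norm (Gb x))\<^sup>2)"
  proof -
    have "integrable (lebesgue_on ?B) (\<lambda>x. (norm (G x))\<^sup>2)" using GL by (simp add: L2_on_def)
    then have i: "integrable lebesgue (\<lambda>x. ?I x *\<^sub>R (norm (G x))\<^sup>2)"
      by (subst (asm) integrable_restrict_space) auto
    have gm: "(\<lambda>x. ?I x * (norm (Gb x))\<^sup>2) \<in> borel_measurable lborel" by measurable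
    have "AE x in lebesgue. ?I x *\<^sub>R (norm (G x))\<^sup>2 = ?I x * (norm (Gb x))\<^sup>2"
      unfolding AE_completion_iff using Geq by eventually_elim (auto simp: indicator_def)
    then have "integrable lebesgue (\<lambda>x. ?I x * (norm (Gb x))\<^sup>2)"
      using i measurable_completion[OF gm] by (subst integrable_cong_AE[symmetric]) auto
    then show ?thesis using integrable_completion[OF gm] by simp
  qed
  have wk: "(\<integral>x. ?I x * (nb x $ i * D\<psi> x $ j) \<partial>lborel) = - (\<integral>x. ?I x * (\<psi> x * Gb x $ i $ j) \<partial>lborel)"
    if t: "test_function ?B \<psi> D\<psi>" for \<psi> D\<psi> i j
  proof -
    have [measurable]: "\<psi> \<in> borel_measurable borel" "D\<psi> \<in> borel_measurable borel" using test_function_continuous[OF t] by auto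
    have "(LINT x:?B|lebesgue. n x $ i * D\<psi> x $ j) = - (LINT x:?B|lebesgue. \<psi> x * G x $ i $ j)"
      using weak t unfolding weak_gradient_def by blast
    moreover have "(LINT x:?B|lebesgue. n x $ i * D\<psi> x $ j) = (\<integral>x. ?I x * (nb x $ i * D\<psi> x $ j) \<partial>lborel)"
      by (rule integral_lebesgue_eq_lborel, measurable, use nbeq in eventually_elim) auto
    moreover have "(LINT x:?B|lebesgue. \<psi> x * G x $ i $ j) = (\<integral>x. ?I x * (\<psi> x * Gb x $ i $ j) \<partial>lborel)"
      by (rule integral_lebesgue_eq_lborel, measurable, use Geq in eventually_elim) auto
    ultimately show ?thesis by simp
  qed
  note glue = glue_weak_deriv[OF nb Gb nb1 GL2 wk trace_imp_layer[OF d tr nb nb1 nbeq]]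
  have aff: "AE x in lborel. x \<in> ?B \<longrightarrow> approx_affine nb x (nb x) (Gb x)"
    by (rule approx_affine_from_weak_derivs[OF nb glue(1)])
  have nbleb: "AE y in lebesgue. y \<in> ?B \<longrightarrow> n y = nb y" using nbeq by (simp add: AE_completion_iff)
  have grad: "AE x in lborel. x \<in> ?B \<longrightarrow> approx_gradient n x = Gb x"
    using aff
  proof (eventually_elim, intro impI)
    fix x assume "x \<in> ?B \<longrightarrow> approx_affine nb x (nb x) (Gb x)" "x \<in> ?B"
    then show "approx_gradient n x = Gb x"
      using approx_cong(3)[OF open_ball _ nbleb, of x] approx_affine_imp_gradient[OF nb] by simp
  qed
  have pt: "AE x in lborel. ?I x * ((trace (Gb x))\<^sup>2 - trace (Gb x ** Gb x)) \<le> (real CARD('n) - 2) * (?I x * (norm (Gb x))\<^sup>2)"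
    using aff nbunit
  proof eventually_elim
    case (elim x)
    show ?case
    proof (cases "x \<in> ?B")
      case True
      have "transpose (Gb x) *v nb x = 0"
        using elim True by (intro tangential[OF nb _ _ open_ball True nbunit]) auto
      from null_lagrangian_le_norm[OF d _ this] elim True show ?thesis by simp
    qed simp
  qed
  note hb = integral_null_lagrangian[OF nb1 Gb glue]
  have "real CARD('n) * (real CARD('n) - 1) * unit_vol TYPE('n) = (\<integral>x. ?I x * ((trace (Gb x))\<^sup>2 - trace (Gb x ** Gb x)) \<partial>lborel)"
    using hb by (rule has_bochner_integral_integral_eq[symmetric])
  also have "\<dots> \<le> (\<integral>x. (real CARD('n) - 2) * (?I x * (norm (Gb x))\<^sup>2) \<partial>lborel)"
    using hb GL2 pt by (intro integral_mono_AE) (auto simp: has_bochner_integral_iff)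
  also have "\<dots> = (real CARD('n) - 2) * (\<integral>x. ?I x * (norm (Gb x))\<^sup>2 \<partial>lborel)" by simp
  finally have "ennreal (real CARD('n) * (real CARD('n) - 1) * unit_vol TYPE('n)) \<le> ennreal (real CARD('n) - 2) * ennreal (\<integral>x. ?I x * (norm (Gb x))\<^sup>2 \<partial>lborel)"
    using d by (subst ennreal_mult[symmetric]) (auto intro!: ennreal_leI)
  also have "ennreal (\<integral>x. ?I x * (norm (Gb x))\<^sup>2 \<partial>lborel) = (\<integral>\<^sup>+x. ennreal (?I x * (norm (Gb x))\<^sup>2) \<partial>lborel)"
    using GL2 by (intro nn_integral_eq_integral[symmetric]) auto
  also have "\<dots> = (\<integral>\<^sup>+x\<in>?B. ennreal ((norm (approx_gradient n x))\<^sup>2) \<partial>lebesgue)"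
    unfolding nn_integral_completion by (rule nn_integral_cong_AE, use grad in eventually_elim) (auto simp: indicator_def)
  finally show ?thesis .
qed

section \<open>The competitor\<close>

text \<open>A cube is removed instead of a ball because its faces lie in coordinate hyperplanes: the
  divergence theorem reduces to the fundamental theorem of calculus along the axes, and the
  Hausdorff measure of the boundary to counting grid cells.\<close>

definition cube :: "real \<Rightarrow> (real^'n) set" where
  "cube r = {x. \<forall>k. \<bar>x $ k\<bar> \<le> r}"

definition cube_bd :: "real \<Rightarrow> (real^'n) set" where
  "cube_bd r = {x \<in> cube r. \<exists>j. \<bar>x $ j\<bar> = r}"

definition hollow :: "real \<Rightarrow> real^'n \<Rightarrow> real^'n" where
  "hollow r x = (if x \<in> cube r then 0 else x /\<^sub>R norm x)"

text \<open>The Jacobian of x/|x|: the projection onto the orthogonal complement of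
  \<open>x\<close>, of rank d - 1, divided by |x|. Hence the d - 1 in its squared norm.\<close>

definition hgrad :: "real^'n \<Rightarrow> real^'n^'n" where
  "hgrad x = (\<chi> i j. ((if i = j then 1 else 0) - x $ i * x $ j / (norm x)\<^sup>2) / norm x)"

definition hollow_grad :: "real \<Rightarrow> real^'n \<Rightarrow> real^'n^'n" where
  "hollow_grad r x = (if x \<in> cube r then 0 else hgrad x)"

lemma vec_borelI:
  fixes f :: "'a \<Rightarrow> 'b::euclidean_space^'n"
  assumes "\<And>i. (\<lambda>x. f x $ i) \<in> borel_measurable M"
  shows "f \<in> borel_measurable M"
proof (subst borel_measurable_euclidean_space, rule ballI)
  fix b :: "'b^'n" assume "b \<in> Basis"
  then obtain i c where b: "b = axis i c" by (auto simp: Basis_vec_def)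
  show "(\<lambda>x. f x \<bullet> b) \<in> borel_measurable M"
    unfolding b inner_axis by (rule borel_measurable_inner[OF assms borel_measurable_const])
qed

lemma closed_cube: "closed (cube r :: (real^'n) set)"
proof -
  have "(cube r :: (real^'n) set) = (\<Inter>k. {x. \<bar>x $ k\<bar> \<le> r})" by (auto simp: cube_def)
  moreover have "closed {x::real^'n. \<bar>x $ k\<bar> \<le> r}" for k
    by (intro closed_Collect_le continuous_intros)
  ultimately show ?thesis by (simp add: closed_INT)
qed

lemma closed_cube_bd: "closed (cube_bd r :: (real^'n) set)"
proof -
  have "(cube_bd r :: (real^'n) set) = cube r \<inter> (\<Union>j. {x. \<bar>x $ j\<bar> = r})" by (auto simp: cube_bd_def)
  moreover have "closed {x::real^'n. \<bar>x $ k\<bar> = r}" for k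
    by (intro closed_Collect_eq continuous_intros)
  ultimately show ?thesis using closed_cube[of r, where 'n='n] by (simp add: closed_Int closed_UN)
qed

lemma cube_measurable[measurable]: "cube r \<in> sets borel" "cube_bd r \<in> sets borel"
  by (simp_all add: borel_closed closed_cube closed_cube_bd)

lemma open_cube_interior: "open (cube r - cube_bd r :: (real^'n) set)"
proof -
  have "(cube r - cube_bd r :: (real^'n) set) = (\<Inter>k. {x. \<bar>x $ k\<bar> < r})" by (auto simp: cube_def cube_bd_def order.strict_iff_order)
  moreover have "open {x::real^'n. \<bar>x $ k\<bar> < r}" for k
    by (intro open_Collect_less continuous_intros)
  ultimately show ?thesis by (simp add: open_INT)
qed

lemma cube_bd_null: "(cube_bd r :: (real^'n) set) \<in> null_sets lborel"
proof -
  have "{x::real^'n. x $ j = a} \<in> null_sets lebesgue" for j a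
    using negligible_standard_hyperplane[of "axis j 1 :: real^'n" a]
    by (simp add: cart_eq_inner_axis axis_in_Basis_iff negligible_iff_null_sets)
  then have "(\<Union>j. {x::real^'n. x $ j = r} \<union> {x. x $ j = - r}) \<in> null_sets lebesgue"
    by (intro null_sets_UN' null_sets.Un) auto
  moreover have "(cube_bd r :: (real^'n) set) \<subseteq> (\<Union>j. {x::real^'n. x $ j = r} \<union> {x. x $ j = - r})"
    by (auto simp: cube_bd_def abs_if split: if_splits)
  moreover have "(cube_bd r :: (real^'n) set) \<in> sets lebesgue" by simp
  ultimately have "(cube_bd r :: (real^'n) set) \<in> null_sets lebesgue" using null_sets_subset by blast
  then show ?thesis by (simp add: null_sets_def)
qed

lemma norm_gt_outside_cube: "x \<notin> cube r \<Longrightarrow> r < norm x"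
  using component_le_norm_cart[of x] by (auto simp: cube_def not_le intro: less_le_trans)

lemma norm_le_in_cube: "x \<in> cube r \<Longrightarrow> norm (x::real^'n) \<le> real CARD('n) * r"
  using norm_le_l1_cart[of x] sum_bounded_above[of UNIV "\<lambda>i. \<bar>x $ i\<bar>" r] by (auto simp: cube_def)

lemma hollow_measurable[measurable]: "hollow r \<in> borel_measurable borel"
  unfolding hollow_def[abs_def] by measurable

lemma hgrad_measurable[measurable]: "hgrad \<in> borel_measurable borel"
  by (intro vec_borelI) (simp add: hgrad_def)

lemma hollow_grad_measurable[measurable]: "hollow_grad r \<in> borel_measurable borel"
  unfolding hollow_grad_def[abs_def] by measurable

lemma norm_hollow: "r > 0 \<Longrightarrow> norm (hollow r x) \<le> 1"
  using norm_gt_outside_cube[of x r] by (cases "norm x = 0") (auto simp: hollow_def)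

lemma norm_hgrad:
  assumes "x \<noteq> (0 :: real^'n)"
  shows "(norm (hgrad x))\<^sup>2 = (real CARD('n) - 1) / (norm x)\<^sup>2"
proof -
  define s where "s = (norm x)\<^sup>2"
  have s: "s > 0" using assms by (simp add: s_def)
  have ss: "(\<Sum>i\<in>UNIV. (x $ i)\<^sup>2) = s" unfolding s_def power2_norm_eq_inner inner_vec_def by (simp add: power2_eq_square)
  have "(norm (hgrad x))\<^sup>2 = (\<Sum>i\<in>UNIV. \<Sum>j\<in>UNIV. ((if i = j then 1 else 0) - x $ i * x $ j / s)\<^sup>2 / s)"
    unfolding norm_matrix_square by (simp add: hgrad_def s_def power_divide)
  also have "\<dots> = (\<Sum>i\<in>UNIV. \<Sum>j\<in>UNIV. (if i = j then 1 - 2 * (x $ i)\<^sup>2 / s else 0) / s + (x $ i)\<^sup>2 * (x $ j)\<^sup>2 / s\<^sup>2 / s)"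
    using s by (intro sum.cong refl) (auto simp: power2_eq_square field_simps)
  also have "\<dots> = (\<Sum>i\<in>UNIV. (1 - 2 * (x $ i)\<^sup>2 / s) / s) + (\<Sum>i\<in>UNIV. (x $ i)\<^sup>2 * s / s\<^sup>2 / s)"
    by (simp add: sum.distrib sum_distrib_left[symmetric] sum_divide_distrib[symmetric] ss)
  also have "\<dots> = (real CARD('n) - 2 * s / s) / s + s * s / s\<^sup>2 / s"
    by (simp only: sum_divide_distrib[symmetric] sum_distrib_right[symmetric] sum_distrib_left[symmetric] sum_subtractf ss) simp
  also have "\<dots> = (real CARD('n) - 1) / s"
    using s by (simp add: power2_eq_square field_simps)
  finally show ?thesis by (simp add: s_def)
qed

lemma hedgehog_derivative:
  assumes "x \<noteq> (0 :: real^'n)"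
  shows "((\<lambda>x. x /\<^sub>R norm x) has_derivative (\<lambda>h. hgrad x *v h)) (at x)"
proof -
  have "GDERIV (\<lambda>x. inverse (norm x)) x :> - (inverse (norm x))\<^sup>2 *\<^sub>R sgn x"
    using assms by (intro GDERIV_inverse GDERIV_norm) auto
  then have d: "((\<lambda>x. inverse (norm x)) has_derivative (\<lambda>h. h \<bullet> (- (inverse (norm x))\<^sup>2 *\<^sub>R sgn x))) (at x)"
    by (simp add: gderiv_def)
  have "((\<lambda>x. x /\<^sub>R norm x) has_derivative (\<lambda>h. inverse (norm x) *\<^sub>R h + (h \<bullet> (- (inverse (norm x))\<^sup>2 *\<^sub>R sgn x)) *\<^sub>R x)) (at x)"
    by (rule has_derivative_scaleR[OF d has_derivative_ident])
  moreover have "inverse (norm x) *\<^sub>R h + (h \<bullet> (- (inverse (norm x))\<^sup>2 *\<^sub>R sgn x)) *\<^sub>R x = hgrad x *v h" for h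
  proof -
    have "(hgrad x *v h) $ i = h $ i / norm x - x $ i * (x \<bullet> h) / (norm x)^3" for i
    proof -
      have "(hgrad x *v h) $ i = (\<Sum>j\<in>UNIV. (if i = j then h $ j / norm x else 0) - x $ i * (x $ j * h $ j) / (norm x)^3)"
        unfolding matrix_vector_mult_def hgrad_def
        using assms by (simp, intro sum.cong refl) (auto simp: power2_eq_square power3_eq_cube field_simps)
      then show ?thesis
        by (simp add: sum_subtractf inner_vec_def sum_distrib_left sum_divide_distrib)
    qed
    note comp = this
    show ?thesis
    proof (subst vec_eq_iff, rule allI)
      fix i
      have "norm x \<noteq> 0" using assms by simp
      then show "(inverse (norm x) *\<^sub>R h + (h \<bullet> (- (inverse (norm x))\<^sup>2 *\<^sub>R sgn x)) *\<^sub>R x) $ i = (hgrad x *v h) $ i"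
        unfolding comp by (simp add: sgn_div_norm inner_commute field_simps power2_eq_square power3_eq_cube)
    qed
  qed
  ultimately show ?thesis by simp
qed

lemma approx_affine_of_derivative:
  fixes u :: "real^'n \<Rightarrow> real^'m"
  assumes "(u has_derivative (\<lambda>h. A *v h)) (at x)"
  shows "approx_affine u x (u x) A"
  unfolding approx_affine_def
proof (intro allI impI)
  fix e :: real assume e: "e > 0"
  define e' where "e' = e / unit_vol TYPE('n)"
  have e': "e' > 0" using e unit_vol_pos[where 'n='n] by (simp add: e'_def)
  from assms[unfolded has_derivative_at_alt] e' obtain d where d: "d > 0" 
    "\<And>y. norm (y - x) < d \<Longrightarrow> norm (u y - u x - A *v (y - x)) \<le> e' * norm (y - x)" by blast
  have "(\<integral>\<^sup>+y\<in>ball 0 1. ennreal (norm (u (x + \<rho> *\<^sub>R y) - u x - \<rho> *\<^sub>R (A *v y))) \<partial>lborel) \<le> ennreal (e * \<rho>)" if \<rho>: "0 < \<rho>" "\<rho> < d" for \<rho>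
  proof -
    have "(\<integral>\<^sup>+y\<in>ball 0 1. ennreal (norm (u (x + \<rho> *\<^sub>R y) - u x - \<rho> *\<^sub>R (A *v y))) \<partial>lborel) \<le> (\<integral>\<^sup>+y. ennreal (e' * \<rho>) * indicator (ball (0::real^'n) 1) y \<partial>lborel)"
    proof (intro nn_integral_mono)
      fix y :: "real^'n"
      have "norm (u (x + \<rho> *\<^sub>R y) - u x - \<rho> *\<^sub>R (A *v y)) \<le> e' * \<rho>" if "y \<in> ball 0 1"
      proof -
        have le: "\<rho> * norm y \<le> \<rho> * 1" using that \<rho>(1) by (intro mult_left_mono) auto
        then have "norm ((x + \<rho> *\<^sub>R y) - x) < d" using \<rho> by (simp only: add_diff_cancel_left' norm_scaleR abs_of_pos)
        from d(2)[OF this] have "norm (u (x + \<rho> *\<^sub>R y) - u x - \<rho> *\<^sub>R (A *v y)) \<le> e' * (\<rho> * norm y)"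
          using \<rho>(1) by (simp add: matrix_vector_mult_scaleR)
        also have "\<dots> \<le> e' * (\<rho> * 1)" by (rule mult_left_mono[OF le]) (use e' in simp)
        finally show ?thesis by simp
      qed
      then show "ennreal (norm (u (x + \<rho> *\<^sub>R y) - u x - \<rho> *\<^sub>R (A *v y))) * indicator (ball 0 1) y \<le> ennreal (e' * \<rho>) * indicator (ball 0 1) y"
        by (cases "y \<in> ball 0 1") (auto intro: ennreal_leI)
    qed
    also have "\<dots> = ennreal (e' * \<rho>) * ennreal (unit_vol TYPE('n))"
      by (simp add: nn_integral_cmult_indicator emeasure_unit_ball)
    also have "\<dots> = ennreal (e * \<rho>)"
      using \<rho> e e' unit_vol_pos[where 'n='n] by (simp add: e'_def flip: ennreal_mult)
    finally show ?thesis .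
  qed
  with d(1) show "\<exists>d>0. \<forall>\<rho>. 0 < \<rho> \<and> \<rho> < d \<longrightarrow>
     (\<integral>\<^sup>+y\<in>ball 0 1. ennreal (norm (u (x + \<rho> *\<^sub>R y) - u x - \<rho> *\<^sub>R (A *v y))) \<partial>lborel) \<le> ennreal (e * \<rho>)" by blast
qed

lemma hollow_approx_affine:
  assumes r: "r > 0" and x: "x \<notin> cube_bd r"
  shows "approx_affine (hollow r) x (hollow r x) (hollow_grad r x)"
proof (rule approx_affine_of_derivative, cases "x \<in> cube r")
  case True
  have "((\<lambda>x. 0 :: real^'a) has_derivative (\<lambda>h. 0)) (at x)" by (rule has_derivative_const)
  then have "(hollow r has_derivative (\<lambda>h. 0)) (at x)"
    by (rule has_derivative_transform_within_open[OF _ open_cube_interior[of r]]) (use True x in \<open>auto simp: hollow_def\<close>)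
  moreover have "(*v) (0 :: real^'a^'a) = (\<lambda>h. 0)" by (rule ext) simp
  ultimately show "(hollow r has_derivative (*v) (hollow_grad r x)) (at x)"
    using True by (simp only: hollow_grad_def if_True)
next
  case False
  then have "x \<noteq> 0" using norm_gt_outside_cube[OF False] r by auto
  have "open (- cube r :: (real^'a) set)" using closed_cube by blast
  from has_derivative_transform_within_open[OF hedgehog_derivative[OF \<open>x \<noteq> 0\<close>] this, of "hollow r"]
  show "(hollow r has_derivative (*v) (hollow_grad r x)) (at x)"
    using False by (simp add: hollow_grad_def hollow_def)
qed

lemma hollow_approx_gradient:
  assumes "r > 0" "x \<notin> cube_bd r"
  shows "approx_gradient (hollow r) x = hollow_grad r x"
  by (rule approx_affine_imp_gradient[OF hollow_measurable hollow_approx_affine[OF assms]])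

text \<open>At a boundary point there is a set of directions pointing into the cube and one pointing
  out of it, both of positive volume and independent of the scale. The map is 0 along the first and
  has norm 1 along the second, which no single approximate limit tolerates.\<close>

lemma hollow_no_limit:
  fixes x :: "real^'n"
  assumes r: "r > 0" and small: "real CARD('n) * r < 1" and x: "x \<in> cube_bd r"
  shows "\<not> approx_limit (hollow r) x z"
proof
  assume lim: "approx_limit (hollow r) x z"
  have xc: "x \<in> cube r" using x by (simp add: cube_bd_def)
  obtain j where j: "\<bar>x $ j\<bar> = r" using x by (auto simp: cube_bd_def)
  have nx: "norm x < 1" using norm_le_in_cube[OF xc] small by linarith
  have r1: "r < 1"
  proof -
    have "r * 1 \<le> real CARD('n) * r" using r by simp
    then show ?thesis using small by linarith
  qed
  \<comment> \<open>If the rescaled map stays at distance at least \<open>c\<close> from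
    \<open>z\<close> on one set \<open>S\<close> at all small scales, its mean deviation is at least
    c|S|; so \<open>c\<close> or the measure of \<open>S\<close> is 0.\<close>
  have key: "c * measure lborel S = 0"
    if S: "S \<in> sets borel" "S \<subseteq> ball 0 1" and c: "c \<ge> 0"
      and le: "\<And>\<rho> y. 0 < \<rho> \<Longrightarrow> \<rho> < 1 \<Longrightarrow> y \<in> S \<Longrightarrow> c \<le> norm (hollow r (x + \<rho> *\<^sub>R y) - z)" for S c
  proof -
    have fin: "emeasure lborel S < \<infinity>" 
      using emeasure_mono[OF S(2), of lborel] emeasure_lborel_ball_finite[of "0::real^'n" 1] S(1) by (auto intro: le_less_trans)
    have "c * measure lborel S \<le> e" if e: "e > 0" for e
    proof -
      from lim[unfolded approx_limit_iff[OF hollow_measurable], rule_format, OF e] obtain d where d: "d > 0"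
        "\<And>\<rho>. 0 < \<rho> \<Longrightarrow> \<rho> < d \<Longrightarrow> (\<integral>\<^sup>+y\<in>ball 0 1. ennreal (norm (hollow r (x + \<rho> *\<^sub>R y) - z)) \<partial>lborel) \<le> ennreal e" by blast
      define \<rho> where "\<rho> = min d 1 / 2"
      have \<rho>: "0 < \<rho>" "\<rho> < d" "\<rho> < 1" using d(1) by (auto simp: \<rho>_def)
      have "ennreal (c * measure lborel S) = ennreal c * emeasure lborel S"
        using c fin by (simp add: ennreal_mult emeasure_eq_ennreal_measure less_top)
      also have "\<dots> = (\<integral>\<^sup>+y. ennreal c * indicator S y \<partial>lborel)" using S(1) by (simp add: nn_integral_cmult_indicator)
      also have "\<dots> \<le> (\<integral>\<^sup>+y\<in>ball 0 1. ennreal (norm (hollow r (x + \<rho> *\<^sub>R y) - z)) \<partial>lborel)"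
        using le[OF \<rho>(1,3)] S(2) by (intro nn_integral_mono) (auto simp: indicator_def intro!: ennreal_leI)
      also have "\<dots> \<le> ennreal e" by (rule d(2)[OF \<rho>(1,2)])
      finally show ?thesis using e by simp
    qed
    then have "c * measure lborel S \<le> 0" by (rule field_le_epsilon[of _ 0, simplified])
    then show ?thesis using mult_nonneg_nonneg[OF c measure_nonneg[of lborel S]] by linarith
  qed
  \<comment> \<open>Directions within r/2 of -x/2 point into the cube: x + \<rho> y combines (1 -
    \<rho>/2)x with a vector whose entries are at most \<rho> r/2. Here the map is 0, which forces z
    = 0.\<close>
  have "norm z * measure lborel (ball (- (1/2) *\<^sub>R x) (r/2)) = 0"
  proof (rule key)
    show "ball (- (1/2) *\<^sub>R x) (r/2) \<subseteq> ball 0 1"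
    proof
      fix y assume "y \<in> ball (- (1/2) *\<^sub>R x) (r/2)"
      then have "norm (y - - (1/2) *\<^sub>R x) < r/2" by (simp only: mem_ball dist_norm norm_minus_commute)
      then show "y \<in> ball 0 1" using norm_triangle_ineq[of "y - - (1/2) *\<^sub>R x" "- (1/2) *\<^sub>R x"] nx r1 by simp
    qed
    fix \<rho> :: real and y assume \<rho>: "0 < \<rho>" "\<rho> < 1" and "y \<in> ball (- (1/2) *\<^sub>R x) (r/2)"
    then have b: "norm (y - - (1/2) *\<^sub>R x) < r/2" by (simp only: mem_ball dist_norm norm_minus_commute)
    have "x + \<rho> *\<^sub>R y \<in> cube r"
      unfolding cube_def
    proof safe
      fix k
      have "\<bar>(y - - (1/2) *\<^sub>R x) $ k\<bar> \<le> r/2" using component_le_norm_cart[of "y - - (1/2) *\<^sub>R x" k] b by linarith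
      then have yk: "\<bar>y $ k + x $ k / 2\<bar> \<le> r/2" by simp
      have xk: "\<bar>x $ k\<bar> \<le> r" using xc by (simp add: cube_def)
      have "(x + \<rho> *\<^sub>R y) $ k = (1 - \<rho> / 2) * x $ k + \<rho> * (y $ k + x $ k / 2)" by (simp add: algebra_simps)
      also have "\<bar>\<dots>\<bar> \<le> \<bar>(1 - \<rho> / 2) * x $ k\<bar> + \<bar>\<rho> * (y $ k + x $ k / 2)\<bar>" by (rule abs_triangle_ineq)
      also have "\<dots> \<le> (1 - \<rho> / 2) * r + \<rho> * (r / 2)"
        unfolding abs_mult using \<rho> xk yk by (intro add_mono mult_mono) auto
      also have "\<dots> = r" by (simp add: algebra_simps)
      finally show "\<bar>(x + \<rho> *\<^sub>R y) $ k\<bar> \<le> r" .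
    qed
    then show "norm z \<le> norm (hollow r (x + \<rho> *\<^sub>R y) - z)" by (simp add: hollow_def)
  qed auto
  then have z0: "z = 0" using r by simp
  have sx: "\<bar>sgn (x $ j)\<bar> = 1" using j r by (auto simp: abs_sgn_eq)
  \<comment> \<open>A ball of radius 1/2 about half the outward normal: the \<open>j\<close>-th
    entry of each direction has the sign of x_j, so every step leaves the cube through that face and
    the map has norm 1.\<close>
  have "1 * measure lborel (ball ((sgn (x $ j) / 2) *\<^sub>R axis j 1 :: real^'n) (1/2)) = 0"
  proof (rule key)
    let ?a = "(sgn (x $ j) / 2) *\<^sub>R axis j 1 :: real^'n"
    have na: "norm ?a = 1/2" using sx by (simp add: norm_axis_1)
    show "ball ?a (1/2) \<subseteq> ball 0 1"
    proof
      fix y assume "y \<in> ball ?a (1/2)"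
      then have "norm (y - ?a) < 1/2" by (simp only: mem_ball dist_norm norm_minus_commute)
      then show "y \<in> ball 0 1" using norm_triangle_ineq[of "y - ?a" ?a] na by simp
    qed
    fix \<rho> :: real and y assume \<rho>: "0 < \<rho>" "\<rho> < 1" and "y \<in> ball ?a (1/2)"
    then have "norm (y - ?a) < 1/2" by (simp only: mem_ball dist_norm norm_minus_commute)
    then have "\<bar>(y - ?a) $ j\<bar> < 1/2" using component_le_norm_cart[of "y - ?a" j] by linarith
    then have yj: "\<bar>y $ j - sgn (x $ j) / 2\<bar> < 1/2" by (simp add: axis_def)
    have "r < \<bar>(x + \<rho> *\<^sub>R y) $ j\<bar>"
    proof (cases "x $ j > 0")
      case True
      have "y $ j > 0" using yj unfolding sgn_pos[OF True] by linarith
      then have "\<rho> * y $ j > 0" using \<rho>(1) by simp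
      then show ?thesis using True j by simp
    next
      case False
      then have neg: "x $ j < 0" using j r by auto
      have "y $ j < 0" using yj unfolding sgn_neg[OF neg] by linarith
      then have "\<rho> * y $ j < 0" using \<rho>(1) by (simp add: mult_pos_neg)
      then show ?thesis using neg j by simp
    qed
    then have out: "x + \<rho> *\<^sub>R y \<notin> cube r" by (auto simp: cube_def not_le)
    then have "x + \<rho> *\<^sub>R y \<noteq> 0" using norm_gt_outside_cube[OF out] r by auto
    then show "1 \<le> norm (hollow r (x + \<rho> *\<^sub>R y) - z)" using out z0 by (simp add: hollow_def)
  qed auto
  then show False by simp
qed

lemma hollow_discontinuity_set:
  fixes \<Omega> :: "(real^'n) set"
  assumes r: "r > 0" and small: "real CARD('n) * r < 1"
  shows "approx_discontinuity_set \<Omega> (hollow r) = \<Omega> \<inter> cube_bd r"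
  unfolding approx_discontinuity_set_def
  using hollow_no_limit[OF r small] approx_affine_imp_limit[OF hollow_measurable hollow_approx_affine[OF r]] by blast

section \<open>The Hausdorff measure of the boundary of a cube\<close>

lemma hausdorff_content_finite_cover:
  fixes C :: "'i \<Rightarrow> 'a::metric_space set"
  assumes I: "finite I" and E: "E \<subseteq> (\<Union>i\<in>I. C i)" and \<delta>: "\<delta> > 0"
    and C: "\<And>i. i \<in> I \<Longrightarrow> bounded (C i) \<and> diameter (C i) \<le> \<delta>"
  shows "hausdorff_content s \<delta> E \<le> (\<Sum>i\<in>I. hausdorff_weight s (C i))"
proof -
  obtain h where h: "bij_betw h {0..<card I} I" using ex_bij_betw_nat_finite[OF I] by blast
  \<comment> \<open>Hausdorff content uses sequences of sets. The finite family is padded with empty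
    sets, whose weight is 0 by convention.\<close>
  define D where "D k = (if k < card I then C (h k) else {})" for k
  have hI: "h k \<in> I" if "k < card I" for k using h that by (auto simp: bij_betw_def)
  have "D \<in> {C :: nat \<Rightarrow> 'a set. E \<subseteq> (\<Union>i. C i) \<and> (\<forall>i. bounded (C i) \<and> diameter (C i) \<le> \<delta>)}"
  proof (intro CollectI conjI allI)
    show "E \<subseteq> (\<Union>i. D i)"
    proof
      fix x assume "x \<in> E"
      then obtain i where i: "i \<in> I" "x \<in> C i" using E by blast
      then obtain k where "k < card I" "h k = i" using h by (force simp: bij_betw_def)
      then have "x \<in> D k" using i by (simp add: D_def)
      then show "x \<in> (\<Union>i. D i)" by blast
    qed
    show "bounded (D k)" "diameter (D k) \<le> \<delta>" for k
      using C[OF hI] \<delta> by (auto simp: D_def)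
  qed
  then have "hausdorff_content s \<delta> E \<le> (\<Sum>k. hausdorff_weight s (D k))"
    unfolding hausdorff_content_def by (rule INF_lower)
  also have "\<dots> = (\<Sum>k\<in>{0..<card I}. hausdorff_weight s (D k))"
    by (rule suminf_finite) (auto simp: D_def hausdorff_weight_def)
  also have "\<dots> = (\<Sum>k\<in>{0..<card I}. hausdorff_weight s (C (h k)))"
    by (intro sum.cong) (auto simp: D_def)
  also have "\<dots> = (\<Sum>i\<in>I. hausdorff_weight s (C i))" by (rule sum.reindex_bij_betw[OF h])
  finally show ?thesis .
qed

text \<open>Each of the 2d faces is cut into N^{d-1} cells of half diameter at most dr/N, by the l^1
  bound. The total weight does not depend on \<open>N\<close>, so it bounds the content for every
  \<delta>. The bound is not sharp, but only its order r^{d-1} matters.\<close>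

lemma hausdorff_cube_bd:
  fixes r :: real
  assumes r: "r > 0"
  shows "hausdorff_measure (CARD('n) - 1) (cube_bd r :: (real^'n) set) \<le>
    ennreal (2 * real CARD('n) * unit_ball_vol (real (CARD('n) - 1)) * (real CARD('n) * r) ^ (CARD('n) - 1))"
proof -
  define s where "s = CARD('n) - 1"
  define d where "d = real CARD('n)"
  have d: "d \<ge> 1" by (simp add: d_def Suc_leI)
  have "hausdorff_content s \<delta> (cube_bd r :: (real^'n) set) \<le> ennreal (2 * d * unit_ball_vol (real s) * (d * r) ^ s)" if \<delta>: "\<delta> > 0" for \<delta>
  proof -
    obtain N :: nat where Nd: "2 * d * r / \<delta> < real N" using reals_Archimedean2 by blast
    have "0 < 2 * d * r / \<delta>" using d r \<delta> by simp
    then have N0: "0 < real N" using Nd by linarith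
    have "2 * d * r \<le> \<delta> * real N" using Nd \<delta> by (simp add: pos_divide_less_eq mult.commute less_imp_le)
    then have N: "N > 0" "2 * d * r / real N \<le> \<delta>" using N0 by (simp_all add: pos_divide_le_eq)
    define I where "I = (UNIV :: 'n set) \<times> {1, -1 :: real}"
    \<comment> \<open>The fixed coordinate \<open>j\<close> receives the dummy index 0, so that
      functions on all coordinates enumerate the N^{d-1} cells of a face.\<close>
    define P where "P j = (\<Pi>\<^sub>E l\<in>(UNIV :: 'n set). if l = j then {0} else {..<N})" for j
    define J where "J = Sigma I (\<lambda>(j, b). P j)"
    define C where "C = (\<lambda>((j, b), f). {x :: real^'n. x $ j = b * r \<and> 
       (\<forall>l. l \<noteq> j \<longrightarrow> - r + 2 * r * real (f l) / real N \<le> x $ l \<and> x $ l \<le> - r + 2 * r * (real (f l) + 1) / real N)})"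
    have cP: "card (P j) = N ^ s" for j
    proof -
      have "card (P j) = (\<Prod>l\<in>(UNIV :: 'n set). card (if l = j then {0} else {..<N}))"
        unfolding P_def by (rule card_PiE) simp
      also have "\<dots> = (\<Prod>l\<in>UNIV - {j}. N)" by (subst prod.remove[of _ j]) (auto intro!: prod.cong)
      finally show ?thesis by (simp add: s_def card_Diff_singleton)
    qed
    have finP: "finite (P j)" for j unfolding P_def by (intro finite_PiE) auto
    have finJ: "finite J" unfolding J_def I_def using finP by auto
    have cJ: "real (card J) = 2 * d * real N ^ s"
    proof -
      have "card J = (\<Sum>p\<in>I. card (case p of (j, b) \<Rightarrow> P j))"
        unfolding J_def by (rule card_SigmaI) (auto simp: I_def finP)
      also have "\<dots> = (\<Sum>p\<in>I. N ^ s)" by (intro sum.cong refl) (auto simp: cP)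
      also have "\<dots> = card I * N ^ s" by simp
      also have "card I = 2 * CARD('n)" by (simp add: I_def card_cartesian_product)
      finally show ?thesis by (simp add: d_def)
    qed
    have diam: "norm (x - y) \<le> 2 * d * r / real N" if "p \<in> J" "x \<in> C p" "y \<in> C p" for p x y
    proof -
      obtain j b f where p: "p = ((j, b), f)" by (metis prod.collapse)
      have "\<bar>(x - y) $ l\<bar> \<le> 2 * r / real N" for l
      proof (cases "l = j")
        case True
        then show ?thesis using that p r by (simp add: C_def)
      next
        case False
        have "2 * r * (real (f l) + 1) / real N = 2 * r * real (f l) / real N + 2 * r / real N"
          by (simp add: distrib_left add_divide_distrib)
        moreover have "- r + 2 * r * real (f l) / real N \<le> x $ l" "x $ l \<le> - r + 2 * r * (real (f l) + 1) / real N"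
          "- r + 2 * r * real (f l) / real N \<le> y $ l" "y $ l \<le> - r + 2 * r * (real (f l) + 1) / real N"
          using that p False by (auto simp: C_def)
        ultimately show ?thesis unfolding vector_minus_component by linarith
      qed
      then have "(\<Sum>l\<in>UNIV. \<bar>(x - y) $ l\<bar>) \<le> of_nat (card (UNIV :: 'n set)) * (2 * r / real N)"
        by (intro sum_bounded_above) auto
      from order_trans[OF norm_le_l1_cart this] show ?thesis by (simp add: d_def ac_simps)
    qed
    have dN: "0 \<le> 2 * d * r / real N" using d r by simp
    have diam': "diameter (C p) \<le> 2 * d * r / real N" if "p \<in> J" for p
      using diam[OF that] dN by (intro diameter_le) auto
    have bdd: "bounded (C p)" if "p \<in> J" for p
    proof (cases "C p = {}")
      case False
      then obtain y where y: "y \<in> C p" by auto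
      have "C p \<subseteq> cball y (2 * d * r / real N)" using diam[OF that y] by (auto simp: dist_norm)
      then show ?thesis by (meson bounded_cball bounded_subset)
    qed simp
    have cover: "cube_bd r \<subseteq> (\<Union>p\<in>J. C p)"
    proof
      fix x :: "real^'n" assume x: "x \<in> cube_bd r"
      then obtain j where j: "\<bar>x $ j\<bar> = r" by (auto simp: cube_bd_def)
      have xc: "\<bar>x $ l\<bar> \<le> r" for l using x by (auto simp: cube_bd_def cube_def)
      define b where "b = sgn (x $ j)"
      have b: "b \<in> {1, -1}" "x $ j = b * r" using j r by (auto simp: b_def sgn_if abs_if split: if_splits)
      define q where "q l = (x $ l + r) * real N / (2 * r)" for l
      \<comment> \<open>The minimum is for x_l = r, where the rounded index would be
        \<open>N\<close>; that point belongs to the last cell.\<close>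
      define f where "f l = (if l = j then 0 else min (nat \<lfloor>q l\<rfloor>) (N - 1))" for l
      have q: "0 \<le> q l" "q l \<le> real N" for l
      proof -
        have "- r \<le> x $ l" "x $ l \<le> r" using xc[of l] by auto
        then show "0 \<le> q l" using r by (simp add: q_def)
        have "(x $ l + r) * real N \<le> (2 * r) * real N" using \<open>x $ l \<le> r\<close> by (intro mult_right_mono) auto
        then show "q l \<le> real N" using r by (simp add: q_def divide_le_eq mult.commute)
      qed
      have f: "real (f l) \<le> q l" "q l \<le> real (f l) + 1" if "l \<noteq> j" for l
      proof -
        have n: "real (nat \<lfloor>q l\<rfloor>) = of_int \<lfloor>q l\<rfloor>" using q(1)[of l] by simp
        have fl: "real (nat \<lfloor>q l\<rfloor>) \<le> q l" "q l < real (nat \<lfloor>q l\<rfloor>) + 1" unfolding n by linarith+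
        show "real (f l) \<le> q l" using fl(1) that by (simp add: f_def min_def)
        show "q l \<le> real (f l) + 1"
        proof (cases "nat \<lfloor>q l\<rfloor> \<le> N - 1")
          case True
          then show ?thesis using fl(2) that by (simp add: f_def)
        next
          case False
          then have "f l = N - 1" using that by (simp add: f_def)
          then show ?thesis using q(2)[of l] N(1) by (simp add: of_nat_diff)
        qed
      qed
      have xq: "x $ l = - r + 2 * r * q l / real N" for l using r N(1) by (simp add: q_def)
      have "((j, b), f) \<in> J"
        using b(1) N(1) by (auto simp: J_def I_def P_def f_def PiE_iff)
      moreover have "x \<in> C ((j, b), f)"
        unfolding C_def
      proof (simp only: case_prod_conv mem_Collect_eq, intro conjI allI impI)
        show "x $ j = b * r" by (rule b(2))
        fix l assume l: "l \<noteq> j"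
        have "2 * r * real (f l) / real N \<le> 2 * r * q l / real N"
          using f(1)[OF l] r by (intro divide_right_mono mult_left_mono) auto
        then show "- r + 2 * r * real (f l) / real N \<le> x $ l" unfolding xq by simp
        have "2 * r * q l / real N \<le> 2 * r * (real (f l) + 1) / real N"
          using f(2)[OF l] r by (intro divide_right_mono mult_left_mono) auto
        then show "x $ l \<le> - r + 2 * r * (real (f l) + 1) / real N" unfolding xq by simp
      qed
      ultimately show "x \<in> (\<Union>p\<in>J. C p)" by blast
    qed
    have "hausdorff_content s \<delta> (cube_bd r :: (real^'n) set) \<le> (\<Sum>p\<in>J. hausdorff_weight s (C p))"
    proof (rule hausdorff_content_finite_cover[OF finJ cover \<delta>])
      show "bounded (C p) \<and> diameter (C p) \<le> \<delta>" if "p \<in> J" for p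
        using bdd[OF that] order_trans[OF diam'[OF that] N(2)] by simp
    qed
    also have "\<dots> \<le> (\<Sum>p\<in>J. ennreal (unit_ball_vol (real s) * (d * r / real N) ^ s))"
    proof (intro sum_mono)
      fix p assume p: "p \<in> J"
      have "diameter (C p) / 2 \<le> d * r / real N" using diam'[OF p] by (simp add: ac_simps)
      then have "unit_ball_vol (real s) * (diameter (C p) / 2) ^ s \<le> unit_ball_vol (real s) * (d * r / real N) ^ s"
        using diameter_ge_0[OF bdd[OF p]] by (intro mult_left_mono power_mono) auto
      then show "hausdorff_weight s (C p) \<le> ennreal (unit_ball_vol (real s) * (d * r / real N) ^ s)"
        by (simp add: hausdorff_weight_def ennreal_leI)
    qed
    also have "\<dots> = ennreal (real (card J) * (unit_ball_vol (real s) * (d * r / real N) ^ s))"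
      using d r by (subst sum_ennreal) auto
    also have "real (card J) * (unit_ball_vol (real s) * (d * r / real N) ^ s) = 2 * d * unit_ball_vol (real s) * (d * r) ^ s"
      unfolding cJ using N(1) by (simp add: power_divide)
    finally show ?thesis .
  qed
  then show ?thesis
    unfolding hausdorff_measure_def s_def d_def by (intro SUP_least) auto
qed

section \<open>The distributional derivative of the competitor\<close>

text \<open>The radial factor as a function of t = |x|^2: it equals 1/sqrt t for t >= r^2 and is cut
  to 0 for t \<le> r^2/2. Using the squared norm keeps the composition differentiable at the
  origin.\<close>

definition rfac :: "real \<Rightarrow> real \<Rightarrow> real" where
  "rfac r t = smoothstep (2 * t / r\<^sup>2 - 1) / sqrt t"

definition rfac' :: "real \<Rightarrow> real \<Rightarrow> real" where
  "rfac' r t = smoothstep' (2 * t / r\<^sup>2 - 1) * (2 / r\<^sup>2) / sqrt t - smoothstep (2 * t / r\<^sup>2 - 1) / (2 * t * sqrt t)"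

lemma rfac_small: "r > 0 \<Longrightarrow> t < r\<^sup>2 / 2 \<Longrightarrow> rfac r t = 0 \<and> rfac' r t = 0"
  by (simp add: rfac_def rfac'_def smoothstep_0 smoothstep'_eq_0 field_simps)

lemma DERIV_rfac:
  assumes r: "r > 0"
  shows "DERIV (rfac r) t :> rfac' r t"
proof (cases "t < r\<^sup>2 / 2")
  case True
  have "DERIV (\<lambda>t::real. 0 :: real) t :> rfac' r t" using rfac_small[OF r True] by simp
  then show ?thesis
    by (rule has_field_derivative_transform_within_open[where S="{..<r\<^sup>2 / 2}"]) (use True rfac_small[OF r] in auto)
next
  case False
  have "r\<^sup>2 / 2 > 0" using r by simp
  then have t: "t > 0" using False by linarith
  have "DERIV (\<lambda>t. 2 * t / r\<^sup>2 - 1) t :> 2 / r\<^sup>2"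
  proof -
    have "DERIV (\<lambda>t. c * t - 1) t :> c" for c :: real by (auto intro!: derivative_eq_intros)
    from this[of "2 / r\<^sup>2"] show ?thesis by simp
  qed
  then have s: "DERIV (\<lambda>t. smoothstep (2 * t / r\<^sup>2 - 1)) t :> smoothstep' (2 * t / r\<^sup>2 - 1) * (2 / r\<^sup>2)"
    by (rule DERIV_chain2[OF DERIV_smoothstep])
  have "DERIV (\<lambda>t. smoothstep (2 * t / r\<^sup>2 - 1) / sqrt t) t :> (smoothstep' (2 * t / r\<^sup>2 - 1) * (2 / r\<^sup>2) * sqrt t - smoothstep (2 * t / r\<^sup>2 - 1) * (inverse (sqrt t) / 2)) / (sqrt t * sqrt t)"
    using t by (intro DERIV_divide s DERIV_real_sqrt) auto
  moreover have "(smoothstep' (2 * t / r\<^sup>2 - 1) * (2 / r\<^sup>2) * sqrt t - smoothstep (2 * t / r\<^sup>2 - 1) * (inverse (sqrt t) / 2)) / (sqrt t * sqrt t) = rfac' r t"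
  proof -
    have q: "sqrt t > 0" "t = sqrt t * sqrt t" using t by auto
    have "(a * q - b * (inverse q / 2)) / (q * q) = a / q - b / (2 * (q * q) * q)" if "q > 0" for a b q :: real
      using that by (simp add: field_simps)
    from this[OF q(1)] have "(a * sqrt t - b * (inverse (sqrt t) / 2)) / (sqrt t * sqrt t) = a / sqrt t - b / (2 * t * sqrt t)" for a b
      unfolding q(2)[symmetric] .
    then show ?thesis unfolding rfac'_def .
  qed
  ultimately show ?thesis by (simp add: rfac_def[abs_def])
qed

lemma continuous_rfac':
  assumes r: "r > 0"
  shows "continuous_on UNIV (rfac' r)"
proof -
  have "continuous_on {..<r\<^sup>2 / 2} (rfac' r) \<longleftrightarrow> continuous_on {..<r\<^sup>2 / 2} (\<lambda>t. 0 :: real)"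
    using rfac_small[OF r] by (intro continuous_on_cong) auto
  then have 1: "continuous_on {..<r\<^sup>2 / 2} (rfac' r)" by simp
  have c: "continuous_on {0<..} (\<lambda>t. smoothstep' (2 * t / r\<^sup>2 - 1))"
    by (rule continuous_on_compose2[OF continuous_smoothstep']) (use r in \<open>auto intro!: continuous_intros\<close>)
  have "continuous_on UNIV smoothstep" by (rule DERIV_continuous_on, rule has_field_derivative_at_within, rule DERIV_smoothstep)
  then have d: "continuous_on {0<..} (\<lambda>t. smoothstep (2 * t / r\<^sup>2 - 1))"
    by (rule continuous_on_compose2) (use r in \<open>auto intro!: continuous_intros\<close>)
  have 2: "continuous_on {0<..} (rfac' r)"
    unfolding rfac'_def[abs_def] by (intro continuous_intros c d) auto
  have "continuous_on ({..<r\<^sup>2 / 2} \<union> {0<..}) (rfac' r)" by (intro continuous_on_open_Un 1 2) auto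
  moreover have "{..<r\<^sup>2 / 2} \<union> {0<..} = (UNIV :: real set)"
  proof -
    have "r\<^sup>2 / 2 > 0" using r by simp
    then have "t < r\<^sup>2 / 2 \<or> 0 < t" for t by linarith
    then show ?thesis unfolding set_eq_iff Un_iff lessThan_iff greaterThan_iff by blast
  qed
  ultimately show ?thesis by simp
qed

text \<open>A map of class \<open>C\<^sup>1\<close> on the whole space that agrees with \<open>x / |x|\<close> for \<open>|x| \<ge> r\<close>.\<close>

definition mhedge :: "real \<Rightarrow> 'n::finite \<Rightarrow> real^'n \<Rightarrow> real" where
  "mhedge r i x = x $ i * rfac r ((norm x)\<^sup>2)"

definition Dmhedge :: "real \<Rightarrow> 'n::finite \<Rightarrow> real^'n \<Rightarrow> real^'n" where
  "Dmhedge r i x = x $ i *\<^sub>R (rfac' r ((norm x)\<^sup>2) *\<^sub>R (2 *\<^sub>R x)) + rfac r ((norm x)\<^sup>2) *\<^sub>R axis i 1"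

lemma GDERIV_mhedge:
  assumes r: "r > 0"
  shows "GDERIV (mhedge r i) x :> Dmhedge r i x"
proof -
  have n: "GDERIV (\<lambda>x. (norm x)\<^sup>2) x :> 2 *\<^sub>R x" using GDERIV_norm_square[of 0 x] by simp
  have "GDERIV (\<lambda>x. rfac r ((norm x)\<^sup>2)) x :> rfac' r ((norm x)\<^sup>2) *\<^sub>R (2 *\<^sub>R x)"
    by (rule GDERIV_DERIV_compose[OF n DERIV_rfac[OF r]])
  moreover have "GDERIV (\<lambda>x. x $ i) x :> axis i 1"
  proof -
    have "((\<lambda>x. x $ i) has_derivative (\<lambda>h. h $ i)) (at x)"
      by (rule bounded_linear.has_derivative[OF bounded_linear_vec_nth]) (rule has_derivative_ident)
    then show ?thesis by (simp add: gderiv_def inner_axis)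
  qed
  ultimately show ?thesis unfolding mhedge_def[abs_def] Dmhedge_def by (rule GDERIV_mult[rotated])
qed

lemma continuous_Dmhedge:
  assumes r: "r > 0"
  shows "continuous_on UNIV (Dmhedge r i)"
proof -
  have "continuous_on UNIV (rfac r)" by (rule DERIV_continuous_on, rule has_field_derivative_at_within, rule DERIV_rfac[OF r])
  then have 1: "continuous_on UNIV (\<lambda>x. rfac r ((norm x)\<^sup>2))"
    by (rule continuous_on_compose2) (auto intro!: continuous_intros)
  have 2: "continuous_on UNIV (\<lambda>x. rfac' r ((norm x)\<^sup>2))"
    by (rule continuous_on_compose2[OF continuous_rfac'[OF r]]) (auto intro!: continuous_intros)
  show ?thesis unfolding Dmhedge_def[abs_def] by (intro continuous_intros 1 2)
qed

lemma mhedge_outside: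
  fixes x :: "real^'n"
  assumes r: "r > 0" and x: "r \<le> norm x"
  shows "mhedge r i x = x $ i / norm x" "Dmhedge r i x $ j = hgrad x $ i $ j"
proof -
  have "r\<^sup>2 \<le> (norm x)\<^sup>2" using r x by (intro power_mono) auto
  then have a: "1 \<le> 2 * (norm x)\<^sup>2 / r\<^sup>2 - 1" using r by (simp add: field_simps)
  have nx: "norm x > 0" using r x by linarith
  have s: "sqrt ((norm x)\<^sup>2) = norm x" by simp
  have f: "rfac r ((norm x)\<^sup>2) = 1 / norm x" unfolding rfac_def s by (simp add: smoothstep_1[OF a])
  have f': "rfac' r ((norm x)\<^sup>2) = - 1 / (2 * (norm x)\<^sup>2 * norm x)"
    unfolding rfac'_def s using smoothstep'_eq_0 a by (simp add: smoothstep_1[OF a])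
  show "mhedge r i x = x $ i / norm x" by (simp add: mhedge_def f)
  show "Dmhedge r i x $ j = hgrad x $ i $ j"
    unfolding Dmhedge_def f f' hgrad_def using nx
    by (auto simp: axis_def field_simps power2_eq_square)
qed

text \<open>A parameter domain for both faces orthogonal to axis \<open>j\<close>: a
  full-dimensional set with the dummy \<open>j\<close>-th coordinate in the unit interval, so that
  its Lebesgue measure is the area (2r)^{d-1} of the face.\<close>

definition face :: "real \<Rightarrow> 'n::finite \<Rightarrow> (real^'n) set" where
  "face r j = {x \<in> strip j. \<forall>k. k \<noteq> j \<longrightarrow> \<bar>x $ k\<bar> \<le> r}"

lemma face_measurable[measurable]: "face r j \<in> sets borel"
proof -
  have "face r j = strip j \<inter> (\<Inter>k\<in>UNIV. if k = j then UNIV else {x. \<bar>x $ k\<bar> \<le> r})"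
    by (auto simp: face_def split: if_splits)
  moreover have "(if k = j then UNIV else {x. \<bar>x $ k\<bar> \<le> r}) \<in> sets (borel :: (real^'a) measure)" for k
    by simp
  ultimately show ?thesis by (auto intro!: sets.Int sets.countable_INT'')
qed

lemma face_finite:
  assumes "r > 0" shows "emeasure lborel (face r (j :: 'n::finite)) < \<infinity>"
proof -
  have "norm x \<le> real CARD('n) * (1 + r)" if "x \<in> face r j" for x
  proof -
    have "\<bar>x $ k\<bar> \<le> 1 + r" for k using that assms by (cases "k = j") (auto simp: face_def strip_def intro: order_trans)
    then have "(\<Sum>k\<in>UNIV. \<bar>x $ k\<bar>) \<le> of_nat (card (UNIV :: 'n set)) * (1 + r)" by (intro sum_bounded_above) auto
    from order_trans[OF norm_le_l1_cart this] show ?thesis by simp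
  qed
  then have "bounded (face r j)" by (auto intro: boundedI)
  then show ?thesis by (rule emeasure_bounded_finite)
qed

text \<open>After slicing in direction \<open>j\<close>, a line either misses the cube or meets it
  in the full interval from -r to r, according to its transversal position; on the latter lines the
  fundamental theorem applies.\<close>

lemma cube_divergence:
  assumes r: "r > 0" and t: "test_function UNIV f Df"
  shows "(\<integral>x. indicat_real (cube r) x * Df x $ j \<partial>lborel)
     = (\<integral>x. indicat_real (face r j) x * (f (put j r x) - f (put j (- r) x)) \<partial>lborel)"
proof -
  have "integrable lborel (\<lambda>x. Df x $ j)"
    using test_function_integrable(2)[OF t] by (rule integrable_bounded_linear[OF bounded_linear_vec_nth])
  then have "integrable lborel (\<lambda>x. indicat_real (cube r) x *\<^sub>R (Df x $ j))"
    by (rule integrable_mult_indicator[rotated]) simp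
  from integral_slice(1)[OF this, of j]
  have "(\<integral>x. indicat_real (cube r) x * Df x $ j \<partial>lborel) = 
    (\<integral>x. indicat_real (strip j) x * (\<integral>t. indicat_real (cube r) (put j t x) * Df (put j t x) $ j \<partial>lborel) \<partial>lborel)" by simp
  also have "\<dots> = (\<integral>x. indicat_real (face r j) x * (f (put j r x) - f (put j (- r) x)) \<partial>lborel)"
  proof (rule Bochner_Integration.integral_cong[OF refl])
    fix x
    show "indicat_real (strip j) x * (\<integral>t. indicat_real (cube r) (put j t x) * Df (put j t x) $ j \<partial>lborel)
       = indicat_real (face r j) x * (f (put j r x) - f (put j (- r) x))"
    proof (cases "x \<in> face r j")
      case True
      have "(\<integral>t. indicat_real (cube r) (put j t x) * Df (put j t x) $ j \<partial>lborel) = (\<integral>t. Df (put j t x) $ j * indicator {-r..r} t \<partial>lborel)"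
        using True by (intro Bochner_Integration.integral_cong) (auto simp: indicator_def cube_def face_def put_nth abs_le_iff)
      also have "\<dots> = f (put j r x) - f (put j (- r) x)"
        using t r test_function_continuous[OF t] by (intro FTC_put) (auto simp: test_function_def)
      finally show ?thesis using True by (simp add: face_def)
    next
      case False
      have "indicat_real (cube r) (put j t x) = 0" if "x \<in> strip j" for t
        using False that by (auto simp: face_def cube_def put_nth indicator_def)
      then show ?thesis using False by (auto simp: indicator_def)
    qed
  qed
  finally show ?thesis .
qed

section \<open>Surface measure and orientation of the boundary of the cube\<close>

definition face_pos :: "real \<Rightarrow> 'n::finite \<times> bool \<Rightarrow> real^'n \<Rightarrow> real^'n" where
  "face_pos r p x = put (fst p) (if snd p then r else - r) x"

text \<open>The disjoint union of the 2d parameter domains, as a density on the product of the face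
  index with the full space.\<close>

definition faces :: "real \<Rightarrow> (('n::finite \<times> bool) \<times> (real^'n)) measure" where
  "faces r = density (count_space UNIV \<Otimes>\<^sub>M lborel) (\<lambda>z. ennreal (indicat_real (face r (fst (fst z))) (snd z)))"

text \<open>The area measure of the boundary of the cube, in the role of the total variation of the
  singular part of the derivative. Having it as an image of Lebesgue measure makes its integrals
  finite sums of ordinary ones.\<close>

definition surf :: "real \<Rightarrow> (real^'n::finite) measure" where
  "surf r = distr (faces r) borel (\<lambda>z. face_pos r (fst z) (snd z))"

lemma face_pos_measurable[measurable]: 
  "face_pos r p \<in> borel_measurable borel"
  "(\<lambda>z. face_pos r (fst z) (snd z)) \<in> borel_measurable (count_space UNIV \<Otimes>\<^sub>M lborel)"
proof -
  show 1: "face_pos r p \<in> borel_measurable borel" for p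
    unfolding face_pos_def[abs_def] by measurable
  show "(\<lambda>z. face_pos r (fst z) (snd z)) \<in> borel_measurable (count_space UNIV \<Otimes>\<^sub>M lborel)"
    by (rule measurable_pair_measure_countable1) (use 1 in auto)
qed

lemma face_ind_measurable[measurable]:
  "(\<lambda>z. indicat_real (face r (fst (fst z))) (snd z)) \<in> borel_measurable (count_space (UNIV :: ('n::finite \<times> bool) set) \<Otimes>\<^sub>M lborel)"
  by (rule measurable_pair_measure_countable1) auto

lemma sigma_finite_count_space: "sigma_finite_measure (count_space (UNIV :: ('n::finite \<times> bool) set))"
  by (rule sigma_finite_measure_count_space_finite) simp

lemma nn_integral_surf:
  fixes h :: "real^'n::finite \<Rightarrow> ennreal"
  assumes [measurable]: "h \<in> borel_measurable borel"
  shows "(\<integral>\<^sup>+x. h x \<partial>surf r) = (\<Sum>p\<in>UNIV. \<integral>\<^sup>+x. h (face_pos r p x) * indicator (face r (fst p)) x \<partial>lborel)"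
proof -
  have "(\<integral>\<^sup>+x. h x \<partial>surf r) = (\<integral>\<^sup>+z. ennreal (indicat_real (face r (fst (fst z))) (snd z)) * h (face_pos r (fst z) (snd z)) \<partial>(count_space UNIV \<Otimes>\<^sub>M lborel))"
    unfolding surf_def faces_def
    by (subst nn_integral_distr, measurable) (subst nn_integral_density, auto)
  also have "\<dots> = (\<integral>\<^sup>+p. \<integral>\<^sup>+x. ennreal (indicat_real (face r (fst p)) x) * h (face_pos r p x) \<partial>lborel \<partial>count_space UNIV)"
    by (subst lborel.nn_integral_fst[symmetric]) auto
  also have "\<dots> = (\<Sum>p\<in>UNIV. \<integral>\<^sup>+x. ennreal (indicat_real (face r (fst p)) x) * h (face_pos r p x) \<partial>lborel)"
    by (rule nn_integral_count_space_finite) simp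
  also have "\<dots> = (\<Sum>p\<in>UNIV. \<integral>\<^sup>+x. h (face_pos r p x) * indicator (face r (fst p)) x \<partial>lborel)"
    by (intro sum.cong refl nn_integral_cong) (auto simp: indicator_def)
  finally show ?thesis .
qed

lemma sets_surf[simp, measurable_cong]: "sets (surf r) = sets borel"
  by (simp add: surf_def)

lemma finite_surf:
  assumes "r > 0" shows "finite_measure (surf r :: (real^'n::finite) measure)"
proof
  have "emeasure (surf r) (space (surf r :: (real^'n) measure)) = (\<integral>\<^sup>+x. 1 \<partial>(surf r :: (real^'n) measure))" by simp
  also have "\<dots> = (\<Sum>p\<in>(UNIV :: ('n \<times> bool) set). \<integral>\<^sup>+x. 1 * indicator (face r (fst p)) x \<partial>lborel)" by (rule nn_integral_surf) simp
  also have "\<dots> < \<infinity>" using face_finite[OF assms] by (auto simp: less_top sum_Pinfty ennreal_sum_less_top)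
  finally show "emeasure (surf r) (space (surf r :: (real^'n) measure)) \<noteq> \<infinity>" by simp
qed

lemma AE_surfI:
  assumes [measurable]: "{x. \<not> P x} \<in> sets borel" 
    and P: "\<And>p. AE x in lborel. x \<in> face r (fst p) \<longrightarrow> P (face_pos r p x)"
  shows "AE x in surf r. P x"
proof -
  have "emeasure (surf r) {x. \<not> P x} = (\<integral>\<^sup>+x. indicator {x. \<not> P x} x \<partial>surf r)" by simp
  also have "\<dots> = (\<Sum>p\<in>UNIV. \<integral>\<^sup>+x. indicator {x. \<not> P x} (face_pos r p x) * indicator (face r (fst p)) x \<partial>lborel)"
    by (rule nn_integral_surf) measurable
  also have "\<dots> = (\<Sum>p\<in>(UNIV :: ('a \<times> bool) set). 0)"
  proof (intro sum.cong refl)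
    fix p
    have "(\<integral>\<^sup>+x. indicator {x. \<not> P x} (face_pos r p x) * indicator (face r (fst p)) x \<partial>lborel) = (\<integral>\<^sup>+x. 0 \<partial>(lborel :: (real^'a) measure))"
      by (rule nn_integral_cong_AE, use P[of p] in eventually_elim) (auto simp: indicator_def)
    then show "(\<integral>\<^sup>+x. indicator {x. \<not> P x} (face_pos r p x) * indicator (face r (fst p)) x \<partial>lborel) = 0" by simp
  qed
  finally have "emeasure (surf r) {x. \<not> P x} = 0" by (simp only: sum.neutral_const)
  then have "{x. \<not> P x} \<in> null_sets (surf r)" by (simp add: null_sets_def)
  then show ?thesis by (rule AE_I') auto
qed

lemma integral_surf:
  fixes h :: "real^'n::finite \<Rightarrow> real"
  assumes r: "r > 0" and [measurable]: "h \<in> borel_measurable borel" and C: "\<And>x. \<bar>h x\<bar> \<le> C"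
  shows "(\<integral>x. h x \<partial>surf r) = (\<Sum>p\<in>UNIV. \<integral>x. indicat_real (face r (fst p)) x * h (face_pos r p x) \<partial>lborel)"
proof -
  interpret finite_measure "surf r :: (real^'n) measure" by (rule finite_surf[OF r])
  interpret c: sigma_finite_measure "count_space (UNIV :: ('n \<times> bool) set)" by (rule sigma_finite_count_space)
  interpret P: pair_sigma_finite "count_space (UNIV :: ('n \<times> bool) set)" "lborel :: (real^'n) measure"
    by (intro pair_sigma_finite.intro sigma_finite_count_space sigma_finite_lborel)
  have "integrable (surf r) h" by (rule integrable_const_bound[of _ C]) (use C in auto)
  then have int: "integrable (count_space UNIV \<Otimes>\<^sub>M lborel) (\<lambda>z. indicat_real (face r (fst (fst z))) (snd z) *\<^sub>R h (face_pos r (fst z) (snd z)))"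
    unfolding surf_def faces_def
    by (subst (asm) integrable_distr_eq, measurable) (subst (asm) integrable_density, auto)
  have "(\<integral>x. h x \<partial>surf r) = (\<integral>z. indicat_real (face r (fst (fst z))) (snd z) *\<^sub>R h (face_pos r (fst z) (snd z)) \<partial>(count_space UNIV \<Otimes>\<^sub>M lborel))"
    unfolding surf_def faces_def
    by (subst integral_distr, measurable) (subst integral_density, auto)
  also have "\<dots> = (\<integral>p. \<integral>x. indicat_real (face r (fst p)) x *\<^sub>R h (face_pos r p x) \<partial>lborel \<partial>count_space UNIV)"
    using P.integral_fst'[OF int] by simp
  also have "\<dots> = (\<Sum>p\<in>UNIV. \<integral>x. indicat_real (face r (fst p)) x * h (face_pos r p x) \<partial>lborel)"
    by (subst lebesgue_integral_count_space_finite) auto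
  finally show ?thesis .
qed

text \<open>The polar factor of the jump part: the jump x/|x|, outer value minus inner value 0,
  tensored with the outer unit normal. On a face the normal component is x_j/r, that is 1 or -1; on
  edges, which are null for \<open>surf\<close>, it is set to 0.\<close>

definition orient :: "real \<Rightarrow> real^'n \<Rightarrow> real^'n^'n" where
  "orient r x = (\<chi> i j. (x $ i / norm x) * (if \<bar>x $ j\<bar> = r \<and> (\<forall>l. l \<noteq> j \<longrightarrow> \<bar>x $ l\<bar> < r) then x $ j / r else 0))"

lemma orient_measurable[measurable]: "orient r \<in> borel_measurable borel"
proof (intro vec_borelI)
  fix i j
  have [measurable]: "Measurable.pred borel (\<lambda>x::real^'a. l \<noteq> j \<longrightarrow> \<bar>x $ l\<bar> < r)" for l
    by (cases "l = j") simp_all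
  have [measurable]: "Measurable.pred borel (\<lambda>x::real^'a. \<forall>l. l \<noteq> j \<longrightarrow> \<bar>x $ l\<bar> < r)"
    by (rule pred_intros_countable) measurable
  show "(\<lambda>x::real^'a. orient r x $ i $ j) \<in> borel_measurable borel"
    unfolding orient_def vec_lambda_beta by measurable
qed

lemma orient_bound:
  assumes "r > 0" shows "\<bar>orient r x $ i $ j\<bar> \<le> 1"
proof -
  have "\<bar>x $ i / norm x\<bar> \<le> 1" using component_le_norm_cart[of x i] by (cases "x = 0") (auto simp: divide_le_eq)
  moreover have "\<bar>if \<bar>x $ j\<bar> = r \<and> (\<forall>l. l \<noteq> j \<longrightarrow> \<bar>x $ l\<bar> < r) then x $ j / r else 0\<bar> \<le> 1" using assms by auto
  ultimately show ?thesis unfolding orient_def vec_lambda_beta abs_mult by (intro mult_le_one) auto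
qed

text \<open>Points on the rim of the parameter domain lie in finitely many hyperplanes; off them the
  normal is unambiguous.\<close>

lemma face_regular:
  "AE x in lborel. x \<in> face r (k :: 'n::finite) \<longrightarrow> (\<forall>l. l \<noteq> k \<longrightarrow> \<bar>x $ l\<bar> < r)"
proof -
  have h: "{x::real^'n. x $ l = a} \<in> null_sets lborel" for l a
    using negligible_standard_hyperplane[of "axis l 1 :: real^'n" a]
    by (simp add: cart_eq_inner_axis axis_in_Basis_iff negligible_iff_null_sets null_sets_def)
  have each: "AE x in lborel. x \<in> face r k \<longrightarrow> l \<noteq> k \<longrightarrow> \<bar>x $ l\<bar> < r" for l
    using AE_not_in[OF h[of l r]] AE_not_in[OF h[of l "- r"]]
    by eventually_elim (auto simp: face_def abs_if split: if_splits)
  then have "AE x in lborel. \<forall>l. x \<in> face r k \<longrightarrow> l \<noteq> k \<longrightarrow> \<bar>x $ l\<bar> < r" 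
    unfolding AE_all_countable by (rule allI)
  then show ?thesis by eventually_elim blast
qed

lemma orient_face_pos:
  fixes x :: "real^'n"
  assumes r: "r > 0" and x: "\<forall>l. l \<noteq> fst p \<longrightarrow> \<bar>x $ l\<bar> < r"
  shows "orient r (face_pos r p x) $ i $ j = (if j = fst p then (if snd p then 1 else - 1) * (face_pos r p x $ i / norm (face_pos r p x)) else 0)"
    and "r \<le> norm (face_pos r p x)" and "face_pos r p x \<in> cube_bd r"
proof -
  let ?y = "face_pos r p x"
  have k: "?y $ fst p = (if snd p then r else - r)" and l: "l \<noteq> fst p \<Longrightarrow> \<bar>?y $ l\<bar> < r" for l
    using x by (auto simp: face_pos_def put_nth)
  show "r \<le> norm ?y" using component_le_norm_cart[of ?y "fst p"] k r by (auto split: if_splits)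
  show "?y \<in> cube_bd r" unfolding cube_bd_def cube_def mem_Collect_eq
  proof (intro conjI allI exI)
    fix m show "\<bar>?y $ m\<bar> \<le> r" using k l[of m] r by (cases "m = fst p") auto
  next
    show "\<bar>?y $ fst p\<bar> = r" using k r by auto
  qed
  show "orient r ?y $ i $ j = (if j = fst p then (if snd p then 1 else - 1) * (?y $ i / norm ?y) else 0)"
  proof (cases "j = fst p")
    case True
    then have "(\<forall>m. m \<noteq> j \<longrightarrow> \<bar>?y $ m\<bar> < r) \<and> \<bar>?y $ j\<bar> = r" using l k r by auto
    then show ?thesis using True k r by (simp add: orient_def)
  next
    case False
    then show ?thesis using l[OF False] by (simp add: orient_def)
  qed
qed

lemma norm_orient_AE:
  assumes r: "r > 0"
  shows "AE x in surf r. norm (orient r (x :: real^'n)) = 1"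
proof (rule AE_surfI)
  show "{x::real^'n. norm (orient r x) \<noteq> 1} \<in> sets borel" by measurable
  fix p :: "'n \<times> bool"
  show "AE x in lborel. x \<in> face r (fst p) \<longrightarrow> norm (orient r (face_pos r p x)) = 1"
    using face_regular[of r "fst p"]
  proof eventually_elim
    case (elim x)
    show ?case
    proof
      assume "x \<in> face r (fst p)"
      then have reg: "\<forall>l. l \<noteq> fst p \<longrightarrow> \<bar>x $ l\<bar> < r" using elim by blast
      let ?y = "face_pos r p x"
      have y: "norm ?y > 0" using orient_face_pos(2)[OF r reg] r by linarith
      have "(norm (orient r ?y))\<^sup>2 = (\<Sum>i\<in>UNIV. \<Sum>j\<in>UNIV. if j = fst p then (?y $ i)\<^sup>2 / (norm ?y)\<^sup>2 else 0)"
        unfolding norm_matrix_square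
        by (intro sum.cong refl) (auto simp: orient_face_pos(1)[OF r reg] power_divide power_mult_distrib)
      also have "\<dots> = (\<Sum>i\<in>UNIV. (?y $ i)\<^sup>2) / (norm ?y)\<^sup>2" by (simp add: sum_divide_distrib)
      also have "(\<Sum>i\<in>UNIV. (?y $ i)\<^sup>2) = (norm ?y)\<^sup>2" unfolding power2_norm_eq_inner inner_vec_def by (simp add: power2_eq_square)
      finally have "(norm (orient r ?y))\<^sup>2 = 1" using y by simp
      then show "norm (orient r ?y) = 1" by (simp add: power2_eq_1_iff) (use norm_ge_zero[of "orient r ?y"] in linarith)
    qed
  qed
qed

lemma surf_cube_bd:
  assumes r: "r > 0"
  shows "AE x in surf r. (x :: real^'n) \<in> cube_bd r"
proof (rule AE_surfI)
  have "{x::real^'n. x \<notin> cube_bd r} = - cube_bd r" by auto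
  then show "{x::real^'n. x \<notin> cube_bd r} \<in> sets borel" by (simp add: borel_comp cube_measurable(2))
  fix p :: "'n \<times> bool"
  show "AE x in lborel. x \<in> face r (fst p) \<longrightarrow> face_pos r p x \<in> cube_bd r"
    using face_regular[of r "fst p"] by eventually_elim (use orient_face_pos(3)[OF r] in blast)
qed

text \<open>Only the two faces orthogonal to axis \<open>j\<close> have a normal with nonzero
  \<open>j\<close>-th component, and there the components have opposite signs. The jump is replaced
  by \<open>mhedge\<close>, which is of class C^1 also inside the cube.\<close>

lemma surf_flux:
  fixes \<phi> :: "real^'n \<Rightarrow> real"
  assumes r: "r > 0" and t: "test_function UNIV \<phi> D\<phi>"
  shows "(\<integral>x. \<phi> x * orient r x $ i $ j \<partial>surf r)
    = (\<integral>x. indicat_real (face r j) x * (\<phi> (put j r x) * mhedge r i (put j r x) - \<phi> (put j (- r) x) * mhedge r i (put j (- r) x)) \<partial>lborel)"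
proof -
  let ?f = "\<lambda>x. \<phi> x * mhedge r i x"
  note [measurable] = test_function_continuous(3)[OF t]
  have "continuous_on UNIV (mhedge r i)"
    using GDERIV_imp_isCont[of "mhedge r i" "Dmhedge r i" UNIV] GDERIV_mhedge[OF r] by (auto intro: continuous_at_imp_continuous_on)
  then have [measurable]: "mhedge r i \<in> borel_measurable borel" by (rule borel_measurable_continuous_onI)
  obtain B where B: "B > 0" "\<And>x. \<bar>\<phi> x\<bar> \<le> B" and "\<And>x. norm (D\<phi> x) \<le> B"
    by (rule test_function_bounded[OF t]) (rule that)
  have bd: "\<bar>\<phi> x * orient r x $ i $ j\<bar> \<le> B" for x
  proof -
    have "\<bar>orient r x $ i $ j\<bar> \<le> 1" by (rule orient_bound[OF r])
    from mult_mono[OF B(2)[of x] this] B(1) show ?thesis unfolding abs_mult by simp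
  qed
  \<comment> \<open>On the faces |x| >= r, so \<open>mhedge\<close> takes its outer value x_i/|x|.
    The premise leaves out the edges, where \<open>orient\<close> is degenerate.\<close>
  have val: "indicat_real (face r (fst p)) x * (\<phi> (face_pos r p x) * orient r (face_pos r p x) $ i $ j)
     = (if fst p = j then (if snd p then 1 else - 1) * (indicat_real (face r j) x * ?f (face_pos r p x)) else 0)"
    if "x \<in> face r (fst p) \<longrightarrow> (\<forall>l. l \<noteq> fst p \<longrightarrow> \<bar>x $ l\<bar> < r)" for p x
  proof (cases "x \<in> face r (fst p)")
    case True
    then have reg: "\<forall>l. l \<noteq> fst p \<longrightarrow> \<bar>x $ l\<bar> < r" using that by blast
    show ?thesis
    proof (cases "fst p = j")
      case eq: True
      show ?thesis unfolding orient_face_pos(1)[OF r reg] mhedge_outside(1)[OF r orient_face_pos(2)[OF r reg]] using True eq by simp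
    next
      case neq: False
      then have "j \<noteq> fst p" by simp
      then show ?thesis unfolding orient_face_pos(1)[OF r reg] using neq by simp
    qed
  next
    case False
    then show ?thesis by (cases "fst p = j") simp_all
  qed
  have M: "(\<integral>x. indicat_real (face r (fst p)) x * (\<phi> (face_pos r p x) * orient r (face_pos r p x) $ i $ j) \<partial>lborel)
     = (if fst p = j then (if snd p then 1 else - 1) * (\<integral>x. indicat_real (face r j) x * ?f (face_pos r p x) \<partial>lborel) else 0)" for p
  proof -
    have "(\<integral>x. indicat_real (face r (fst p)) x * (\<phi> (face_pos r p x) * orient r (face_pos r p x) $ i $ j) \<partial>lborel)
       = (\<integral>x. (if fst p = j then (if snd p then 1 else - 1) * (indicat_real (face r j) x * ?f (face_pos r p x)) else 0) \<partial>lborel)"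
    proof (rule integral_cong_AE)
      show "AE x in lborel. indicat_real (face r (fst p)) x * (\<phi> (face_pos r p x) * orient r (face_pos r p x) $ i $ j)
        = (if fst p = j then (if snd p then 1 else - 1) * (indicat_real (face r j) x * ?f (face_pos r p x)) else 0)"
        using face_regular[of r "fst p"] by eventually_elim (rule val)
    qed measurable
    then show ?thesis by auto
  qed
  have int: "integrable lborel (\<lambda>x. indicat_real (face r j) x * ?f (face_pos r p x))" if p: "fst p = j" for p
  proof -
    have b1: "\<bar>mhedge r i (face_pos r p x)\<bar> \<le> 1" for x
    proof -
      let ?y = "face_pos r p x"
      have "\<bar>?y $ fst p\<bar> = r" using r by (auto simp: face_pos_def put_nth)
      then have "r \<le> norm ?y" using component_le_norm_cart[of ?y "fst p"] by simp
      then have "\<bar>mhedge r i ?y\<bar> = \<bar>?y $ i\<bar> / norm ?y" by (simp add: mhedge_outside(1)[OF r])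
      also have "\<dots> \<le> 1" using component_le_norm_cart[of ?y i] by (cases "?y = 0") (auto simp: divide_le_eq)
      finally show ?thesis .
    qed
    have "integrable lborel (\<lambda>x. indicat_real (face r j) x *\<^sub>R ?f (face_pos r p x))"
    proof (rule integrableI_bounded_set_indicator[where B=B])
      show "AE x in lborel. x \<in> face r j \<longrightarrow> norm (?f (face_pos r p x)) \<le> B"
      proof (intro AE_I2 impI)
        fix x show "norm (?f (face_pos r p x)) \<le> B"
          using mult_mono[OF B(2)[of "face_pos r p x"] b1[of x]] B(1) by (simp add: abs_mult)
      qed
    qed (use face_finite[OF r] in auto)
    then show ?thesis by simp
  qed
  have "(\<integral>x. \<phi> x * orient r x $ i $ j \<partial>surf r)
      = (\<Sum>p\<in>UNIV. \<integral>x. indicat_real (face r (fst p)) x * (\<phi> (face_pos r p x) * orient r (face_pos r p x) $ i $ j) \<partial>lborel)"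
    by (rule integral_surf[OF r _ bd]) measurable
  also have "\<dots> = (\<Sum>p\<in>UNIV \<times> UNIV. case p of (k, s) \<Rightarrow> if k = j then (if s then 1 else - 1) * (\<integral>x. indicat_real (face r j) x * ?f (face_pos r (k, s) x) \<partial>lborel) else 0)"
    unfolding M by (simp only: UNIV_Times_UNIV case_prod_unfold prod.collapse)
  also have "\<dots> = (\<Sum>k\<in>UNIV. \<Sum>s\<in>UNIV. if k = j then (if s then 1 else - 1) * (\<integral>x. indicat_real (face r j) x * ?f (face_pos r (k, s) x) \<partial>lborel) else 0)"
    by (rule sum.cartesian_product[symmetric])
  also have "\<dots> = (\<Sum>k\<in>UNIV. if k = j then (\<Sum>s\<in>UNIV. (if s then 1 else - 1) * (\<integral>x. indicat_real (face r j) x * ?f (face_pos r (j, s) x) \<partial>lborel)) else 0)"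
    by (intro sum.cong refl) auto
  also have "\<dots> = (\<integral>x. indicat_real (face r j) x * ?f (face_pos r (j, True) x) \<partial>lborel) - (\<integral>x. indicat_real (face r j) x * ?f (face_pos r (j, False) x) \<partial>lborel)"
    by (simp add: UNIV_bool)
  also have "\<dots> = (\<integral>x. indicat_real (face r j) x * ?f (face_pos r (j, True) x) - indicat_real (face r j) x * ?f (face_pos r (j, False) x) \<partial>lborel)"
    by (rule Bochner_Integration.integral_diff[symmetric]) (use int[of "(j, True)"] int[of "(j, False)"] in auto)
  finally show ?thesis by (simp add: face_pos_def algebra_simps)
qed

section \<open>Green's formula for the competitor and its membership in SBV^2\<close>

lemma LINT_lebesgue_eq_lborel:
  fixes h :: "real^'n \<Rightarrow> real"
  assumes "h \<in> borel_measurable borel" "\<And>x. x \<notin> \<Omega> \<Longrightarrow> h x = 0"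
  shows "(LINT x:\<Omega>|lebesgue. h x) = (\<integral>x. h x \<partial>lborel)"
proof -
  have "(LINT x:\<Omega>|lebesgue. h x) = (\<integral>x. h x \<partial>lebesgue)"
    unfolding set_lebesgue_integral_def using assms(2) by (intro Bochner_Integration.integral_cong) (auto simp: indicator_def)
  also have "\<dots> = (\<integral>x. h x \<partial>lborel)" by (rule integral_completion) (use assms(1) in simp)
  finally show ?thesis .
qed

text \<open>Off the cube the competitor coincides with the globally differentiable
  \<open>mhedge\<close>. The gradient of \<phi> \<open>mhedge\<close> integrates to 0 over the
  space, and its integral over the cube is a flux through the faces; their difference is the
  formula. The values of \<open>mhedge\<close> inside the cube cancel.\<close>

lemma hollow_Green:
  assumes r: "r > 0" and t: "test_function \<Omega> \<phi> D\<phi>"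
  shows "(LINT x:\<Omega>|lebesgue. hollow r x $ i * D\<phi> x $ j)
    = - ((LINT x:\<Omega>|lebesgue. \<phi> x * hollow_grad r x $ i $ j) + (\<integral>x. \<phi> x * orient r x $ i $ j \<partial>surf r))"
proof -
  have t': "test_function UNIV \<phi> D\<phi>" using t by (rule test_function_mono) simp
  define f where "f x = \<phi> x * mhedge r i x" for x
  define Df where "Df x = \<phi> x *\<^sub>R Dmhedge r i x + mhedge r i x *\<^sub>R D\<phi> x" for x
  have tf: "test_function UNIV f Df" unfolding f_def[abs_def] Df_def[abs_def]
    by (rule test_function_mult[OF t' GDERIV_mhedge[OF r] continuous_Dmhedge[OF r], of UNIV]) auto
  note [measurable] = test_function_continuous(3,4)[OF t] test_function_continuous(3,4)[OF tf]
  have iD: "integrable lborel (\<lambda>x. Df x $ j)"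
    using test_function_integrable(2)[OF tf] by (rule integrable_bounded_linear[OF bounded_linear_vec_nth])
  have iC: "integrable lborel (\<lambda>x. indicat_real (cube r) x * (Df x $ j))"
    using integrable_mult_indicator[OF _ iD, of "cube r"] by simp
  \<comment> \<open>The product rule outside the cube; inside both sides are 0.\<close>
  have split: "Df x $ j - indicat_real (cube r) x * (Df x $ j) = hollow r x $ i * D\<phi> x $ j + \<phi> x * hollow_grad r x $ i $ j" for x
  proof (cases "x \<in> cube r")
    case False
    then have x: "r \<le> norm x" using norm_gt_outside_cube[OF False] by simp
    show ?thesis using False by (simp add: Df_def mhedge_outside[OF r x] hollow_def hollow_grad_def divide_inverse)
  qed (simp add: hollow_def hollow_grad_def)
  have i1: "integrable lborel (\<lambda>x. hollow r x $ i * D\<phi> x $ j)"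
  proof (rule Bochner_Integration.integrable_bound[OF test_function_integrable(2)[OF t]])
    show "AE x in lborel. norm (hollow r x $ i * D\<phi> x $ j) \<le> norm (D\<phi> x)"
    proof (rule AE_I2)
      fix x
      have "\<bar>hollow r x $ i\<bar> \<le> 1" using component_le_norm_cart[of "hollow r x" i] norm_hollow[OF r, of x] by linarith
      from mult_mono[OF this component_le_norm_cart[of "D\<phi> x" j]]
      show "norm (hollow r x $ i * D\<phi> x $ j) \<le> norm (D\<phi> x)" by (simp add: abs_mult)
    qed
  qed measurable
  have i2: "integrable lborel (\<lambda>x. \<phi> x * hollow_grad r x $ i $ j)"
    using Bochner_Integration.integrable_diff[OF Bochner_Integration.integrable_diff[OF iD iC] i1] by (simp add: split)
  have "(\<integral>x. hollow r x $ i * D\<phi> x $ j \<partial>lborel) + (\<integral>x. \<phi> x * hollow_grad r x $ i $ j \<partial>lborel)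
     = (\<integral>x. Df x $ j - indicat_real (cube r) x * (Df x $ j) \<partial>lborel)"
    unfolding split by (rule Bochner_Integration.integral_add[OF i1 i2, symmetric])
  also have "\<dots> = (\<integral>x. Df x $ j \<partial>lborel) - (\<integral>x. indicat_real (cube r) x * (Df x $ j) \<partial>lborel)"
    by (rule Bochner_Integration.integral_diff[OF iD iC])
  also have "\<dots> = - (\<integral>x. \<phi> x * orient r x $ i $ j \<partial>surf r)"
    unfolding integral_gradient_0[OF tf] cube_divergence[OF r tf] surf_flux[OF r t'] by (simp add: f_def)
  finally have key: "(\<integral>x. hollow r x $ i * D\<phi> x $ j \<partial>lborel) + (\<integral>x. \<phi> x * hollow_grad r x $ i $ j \<partial>lborel)
     = - (\<integral>x. \<phi> x * orient r x $ i $ j \<partial>surf r)" .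
  have "(LINT x:\<Omega>|lebesgue. hollow r x $ i * D\<phi> x $ j) = (\<integral>x. hollow r x $ i * D\<phi> x $ j \<partial>lborel)"
    by (rule LINT_lebesgue_eq_lborel) (auto simp: test_function_0_outside[OF t])
  moreover have "(LINT x:\<Omega>|lebesgue. \<phi> x * hollow_grad r x $ i $ j) = (\<integral>x. \<phi> x * hollow_grad r x $ i $ j \<partial>lborel)"
    by (rule LINT_lebesgue_eq_lborel) (auto simp: test_function_0_outside[OF t])
  ultimately show ?thesis using key by linarith
qed

lemma norm_hollow_grad:
  fixes x :: "real^'n"
  assumes r: "r > 0"
  shows "norm (hollow_grad r x) \<le> sqrt (real CARD('n)) / r"
proof (cases "x \<in> cube r")
  case True
  then show ?thesis using r by (simp add: hollow_grad_def)
next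
  case False
  then have x: "r < norm x" by (rule norm_gt_outside_cube)
  then have "x \<noteq> 0" using r by auto
  have sq: "r\<^sup>2 \<le> (norm x)\<^sup>2" using x r by (intro power_mono) auto
  have "(norm (hgrad x))\<^sup>2 = (real CARD('n) - 1) / (norm x)\<^sup>2" by (rule norm_hgrad) fact
  also have "\<dots> \<le> real CARD('n) / r\<^sup>2" using sq r by (intro frac_le) auto
  also have "\<dots> = (sqrt (real CARD('n)) / r)\<^sup>2" by (simp add: power_divide)
  finally have "norm (hgrad x) \<le> sqrt (real CARD('n)) / r" by (rule power2_le_imp_le) (use r in simp)
  then show ?thesis using False by (simp add: hollow_grad_def)
qed

lemma bounded_L2_on:
  fixes f g :: "real^'n \<Rightarrow> 'b::euclidean_space"
  assumes g: "g \<in> borel_measurable borel" "\<And>x. norm (g x) \<le> M" 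
    and N: "N \<in> null_sets lborel" "\<And>x. x \<notin> N \<Longrightarrow> f x = g x"
  shows "L2_on (ball 0 \<rho>) f"
proof -
  have "g \<in> borel_measurable lborel" using g(1) by simp
  then have gl: "g \<in> borel_measurable lebesgue" by (rule measurable_completion)
  have ae: "AE x in lebesgue. g x = f x"
    unfolding AE_completion_iff using AE_not_in[OF N(1)] by eventually_elim (use N(2) in metis)
  have fl: "f \<in> borel_measurable lebesgue" using gl ae by (rule borel_measurable_AE)
  have "integrable lebesgue (\<lambda>x. indicat_real (ball 0 \<rho>) x *\<^sub>R (norm (f x))\<^sup>2)"
  proof (rule integrableI_bounded_set_indicator[where B="M\<^sup>2"])
    show "(\<lambda>x. (norm (f x))\<^sup>2) \<in> borel_measurable lebesgue" using fl by measurable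
    show "emeasure lebesgue (ball (0::real^'n) \<rho>) < \<infinity>" using emeasure_bounded_finite[of "ball (0::real^'n) \<rho>"] by simp
    show "AE x in lebesgue. x \<in> ball 0 \<rho> \<longrightarrow> norm ((norm (f x))\<^sup>2) \<le> M\<^sup>2"
      using ae
    proof eventually_elim
      case (elim x)
      have "norm (f x) \<le> M" using g(2)[of x] elim by simp
      then have "(norm (f x))\<^sup>2 \<le> M\<^sup>2" by (intro power_mono) auto
      then show ?case by simp
    qed
  qed simp
  then show ?thesis unfolding L2_on_def using measurable_restrict_space1[OF fl]
    by (subst integrable_restrict_space) auto
qed

lemma bounded_absolutely_integrable:
  fixes g :: "real^'n \<Rightarrow> 'b::euclidean_space"
  assumes g: "g \<in> borel_measurable borel" "\<And>x. norm (g x) \<le> M"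
  shows "g absolutely_integrable_on ball 0 \<rho>"
proof -
  have "integrable lborel (\<lambda>x. indicat_real (ball 0 \<rho>) x *\<^sub>R g x)"
    by (rule integrableI_bounded_set_indicator[where B=M]) (use g emeasure_bounded_finite[of "ball (0::real^'n) \<rho>"] in auto)
  then show ?thesis unfolding set_integrable_def using g(1) by (subst integrable_completion) auto
qed

lemma cube_subset_ball:
  assumes "real CARD('n) * r < 1"
  shows "cube r \<subseteq> ball (0::real^'n) 1"
  using norm_le_in_cube[where 'n='n] assms by (force simp: dist_norm)

text \<open>The cube lies in the unit ball, so the same derivative data and the same jump set serve
  all radii from 1 on: radius 1 for the map itself, radius \<open>R\<close> for its radial
  extension.\<close>

lemma hollow_SBV2:
  assumes r: "r > 0" and small: "real CARD('n) * r < 1" and \<rho>: "\<rho> \<ge> 1"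
  shows "hollow r \<in> SBV2 (ball (0::real^'n) \<rho>)"
proof -
  let ?\<Omega> = "ball (0::real^'n) \<rho>"
  have cb: "cube_bd r \<subseteq> ?\<Omega>"
    using cube_subset_ball[OF small] subset_ball[OF \<rho>, of "0::real^'n"] by (auto simp: cube_bd_def)
  have disc: "approx_discontinuity_set ?\<Omega> (hollow r) = cube_bd r"
    using hollow_discontinuity_set[OF r small] cb by (simp add: Int_absorb1)
  have sAE: "AE x in surf r. x \<in> ?\<Omega>" using surf_cube_bd[OF r] by eventually_elim (use cb in blast)
  have "BV_derivative ?\<Omega> (hollow r) (hollow_grad r) (surf r) (orient r)"
    unfolding BV_derivative_def
    using bounded_absolutely_integrable[OF hollow_grad_measurable norm_hollow_grad[OF r]]
      finite_surf[OF r] sets_surf sAE cube_bd_null surf_cube_bd[OF r] orient_measurable norm_orient_AE[OF r]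
      hollow_Green[OF r]
    by (intro conjI allI impI bexI[of _ "cube_bd r"])
  moreover have "AE x in surf r. x \<in> approx_discontinuity_set ?\<Omega> (hollow r)"
    unfolding disc by (rule surf_cube_bd[OF r])
  moreover have "hollow r absolutely_integrable_on ?\<Omega>"
    by (rule bounded_absolutely_integrable[OF hollow_measurable norm_hollow[OF r]])
  ultimately have "hollow r \<in> SBV ?\<Omega>" unfolding SBV_def by blast
  moreover have "L2_on ?\<Omega> (approx_gradient (hollow r))"
    by (rule bounded_L2_on[OF hollow_grad_measurable norm_hollow_grad[OF r] cube_bd_null hollow_approx_gradient[OF r]])
  moreover have "hausdorff_measure (CARD('n) - 1) (approx_discontinuity_set ?\<Omega> (hollow r)) < \<infinity>"
    unfolding disc by (rule order.strict_trans1[OF hausdorff_cube_bd[OF r]]) simp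
  ultimately show ?thesis unfolding SBV2_def by blast
qed

lemma radial_extension_hollow:
  assumes "real CARD('n) * r < 1"
  shows "radial_extension (hollow r) = (hollow r :: real^'n \<Rightarrow> real^'n)"
  using cube_subset_ball[OF assms] by (auto simp: radial_extension_def hollow_def fun_eq_iff)

lemma hollow_admissible:
  assumes r: "r > 0" and small: "real CARD('n) * r < 1" and R: "R > 1"
  shows "hollow r \<in> (admissible_SBV R :: (real^'n \<Rightarrow> real^'n) set)"
proof -
  have "hollow r x \<in> sphere 0 1 \<union> {0}" for x :: "real^'n"
  proof (cases "x \<in> cube r")
    case False
    then have "norm x > 0" using norm_gt_outside_cube[OF False] r by linarith
    then show ?thesis using False by (simp add: hollow_def)
  qed (simp add: hollow_def)
  then show ?thesis unfolding admissible_SBV_def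
    using hollow_SBV2[OF r small, of 1] hollow_SBV2[OF r small, of R] R by (simp add: radial_extension_hollow[OF small])
qed

section \<open>Comparison of the energies\<close>

lemma emeasure_cball_unit_vol:
  "t \<ge> 0 \<Longrightarrow> emeasure lborel (cball (0::real^'n) t) = ennreal (unit_vol TYPE('n) * t ^ CARD('n))"
  by (simp add: emeasure_cball measure_def emeasure_ball)

definition shell :: "real \<Rightarrow> (real^'n) \<Rightarrow> ennreal" where
  "shell s x = ennreal (1 / (norm x)\<^sup>2) * indicator (ball 0 s) x"

lemma shell_measurable[measurable]: "shell s \<in> borel_measurable borel"
  unfolding shell_def[abs_def] by measurable

text \<open>This replaces polar coordinates: 1/|x|^2 is written as an integral over the radii above
  |x|, so that integration over \<open>x\<close> only meets volumes of balls.\<close>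

lemma inverse_square_layer_cake:
  assumes "0 < a" "a \<le> 1"
  shows "ennreal (1 / a\<^sup>2) = 1 + (\<integral>\<^sup>+t. ennreal (2 / t^3) * indicator {a..1} t \<partial>lborel)"
proof -
  have "(\<integral>\<^sup>+t. ennreal (2 / t^3) * indicator {a..1} t \<partial>lborel) = ennreal (- (1 / 1\<^sup>2) - (- (1 / a\<^sup>2)))"
  proof (rule nn_integral_FTC_Icc[where F="\<lambda>t. - (1 / t\<^sup>2)"])
    fix t :: real assume t: "t \<in> {a..1}"
    then have "t \<noteq> 0" using assms by auto
    then show "DERIV (\<lambda>t::real. - (1 / t\<^sup>2)) t :> 2 / t^3"
      by (auto intro!: derivative_eq_intros simp: field_simps power2_eq_square power3_eq_cube)
  next
    fix t :: real assume "t \<in> {a..1}"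
    then show "0 \<le> 2 / t^3" using assms by auto
  qed (use assms in auto)
  moreover have "1 \<le> 1 / a\<^sup>2" using assms by (simp add: power_le_one)
  ultimately show ?thesis by (simp add: ennreal_1[symmetric] ennreal_plus[symmetric] del: ennreal_1)
qed

text \<open>After the exchange of integrals the ball of radius \<open>t\<close> contributes 2t^{-3}
  times wt^d, with \<open>w\<close> the volume of the unit ball. Integrating 2wt^{d-3} over [0,1]
  gives 2w/(d-2), and the constant layer adds \<open>w\<close>, in total wd/(d-2). Here d >= 3
  enters.\<close>

lemma shell_bound:
  assumes d: "CARD('n) \<ge> 3"
  shows "(\<integral>\<^sup>+x. shell 1 (x :: real^'n) \<partial>lborel) \<le> ennreal (unit_vol TYPE('n) * real CARD('n) / (real CARD('n) - 2))"
proof -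
  let ?d = "CARD('n)" and ?w = "unit_vol TYPE('n)"
  have w: "?w > 0" by (rule unit_vol_pos)
  define k where "k = ?d - 3"
  have dk: "?d = k + 3" using d by (simp add: k_def)
  let ?k = "\<lambda>(x::real^'n) t. ennreal (2 / t^3) * indicator {z. 0 < fst z \<and> norm (snd z) \<le> fst z \<and> fst z \<le> 1} (t, x)"
  have [measurable]: "{z :: real \<times> (real^'n). 0 < fst z \<and> norm (snd z) \<le> fst z \<and> fst z \<le> 1} \<in> sets (borel \<Otimes>\<^sub>M borel)"
  proof -
    have "{z \<in> space (borel \<Otimes>\<^sub>M borel). 0 < fst z \<and> norm (snd z :: real^'n) \<le> fst z \<and> fst z \<le> (1::real)} \<in> sets (borel \<Otimes>\<^sub>M borel)"
      by measurable
    then show ?thesis by (simp add: space_pair_measure)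
  qed
  have "(\<integral>\<^sup>+x. shell 1 (x :: real^'n) \<partial>lborel) \<le> (\<integral>\<^sup>+x. indicator (ball (0::real^'n) 1) x + (\<integral>\<^sup>+t. ?k x t \<partial>lborel) \<partial>lborel)"
  proof (rule nn_integral_mono)
    fix x :: "real^'n"
    show "shell 1 x \<le> indicator (ball 0 1) x + (\<integral>\<^sup>+t. ?k x t \<partial>lborel)"
    \<comment> \<open>At the origin the convention 1/0 = 0 makes the left-hand side 0.\<close>
    proof (cases "x \<in> ball 0 1 \<and> x \<noteq> 0")
      case True
      then have "0 < norm x" "norm x \<le> 1" by auto
      from inverse_square_layer_cake[OF this] have "shell 1 x = 1 + (\<integral>\<^sup>+t. ennreal (2 / t^3) * indicator {norm x..1} t \<partial>lborel)"
        using True by (simp add: shell_def)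
      also have "(\<integral>\<^sup>+t. ennreal (2 / t^3) * indicator {norm x..1} t \<partial>lborel) = (\<integral>\<^sup>+t. ?k x t \<partial>lborel)"
      proof (rule nn_integral_cong)
        fix t
        have "0 < t" if "norm x \<le> t" using \<open>0 < norm x\<close> that by (rule less_le_trans)
        then show "ennreal (2 / t^3) * indicator {norm x..1} t = ?k x t" by (auto simp: indicator_def)
      qed
      finally show ?thesis using True by simp
    qed (auto simp: shell_def)
  qed
  also have "\<dots> = (\<integral>\<^sup>+x. indicator (ball (0::real^'n) 1) x \<partial>lborel) + (\<integral>\<^sup>+x. \<integral>\<^sup>+t. ?k x t \<partial>lborel \<partial>lborel)"
    by (rule nn_integral_add) measurable
  also have "(\<integral>\<^sup>+x. indicator (ball (0::real^'n) 1) x \<partial>lborel) = ennreal ?w" by (simp add: emeasure_unit_ball)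
  also have "(\<integral>\<^sup>+x. \<integral>\<^sup>+t. ?k x t \<partial>lborel \<partial>lborel) = (\<integral>\<^sup>+t. \<integral>\<^sup>+x. ?k x t \<partial>lborel \<partial>lborel)"
    by (rule lborel_pair.Fubini'[symmetric]) measurable
  also have "\<dots> \<le> (\<integral>\<^sup>+t. ennreal (2 * ?w * t ^ k) * indicator {0..1} t \<partial>lborel)"
  proof (rule nn_integral_mono)
    fix t :: real
    show "(\<integral>\<^sup>+x. ?k x t \<partial>lborel) \<le> ennreal (2 * ?w * t ^ k) * indicator {0..1} t"
    proof (cases "0 < t \<and> t \<le> 1")
      case True
      then have "?k x t = ennreal (2 / t^3) * indicator (cball 0 t) x" for x by (auto simp: indicator_def)
      then have "(\<integral>\<^sup>+x. ?k x t \<partial>lborel) = (\<integral>\<^sup>+x. ennreal (2 / t^3) * indicator (cball (0::real^'n) t) x \<partial>lborel)"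
        by (rule nn_integral_cong)
      also have "\<dots> = ennreal (2 / t^3) * ennreal (?w * t ^ (k + 3))"
        using True by (simp add: nn_integral_cmult_indicator emeasure_cball_unit_vol dk)
      also have "\<dots> = ennreal (2 * ?w * t ^ k)"
        using True w by (subst ennreal_mult[symmetric]) (auto simp: power_add)
      finally show ?thesis using True by simp
    next
      case False
      then have "(\<integral>\<^sup>+x. ?k x t \<partial>lborel) = (\<integral>\<^sup>+x. 0 \<partial>(lborel :: (real^'n) measure))"
        by (intro nn_integral_cong) (auto simp: indicator_def)
      then show ?thesis by simp
    qed
  qed
  also have "(\<integral>\<^sup>+t. ennreal (2 * ?w * t ^ k) * indicator {0..1} t \<partial>lborel)
      = ennreal (2 * ?w * (1 ^ Suc k / real (Suc k)) - 2 * ?w * (0 ^ Suc k / real (Suc k)))"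
  proof (rule nn_integral_FTC_Icc[where F="\<lambda>t. 2 * ?w * (t ^ Suc k / real (Suc k))"])
    fix t :: real assume t: "t \<in> {0..1}"
    have "DERIV (\<lambda>t. t ^ Suc k / real (Suc k)) t :> t ^ k"
      by (rule DERIV_cong, rule DERIV_cdivide, rule DERIV_pow) (simp del: of_nat_Suc)
    then show "DERIV (\<lambda>t. 2 * ?w * (t ^ Suc k / real (Suc k))) t :> 2 * ?w * t ^ k"
      by (rule DERIV_cmult)
    show "0 \<le> 2 * ?w * t ^ k" using t w by auto
  qed auto
  also have "ennreal ?w + \<dots> = ennreal (?w * real ?d / (real ?d - 2))"
    using w by (simp add: ennreal_plus[symmetric] dk field_simps del: ennreal_plus)
  finally show ?thesis by (simp add: add_mono)
qed

text \<open>Homogeneity: dilation by \<open>s\<close> multiplies volume by s^d and the integrand by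
  s^{-2}. The exponent d - 2 is the order of the energy saved by the hole.\<close>

lemma shell_scale:
  assumes d: "CARD('n) \<ge> 2" and s: "s > 0"
  shows "(\<integral>\<^sup>+x. shell s (x :: real^'n) \<partial>lborel) = ennreal (s ^ (CARD('n) - 2)) * (\<integral>\<^sup>+x. shell 1 (x :: real^'n) \<partial>lborel)"
proof -
  have p: "s ^ CARD('n) = s ^ (CARD('n) - 2) * s\<^sup>2" 
  proof -
    have "CARD('n) = CARD('n) - 2 + 2" using d by simp
    then have "s ^ CARD('n) = s ^ (CARD('n) - 2 + 2)" by simp
    then show ?thesis by (simp only: power_add)
  qed
  have "(\<integral>\<^sup>+x. shell s (x :: real^'n) \<partial>lborel) = ennreal (s ^ CARD('n)) * (\<integral>\<^sup>+x. shell s (0 + s *\<^sub>R x :: real^'n) \<partial>lborel)"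
    using nn_integral_affine[OF shell_measurable s, of s "0::real^'n"] by simp
  also have "(\<integral>\<^sup>+x. shell s (0 + s *\<^sub>R x :: real^'n) \<partial>lborel) = (\<integral>\<^sup>+x. ennreal (1 / s\<^sup>2) * shell 1 (x :: real^'n) \<partial>lborel)"
  proof (rule nn_integral_cong)
    fix x :: "real^'n"
    have "s *\<^sub>R x \<in> ball 0 s \<longleftrightarrow> x \<in> ball 0 1" using s by (simp add: mult_less_cancel_left1)
    then show "shell s (0 + s *\<^sub>R x) = ennreal (1 / s\<^sup>2) * shell 1 x"
      using s by (auto simp: shell_def power_mult_distrib ennreal_mult[symmetric] indicator_def)
  qed
  also have "\<dots> = ennreal (1 / s\<^sup>2) * (\<integral>\<^sup>+x. shell 1 (x :: real^'n) \<partial>lborel)" by (rule nn_integral_cmult) measurable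
  also have "ennreal (s ^ CARD('n)) * \<dots> = ennreal (s ^ CARD('n) * (1 / s\<^sup>2)) * (\<integral>\<^sup>+x. shell 1 (x :: real^'n) \<partial>lborel)"
    using s by (subst ennreal_mult) (auto simp: mult.assoc)
  also have "s ^ CARD('n) * (1 / s\<^sup>2) = s ^ (CARD('n) - 2)" unfolding p using s by simp
  finally show ?thesis .
qed

text \<open>By scaling, the annulus carries exactly the fraction 1 - s^{d-2} of the integral over
  the whole ball. This fraction is nonnegative, so the upper bound for the whole carries over with
  the gain intact.\<close>

lemma annulus_bound:
  assumes d: "CARD('n) \<ge> 3" and s: "0 < s" "s < 1"
  shows "(\<integral>\<^sup>+x. ennreal (1 / (norm x)\<^sup>2) * indicator (ball 0 1 - ball 0 s) (x :: real^'n) \<partial>lborel)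
     \<le> ennreal (unit_vol TYPE('n) * real CARD('n) / (real CARD('n) - 2) * (1 - s ^ (CARD('n) - 2)))" (is "?J \<le> ennreal (?E * (1 - ?p))")
proof -
  have fin: "(\<integral>\<^sup>+x. shell 1 (x :: real^'n) \<partial>lborel) \<le> ennreal ?E" by (rule shell_bound[OF d])
  then obtain l where l: "(\<integral>\<^sup>+x. shell 1 (x :: real^'n) \<partial>lborel) = ennreal l" "l \<ge> 0"
    by (cases "\<integral>\<^sup>+x. shell 1 (x :: real^'n) \<partial>lborel") (auto simp: top_unique)
  have E: "?E \<ge> 0" using d by simp
  have lE: "l \<le> ?E" using fin E unfolding l(1) by (simp add: l)
  have p: "0 \<le> ?p" "?p \<le> 1" using s by (auto intro: power_le_one)
  have "ennreal l = (\<integral>\<^sup>+x. shell s x + ennreal (1 / (norm x)\<^sup>2) * indicator (ball 0 1 - ball 0 s) (x :: real^'n) \<partial>lborel)"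
    unfolding l(1)[symmetric] by (rule nn_integral_cong) (use s in \<open>auto simp: shell_def indicator_def\<close>)
  also have "\<dots> = (\<integral>\<^sup>+x. shell s (x :: real^'n) \<partial>lborel) + ?J" by (rule nn_integral_add) measurable
  also have "(\<integral>\<^sup>+x. shell s (x :: real^'n) \<partial>lborel) = ennreal (?p * l)"
    using shell_scale[of s, where 'n='n] d s p l by (simp add: ennreal_mult)
  finally have eq: "ennreal l = ennreal (?p * l) + ?J" .
  then obtain j where j: "?J = ennreal j" "j \<ge> 0" by (cases ?J) auto
  have "l = ?p * l + j" using eq l(2) j(2) p by (simp add: j(1) ennreal_plus[symmetric] del: ennreal_plus)
  then have "j = l * (1 - ?p)" by (simp add: algebra_simps)
  also have "\<dots> \<le> ?E * (1 - ?p)" using lE p by (intro mult_right_mono) auto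
  finally show ?thesis unfolding j(1) by (rule ennreal_leI)
qed

text \<open>Outside the cube |x| > r, so the Dirichlet part is at most that of the hedgehog on the
  annulus: only the ball inscribed in the cube is credited as saved energy, and that has the right
  order.\<close>

lemma energy_hollow:
  assumes d: "CARD('n) \<ge> 2" and r: "r > 0" and small: "real CARD('n) * r < 1" and R: "R > 1" and K: "K > 1"
  shows "energy R K (hollow r :: real^'n \<Rightarrow> real^'n)
    \<le> ennreal (real CARD('n) - 1) * (\<integral>\<^sup>+x. ennreal (1 / (norm x)\<^sup>2) * indicator (ball 0 1 - ball 0 r) (x :: real^'n) \<partial>lborel)
      + ennreal (K * (2 * real CARD('n) * unit_ball_vol (real (CARD('n) - 1)) * (real CARD('n) * r) ^ (CARD('n) - 1)))"
proof -
  let ?h = "\<lambda>x::real^'n. ennreal (real CARD('n) - 1) * (ennreal (1 / (norm x)\<^sup>2) * indicator (ball 0 1 - ball 0 r) x)"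
  have "(\<integral>\<^sup>+x\<in>ball 0 1. ennreal ((norm (approx_gradient (hollow r :: real^'n \<Rightarrow> real^'n) x))\<^sup>2) \<partial>lebesgue) \<le> (\<integral>\<^sup>+x. ?h x \<partial>lebesgue)"
  proof (rule nn_integral_mono_AE, unfold AE_completion_iff)
    show "AE x in lborel. ennreal ((norm (approx_gradient (hollow r) x))\<^sup>2) * indicator (ball 0 1) x \<le> ?h x"
      using AE_not_in[OF cube_bd_null[of r]]
    proof eventually_elim
      case (elim x)
      show ?case
      proof (cases "x \<in> cube r \<or> x \<notin> ball 0 1")
        case True
        then show ?thesis by (auto simp: hollow_approx_gradient[OF r elim] hollow_grad_def)
      next
        case False
        then have x: "r < norm x" using norm_gt_outside_cube by blast
        then have "x \<noteq> 0" using r by auto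
        have "ennreal ((norm (hgrad x))\<^sup>2) = ennreal (real CARD('n) - 1) * ennreal (1 / (norm x)\<^sup>2)"
          unfolding norm_hgrad[OF \<open>x \<noteq> 0\<close>] using d by (subst ennreal_mult[symmetric]) auto
        then show ?thesis using False x by (simp add: hollow_approx_gradient[OF r elim] hollow_grad_def)
      qed
    qed
  qed
  also have "\<dots> = (\<integral>\<^sup>+x. ?h x \<partial>lborel)" by (rule nn_integral_completion) measurable
  also have "\<dots> = ennreal (real CARD('n) - 1) * (\<integral>\<^sup>+x. ennreal (1 / (norm x)\<^sup>2) * indicator (ball 0 1 - ball 0 r) (x :: real^'n) \<partial>lborel)"
    by (rule nn_integral_cmult) measurable
  finally have 1: "(\<integral>\<^sup>+x\<in>ball 0 1. ennreal ((norm (approx_gradient (hollow r :: real^'n \<Rightarrow> real^'n) x))\<^sup>2) \<partial>lebesgue) \<le> \<dots>" .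
  have "cube_bd r \<subseteq> ball (0::real^'n) R"
    using cube_subset_ball[OF small] R by (force simp: cube_bd_def)
  then have "approx_discontinuity_set (ball 0 R) (radial_extension (hollow r :: real^'n \<Rightarrow> real^'n)) = cube_bd r"
    by (simp add: radial_extension_hollow[OF small] hollow_discontinuity_set[OF r small] Int_absorb1)
  then have 2: "ennreal K * hausdorff_measure (CARD('n) - 1) (approx_discontinuity_set (ball 0 R) (radial_extension (hollow r :: real^'n \<Rightarrow> real^'n)))
    \<le> ennreal K * ennreal (2 * real CARD('n) * unit_ball_vol (real (CARD('n) - 1)) * (real CARD('n) * r) ^ (CARD('n) - 1))"
    using hausdorff_cube_bd[OF r, where 'n='n] by (simp add: mult_left_mono)
  have "energy R K (hollow r :: real^'n \<Rightarrow> real^'n) \<le> ennreal (real CARD('n) - 1) * (\<integral>\<^sup>+x. ennreal (1 / (norm x)\<^sup>2) * indicator (ball 0 1 - ball 0 r) (x :: real^'n) \<partial>lborel)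
    + ennreal K * ennreal (2 * real CARD('n) * unit_ball_vol (real (CARD('n) - 1)) * (real CARD('n) * r) ^ (CARD('n) - 1))"
    unfolding energy_def by (rule add_mono[OF 1 2])
  then show ?thesis using K by (subst ennreal_mult') auto
qed

theorem theorem8p1:
  fixes K R :: real
  assumes "CARD('n::finite) \<ge> 2" and "K > 1" and "R > 1"
  shows "(INF n \<in> (admissible_SBV R :: (real^'n \<Rightarrow> real^'n) set). energy R K n)
       < (INF n \<in> (admissible_Sobolev :: (real^'n \<Rightarrow> real^'n) set). energy R K n)"
proof -
  let ?d = "CARD('n)" and ?w = "unit_vol TYPE('n)"
  have w: "?w > 0" by (rule unit_vol_pos)
  have lower: "(INF n \<in> (admissible_SBV R :: (real^'n \<Rightarrow> real^'n) set). energy R K n) \<le> energy R K (hollow r :: real^'n \<Rightarrow> real^'n)"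
    if "r > 0" "real ?d * r < 1" for r
    by (rule INF_lower, rule hollow_admissible[OF that assms(3)])
  show ?thesis
  proof (cases "?d = 2")
    case True
    have "n \<notin> admissible_Sobolev" for n :: "real^'n \<Rightarrow> real^'n"
    proof
      assume "n \<in> admissible_Sobolev"
      from sobolev_lower_bound[OF assms(1) this] have "ennreal (2 * ?w) \<le> 0" unfolding True by simp
      then show False using w by (simp add: ennreal_eq_0_iff)
    qed
    then have "(admissible_Sobolev :: (real^'n \<Rightarrow> real^'n) set) = {}" by blast
    \<comment> \<open>The infimum over the empty set is infinite, so a competitor of finite energy
      is enough.\<close>
    then have top: "(INF n \<in> (admissible_Sobolev :: (real^'n \<Rightarrow> real^'n) set). energy R K n) = top" by simp
    define r :: real where "r = 1 / 4"
    have r: "r > 0" "real ?d * r < 1" by (auto simp: r_def True)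
    have "(\<integral>\<^sup>+x. ennreal (1 / (norm x)\<^sup>2) * indicator (ball 0 1 - ball 0 r) (x :: real^'n) \<partial>lborel) \<le> (\<integral>\<^sup>+x. ennreal (1 / r\<^sup>2) * indicator (ball 0 1) (x :: real^'n) \<partial>lborel)"
    proof (rule nn_integral_mono)
      fix x :: "real^'n"
      have "1 / (norm x)\<^sup>2 \<le> 1 / r\<^sup>2" if "r \<le> norm x" using that r(1) by (intro frac_le power_mono) auto
      then show "ennreal (1 / (norm x)\<^sup>2) * indicator (ball 0 1 - ball 0 r) x \<le> ennreal (1 / r\<^sup>2) * indicator (ball 0 1) x"
        by (auto simp: indicator_def intro!: ennreal_leI)
    qed
    also have "\<dots> = ennreal (1 / r\<^sup>2) * ennreal ?w" by (simp add: nn_integral_cmult_indicator emeasure_unit_ball)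
    also have "\<dots> < top" by (simp add: ennreal_mult_less_top)
    finally have "energy R K (hollow r :: real^'n \<Rightarrow> real^'n) < top"
      by (intro le_less_trans[OF energy_hollow[OF assms(1) r assms(3,2)]]) (simp add: ennreal_mult_less_top)
    then show ?thesis unfolding top using lower[OF r] by (rule le_less_trans[rotated])
  next
    case False
    then have d: "?d \<ge> 3" using assms(1) by simp
    \<comment> \<open>\<open>E\<close> bounds the integral of 1/|x|^2 over the ball, so that (d-1)E
      bounds the hedgehog energy from above; it is also the Sobolev lower bound. \<open>c\<close> is
      the constant of the Hausdorff bound with r^{d-1} taken out.\<close>
    define E where "E = ?w * real ?d / (real ?d - 2)"
    define c where "c = 2 * real ?d * unit_ball_vol (real (?d - 1)) * real ?d ^ (?d - 1)"
    have E: "E > 0" using w d by (simp add: E_def)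
    have c: "c > 0" using unit_ball_vol_pos[of "real (?d - 1)"] d by (simp add: c_def)
    \<comment> \<open>The first bound keeps the cube inside the unit ball. The second makes the jump
      cost K c r^{d-1} smaller than the saving (d-1)E r^{d-2}, by comparing the one extra power of
      \<open>r\<close>.\<close>
    have "0 < min (1 / real ?d) ((real ?d - 1) * E / (K * c))" using d E c assms(2) by simp
    then obtain r where r: "0 < r" "r < min (1 / real ?d) ((real ?d - 1) * E / (K * c))" using dense by blast
    have small: "real ?d * r < 1" using r(2) d by (simp add: field_simps)
    have r1: "r < 1" 
  proof -
      have "1 * r \<le> real ?d * r" using d r(1) by (intro mult_right_mono) auto
      then show ?thesis using small by linarith
    qed
    have crit: "K * c * r < (real ?d - 1) * E" using r(2) c assms(2) by (simp add: field_simps)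
    let ?p = "r ^ (?d - 2)"
    have p: "?p > 0" "?p \<le> 1" using r(1) r1 by (auto intro: power_le_one)
    have "r ^ (?d - 1) = r * ?p" using d by (simp flip: power_Suc add: Suc_diff_Suc numeral_2_eq_2)
    then have cp: "2 * real ?d * unit_ball_vol (real (?d - 1)) * (real ?d * r) ^ (?d - 1) = c * r * ?p"
      by (simp add: c_def power_mult_distrib)
    have "energy R K (hollow r :: real^'n \<Rightarrow> real^'n) \<le> ennreal (real ?d - 1) * ennreal (E * (1 - ?p)) + ennreal (K * (c * r * ?p))"
      using energy_hollow[OF assms(1) r(1) small assms(3,2)] annulus_bound[OF d r(1) r1]
      unfolding cp E_def by (elim order_trans) (intro add_mono mult_left_mono; simp)
    also have "\<dots> = ennreal ((real ?d - 1) * (E * (1 - ?p)) + K * (c * r * ?p))"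
      using d E p c r(1) assms(2) by (simp add: ennreal_mult ennreal_plus)
    also have "\<dots> < ennreal ((real ?d - 1) * E)"
    proof (rule ennreal_lessI)
      show "0 < (real ?d - 1) * E" using d E by simp
      have "K * c * r * ?p < (real ?d - 1) * E * ?p" using crit p(1) by (rule mult_strict_right_mono)
      then show "(real ?d - 1) * (E * (1 - ?p)) + K * (c * r * ?p) < (real ?d - 1) * E" by (simp add: algebra_simps)
    qed
    finally have less: "energy R K (hollow r :: real^'n \<Rightarrow> real^'n) < ennreal ((real ?d - 1) * E)" .
    have "ennreal ((real ?d - 1) * E) \<le> (INF n \<in> (admissible_Sobolev :: (real^'n \<Rightarrow> real^'n) set). energy R K n)"
    proof (rule INF_greatest)
      fix n :: "real^'n \<Rightarrow> real^'n" assume n: "n \<in> admissible_Sobolev"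
      let ?D = "\<integral>\<^sup>+x\<in>ball 0 1. ennreal ((norm (approx_gradient n x))\<^sup>2) \<partial>lebesgue"
      have "ennreal ((real ?d - 1) * E) \<le> ?D"
      \<comment> \<open>An infinite Dirichlet integral satisfies the bound trivially; a finite one
        allows division by d - 2 in the reals.\<close>
      proof (cases ?D)
        case (real q)
        have "ennreal (real ?d * (real ?d - 1) * ?w) \<le> ennreal ((real ?d - 2) * q)"
          using sobolev_lower_bound[OF assms(1) n] d real(1) unfolding real(2) by (simp add: ennreal_mult)
        then have "real ?d * (real ?d - 1) * ?w \<le> (real ?d - 2) * q" using d real(1) by simp
        then have "(real ?d - 1) * E \<le> q" using d by (simp add: E_def field_simps)
        then show ?thesis unfolding real(2) by (rule ennreal_leI)
      qed simp
      also have "?D \<le> energy R K n" unfolding energy_def by simp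
      finally show "ennreal ((real ?d - 1) * E) \<le> energy R K n" .
    qed
    from less_le_trans[OF less this] show ?thesis using lower[OF r(1) small] by (rule le_less_trans[rotated])
  qed
qed

end
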